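(* Consider the standard quadratic program $\min\{x^\top Qx: x\in\Delta^{n-1}\}$ with $Q$ drawn from the Gaussian Orthogonal Ensemble, and let $\kappa_n$ be the support size of its almost surely unique global minimizer. With $S_n,A_n,B_n$ as defined in the context, as $n\to\infty$, $$\mathbb P(\kappa_n=2)=S_n+A_n+B_n+o(B_n),$$ $$\mathbb P(\kappa_n>1)=S_n+A_n+B_n+o(B_n),$$ $$\mathbb P(\kappa_n=1)=1-S_n-A_n-B_n+o(B_n),$$ where $$A_n\sim 3\sqrt{\frac{\pi}{2}}\,\frac{1}{n\sqrt{\log n}},\qquad B_n\sim 9\sqrt{\frac{\pi}{2}}\,\frac{1}{n(\log n)^{3/2}}.$$ Moreover, $$S_n\sim 2\sqrt{2\pi}\,\frac{\sqrt{\log n}}{n}.$$ Consequently, $$\mathbb P(\kappa_n>1)\sim 2\sqrt{2\pi}\,\frac{\sqrt{\log n}}{n},\qquad \mathbb P(\kappa_n=1)=1-\Theta\left(\frac{\sqrt{\log n}}{n}\right).$$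
   Context: $\Delta^{n-1}=\{x\in\mathbb R^n: x_i\ge 0\ \forall i,\ \sum_i x_i=1\}$. $Q$ is a random symmetric $n\times n$ matrix with $Q_{ii}\sim N(0,1)$ and $Q_{ij}=Q_{ji}\sim N(0,1/2)$ (variance $1/2$) for $i<j$, all upper-triangular entries (including the diagonal) being independent. The program has almost surely a unique global minimizer $x^\star$; $\kappa_n:=|\{i:x^\star_i>0\}|$. $\Phi$ is the standard normal distribution function. $a_n\sim b_n$ (for sequences) means $a_n/b_n\to1$ as $n\to\infty$. Let $Z_{(1)}\le\cdots\le Z_{(n)}$ be the ordered diagonal entries of $Q$, and for $1\le i<j\le n$ put $$\tau_{ij}:=Z_{(1)}-\sqrt{(Z_{(i)}-Z_{(1)})(Z_{(j)}-Z_{(1)})},\qquad p_{ij}:=\Phi(\sqrt2\,\tau_{ij}),\qquad q_n:=\Phi(\sqrt2\,Z_{(1)}).$$ For $n\ge3$ define $$S_n:=\mathbb E\left[1-(1-q_n)^{n-1}\right],$$ $$A_n:=\mathbb E\left[(1-q_n)^{n-1}\left(1-\prod_{j=3}^n(1-p_{2j})\right)\right],$$ $$B_n:=\mathbb E\left[(1-q_n)^{n-1}\prod_{j=3}^n(1-p_{2j})\left(1-\prod_{3\le i<j\le n}(1-p_{ij})\right)\right].$$ *)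

theory Defs
  imports "HOL-Probability.Probability" "HOL-Library.Landau_Symbols"
begin

(* Matrices and vectors are functions on nat, used at indices 1..n only.
   Q :: 'a => nat => nat => real is a random matrix on the probability space M. *)

definition goe :: "'a measure \<Rightarrow> nat \<Rightarrow> ('a \<Rightarrow> nat \<Rightarrow> nat \<Rightarrow> real) \<Rightarrow> bool" where
  "goe M n Q \<longleftrightarrow>
     prob_space M \<and>
     (\<forall>\<omega>\<in>space M. \<forall>i\<in>{1..n}. \<forall>j\<in>{1..n}. Q \<omega> i j = Q \<omega> j i) \<and>
     (\<forall>i\<in>{1..n}. distributed M lborel (\<lambda>\<omega>. Q \<omega> i i) (normal_density 0 1)) \<and>
     (\<forall>i\<in>{1..n}. \<forall>j\<in>{1..n}. i < j \<longrightarrow>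
        distributed M lborel (\<lambda>\<omega>. Q \<omega> i j) (normal_density 0 (sqrt (1 / 2)))) \<and>
     prob_space.indep_vars M (\<lambda>_. borel) (\<lambda>(i, j) \<omega>. Q \<omega> i j)
       {(i, j). 1 \<le> i \<and> i \<le> j \<and> j \<le> n}"

(* The standard simplex in R^n. Entries outside 1..n are pinned to 0, so that
   distinct functions in the set are distinct points of R^n. *)
definition std_simplex :: "nat \<Rightarrow> (nat \<Rightarrow> real) set" where
  "std_simplex n =
     {x. (\<forall>i\<in>{1..n}. 0 \<le> x i) \<and> (\<Sum>i=1..n. x i) = 1 \<and> (\<forall>i. i \<notin> {1..n} \<longrightarrow> x i = 0)}"

definition quad_form :: "nat \<Rightarrow> (nat \<Rightarrow> nat \<Rightarrow> real) \<Rightarrow> (nat \<Rightarrow> real) \<Rightarrow> real" where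
  "quad_form n Q x = (\<Sum>i=1..n. \<Sum>j=1..n. x i * Q i j * x j)"

definition stqp_minimizer :: "nat \<Rightarrow> (nat \<Rightarrow> nat \<Rightarrow> real) \<Rightarrow> (nat \<Rightarrow> real) \<Rightarrow> bool" where
  "stqp_minimizer n Q = is_arg_min (quad_form n Q) (\<lambda>x. x \<in> std_simplex n)"

(* The support size of the minimizer. The value 0, impossible for a point of the
   simplex, marks matrices whose minimizer is not unique (a null event for the GOE). *)
definition kappa :: "nat \<Rightarrow> (nat \<Rightarrow> nat \<Rightarrow> real) \<Rightarrow> nat" where
  "kappa n Q =
     (if \<exists>!x. stqp_minimizer n Q x
      then card {i\<in>{1..n}. 0 < (THE x. stqp_minimizer n Q x) i}
      else 0)"

abbreviation Phi :: "real \<Rightarrow> real" where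
  "Phi \<equiv> cdf std_normal_distribution"

(* zord n Q k is the k-th smallest diagonal entry, for k in 1..n. *)
definition zord :: "nat \<Rightarrow> (nat \<Rightarrow> nat \<Rightarrow> real) \<Rightarrow> nat \<Rightarrow> real" where
  "zord n Q k = sort (map (\<lambda>i. Q i i) [1..<Suc n]) ! (k - 1)"

definition tau :: "nat \<Rightarrow> (nat \<Rightarrow> nat \<Rightarrow> real) \<Rightarrow> nat \<Rightarrow> nat \<Rightarrow> real" where
  "tau n Q i j =
     zord n Q 1 - sqrt ((zord n Q i - zord n Q 1) * (zord n Q j - zord n Q 1))"

definition pij :: "nat \<Rightarrow> (nat \<Rightarrow> nat \<Rightarrow> real) \<Rightarrow> nat \<Rightarrow> nat \<Rightarrow> real" where
  "pij n Q i j = Phi (sqrt 2 * tau n Q i j)"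

definition qn :: "nat \<Rightarrow> (nat \<Rightarrow> nat \<Rightarrow> real) \<Rightarrow> real" where
  "qn n Q = Phi (sqrt 2 * zord n Q 1)"

(* In the next three definitions M n and Q n are the space and the matrix of order n. *)

definition S_seq ::
  "(nat \<Rightarrow> 'a measure) \<Rightarrow> (nat \<Rightarrow> 'a \<Rightarrow> nat \<Rightarrow> nat \<Rightarrow> real) \<Rightarrow> nat \<Rightarrow> real" where
  "S_seq M Q n = prob_space.expectation (M n) (\<lambda>\<omega>. 1 - (1 - qn n (Q n \<omega>)) ^ (n - 1))"

definition A_seq ::
  "(nat \<Rightarrow> 'a measure) \<Rightarrow> (nat \<Rightarrow> 'a \<Rightarrow> nat \<Rightarrow> nat \<Rightarrow> real) \<Rightarrow> nat \<Rightarrow> real" where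
  "A_seq M Q n = prob_space.expectation (M n) (\<lambda>\<omega>.
     (1 - qn n (Q n \<omega>)) ^ (n - 1) * (1 - (\<Prod>j=3..n. 1 - pij n (Q n \<omega>) 2 j)))"

definition B_seq ::
  "(nat \<Rightarrow> 'a measure) \<Rightarrow> (nat \<Rightarrow> 'a \<Rightarrow> nat \<Rightarrow> nat \<Rightarrow> real) \<Rightarrow> nat \<Rightarrow> real" where
  "B_seq M Q n = prob_space.expectation (M n) (\<lambda>\<omega>.
     (1 - qn n (Q n \<omega>)) ^ (n - 1) * (\<Prod>j=3..n. 1 - pij n (Q n \<omega>) 2 j) *
     (1 - (\<Prod>(i, j)\<in>{(i, j). 3 \<le> i \<and> i < j \<and> j \<le> n}. 1 - pij n (Q n \<omega>) i j)))"

end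

theory Submission
  imports Defs "HOL-Real_Asymp.Real_Asymp"
begin

text \<open>
Write \<open>z\<close> for the smallest diagonal entry of \<open>Q\<close>.  The edge of the simplex between two vertices
contains a point of value below \<open>z\<close> exactly when the off-diagonal entry joining them is below
\<open>z - sqrt ((Q i i - z) * (Q j j - z))\<close>.  If some edge has this property, no vertex is a minimizer; and if the
support has two elements, the edge carrying the minimizer has the property.  Hence both
\<open>\<kappa> > 1\<close> and \<open>\<kappa> = 2\<close> differ from the edge event only by events contained in \<open>\<kappa> \<ge> 3\<close>
(\<open>kappa_events\<close>, \<open>kappa_prob_bounds\<close>).

Conditionally on the diagonal the off-diagonal entries are independent, so the probability that no edge
has the property is a product over all pairs.  Grouping the pairs by the rank of their lower diagonal
entry splits it into three factors \<open>u\<close>, \<open>v\<close>, \<open>w\<close>, and \<open>1 - u * v * w = (1 - u) + u * (1 - v) + u * v * (1 - w)\<close>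
shows that the edge event has probability exactly \<open>S + A + B\<close> (\<open>edge_prob_sum\<close>).  Two things remain: the
asymptotics of the three expectations, and the claim that \<open>\<kappa> \<ge> 3\<close> has probability \<open>o(B)\<close>.

For the latter, let \<open>x\<close> be the minimizer and let \<open>i\<close> maximize \<open>sqrt (Q i i - l) * x i\<close> over the
support, \<open>l\<close> being the minimum.  Stationarity in the single coordinate \<open>i\<close> forces row \<open>i\<close> to contain
three entries below \<open>z\<close>, or two of which one is lower still, by half of the gap of an edge
(\<open>large_support_row\<close>).  Union bounds over these configurations suffice (\<open>large_support_prob\<close>).

All expectations reduce to integrals of a function of \<open>z\<close> against the law of the minimum of \<open>n\<close>
Gaussians.  Such an integral concentrates where \<open>n * Phi z\<close> is of order one and \<open>- z\<close> is close to
\<open>sqrt (2 * ln n)\<close>, so that a tail \<open>f z \<sim> c * Phi z ^ k * (- z) powr r\<close> translates into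
\<open>c * 2 powr (r/2) * fact k * n ^ -(k+1) * (ln n) powr (r/2)\<close> (\<open>laplace_minimum\<close>).

For \<open>S\<close> the function is \<open>Phi (sqrt 2 * z) \<sim> sqrt pi * Phi z ^ 2 * (- z)\<close>.  For \<open>A\<close> and \<open>B\<close> it is an
integral of the edge probability over two further diagonal entries \<open>w < c\<close>, with one more entry between
\<open>z\<close> and \<open>w\<close> in the case of \<open>B\<close>.  The dominant pairs have \<open>w - z\<close> of order \<open>(- z) powr (-3)\<close> and \<open>c\<close> in
the bulk; with \<open>y = (w - z) * (- z) ^ 3\<close> they produce the integral of \<open>y ^ p * exp (- 2 * sqrt y)\<close>, where
\<open>p = 0\<close> for \<open>A\<close> and \<open>p = 1\<close> for \<open>B\<close> (\<open>near_kernel_limit\<close>).  It equals \<open>2 * (2 * p + 1)! / 2 ^ (2 * p + 2)\<close>, that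
is \<open>1/2\<close> and \<open>3/4\<close>, whence the constants \<open>3 * sqrt (pi / 2)\<close> and \<open>9 * sqrt (pi / 2)\<close>.  Each
further entry below \<open>w\<close> costs a factor of order \<open>1 / ln n\<close>, so that only pairs whose lower entry has rank
two contribute to the leading order of \<open>A\<close>, and rank three to that of \<open>B\<close>.  The remaining pairs are
smaller by a factor exponential in \<open>- z\<close> (\<open>far_kernel_asymp\<close>).
\<close>


section \<open>Tails and quantiles of the standard normal law\<close>

abbreviation \<phi> :: "real \<Rightarrow> real" where "\<phi> \<equiv> std_normal_density"

abbreviation \<N> :: "real measure" where "\<N> \<equiv> std_normal_distribution"

interpretation N: cdf_distribution \<N>
  unfolding cdf_distribution_def by (rule real_dist_normal_dist)

lemma \<phi>_pos [simp]: "\<phi> x > 0"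
  by (simp add: normal_density_pos)

lemma DERIV_\<phi>: "DERIV \<phi> x :> - x * \<phi> x"
  unfolding std_normal_density_def[abs_def]
  by (auto intro!: derivative_eq_intros simp: field_simps)

lemma isCont_\<phi>: "isCont \<phi> x"
  using DERIV_\<phi> by (rule DERIV_isCont)

lemma \<phi>_shift: "\<phi> (x - t) = \<phi> x * exp (x * t - t\<^sup>2 / 2)"
  unfolding std_normal_density_def by (simp add: exp_add[symmetric] power2_eq_square field_simps)

lemma Phi_diff:
  assumes "a \<le> b" shows "Phi b - Phi a = (LBINT y=a..b. \<phi> y)"
proof (cases "a = b")
  case False
  then have ab: "a < b" using assms by simp
  have "Phi b - Phi a = measure \<N> {a<..b}"
    by (rule N.cdf_diff_eq[OF ab])
  also have "\<dots> = (\<integral>y. indicator {a<..b} y * \<phi> y \<partial>lborel)"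
  proof -
    have "measure \<N> {a<..b} = enn2real (\<integral>\<^sup>+y. ennreal (\<phi> y) * indicator {a<..b} y \<partial>lborel)"
      unfolding measure_def by (subst emeasure_density) auto
    also have "\<dots> = enn2real (\<integral>\<^sup>+y. ennreal (indicator {a<..b} y * \<phi> y) \<partial>lborel)"
      by (intro arg_cong[where f=enn2real] nn_integral_cong) (auto split: split_indicator)
    also have "\<dots> = (\<integral>y. indicator {a<..b} y * \<phi> y \<partial>lborel)"
      by (subst integral_eq_nn_integral) auto
    finally show ?thesis .
  qed
  also have "\<dots> = (LBINT y=a..b. \<phi> y)"
    using ab by (simp add: interval_integral_Ioc set_lebesgue_integral_def)
  finally show ?thesis .
qed simp

lemma DERIV_Phi: "DERIV Phi x :> \<phi> x"
proof -
  have "((\<lambda>u. LBINT y=(x-1)..u. \<phi> y) has_vector_derivative \<phi> x) (at x within {x-1..x+1})"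
    by (rule interval_integral_FTC2) (auto intro!: continuous_at_imp_continuous_on isCont_\<phi>)
  then have "((\<lambda>u. Phi (x-1) + (LBINT y=(x-1)..u. \<phi> y)) has_vector_derivative \<phi> x) (at x within {x-1..x+1})"
    by (auto intro!: derivative_eq_intros)
  then have "(Phi has_vector_derivative \<phi> x) (at x within {x-1..x+1})"
    by (rule has_vector_derivative_transform[rotated 2]) (auto simp: Phi_diff[symmetric])
  then have "(Phi has_vector_derivative \<phi> x) (at x within {x-1<..<x+1})"
    by (rule has_vector_derivative_within_subset) auto
  then have "(Phi has_vector_derivative \<phi> x) (at x)"
    by (subst (asm) has_vector_derivative_within_open) auto
  then show ?thesis
    by (simp only: has_real_derivative_iff_has_vector_derivative)
qed

lemma isCont_Phi: "isCont Phi x"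
  using DERIV_Phi by (rule DERIV_isCont)

lemma Phi_strict_mono: "a < b \<Longrightarrow> Phi a < Phi b"
  using DERIV_pos_imp_increasing[of a b Phi] DERIV_Phi \<phi>_pos by blast

lemma Phi_mono: "a \<le> b \<Longrightarrow> Phi a \<le> Phi b"
  by (rule N.cdf_nondecreasing)

lemma Phi_pos [simp]: "Phi x > 0"
  using Phi_strict_mono[of "x - 1" x] N.cdf_nonneg[of "x-1"] by linarith

lemma Phi_less_1 [simp]: "Phi x < 1"
  using Phi_strict_mono[of x "x + 1"] N.cdf_bounded_prob[of "x+1"] by linarith

lemma Phi_nonneg [simp]: "Phi x \<ge> 0" and Phi_le_1 [simp]: "Phi x \<le> 1"
  using Phi_pos[of x] Phi_less_1[of x] by linarith+

lemma Phi_at_bot: "(Phi \<longlongrightarrow> 0) at_bot"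
  by (rule N.cdf_lim_at_bot)

lemma Phi_diff_bounds:
  assumes "a \<le> b" "b \<le> 0"
  shows "\<phi> a * (b - a) \<le> Phi b - Phi a" "Phi b - Phi a \<le> \<phi> b * (b - a)"
proof -
  have mono: "\<phi> x \<le> \<phi> y" if "x \<le> y" "y \<le> 0" for x y
    using that unfolding std_normal_density_def
    by (auto intro!: divide_right_mono simp: abs_le_square_iff[symmetric])
  have "\<phi> a * (b - a) \<le> Phi b - Phi a \<and> Phi b - Phi a \<le> \<phi> b * (b - a)"
  proof (cases "a = b")
    case False
    then obtain x where x: "a < x" "x < b" "Phi b - Phi a = (b - a) * \<phi> x"
      using MVT2[of a b Phi \<phi>] DERIV_Phi assms by (metis less_eq_real_def)
    show ?thesis using mono[of a x] mono[of x b] x assms by (auto simp: mult.commute mult_le_cancel_left)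
  qed simp
  then show "\<phi> a * (b - a) \<le> Phi b - Phi a" "Phi b - Phi a \<le> \<phi> b * (b - a)" by auto
qed

text \<open>A function that vanishes at minus infinity and increases is nonnegative; the tail
  estimates below compare derivatives through this principle.\<close>

lemma nonneg_of_increasing_from_bot:
  fixes h h' :: "real \<Rightarrow> real"
  assumes d: "\<And>y. y \<le> x \<Longrightarrow> DERIV h y :> h' y" and n: "\<And>y. y \<le> x \<Longrightarrow> h' y \<ge> 0"
    and l: "(h \<longlongrightarrow> 0) at_bot"
  shows "h x \<ge> 0"
proof (rule tendsto_upperbound[OF l])
  show "\<forall>\<^sub>F y in at_bot. h y \<le> h x"
    using eventually_le_at_bot[of x]
    by eventually_elim (rule DERIV_nonneg_imp_nondecreasing, auto intro: d n)
qed simp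

lemma Phi_upper:
  assumes "x < 0" shows "Phi x \<le> \<phi> x / (-x)"
proof -
  have "0 \<le> \<phi> x / (-x) - Phi x"
  proof (rule nonneg_of_increasing_from_bot[where h = "\<lambda>x. \<phi> x / (-x) - Phi x" and h' = "\<lambda>y. \<phi> y / y\<^sup>2"])
    fix y assume "y \<le> x"
    then show "DERIV (\<lambda>x. \<phi> x / (-x) - Phi x) y :> \<phi> y / y\<^sup>2"
      using assms by (auto intro!: derivative_eq_intros DERIV_\<phi> DERIV_Phi simp: field_simps power2_eq_square)
    show "0 \<le> \<phi> y / y\<^sup>2" by simp
  next
    have "((\<lambda>x. \<phi> x / (-x)) \<longlongrightarrow> 0) at_bot"
      unfolding std_normal_density_def[abs_def] by real_asymp
    from tendsto_diff[OF this Phi_at_bot] show "((\<lambda>x. \<phi> x / (-x) - Phi x) \<longlongrightarrow> 0) at_bot" by simp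
  qed
  then show ?thesis by simp
qed

lemma Phi_lower:
  assumes "x < 0" shows "Phi x \<ge> \<phi> x / (-x) * (1 - 1 / x\<^sup>2)"
proof -
  have "0 \<le> Phi x - \<phi> x * (1/x^3 - 1/x)"
  proof (rule nonneg_of_increasing_from_bot[where h = "\<lambda>x. Phi x - \<phi> x * (1/x^3 - 1/x)" and h' = "\<lambda>y. 3 * \<phi> y / y^4"])
    fix y assume "y \<le> x"
    then show "DERIV (\<lambda>x. Phi x - \<phi> x * (1/x^3 - 1/x)) y :> 3 * \<phi> y / y^4"
    proof -
      have y: "y \<noteq> 0" using assms \<open>y \<le> x\<close> by simp
      have "DERIV (\<lambda>x. 1/x^3) y :> - 3/y^4"
        using y by (auto intro!: derivative_eq_intros simp: field_simps eval_nat_numeral)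
      moreover have "DERIV (\<lambda>x. 1/x) y :> - 1/y^2"
        using y by (auto intro!: derivative_eq_intros simp: field_simps eval_nat_numeral)
      ultimately have "DERIV (\<lambda>x. 1/x^3 - 1/x) y :> - 3/y^4 - - 1/y^2"
        by (rule DERIV_diff)
      then have "DERIV (\<lambda>x. 1/x^3 - 1/x) y :> 1/y^2 - 3/y^4" by simp
      from DERIV_diff[OF DERIV_Phi DERIV_mult[OF DERIV_\<phi> this]]
      have "DERIV (\<lambda>x. Phi x - \<phi> x * (1/x^3 - 1/x)) y :>
        \<phi> y - (- y * \<phi> y * (1/y^3 - 1/y) + (1/y^2 - 3/y^4) * \<phi> y)" .
      moreover have "\<phi> y - (- y * \<phi> y * (1/y^3 - 1/y) + (1/y^2 - 3/y^4) * \<phi> y) = 3 * \<phi> y / y^4"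
        using y by (simp add: field_simps eval_nat_numeral)
      ultimately show ?thesis by simp
    qed
    show "0 \<le> 3 * \<phi> y / y^4" by simp
  next
    have "((\<lambda>x. \<phi> x * (1/x^3 - 1/x)) \<longlongrightarrow> 0) at_bot"
      unfolding std_normal_density_def[abs_def] by real_asymp
    from tendsto_diff[OF Phi_at_bot this] show "((\<lambda>x. Phi x - \<phi> x * (1/x^3 - 1/x)) \<longlongrightarrow> 0) at_bot" by simp
  qed
  moreover have "\<phi> x * (1/x^3 - 1/x) = \<phi> x / (-x) * (1 - 1 / x\<^sup>2)"
    using assms by (simp add: field_simps power2_eq_square power3_eq_cube)
  ultimately show ?thesis by simp
qed

lemma Mills_ratio: "((\<lambda>z. Phi z * (-z) / \<phi> z) \<longlongrightarrow> 1) at_bot"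
proof (rule tendsto_sandwich)
  show "\<forall>\<^sub>F z in at_bot. 1 - 1 / z\<^sup>2 \<le> Phi z * (-z) / \<phi> z"
    using eventually_le_at_bot[of "-1"]
  proof eventually_elim
    case (elim z)
    have "(1 - 1 / z\<^sup>2) * (\<phi> z / (-z)) \<le> Phi z" using Phi_lower[of z] elim by (simp add: mult.commute)
    then have "(1 - 1 / z\<^sup>2) \<le> Phi z / (\<phi> z / (-z))"
      using elim by (subst le_divide_eq) (auto simp: divide_pos_neg)
    then show ?case by simp
  qed
  show "\<forall>\<^sub>F z in at_bot. Phi z * (-z) / \<phi> z \<le> 1"
    using eventually_le_at_bot[of "-1"]
  proof eventually_elim
    case (elim z)
    then show ?case using Phi_upper[of z] by (simp add: field_simps)
  qed
  show "((\<lambda>z::real. 1 - 1 / z\<^sup>2) \<longlongrightarrow> 1) at_bot" by real_asymp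
qed simp

text \<open>The exact Gaussian shift identity for the density integrates to an inequality for the
  distribution function.\<close>

lemma Phi_shift_le:
  assumes "t \<ge> 0" shows "Phi (x - t) \<le> Phi x * exp (x * t - t\<^sup>2 / 2)"
proof (cases "t = 0")
  case False
  then have t: "t > 0" using assms by simp
  have "0 \<le> Phi x * exp (x * t - t\<^sup>2 / 2) - Phi (x - t)"
  proof (rule nonneg_of_increasing_from_bot[where h = "\<lambda>x. Phi x * exp (x * t - t\<^sup>2 / 2) - Phi (x - t)" and h' = "\<lambda>y. t * Phi y * exp (y * t - t\<^sup>2 / 2)"])
    fix y
    have "DERIV (\<lambda>x. Phi (x - t)) y :> \<phi> (y - t)"
      using DERIV_Phi[of "y - t"] by (simp add: DERIV_shift[of Phi _ y "-t", simplified])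
    then show "DERIV (\<lambda>x. Phi x * exp (x * t - t\<^sup>2 / 2) - Phi (x - t)) y :> t * Phi y * exp (y * t - t\<^sup>2 / 2)"
      unfolding \<phi>_shift
      by (auto intro!: derivative_eq_intros DERIV_Phi simp: algebra_simps)
    show "0 \<le> t * Phi y * exp (y * t - t\<^sup>2 / 2)" using t by simp
  next
    have 1: "((\<lambda>x. exp (x * t - t\<^sup>2 / 2)) \<longlongrightarrow> 0) at_bot"
      using t by real_asymp
    have "filterlim (\<lambda>x. x - t) at_bot at_bot" by real_asymp
    from filterlim_compose[OF Phi_at_bot this]
    show "((\<lambda>x. Phi x * exp (x * t - t\<^sup>2 / 2) - Phi (x - t)) \<longlongrightarrow> 0) at_bot"
      using tendsto_diff[OF tendsto_mult[OF Phi_at_bot 1]] by force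
  qed
  then show ?thesis by simp
qed simp

text \<open>The probability that an off-diagonal entry of the matrix, of variance \<open>1/2\<close>, lies below \<open>z\<close>.\<close>

abbreviation qmin :: "real \<Rightarrow> real" where "qmin z \<equiv> Phi (sqrt 2 * z)"

lemma filterlim_sqrt2_at_bot: "filterlim (\<lambda>z. sqrt 2 * z) at_bot at_bot"
  by (rule filterlim_tendsto_pos_mult_at_bot[OF tendsto_const]) (auto simp: filterlim_ident)

text \<open>Mills ratios at \<open>z\<close> and \<open>sqrt 2 * z\<close>, linked by
  \<open>\<phi> (sqrt 2 * z) = sqrt (2 * pi) * (\<phi> z)\<^sup>2\<close>.\<close>

lemma qmin_asymp: "((\<lambda>z. qmin z / (Phi z ^ 2 * (-z))) \<longlongrightarrow> sqrt pi) at_bot"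
proof -
  have 1: "((\<lambda>z. qmin z * (- (sqrt 2 * z)) / \<phi> (sqrt 2 * z)) \<longlongrightarrow> 1) at_bot"
    by (rule filterlim_compose[OF Mills_ratio filterlim_sqrt2_at_bot])
  have "((\<lambda>z. (qmin z * (- (sqrt 2 * z)) / \<phi> (sqrt 2 * z)) / (Phi z * (-z) / \<phi> z)^2 * sqrt pi) \<longlongrightarrow> 1 / 1^2 * sqrt pi) at_bot"
    by (intro tendsto_intros 1 Mills_ratio) auto
  then have "((\<lambda>z. (qmin z * (- (sqrt 2 * z)) / \<phi> (sqrt 2 * z)) / (Phi z * (-z) / \<phi> z)^2 * sqrt pi) \<longlongrightarrow> sqrt pi) at_bot"
    by simp
  then show ?thesis
  proof (rule Lim_transform_eventually)
    show "\<forall>\<^sub>F z in at_bot. (qmin z * (- (sqrt 2 * z)) / \<phi> (sqrt 2 * z)) / (Phi z * (-z) / \<phi> z)^2 * sqrt pi = qmin z / (Phi z ^ 2 * (-z))"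
      using eventually_le_at_bot[of "-1"]
    proof eventually_elim
      case (elim z)
      have "\<phi> (sqrt 2 * z) = \<phi> z ^ 2 * sqrt (2 * pi)"
        unfolding std_normal_density_def
        by (simp add: power_mult_distrib power_divide exp_double[symmetric] field_simps) 
      moreover have "Phi z \<noteq> 0" "\<phi> z \<noteq> 0" using Phi_pos[of z] \<phi>_pos[of z] by linarith+
      moreover have "sqrt (2 * pi) = sqrt 2 * sqrt pi" by (rule real_sqrt_mult)
      ultimately show ?case using elim
        by (simp add: field_simps power2_eq_square)
    qed
  qed
qed

lemma qmin_pos: "0 < qmin z" "qmin z < 1" by simp_all

lemma ln_Phi_asymp: "((\<lambda>z. z\<^sup>2 / ln (1 / Phi z)) \<longlongrightarrow> 2) at_bot"
proof -
  \<comment> \<open>With \<open>r\<close> the Mills ratio, \<open>- ln (Phi z) = z\<^sup>2 / 2 + ln (- z) + ln (sqrt (2 * pi)) - ln r\<close>.\<close>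
  have "((\<lambda>z. ln (Phi z * (-z) / \<phi> z)) \<longlongrightarrow> ln 1) at_bot"
    by (intro tendsto_ln Mills_ratio) auto
  moreover have "((\<lambda>z::real. 1 / z\<^sup>2) \<longlongrightarrow> 0) at_bot" by real_asymp
  ultimately have "((\<lambda>z. ln (Phi z * (-z) / \<phi> z) * (1 / z\<^sup>2)) \<longlongrightarrow> ln 1 * 0) at_bot"
    by (rule tendsto_mult)
  moreover have "((\<lambda>z::real. (z\<^sup>2 / 2 + ln (- z) + ln (sqrt (2 * pi))) / z\<^sup>2) \<longlongrightarrow> 1/2) at_bot"
    by real_asymp
  ultimately have "((\<lambda>z. (z\<^sup>2 / 2 + ln (- z) + ln (sqrt (2 * pi))) / z\<^sup>2 - ln (Phi z * (-z) / \<phi> z) * (1 / z\<^sup>2)) \<longlongrightarrow> 1/2 - ln 1 * 0) at_bot"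
    by (intro tendsto_diff)
  then have "((\<lambda>z. 1 / ((z\<^sup>2 / 2 + ln (- z) + ln (sqrt (2 * pi))) / z\<^sup>2 - ln (Phi z * (-z) / \<phi> z) * (1 / z\<^sup>2))) \<longlongrightarrow> 1 / (1/2 - ln 1 * 0)) at_bot"
    by (intro tendsto_divide tendsto_const) auto
  then have "((\<lambda>z. 1 / ((z\<^sup>2 / 2 + ln (- z) + ln (sqrt (2 * pi))) / z\<^sup>2 - ln (Phi z * (-z) / \<phi> z) * (1 / z\<^sup>2))) \<longlongrightarrow> 2) at_bot"
    by simp
  then show ?thesis
  proof (rule Lim_transform_eventually)
    show "\<forall>\<^sub>F z in at_bot. 1 / ((z\<^sup>2 / 2 + ln (- z) + ln (sqrt (2 * pi))) / z\<^sup>2 - ln (Phi z * (-z) / \<phi> z) * (1 / z\<^sup>2))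
       = z\<^sup>2 / ln (1 / Phi z)"
      using eventually_le_at_bot[of "-1"]
    proof eventually_elim
      case (elim z)
      have "ln (\<phi> z) = - ln (sqrt (2 * pi)) - z\<^sup>2 / 2"
        unfolding std_normal_density_def by (simp add: ln_mult ln_div)
      moreover have "ln (Phi z * (-z) / \<phi> z) = ln (Phi z) + ln (- z) - ln (\<phi> z)"
        using elim ln_mult[of "Phi z" "-z"] ln_div[of "Phi z * (-z)" "\<phi> z"] \<phi>_pos[of z] Phi_pos[of z]
        by (simp add: mult_pos_neg del: \<phi>_pos Phi_pos)
      moreover have "ln (1 / Phi z) = - ln (Phi z)" by (simp add: ln_div)
      ultimately have "z\<^sup>2 / 2 + ln (- z) + ln (sqrt (2 * pi)) - ln (Phi z * (-z) / \<phi> z) = ln (1 / Phi z)"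
        by linarith
      then have "(z\<^sup>2 / 2 + ln (- z) + ln (sqrt (2 * pi))) / z\<^sup>2 - ln (Phi z * (-z) / \<phi> z) * (1 / z\<^sup>2) = ln (1 / Phi z) / z\<^sup>2"
        by (metis diff_divide_distrib times_divide_eq_right mult.right_neutral)
      then show ?case by simp
    qed
  qed
qed

lemma Phi_quantile:
  assumes "0 < u" "u < 1" shows "Phi (N.I u) = u"
proof (rule antisym)
  show "u \<le> Phi (N.I u)" using N.pseudoinverse[OF assms, of "N.I u"] by simp
  have "(Phi \<longlongrightarrow> Phi (N.I u)) (at_left (N.I u))"
    using isCont_Phi[of "N.I u"] unfolding isCont_def by (rule tendsto_within_subset) simp
  then show "Phi (N.I u) \<le> u"
  proof (rule tendsto_upperbound)
    show "\<forall>\<^sub>F x in at_left (N.I u). Phi x \<le> u"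
    proof -
      have "\<forall>\<^sub>F x in at_left (N.I u). x < N.I u" by (auto simp: eventually_at_filter)
      then show ?thesis
      proof eventually_elim
      case (elim x)
      then show ?case using N.pseudoinverse[OF assms, of x] by linarith
      qed
    qed
  qed simp
qed

lemma quantile_at_bot: "filterlim N.I at_bot (at_right 0)"
  unfolding filterlim_at_bot
proof
  fix Z :: real
  have "\<forall>\<^sub>F u in at_right 0. u \<in> {0<..<Phi Z}"
    by (rule eventually_at_right_real) simp
  then show "\<forall>\<^sub>F u in at_right 0. N.I u \<le> Z"
  proof eventually_elim
    case (elim u)
    then have "0 < u" "u < 1" using Phi_less_1[of Z] by (auto simp del: Phi_less_1)
    then show ?case using N.pseudoinverse[of u Z] elim by auto
  qed
qed

text \<open>Normal expectations become Lebesgue integrals over the unit interval, in the variable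
  \<open>u = Phi z\<close>.\<close>

lemma quantile_transform:
  fixes f :: "real \<Rightarrow> real"
  assumes [measurable]: "f \<in> borel_measurable borel"
  shows "(\<integral>z. f z \<partial>\<N>) = (\<integral>u. indicator {0<..<1} u * f (N.I u) \<partial>lborel)"
proof -
  have "(\<integral>z. f z \<partial>\<N>) = (\<integral>z. f z \<partial>distr (restrict_space lborel {0<..<1::real}) borel N.I)"
    by (subst N.distr_I_eq_M) simp
  also have "\<dots> = (\<integral>u. f (N.I u) \<partial>restrict_space lborel {0<..<1})"
    by (rule integral_distr) auto
  also have "\<dots> = (\<integral>u. indicator {0<..<1} u * f (N.I u) \<partial>lborel)"
    by (subst integral_restrict_space) (auto simp: set_lebesgue_integral_def)
  finally show ?thesis .
qed

lemma borel_measurable_quantile: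
  assumes [measurable]: "f \<in> borel_measurable borel"
  shows "(\<lambda>u. indicator {0<..<1} u * (f (N.I u) :: real)) \<in> borel_measurable borel"
proof -
  have "(\<lambda>u. f (N.I u)) \<in> borel_measurable (restrict_space borel {0<..<1::real})"
    by measurable
  then show ?thesis by (subst (asm) borel_measurable_restrict_space_iff) auto
qed

section \<open>A Laplace asymptotic for the minimum of a Gaussian sample\<close>

lemma gamma_integral:
  assumes l: "l > (0::real)"
  shows "has_bochner_integral lborel (\<lambda>x. indicator {0<..} x * (x ^ k * exp (- l * x))) (fact k / l ^ Suc k)"
proof -
  interpret prob_space "density lborel (erlang_density k l)"
    by (rule prob_space_erlang_density[OF l])
  have "(\<integral>\<^sup>+x. ennreal (erlang_density k l x) \<partial>lborel) = ennreal 1"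
    using emeasure_space_1 by (simp add: emeasure_density)
  then have "has_bochner_integral lborel (erlang_density k l) 1"
    using l by (intro has_bochner_integral_nn_integral) auto
  from has_bochner_integral_mult_left[OF this, of "fact k / l ^ Suc k"]
  have "has_bochner_integral lborel (\<lambda>x. erlang_density k l x * (fact k / l ^ Suc k)) (fact k / l ^ Suc k)"
    by simp
  moreover have "AE x in lborel. erlang_density k l x * (fact k / l ^ Suc k) = indicator {0<..} x * (x ^ k * exp (- l * x))"
      using AE_lborel_singleton[of 0]
      by eventually_elim (use l in \<open>auto simp: erlang_density_def indicator_def\<close>)
  ultimately show ?thesis by (subst (asm) has_bochner_integral_cong_AE) auto
qed

lemma powr_le_powr_abs:
  assumes "B \<ge> 1" "X > 0" "X \<le> B" "1 / X \<le> (B::real)"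
  shows "X powr a \<le> B powr \<bar>a\<bar>" "B powr (- \<bar>a\<bar>) \<le> X powr a"
proof -
  have *: "X powr a \<le> B powr \<bar>a\<bar>" if "X > 0" "X \<le> B" "1 / X \<le> B" for X a
  proof (cases "a \<ge> 0")
    case True then show ?thesis using that by (auto intro: powr_mono2)
  next
    case False
    then have "X powr a = (1 / X) powr \<bar>a\<bar>" using that by (simp add: powr_divide powr_minus_divide[of X "-a", simplified])
    also have "\<dots> \<le> B powr \<bar>a\<bar>" using that by (intro powr_mono2) auto
    finally show ?thesis .
  qed
  show "X powr a \<le> B powr \<bar>a\<bar>" using *[OF assms(2-4)] .
  have "X powr (- a) \<le> B powr \<bar>a\<bar>" using *[OF assms(2-4), of "-a"] by simp
  moreover have "X powr (-a) > 0" using assms by simp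
  ultimately have "1 / (B powr \<bar>a\<bar>) \<le> 1 / (X powr (-a))"
    by (intro divide_left_mono) (use assms in auto)
  then show "B powr (- \<bar>a\<bar>) \<le> X powr a" by (simp add: powr_minus_divide)
qed

text \<open>Reduces the logarithmic factor of the dominating function to powers of \<open>e\<close>, so that Gamma integrals
  suffice.  The exponent 2 is the largest \<open>\<bar>r / 2\<bar>\<close> admitted below.\<close>

lemma abs_ln_square_le:
  assumes "e > (0::real)" shows "(2 + \<bar>ln e\<bar>) powr 2 \<le> 8 + 16 * e + 16 / e"
proof -
  define s where "s = sqrt e"
  have s: "s > 0" "e = s^2" using assms by (auto simp: s_def)
  have "ln e = 2 * ln s" using s by (simp add: ln_realpow)
  moreover have "ln s \<le> s" "ln (1/s) \<le> 1/s" using s ln_le_minus_one[of s] ln_le_minus_one[of "1/s"] by auto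
  moreover have "ln (1/s) = - ln s" using s by (simp add: ln_div)
  moreover have "1/s > 0" using s by simp
  ultimately have "ln e \<le> 2 * s" "- ln e \<le> 2 * (1/s)" by simp_all
  moreover have "0 < 2 * s" "0 < 2 * (1/s)" using s by simp_all
  ultimately have "ln e \<le> 2 * (s + 1/s)" "- ln e \<le> 2 * (s + 1/s)" unfolding distrib_left by linarith+
  then have *: "\<bar>ln e\<bar> \<le> 2 * (s + 1/s)" by (rule abs_leI)
  have "(2 + \<bar>ln e\<bar>) powr 2 = (2 + \<bar>ln e\<bar>)^2" by (simp add: powr_numeral)
  also have "\<dots> \<le> (2 + 2 * (s + 1/s))^2" using * by (intro power_mono) auto
  also have "\<dots> \<le> 8 + 2 * (2 * (s + 1/s))^2"
    using sum_squares_bound[of 2 "2 * (s + 1/s)"] by (simp add: power2_eq_square algebra_simps)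
  also have "\<dots> = 8 + 8 * (s^2 + 2 + 1/s^2)"
    using s by (simp add: power2_eq_square field_simps)
  also have "\<dots> \<le> 8 + 16 * (s^2 + 1/s^2)"
  proof -
    have "2 \<le> s^2 + 1/s^2"
      using sum_squares_bound[of s "1/s"] s by (simp add: power_divide)
    then show ?thesis by simp
  qed
  finally show ?thesis using s by (simp add: algebra_simps)
qed

text \<open>At the quantile of \<open>u\<close> the factor \<open>- z\<close> is asymptotic to \<open>sqrt (2 * ln (1/u))\<close>; this is where
  powers of \<open>2\<close> enter the constants.\<close>

lemma quantile_profile:
  fixes f :: "real \<Rightarrow> real"
  assumes lim: "((\<lambda>z. f z / (Phi z ^ k * (-z) powr r)) \<longlongrightarrow> c) at_bot"
  shows "((\<lambda>u. f (N.I u) / (u ^ k * ln (1/u) powr (r/2))) \<longlongrightarrow> c * 2 powr (r/2)) (at_right 0)"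
proof -
  have 1: "((\<lambda>u. f (N.I u) / (Phi (N.I u) ^ k * (- N.I u) powr r)) \<longlongrightarrow> c) (at_right 0)"
    by (rule filterlim_compose[OF lim quantile_at_bot])
  have "((\<lambda>u. (N.I u)\<^sup>2 / ln (1 / Phi (N.I u))) \<longlongrightarrow> 2) (at_right 0)"
    by (rule filterlim_compose[OF ln_Phi_asymp quantile_at_bot])
  then have "((\<lambda>u. ((N.I u)\<^sup>2 / ln (1 / Phi (N.I u))) powr (r/2)) \<longlongrightarrow> 2 powr (r/2)) (at_right 0)"
    by (rule tendsto_powr[OF _ tendsto_const]) simp
  from tendsto_mult[OF 1 this] show ?thesis
  proof (rule Lim_transform_eventually)
    have "\<forall>\<^sub>F u in at_right (0::real). u \<in> {0<..<1}" by (rule eventually_at_right_real) simp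
    moreover have "\<forall>\<^sub>F u in at_right 0. N.I u < 0"
      using quantile_at_bot unfolding filterlim_at_bot_dense by blast
    ultimately show "\<forall>\<^sub>F u in at_right 0. f (N.I u) / (Phi (N.I u) ^ k * (- N.I u) powr r) *
        ((N.I u)\<^sup>2 / ln (1 / Phi (N.I u))) powr (r/2) = f (N.I u) / (u ^ k * ln (1/u) powr (r/2))"
    proof eventually_elim
      case (elim u)
      then have u: "0 < u" "u < 1" by auto
      have "((N.I u)\<^sup>2) powr (r/2) = ((- N.I u) powr 2) powr (r/2)"
        using elim by (simp add: powr_numeral)
      also have "\<dots> = (- N.I u) powr r" by (simp only: powr_powr) simp
      finally show ?case
        using elim u by (simp add: Phi_quantile powr_divide)
    qed
  qed
qed

text \<open>The asymptotic relation controls \<open>f\<close> only near \<open>0\<close>; on the rest of the unit interval \<open>f \<le> 1\<close>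
  and the right-hand side is bounded below.  The summand \<open>1\<close> keeps the logarithmic factor away from
  zero at \<open>u = 1\<close>.\<close>

lemma quantile_profile_bound:
  fixes f :: "real \<Rightarrow> real"
  assumes "\<And>z. 0 \<le> f z" "\<And>z. f z \<le> 1"
    and lim: "((\<lambda>z. f z / (Phi z ^ k * (-z) powr r)) \<longlongrightarrow> c) at_bot"
  obtains C where "C \<ge> 0" "\<And>u. 0 < u \<Longrightarrow> u < 1 \<Longrightarrow> f (N.I u) \<le> C * u ^ k * (1 + ln (1/u)) powr (r/2)"
proof -
  define c' where "c' = \<bar>c * 2 powr (r/2)\<bar> + 1"
  have c': "c' \<ge> 0" unfolding c'_def by simp
  have "\<forall>\<^sub>F u in at_right 0. f (N.I u) / (u ^ k * ln (1/u) powr (r/2)) < c'"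
    by (rule order_tendstoD(2)[OF quantile_profile[OF lim]]) (simp add: c'_def)
  then obtain d0 where d0: "d0 > 0" "\<And>u. 0 < u \<Longrightarrow> u < d0 \<Longrightarrow> f (N.I u) / (u ^ k * ln (1/u) powr (r/2)) < c'"
    unfolding eventually_at_right_field by auto
  define d where "d = min d0 (exp (-1))"
  have d: "d > 0" "d \<le> exp (-1)" "d \<le> d0" using d0 by (auto simp: d_def)
  have d1: "d < 1" by (rule le_less_trans[OF d(2)]) simp
  define B where "B = 1 + ln (1/d)"
  have B: "B \<ge> 1" using d d1 by (simp add: B_def)
  define C where "C = c' * 2 powr \<bar>r/2\<bar> + (1 / d) ^ k * B powr \<bar>r/2\<bar>"
  have C0: "C \<ge> 0" using c' d by (simp add: C_def)
  have "f (N.I u) \<le> C * u ^ k * (1 + ln (1/u)) powr (r/2)" if u: "0 < u" "u < 1" for u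
  proof (cases "u < d")
    case True
    define l where "l = ln (1/u)"
    have "u < exp (-1)" using True d by linarith
    then have "ln u < ln (exp (-1))" using u by (subst ln_less_cancel_iff) auto
    then have l: "l \<ge> 1" using u unfolding l_def by (simp add: ln_div)
    have "f (N.I u) \<le> c' * (u ^ k * l powr (r/2))"
      using d0(2)[of u] True d u l unfolding l_def[symmetric]
      by (simp add: divide_less_eq less_imp_le)
    also have "l powr (r/2) = (l / (1 + l)) powr (r/2) * (1 + l) powr (r/2)"
      using l by (simp add: powr_divide)
    also have "(l / (1 + l)) powr (r/2) \<le> 2 powr \<bar>r/2\<bar>"
      using l by (intro powr_le_powr_abs(1)) (auto simp: field_simps)
    finally have "f (N.I u) \<le> c' * (u ^ k * (2 powr \<bar>r/2\<bar> * (1 + l) powr (r/2)))"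
      using c' u by (simp add: mult_left_mono mult_right_mono)
    also have "\<dots> = (c' * 2 powr \<bar>r/2\<bar>) * (u ^ k * (1 + l) powr (r/2))" by simp
    also have "\<dots> \<le> C * (u ^ k * (1 + l) powr (r/2))"
      using u d by (intro mult_right_mono) (auto simp: C_def)
    finally show ?thesis by (simp add: l_def)
  next
    case False
    define X where "X = 1 + ln (1/u)"
    have X: "X \<ge> 1" "X \<le> B" using u False d by (auto simp: X_def B_def ln_div)
    have "B powr (- \<bar>r/2\<bar>) \<le> X powr (r/2)"
      using X B by (intro powr_le_powr_abs(2)) (auto simp: field_simps intro: order_trans)
    then have "1 \<le> B powr \<bar>r/2\<bar> * X powr (r/2)"
      using B by (simp add: powr_minus_divide field_simps)
    moreover have "1 \<le> (1/d)^k * u^k"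
      using False d u by (simp add: power_mult_distrib[symmetric] one_le_power)
    ultimately have "1 * 1 \<le> ((1/d)^k * u^k) * (B powr \<bar>r/2\<bar> * X powr (r/2))"
      by (intro mult_mono) auto
    also have "\<dots> = ((1/d)^k * B powr \<bar>r/2\<bar>) * (u^k * X powr (r/2))" by simp
    also have "\<dots> \<le> C * (u^k * X powr (r/2))"
      using u c' by (intro mult_right_mono) (auto simp: C_def)
    finally show ?thesis using assms(2)[of "N.I u"] by (simp add: X_def)
  qed
  with C0 show ?thesis by (rule that)
qed

text \<open>The number \<open>Phi z\<close> for the minimum \<open>z\<close> of \<open>n\<close> Gaussians is of order \<open>1/n\<close>,
  and \<open>- z\<close> is then close to \<open>sqrt (2 * ln n)\<close>.  In the variable \<open>e = n * Phi z\<close> the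
  integrand converges to \<open>e ^ k * exp (- e)\<close>, and the slowly varying factor only costs a power
  of \<open>2 + \<bar>ln e\<bar>\<close>, which is integrable against it.\<close>

theorem laplace_minimum:
  fixes f :: "real \<Rightarrow> real" and k j :: nat
  assumes k: "k \<ge> 1" and r: "\<bar>r\<bar> \<le> 4" and meas [measurable]: "f \<in> borel_measurable borel"
    and f0: "\<And>z. 0 \<le> f z" and f1: "\<And>z. f z \<le> 1"
    and lim: "((\<lambda>z. f z / (Phi z ^ k * (-z) powr r)) \<longlongrightarrow> c) at_bot"
  shows "(\<lambda>n. real n ^ Suc k * ln (real n) powr (- (r/2)) * (\<integral>z. f z * (1 - Phi z) ^ (n - j) \<partial>\<N>))
           \<longlonglongrightarrow> c * 2 powr (r/2) * fact k"
proof -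
  obtain C where C: "C \<ge> 0" and fC: "\<And>u. 0 < u \<Longrightarrow> u < 1 \<Longrightarrow> f (N.I u) \<le> C * u ^ k * (1 + ln (1/u)) powr (r/2)"
    using quantile_profile_bound[OF f0 f1 lim] by blast
  define c' where "c' = c * 2 powr (r/2)"
  define s where "s n e = indicator {0<..<1} (e / real n) * (f (N.I (e / real n)) * (1 - Phi (N.I (e / real n))) ^ (n - j))
      * real n ^ k * ln (real n) powr (- (r/2))" for n e
  \<comment> \<open>The dominating function: \<open>C * e ^ k * (8 + 16 * e + 16 / e) * exp (- e / 2)\<close>.\<close>
  define w where "w e = C * (8 * (indicator {0<..} e * (e ^ k * exp (- (1/2) * e)))
      + 16 * (indicator {0<..} e * (e ^ (k+1) * exp (- (1/2) * e)))
      + 16 * (indicator {0<..} e * (e ^ (k-1) * exp (- (1/2) * e))))" for e :: real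
  have [measurable]: "(\<lambda>u. indicator {0<..<1} u * (f (N.I u) * (1 - Phi (N.I u)) ^ (n - j))) \<in> borel_measurable borel" for n
    using borel_measurable_quantile[of "\<lambda>z. f z * (1 - Phi z) ^ (n - j)"] by measurable
  have eq: "real n ^ Suc k * ln (real n) powr (- (r/2)) * (\<integral>z. f z * (1 - Phi z) ^ (n - j) \<partial>\<N>) = (\<integral>e. s n e \<partial>lborel)"
    if n: "n \<ge> 1" for n
  proof -
    have "(\<integral>z. f z * (1 - Phi z) ^ (n - j) \<partial>\<N>) = (\<integral>u. indicator {0<..<1} u * (f (N.I u) * (1 - Phi (N.I u)) ^ (n - j)) \<partial>lborel)"
      by (rule quantile_transform) measurable
    also have "\<dots> = (1 / real n) * (\<integral>e. indicator {0<..<1} (0 + (1 / real n) * e) * (f (N.I (0 + (1 / real n) * e)) * (1 - Phi (N.I (0 + (1 / real n) * e))) ^ (n - j)) \<partial>lborel)"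
      by (subst lborel_integral_real_affine[of "1 / real n" _ 0]) (use n in auto)
    finally have *: "(\<integral>z. f z * (1 - Phi z) ^ (n - j) \<partial>\<N>) = (1 / real n) * (\<integral>e. indicator {0<..<1} (e / real n) * (f (N.I (e / real n)) * (1 - Phi (N.I (e / real n))) ^ (n - j)) \<partial>lborel)"
      by (simp only: add_0 times_divide_eq_left mult_1)
    have **: "(\<integral>e. s n e \<partial>lborel) = (\<integral>e. indicator {0<..<1} (e / real n) * (f (N.I (e / real n)) * (1 - Phi (N.I (e / real n))) ^ (n - j)) \<partial>lborel) * real n ^ k * ln (real n) powr (- (r/2))"
      unfolding s_def by (simp only: integral_mult_left_zero)
    have arith: "real n ^ Suc k * L * (1 / real n * I) = I * real n ^ k * L" for I L
      using n by simp
    show ?thesis unfolding * ** by (rule arith)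
  qed
  have "(\<lambda>n. \<integral>e. s n e \<partial>lborel) \<longlonglongrightarrow> (\<integral>e. c' * (indicator {0<..} e * (e ^ k * exp (- 1 * e))) \<partial>lborel)"
  proof -
    \<comment> \<open>From \<open>n = 2 * j\<close> on, \<open>(1 - u) ^ (n - j) \<le> exp (- n * u / 2)\<close>; from \<open>n = 3\<close> on, \<open>ln n \<ge> 1\<close>.\<close>
    define m where "m = max 3 (2 * j)"
    have "(\<lambda>n. \<integral>e. s (n + m) e \<partial>lborel) \<longlonglongrightarrow> (\<integral>e. c' * (indicator {0<..} e * (e ^ k * exp (- 1 * e))) \<partial>lborel)"
    proof (rule integral_dominated_convergence[where w = w])
      show "integrable lborel w"
        unfolding w_def
        by (intro integrable_mult_right Bochner_Integration.integrable_add integrable.intros[OF gamma_integral]) auto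
      show "(\<lambda>e. s (n + m) e) \<in> borel_measurable lborel" for n
        unfolding s_def
        using measurable_compose[OF _ \<open>\<And>n. (\<lambda>u. indicator {0<..<1} u * (f (N.I u) * (1 - Phi (N.I u)) ^ (n - j))) \<in> borel_measurable borel\<close>, of "\<lambda>e. e / real (n + m)" lborel "n + m"]
        by measurable
      show "AE e in lborel. norm (s (n + m) e) \<le> w e" for n
      proof (rule AE_I2)
        fix e :: real
        define p where "p = n + m"
        have p: "p \<ge> 3" "p \<ge> 2 * j" by (auto simp: p_def m_def)
        show "norm (s (n + m) e) \<le> w e"
        proof (cases "0 < e \<and> e < real p")
          case False
          then have "s p e = 0" using p by (auto simp: s_def indicator_def field_simps)
          then show ?thesis using C by (simp add: w_def p_def indicator_def)
        next
          case True
          define u where "u = e / real p"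
          have u: "0 < u" "u < 1" using True p by (auto simp: u_def)
          have lnp: "ln (real p) \<ge> 1"
          proof -
            have "exp 1 \<le> (3::real)" by (rule exp_le)
            also have "3 \<le> real p" using p by simp
            finally show ?thesis using p by (subst ln_ge_iff) auto
          qed
          have 1: "(1 - u) ^ (p - j) \<le> exp (- (1/2) * e)"
          proof -
            have "(1 - u) ^ (p - j) \<le> exp (- u) ^ (p - j)"
              using u exp_ge_add_one_self[of "-u"] by (intro power_mono) auto
            also have "\<dots> = exp (- (u * real (p - j)))" by (simp add: exp_of_nat_mult[symmetric] mult.commute)
            also have "u * real (p - j) \<ge> u * (real p / 2)"
              using u p by (intro mult_left_mono) auto
            then have "exp (- (u * real (p - j))) \<le> exp (- (1/2) * e)"
              using p by (simp add: u_def)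
            finally show ?thesis .
          qed
          \<comment> \<open>\<open>X\<close> compares the logarithm at \<open>u = e / p\<close> with \<open>ln p\<close>; both it and its inverse are at most \<open>2 + \<bar>ln e\<bar>\<close>.\<close>
          define X where "X = (1 + ln (1/u)) / ln (real p)"
          have lnu: "ln (1/u) = ln (real p) - ln e" using True p by (simp add: u_def ln_div)
          have lnu0: "ln (1/u) > 0" using u by (simp add: ln_div)
          have X: "X > 0" "X \<le> 2 + \<bar>ln e\<bar>" "1 / X \<le> 2 + \<bar>ln e\<bar>"
          proof -
            show "X > 0" using lnu0 lnp by (simp add: X_def)
            have "1 + ln (1/u) \<le> ln (real p) + ln (real p) * 1 + ln (real p) * \<bar>ln e\<bar>"
              using lnu lnp mult_right_mono[OF lnp, of "\<bar>ln e\<bar>"] by linarith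
            then show "X \<le> 2 + \<bar>ln e\<bar>" using lnp by (simp add: X_def divide_le_eq algebra_simps)
            have "ln (real p) \<le> (2 + \<bar>ln e\<bar>) * (1 + ln (1/u))"
            proof (cases "ln e \<le> 1")
              case True
              then have "ln (real p) \<le> 1 * (1 + ln (1/u))" using lnu by simp
              also have "\<dots> \<le> (2 + \<bar>ln e\<bar>) * (1 + ln (1/u))" using lnu0 by (intro mult_right_mono) auto
              finally show ?thesis .
            next
              case False
              then have "(1 + ln e) * (1 + ln (1/u)) - ln (real p) = 1 + ln e * ln (1/u)"
                using lnu by (simp add: algebra_simps)
              moreover have "ln e * ln (1/u) \<ge> 0" using False lnu0 by simp
              moreover have "(1 + ln e) * (1 + ln (1/u)) \<le> (2 + \<bar>ln e\<bar>) * (1 + ln (1/u))"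
                using lnu0 by (intro mult_right_mono) auto
              ultimately show ?thesis by linarith
            qed
            then show "1 / X \<le> 2 + \<bar>ln e\<bar>" using lnu0 lnp by (simp add: X_def divide_le_eq)
          qed
          have "f (N.I u) * real p ^ k * ln (real p) powr (- (r/2))
              \<le> (C * u ^ k * (1 + ln (1/u)) powr (r/2)) * real p ^ k * ln (real p) powr (- (r/2))"
            using fC[OF u] by (intro mult_right_mono) auto
          also have "\<dots> = C * e ^ k * X powr (r/2)"
            using lnp lnu0 p by (simp add: X_def powr_divide powr_minus_divide u_def power_divide)
          also have "X powr (r/2) \<le> (2 + \<bar>ln e\<bar>) powr \<bar>r/2\<bar>"
            using X by (intro powr_le_powr_abs(1)) auto
          also have "(2 + \<bar>ln e\<bar>) powr \<bar>r/2\<bar> \<le> (2 + \<bar>ln e\<bar>) powr 2"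
            using r by (intro powr_mono) auto
          also have "(2 + \<bar>ln e\<bar>) powr 2 \<le> 8 + 16 * e + 16 / e"
            using True by (intro abs_ln_square_le) auto
          finally have 2: "f (N.I u) * real p ^ k * ln (real p) powr (- (r/2)) \<le> C * e ^ k * (8 + 16 * e + 16 / e)"
            using C True by (simp add: mult_left_mono)
          have "norm (s p e) = (f (N.I u) * real p ^ k * ln (real p) powr (- (r/2))) * (1 - u) ^ (p - j)"
            using u f0 unfolding s_def u_def[symmetric] by (simp add: Phi_quantile abs_mult)
          also have "\<dots> \<le> (C * e ^ k * (8 + 16 * e + 16 / e)) * exp (- (1/2) * e)"
            using u C True by (intro mult_mono[OF 2 1]) auto
          also have "\<dots> = w e"
          proof -
            have "e ^ k = e * e ^ (k - 1)" using k by (cases k) auto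
            then show ?thesis using True by (simp add: w_def field_simps)
          qed
          finally show ?thesis by (simp add: p_def)
        qed
      qed
      show "AE e in lborel. (\<lambda>n. s (n + m) e) \<longlonglongrightarrow> c' * (indicator {0<..} e * (e ^ k * exp (- 1 * e)))"
      proof (rule AE_I2)
        fix e :: real
        have "(\<lambda>n. s n e) \<longlonglongrightarrow> c' * (indicator {0<..} e * (e ^ k * exp (- 1 * e)))"
        proof (cases "e > 0")
          case False
          then have "s n e = 0" for n by (auto simp: s_def indicator_def zero_less_divide_iff)
          then show ?thesis using False by (simp add: indicator_def)
        next
          case True
          have "(\<lambda>n. e / real n) \<longlonglongrightarrow> 0" by real_asymp
          then have "filterlim (\<lambda>n. e / real n) (at_right 0) sequentially"
            using True by (auto simp: filterlim_at intro!: eventually_sequentiallyI[of 1])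
          from filterlim_compose[OF quantile_profile[OF lim] this]
          have h: "(\<lambda>n. f (N.I (e / real n)) / ((e / real n) ^ k * ln (1/(e / real n)) powr (r/2))) \<longlonglongrightarrow> c'"
            by (simp add: c'_def)
          have "(\<lambda>n. ln (1 / (e / real n)) / ln (real n)) \<longlonglongrightarrow> 1" using True by real_asymp
          then have l: "(\<lambda>n. (ln (1 / (e / real n)) / ln (real n)) powr (r/2)) \<longlonglongrightarrow> 1 powr (r/2)"
            by (rule tendsto_powr[OF _ tendsto_const]) simp
          have "(\<lambda>n. (1 + (-e) / real n) ^ n) \<longlonglongrightarrow> exp (-e)"
            by (rule tendsto_exp_limit_sequentially)
          moreover have "(\<lambda>n. (1 - e / real n) ^ j) \<longlonglongrightarrow> 1 ^ j"
            by (rule tendsto_power) real_asymp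
          ultimately have "(\<lambda>n. (1 + (-e) / real n) ^ n / (1 - e / real n) ^ j) \<longlonglongrightarrow> exp (-e) / 1 ^ j"
            by (rule tendsto_divide) auto
          from tendsto_mult[OF tendsto_mult[OF tendsto_mult[OF h l] this] tendsto_const[of "e^k"]]
          have "(\<lambda>n. f (N.I (e / real n)) / ((e / real n) ^ k * ln (1/(e / real n)) powr (r/2))
              * (ln (1 / (e / real n)) / ln (real n)) powr (r/2) * ((1 + (-e) / real n) ^ n / (1 - e / real n) ^ j) * e ^ k)
              \<longlonglongrightarrow> c' * (indicator {0<..} e * (e ^ k * exp (- 1 * e)))"
            using True by (simp add: indicator_def mult_ac)
          then show ?thesis
          proof (rule Lim_transform_eventually)
            have "\<forall>\<^sub>F n in sequentially. e < real n" by real_asymp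
            then show "\<forall>\<^sub>F n in sequentially. f (N.I (e / real n)) / ((e / real n) ^ k * ln (1/(e / real n)) powr (r/2))
              * (ln (1 / (e / real n)) / ln (real n)) powr (r/2) * ((1 + (-e) / real n) ^ n / (1 - e / real n) ^ j) * e ^ k = s n e"
              using eventually_ge_at_top[of "max 3 j"]
            proof eventually_elim
              case (elim n)
              define u where "u = e / real n"
              have u: "0 < u" "u < 1" using True elim by (auto simp: u_def)
              have "ln (1/u) > 0" "ln (real n) > 0" using u elim by (auto simp: ln_div)
              moreover have "(1 + (-e) / real n) ^ n / (1 - e / real n) ^ j = (1 - u) ^ (n - j)"
                using elim u by (simp add: u_def power_diff)
              moreover have "e ^ k = u ^ k * real n ^ k" using elim by (simp add: u_def power_divide)
              ultimately show ?case using u elim True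
                unfolding s_def u_def[symmetric]
                by (simp add: Phi_quantile powr_divide powr_minus_divide)
            qed
          qed
        qed
        then show "(\<lambda>n. s (n + m) e) \<longlonglongrightarrow> c' * (indicator {0<..} e * (e ^ k * exp (- 1 * e)))"
          by (rule LIMSEQ_ignore_initial_segment)
      qed
    qed auto
    then show ?thesis by (rule LIMSEQ_offset)
  qed
  also have "(\<integral>e. c' * (indicator {0<..} e * (e ^ k * exp (- 1 * e))) \<partial>lborel) = c' * fact k"
    using has_bochner_integral_integral_eq[OF gamma_integral[of 1 k]] by simp
  finally show ?thesis
    unfolding c'_def
    by (rule Lim_transform_eventually) (auto intro!: eventually_sequentiallyI[of 1] simp only: eq)
qed

section \<open>Kernels for pairs and triples of diagonal entries\<close>

lemma \<phi>_nonzero [simp]: "\<phi> x \<noteq> 0" and Phi_nonzero [simp]: "Phi x \<noteq> 0"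
  using \<phi>_pos[of x] Phi_pos[of x] by linarith+

lemma N_prob_UNIV [simp]: "measure \<N> UNIV = 1"
  using N.prob_space by simp

text \<open>With \<open>\<kappa> = 1\<close> this is the conditional probability that the edge between vertices with
  diagonal entries \<open>w\<close> and \<open>c\<close> contains a point of value below the smallest diagonal entry \<open>z\<close>;
  \<open>\<kappa> = 1/2\<close> belongs to the weaker requirement that some edge of a larger support satisfies.\<close>

definition edgep :: "real \<Rightarrow> real \<Rightarrow> real \<Rightarrow> real \<Rightarrow> real" where
  "edgep \<kappa> z w c = Phi (sqrt 2 * (z - \<kappa> * sqrt ((w - z) * (c - z))))"

lemma edgep_nonneg [simp]: "edgep \<kappa> z w c \<ge> 0" and edgep_le_1 [simp]: "edgep \<kappa> z w c \<le> 1"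
  by (simp_all add: edgep_def)

lemma edgep_measurable [measurable]:
  assumes [measurable]: "f \<in> borel_measurable M" "g \<in> borel_measurable M" "h \<in> borel_measurable M"
  shows "(\<lambda>x. edgep \<kappa> (f x) (g x) (h x)) \<in> borel_measurable M"
  unfolding edgep_def by measurable

text \<open>Replacing the gap below \<open>z\<close> by any smaller \<open>s\<close> costs an explicit Gaussian factor relative to \<open>qmin z\<close>;
  all upper bounds on edge probabilities go through this estimate.\<close>

lemma edgep_le_exp:
  assumes "\<kappa> \<ge> 0" "0 \<le> s" "z \<le> 0" "s \<le> \<kappa> * sqrt ((w - z) * (c - z))"
  shows "edgep \<kappa> z w c \<le> qmin z * exp (2 * z * s - s\<^sup>2)"
proof -
  have "edgep \<kappa> z w c \<le> Phi (sqrt 2 * z - sqrt 2 * s)"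
    unfolding edgep_def using assms by (intro Phi_mono) (simp add: algebra_simps)
  also have "\<dots> \<le> qmin z * exp (sqrt 2 * z * (sqrt 2 * s) - (sqrt 2 * s)\<^sup>2 / 2)"
    using assms by (intro Phi_shift_le) auto
  also have "sqrt 2 * z * (sqrt 2 * s) - (sqrt 2 * s)\<^sup>2 / 2 = 2 * z * s - s\<^sup>2"
    by (simp add: power_mult_distrib)
  finally show ?thesis .
qed

lemma edgep_le_qmin:
  assumes "\<kappa> \<ge> 0" "z \<le> w" "z \<le> c" shows "edgep \<kappa> z w c \<le> qmin z"
  unfolding edgep_def using assms by (intro Phi_mono) simp

text \<open>A pair is near when its lower entry lies within \<open>1/\<bar>z\<bar>\<close> of the minimum \<open>z\<close> and its upper
  entry lies above \<open>z / 2\<close>, hence typically in the bulk; these pairs produce the asymptotics, and the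
  others are negligible.\<close>

definition near :: "real \<Rightarrow> real \<Rightarrow> real \<Rightarrow> bool" where
  "near z w c \<longleftrightarrow> z < -2 \<and> z < w \<and> w \<le> z - 1 / z \<and> z / 2 < c"

definition near_kernel :: "real \<Rightarrow> real \<Rightarrow> real \<Rightarrow> real" where
  "near_kernel z w c = (if near z w c then edgep 1 z w c else 0)"

definition far_kernel :: "real \<Rightarrow> real \<Rightarrow> real \<Rightarrow> real" where
  "far_kernel z w c = (if z < w \<and> w < c \<and> \<not> near z w c then edgep 1 z w c else 0)"

text \<open>The probability of two small entries in one row: one of them meets the requirement with
  \<open>\<kappa> = 1/2\<close>, the other only has to lie below \<open>z\<close>.\<close>

definition path_kernel :: "real \<Rightarrow> real \<Rightarrow> real \<Rightarrow> real" where
  "path_kernel z w c = (if z < w \<and> z < c then qmin z * edgep (1/2) z w c else 0)"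

lemma near_less:
  assumes "near z w c" shows "z < w" "w < c"
proof -
  have z: "z < -2" "w \<le> z - 1/z" "z/2 < c" using assms by (auto simp: near_def)
  have "- 1 / z < 1 / 2" using z by (simp add: field_simps)
  then show "z < w" "w < c" using assms z by (auto simp: near_def)
qed

text \<open>The factor \<open>(Phi w - Phi z) ^ p\<close> is the probability that \<open>p\<close> further entries fall between the
  minimum \<open>z\<close> and the entry \<open>w\<close>; it separates the pairs by the rank of their lower entry.\<close>

definition kint :: "nat \<Rightarrow> (real \<Rightarrow> real \<Rightarrow> real \<Rightarrow> real) \<Rightarrow> real \<Rightarrow> real" where
  "kint p h z = (\<integral>w. (\<integral>c. (Phi w - Phi z) ^ p * h z w c \<partial>\<N>) \<partial>\<N>)"

lemma kernel_measurable [measurable]: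
  assumes [measurable]: "f \<in> borel_measurable M" "g \<in> borel_measurable M" "h \<in> borel_measurable M"
  shows "(\<lambda>x. near_kernel (f x) (g x) (h x)) \<in> borel_measurable M"
    "(\<lambda>x. far_kernel (f x) (g x) (h x)) \<in> borel_measurable M"
    "(\<lambda>x. path_kernel (f x) (g x) (h x)) \<in> borel_measurable M"
  unfolding near_kernel_def far_kernel_def path_kernel_def near_def by measurable

text \<open>The substitution \<open>y = x\<^sup>2\<close> turns this into a Gamma integral.\<close>

lemma sqrt_gamma_integral:
  assumes c: "c > (0::real)"
  shows "has_bochner_integral lborel (\<lambda>y. indicator {0<..} y * (y ^ p * exp (- c * sqrt y)))
     (2 * fact (2*p+1) / c ^ (2*p+2))"
proof -
  define f where "f y = y ^ p * exp (- c * sqrt y)" for y :: real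
  define B where "B = 2 * fact (2*p+1) / c ^ (2*p+2)"
  have "has_bochner_integral lborel (\<lambda>x. 2 * (indicator {0<..} x * (x ^ (2*p+1) * exp (- c * x)))) (2 * (fact (2*p+1) / c ^ Suc (2*p+1)))"
    by (intro has_bochner_integral_mult_right gamma_integral c)
  moreover have "(\<lambda>x. 2 * (indicator {0<..} x * (x ^ (2*p+1) * exp (- c * x)))) = (\<lambda>x. indicator {0<..} x *\<^sub>R (\<bar>2 * x\<bar> * f (x\<^sup>2)))"
    by (auto simp: fun_eq_iff f_def indicator_def power_mult[symmetric] power_even_eq mult_ac)
  ultimately have g: "has_bochner_integral lborel (\<lambda>x. indicator {0<..} x *\<^sub>R (\<bar>2 * x\<bar> * f (x\<^sup>2))) B"
    by (simp add: B_def)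
  have S: "(\<lambda>x. \<bar>2 * x\<bar> * f (x\<^sup>2)) absolutely_integrable_on {0<..} \<and> integral {0<..} (\<lambda>x. \<bar>2 * x\<bar> * f (x\<^sup>2)) = B"
  proof -
    have si: "set_integrable lborel {0<..} (\<lambda>x. \<bar>2 * x\<bar> * f (x\<^sup>2))"
      using g unfolding set_integrable_def by (rule integrable.intros)
    have "integral {0<..} (\<lambda>x. \<bar>2 * x\<bar> * f (x\<^sup>2)) = (LINT x:{0<..}|lborel. \<bar>2 * x\<bar> * f (x\<^sup>2))"
      by (rule set_borel_integral_eq_integral(2)[OF si, symmetric])
    also have "\<dots> = B" unfolding set_lebesgue_integral_def by (rule has_bochner_integral_integral_eq[OF g])
    finally show ?thesis
      using si by (auto simp: set_integrable_def integrable_completion)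
  qed
  have im: "(\<lambda>x::real. x\<^sup>2) ` {0<..} = {0<..}"
  proof (intro equalityI subsetI)
    fix x :: real assume "x \<in> {0<..}"
    then have "x = (sqrt x)\<^sup>2" "sqrt x \<in> {0<..}" by auto
    then show "x \<in> (\<lambda>x. x\<^sup>2) ` {0<..}" by (rule image_eqI)
  qed auto
  have "f absolutely_integrable_on ((\<lambda>x. x\<^sup>2) ` {0<..}) \<and> integral ((\<lambda>x. x\<^sup>2) ` {0<..}) f = B"
  proof (rule iffD1[OF has_absolute_integral_change_of_variables_1'[where S = "{0<..}" and g = "\<lambda>x. x\<^sup>2" and f = f and b = B and g' = "\<lambda>x. 2 * x"]])
    show "(\<lambda>x. \<bar>2 * x\<bar> * f (x\<^sup>2)) absolutely_integrable_on {0<..} \<and> integral {0<..} (\<lambda>x. \<bar>2 * x\<bar> * f (x\<^sup>2)) = B"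
      by (rule S)
    show "inj_on (\<lambda>x::real. x\<^sup>2) {0<..}" by (auto simp: inj_on_def power2_eq_iff)
  qed (auto intro!: derivative_eq_intros)
  then have ai: "f absolutely_integrable_on {0<..}" "integral {0<..} f = B" unfolding im by auto
  have [measurable]: "f \<in> borel_measurable borel" unfolding f_def by measurable
  have si: "set_integrable lborel {0<..} f"
    using ai(1) unfolding set_integrable_def
    by (subst (asm) integrable_completion) auto
  have "(LINT x:{0<..}|lborel. f x) = B"
    using set_borel_integral_eq_integral(2)[OF si] ai by simp
  then show ?thesis
    using si unfolding has_bochner_integral_iff set_integrable_def set_lebesgue_integral_def f_def B_def by simp
qed

text \<open>Lowering a threshold \<open>- L\<close> by \<open>s\<close> with \<open>L * s \<longlongrightarrow> \<sigma>\<close> multiplies the tail by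
  \<open>exp (- 2 * \<sigma>)\<close>, as \<open>(sqrt 2 * (L + s))\<^sup>2 / 2 = L\<^sup>2 + 2 * L * s + s\<^sup>2\<close>.\<close>

lemma qmin_shift_ratio:
  assumes s: "((\<lambda>L. L * s L) \<longlongrightarrow> \<sigma>) at_top"
  shows "((\<lambda>L. Phi (sqrt 2 * (- L - s L)) / qmin (- L)) \<longlongrightarrow> exp (- 2 * \<sigma>)) at_top"
proof -
  have s0: "(s \<longlongrightarrow> 0) at_top"
  proof -
    have "((\<lambda>L. L * s L * (1 / L)) \<longlongrightarrow> \<sigma> * 0) at_top"
      by (intro tendsto_mult s) real_asymp
    then have "((\<lambda>L. L * s L * (1 / L)) \<longlongrightarrow> 0) at_top" by simp
    then show ?thesis
      by (rule Lim_transform_eventually)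
         (use eventually_gt_at_top[of 0] in \<open>eventually_elim, simp\<close>)
  qed
  have s1: "((\<lambda>L. s L / L) \<longlongrightarrow> 0) at_top"
  proof -
    have "((\<lambda>L. s L * (1 / L)) \<longlongrightarrow> 0 * 0) at_top"
      by (intro tendsto_mult s0) real_asymp
    then show ?thesis by simp
  qed
  have bot0: "filterlim (\<lambda>L::real. - L) at_bot at_top" by real_asymp
  have bot: "filterlim (\<lambda>L. sqrt 2 * (- L)) at_bot at_top"
    by (rule filterlim_compose[OF filterlim_sqrt2_at_bot bot0])
  have "filterlim (\<lambda>L. s L + L) at_top at_top"
    by (rule filterlim_tendsto_add_at_top[OF s0 filterlim_ident])
  then have "filterlim (\<lambda>L. - (s L + L)) at_bot at_top"
    by (simp only: filterlim_uminus_at_top)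
  then have bot1: "filterlim (\<lambda>L. sqrt 2 * (- L - s L)) at_bot at_top"
    by (intro filterlim_compose[OF filterlim_sqrt2_at_bot]) (simp add: algebra_simps)
  define r where "r x = Phi x * (-x) / \<phi> x" for x
  have "((\<lambda>L. r (sqrt 2 * (- L - s L)) / r (sqrt 2 * (- L)) * exp (- 2 * (L * s L) - (s L)\<^sup>2) * (1 / (1 + s L / L)))
     \<longlongrightarrow> 1 / 1 * exp (- 2 * \<sigma> - 0\<^sup>2) * (1 / (1 + 0))) at_top"
    unfolding r_def
    by (intro tendsto_intros filterlim_compose[OF Mills_ratio bot] filterlim_compose[OF Mills_ratio bot1] s s0 s1) auto
  then have "((\<lambda>L. r (sqrt 2 * (- L - s L)) / r (sqrt 2 * (- L)) * exp (- 2 * (L * s L) - (s L)\<^sup>2) * (1 / (1 + s L / L)))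
     \<longlongrightarrow> exp (- 2 * \<sigma>)) at_top" by simp
  then show ?thesis
  proof (rule Lim_transform_eventually)
    have "\<forall>\<^sub>F L in at_top. s L > -1" by (rule order_tendstoD(1)[OF s0]) simp
    then show "\<forall>\<^sub>F L in at_top. r (sqrt 2 * (- L - s L)) / r (sqrt 2 * (- L)) * exp (- 2 * (L * s L) - (s L)\<^sup>2) * (1 / (1 + s L / L))
       = Phi (sqrt 2 * (- L - s L)) / qmin (- L)"
      using eventually_gt_at_top[of 1]
    proof eventually_elim
      case (elim L)
      define A where "A = Phi (sqrt 2 * (- L - s L))"
      define B where "B = qmin (- L)"
      define P where "P = \<phi> (sqrt 2 * (- L))"
      define E where "E = exp (- 2 * (L * s L) - (s L)\<^sup>2)"
      have pos: "A > 0" "B > 0" "P > 0" "E > 0" by (simp_all add: A_def B_def P_def E_def)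
      have Ls: "L + s L > 0" using elim by simp
      have "\<phi> (sqrt 2 * (- L - s L)) = \<phi> (sqrt 2 * (- L) - sqrt 2 * s L)" by (simp add: algebra_simps)
      also have "\<dots> = P * exp (sqrt 2 * (- L) * (sqrt 2 * s L) - (sqrt 2 * s L)\<^sup>2 / 2)"
        unfolding P_def by (rule \<phi>_shift)
      also have "sqrt 2 * (- L) * (sqrt 2 * s L) - (sqrt 2 * s L)\<^sup>2 / 2 = - 2 * (L * s L) - (s L)\<^sup>2"
        by (simp add: power_mult_distrib)
      finally have phi: "\<phi> (sqrt 2 * (- L - s L)) = P * E" by (simp add: E_def)
      have r1: "r (sqrt 2 * (- L - s L)) = A * (sqrt 2 * (L + s L)) / (P * E)"
        unfolding r_def phi A_def by (simp add: algebra_simps)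
      have r2: "r (sqrt 2 * (- L)) = B * (sqrt 2 * L) / P"
        unfolding r_def B_def P_def by simp
      have r3: "1 + s L / L = (L + s L) / L" using elim by (simp add: field_simps)
      have "A * (sqrt 2 * t) / (P * E) / (B * (sqrt 2 * L) / P) * E * (1 / (t / L)) = A / B" if "t > 0" for t
        using pos that elim by simp
      from this[OF Ls] show ?case
        unfolding r1 r2 r3 A_def[symmetric] B_def[symmetric] E_def[symmetric] .
    qed
  qed
qed

text \<open>The right scale for the lower entry is \<open>w = - L + y / L ^ 3\<close>: for \<open>c\<close> in the bulk the gap
  \<open>sqrt ((w + L) * (c + L))\<close> is then close to \<open>sqrt y / L\<close>, so the edge probability is close to
  \<open>qmin (- L) * exp (- 2 * sqrt y)\<close>, while \<open>Phi w - Phi (- L)\<close> is close to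
  \<open>\<phi> (- L) * y / L ^ 3\<close>.  Dominated convergence leaves the integral of
  \<open>y ^ p * exp (- 2 * sqrt y)\<close>.\<close>

theorem near_kernel_limit:
  "((\<lambda>L. kint p near_kernel (- L) / (qmin (- L) * \<phi> (- L) ^ (p+1) / L ^ (3*(p+1))))
     \<longlongrightarrow> 2 * fact (2*p+1) / 2 ^ (2*p+2)) at_top"
proof -
  define W where "W L y = - L + (1 / L^3) * y" for L y :: real
  \<comment> \<open>The inner integral over the upper entry, relative to \<open>qmin (- L)\<close>.\<close>
  define G where "G L w = (\<integral>c. indicator {-L/2<..} c * (edgep 1 (-L) w c / qmin (-L)) \<partial>\<N>)" for L w
  define T where "T L y = indicator {0<..L\<^sup>2} y * (((Phi (W L y) - Phi (-L)) * L^3 / \<phi> (-L)) ^ p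
      * (\<phi> (W L y) / \<phi> (-L)) * G L (W L y))" for L y
  have [measurable]: "G L \<in> borel_measurable borel" for L
    unfolding G_def by measurable
  have [measurable]: "W L \<in> borel_measurable borel" for L unfolding W_def by measurable
  have [measurable]: "T L \<in> borel_measurable borel" for L unfolding T_def by measurable
  have eq: "kint p near_kernel (- L) / (qmin (- L) * \<phi> (- L) ^ (p+1) / L ^ (3*(p+1))) = (\<integral>y. T L y \<partial>lborel)"
    if L: "L > 2" for L
  proof -
    define q where "q = qmin (-L)"
    have q: "q > 0" by (simp add: q_def)
    define f where "f = \<phi> (-L)"
    have f: "f > 0" by (simp add: f_def)
    define Hh where "Hh w = indicator {-L<..-L+1/L} w * (Phi w - Phi (-L)) ^ p * (q * G L w)" for w
    have [measurable]: "Hh \<in> borel_measurable borel" unfolding Hh_def by measurable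
    have "(\<integral>c. (Phi w - Phi (-L)) ^ p * near_kernel (-L) w c \<partial>\<N>) = Hh w" for w
    proof -
      have "(\<integral>c. (Phi w - Phi (-L)) ^ p * near_kernel (-L) w c \<partial>\<N>)
         = (\<integral>c. (indicator {-L<..-L+1/L} w * (Phi w - Phi (-L)) ^ p * q) * (indicator {-L/2<..} c * (edgep 1 (-L) w c / q)) \<partial>\<N>)"
        using L q by (intro Bochner_Integration.integral_cong) (auto simp: near_kernel_def near_def indicator_def)
      then show ?thesis unfolding Hh_def G_def q_def by simp
    qed
    then have "kint p near_kernel (-L) = (\<integral>w. Hh w \<partial>\<N>)" by (simp add: kint_def)
    also have "\<dots> = (\<integral>w. \<phi> w * Hh w \<partial>lborel)"
      by (subst integral_density) auto
    also have "\<dots> = \<bar>1/L^3\<bar> *\<^sub>R (\<integral>y. \<phi> (- L + (1/L^3) * y) * Hh (- L + (1/L^3) * y) \<partial>lborel)"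
      using L by (intro lborel_integral_real_affine) auto
    also have "\<dots> = (1/L^3) * (\<integral>y. \<phi> (W L y) * Hh (W L y) \<partial>lborel)"
      using L by (simp add: W_def)
    also have "(\<lambda>y. \<phi> (W L y) * Hh (W L y)) = (\<lambda>y. (q * f ^ (p+1) / L ^ (3*p)) * T L y)"
    proof
      fix y
      have "W L y \<in> {-L<..-L+1/L} \<longleftrightarrow> y \<in> {0<..L\<^sup>2}"
        using L by (auto simp: W_def field_simps power2_eq_square power3_eq_cube)
      then have i: "indicator {-L<..-L+1/L} (W L y) = (indicator {0<..L\<^sup>2} y :: real)"
        by (simp add: indicator_def)
      define D where "D = Phi (W L y) - Phi (-L)"
      have "L ^ (3*p) = (L^3)^p" by (rule power_mult)
      then show "\<phi> (W L y) * Hh (W L y) = (q * f ^ (p+1) / L ^ (3*p)) * T L y"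
        unfolding Hh_def T_def i f_def[symmetric] D_def[symmetric]
        using f q L by (simp add: power_mult_distrib power_divide)
    qed
    finally have "kint p near_kernel (-L) = (1/L^3) * ((q * f ^ (p+1) / L ^ (3*p)) * (\<integral>y. T L y \<partial>lborel))"
      by simp
    also have "\<dots> = (q * f ^ (p+1) / L ^ (3*(p+1))) * (\<integral>y. T L y \<partial>lborel)"
      using L by (simp add: power_add)
    finally show ?thesis using q f L unfolding q_def[symmetric] f_def[symmetric] by simp
  qed
  have sL: "1 * sqrt ((W L y - - L) * (c - - L)) = sqrt (y * (c + L) / L^3)" for L y c
    by (simp add: W_def field_simps)
  have Gbound: "0 \<le> G L (W L y) \<and> G L (W L y) \<le> exp (- 1 * sqrt y)" if L: "L > 2" and y: "y > 0" for L y
  proof -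
    have pt: "indicator {-L/2<..} c * (edgep 1 (-L) (W L y) c / qmin (-L)) \<le> exp (- 1 * sqrt y)" for c
    proof (cases "c > - L/2")
      case True
      \<comment> \<open>Near pairs have \<open>c + L > L / 2\<close>; half of the limiting exponent survives in the bound.\<close>
      have "sqrt y / (2 * L) \<le> sqrt (y * (c + L) / L^3)"
      proof -
        have "y * (L/2) / L^3 \<le> y * (c + L) / L^3"
          using True y L by (intro divide_right_mono mult_left_mono) auto
        moreover have "y / (2 * L)\<^sup>2 \<le> y * (L/2) / L^3"
          using y L by (simp add: field_simps power2_eq_square power3_eq_cube)
        ultimately have "sqrt (y / (2 * L)\<^sup>2) \<le> sqrt (y * (c + L) / L^3)" by (intro real_sqrt_le_mono) linarith
        moreover have "sqrt (y / (2 * L)\<^sup>2) = sqrt y / (2 * L)"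
          using L by (simp only: real_sqrt_divide real_sqrt_abs)
        ultimately show ?thesis by (simp only:)
      qed
      then have "edgep 1 (-L) (W L y) c \<le> qmin (-L) * exp (2 * (- L) * (sqrt y / (2 * L)) - (sqrt y / (2 * L))\<^sup>2)"
        using L y by (intro edgep_le_exp) (simp_all only: sL, simp_all?)
      also have "\<dots> \<le> qmin (-L) * exp (- 1 * sqrt y)"
        using L by (intro mult_left_mono) auto
      finally show ?thesis using True by (simp add: divide_le_eq mult.commute)
    qed simp
    have "G L (W L y) \<le> (\<integral>c. exp (- 1 * sqrt y) \<partial>\<N>)"
      unfolding G_def using pt
      by (intro integral_mono_AE N.integrable_const_bound[where B = "exp (- 1 * sqrt y)"] AE_I2) (auto simp: abs_mult)
    moreover have "0 \<le> G L (W L y)" unfolding G_def by (intro Bochner_Integration.integral_nonneg) auto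
    ultimately show ?thesis by simp
  qed
  have Glim: "((\<lambda>L. G L (W L y)) \<longlongrightarrow> exp (- 2 * sqrt y)) at_top" if y: "y > 0" for y
  proof -
    have "((\<lambda>L. G L (W L y)) \<longlongrightarrow> (\<integral>c. exp (- 2 * sqrt y) \<partial>\<N>)) at_top"
      unfolding G_def
    proof (rule integral_dominated_convergence_at_top[where w = "\<lambda>_. 1"])
      show "AE c in \<N>. ((\<lambda>L. indicator {-L/2<..} c * (edgep 1 (-L) (W L y) c / qmin (-L))) \<longlongrightarrow> exp (- 2 * sqrt y)) at_top"
      proof (rule AE_I2)
        fix c
        have "((\<lambda>L. L * sqrt (y * (c + L) / L^3)) \<longlongrightarrow> sqrt y) at_top"
          using y powr_half_sqrt[of y] by real_asymp
        from qmin_shift_ratio[OF this]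
        show "((\<lambda>L. indicator {-L/2<..} c * (edgep 1 (-L) (W L y) c / qmin (-L))) \<longlongrightarrow> exp (- 2 * sqrt y)) at_top"
        proof (rule Lim_transform_eventually)
          show "\<forall>\<^sub>F L in at_top. Phi (sqrt 2 * (- L - sqrt (y * (c + L) / L ^ 3))) / qmin (- L) =
             indicator {-L/2<..} c * (edgep 1 (-L) (W L y) c / qmin (-L))"
            using eventually_gt_at_top[of "2 * \<bar>c\<bar>"]
            by eventually_elim (simp only: edgep_def sL, auto simp: indicator_def)
        qed
      qed
      show "\<forall>\<^sub>F L in at_top. AE c in \<N>. norm (indicator {- L / 2<..} c * (edgep 1 (- L) (W L y) c / qmin (- L))) \<le> 1"
        using eventually_gt_at_top[of 2]
      proof eventually_elim
        case (elim L)
        have "edgep 1 (- L) (W L y) c \<le> qmin (- L)" if "c > - L/2" for c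
          using that elim y by (intro edgep_le_qmin) (auto simp: W_def)
        then show ?case by (auto simp: indicator_def)
      qed
    qed auto
    then show ?thesis by simp
  qed
  have "((\<lambda>L. \<integral>y. T L y \<partial>lborel) \<longlongrightarrow> (\<integral>y. indicator {0<..} y * (y ^ p * exp (- 2 * sqrt y)) \<partial>lborel)) at_top"
  proof (rule integral_dominated_convergence_at_top[where w = "\<lambda>y. exp 1 ^ (p+1) * (indicator {0<..} y * (y ^ p * exp (- 1 * sqrt y)))"])
    show "integrable lborel (\<lambda>y. exp 1 ^ (p+1) * (indicator {0<..} y * (y ^ p * exp (- 1 * sqrt y))))"
      by (intro integrable_mult_right integrable.intros[OF sqrt_gamma_integral]) auto
    have W: "W L y \<le> 0" "- L \<le> W L y" "W L y - (- L) = y / L^3"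
      "\<phi> (W L y) / \<phi> (-L) = exp (y / L\<^sup>2 - (y / L^3)\<^sup>2 / 2)"
      if L: "L > 2" and y: "0 < y" "y \<le> L\<^sup>2" for L y
    proof -
      have "y / L^3 \<le> L\<^sup>2 / L^3" using y L by (intro divide_right_mono) auto
      also have "\<dots> = 1 / L" using L by (simp add: field_simps power2_eq_square power3_eq_cube)
      also have "1 / L \<le> L"
        using L mult_mono[of 1 L 1 L] by (simp add: divide_le_eq)
      finally show "W L y \<le> 0" by (simp add: W_def)
      show "- L \<le> W L y" using y L by (simp add: W_def)
      show "W L y - (- L) = y / L^3" by (simp add: W_def)
      have "W L y = - L - (- (y / L^3))" by (simp add: W_def)
      then have "\<phi> (W L y) = \<phi> (-L) * exp ((- L) * (- (y / L^3)) - (- (y / L^3))\<^sup>2 / 2)"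
        by (simp only: \<phi>_shift)
      also have "(- L) * (- (y / L^3)) = y / L\<^sup>2" using L by (simp add: field_simps power2_eq_square power3_eq_cube)
      finally show "\<phi> (W L y) / \<phi> (-L) = exp (y / L\<^sup>2 - (y / L^3)\<^sup>2 / 2)"
        using \<phi>_pos[of "-L"] by simp
    qed
    have D: "y \<le> (Phi (W L y) - Phi (-L)) * L^3 / \<phi> (-L)"
      "(Phi (W L y) - Phi (-L)) * L^3 / \<phi> (-L) \<le> y * (\<phi> (W L y) / \<phi> (-L))"
      if L: "L > 2" and y: "0 < y" "y \<le> L\<^sup>2" for L y
    proof -
      have b: "\<phi> (-L) * (y / L^3) \<le> Phi (W L y) - Phi (-L)" "Phi (W L y) - Phi (-L) \<le> \<phi> (W L y) * (y / L^3)"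
        using Phi_diff_bounds[OF W(2,1)[OF that]] W(3)[OF that] by auto
      then have "\<phi> (-L) * (y / L^3) * L^3 \<le> (Phi (W L y) - Phi (-L)) * L^3" 
        "(Phi (W L y) - Phi (-L)) * L^3 \<le> \<phi> (W L y) * (y / L^3) * L^3" using L
        by (intro mult_right_mono; simp)+
      then show "y \<le> (Phi (W L y) - Phi (-L)) * L^3 / \<phi> (-L)"
        "(Phi (W L y) - Phi (-L)) * L^3 / \<phi> (-L) \<le> y * (\<phi> (W L y) / \<phi> (-L))"
        using L by (simp_all add: le_divide_eq divide_le_eq mult.commute)
    qed
    show "\<forall>\<^sub>F L in at_top. AE y in lborel. norm (T L y) \<le> exp 1 ^ (p+1) * (indicator {0<..} y * (y ^ p * exp (- 1 * sqrt y)))"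
      using eventually_gt_at_top[of 2]
    proof eventually_elim
      case (elim L)
      have "norm (T L y) \<le> exp 1 ^ (p+1) * (indicator {0<..} y * (y ^ p * exp (- 1 * sqrt y)))" for y
      proof (cases "0 < y \<and> y \<le> L\<^sup>2")
        case True
        then have y: "0 < y" "y \<le> L\<^sup>2" by auto
        define A where "A = (Phi (W L y) - Phi (-L)) * L^3 / \<phi> (-L)"
        define F where "F = \<phi> (W L y) / \<phi> (-L)"
        have F: "0 \<le> F" "F \<le> exp 1"
        proof -
          show "0 \<le> F" by (simp add: F_def)
          have "y / L\<^sup>2 \<le> 1" using y elim by (simp add: divide_le_eq)
          then have "y / L\<^sup>2 - (y / L^3)\<^sup>2 / 2 \<le> 1" by (smt (verit) zero_le_power2 divide_nonneg_nonneg)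
          then show "F \<le> exp 1" unfolding F_def W(4)[OF elim y] by simp
        qed
        have A: "0 \<le> A" "A \<le> y * exp 1"
        proof -
          show "0 \<le> A" using D(1)[OF elim y] y by (simp add: A_def)
          have "A \<le> y * F" using D(2)[OF elim y] by (simp add: A_def F_def)
          also have "\<dots> \<le> y * exp 1" using F y by (intro mult_left_mono) auto
          finally show "A \<le> y * exp 1" .
        qed
        have "norm (T L y) = A ^ p * F * G L (W L y)"
          using True A F Gbound[OF elim y(1)] by (simp add: T_def A_def[symmetric] F_def[symmetric] abs_mult)
        also have "\<dots> \<le> (y * exp 1) ^ p * exp 1 * exp (- 1 * sqrt y)"
          using A F Gbound[OF elim y(1)] y
          by (intro mult_mono power_mono mult_nonneg_nonneg) auto
        finally show ?thesis using y by (simp add: power_mult_distrib mult_ac)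
      qed (auto simp: T_def indicator_def)
      then show ?case by (intro AE_I2)
    qed
    show "AE y in lborel. ((\<lambda>L. T L y) \<longlongrightarrow> indicator {0<..} y * (y ^ p * exp (- 2 * sqrt y))) at_top"
    proof (rule AE_I2)
      fix y :: real
      show "((\<lambda>L. T L y) \<longlongrightarrow> indicator {0<..} y * (y ^ p * exp (- 2 * sqrt y))) at_top"
      proof (cases "y > 0")
        case True
        have ev: "\<forall>\<^sub>F L in at_top. L > 2 \<and> y \<le> L\<^sup>2"
          by (intro eventually_conj) real_asymp+
        have F: "((\<lambda>L. \<phi> (W L y) / \<phi> (-L)) \<longlongrightarrow> 1) at_top"
        proof -
          have "((\<lambda>L. exp (y / L\<^sup>2 - (y / L^3)\<^sup>2 / 2)) \<longlongrightarrow> 1) at_top" using True by real_asymp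
          then show ?thesis
            by (rule Lim_transform_eventually) (use ev in eventually_elim, use W(4) True in simp)
        qed
        have A: "((\<lambda>L. (Phi (W L y) - Phi (-L)) * L^3 / \<phi> (-L)) \<longlongrightarrow> y) at_top"
        proof (rule tendsto_sandwich)
          show "\<forall>\<^sub>F L in at_top. y \<le> (Phi (W L y) - Phi (-L)) * L^3 / \<phi> (-L)"
            using ev by eventually_elim (use D(1) True in auto)
          show "\<forall>\<^sub>F L in at_top. (Phi (W L y) - Phi (-L)) * L^3 / \<phi> (-L) \<le> y * (\<phi> (W L y) / \<phi> (-L))"
            using ev by eventually_elim (use D(2) True in auto)
          show "((\<lambda>L. y * (\<phi> (W L y) / \<phi> (-L))) \<longlongrightarrow> y) at_top"
            using tendsto_mult[OF tendsto_const[of y] F] by simp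
        qed simp
        have "((\<lambda>L. ((Phi (W L y) - Phi (-L)) * L^3 / \<phi> (-L)) ^ p * (\<phi> (W L y) / \<phi> (-L)) * G L (W L y))
            \<longlongrightarrow> y ^ p * 1 * exp (- 2 * sqrt y)) at_top"
          by (intro tendsto_intros A F Glim True)
        then have "((\<lambda>L. ((Phi (W L y) - Phi (-L)) * L^3 / \<phi> (-L)) ^ p * (\<phi> (W L y) / \<phi> (-L)) * G L (W L y))
            \<longlongrightarrow> indicator {0<..} y * (y ^ p * exp (- 2 * sqrt y))) at_top"
          using True by simp
        then show ?thesis
          by (rule Lim_transform_eventually) (use ev in eventually_elim, use True in \<open>simp add: T_def\<close>)
      qed (simp add: T_def indicator_def)
    qed
  qed auto
  also have "(\<integral>y. indicator {0<..} y * (y ^ p * exp (- 2 * sqrt y)) \<partial>lborel) = 2 * fact (2*p+1) / 2 ^ (2*p+2)"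
    by (rule has_bochner_integral_integral_eq[OF sqrt_gamma_integral]) simp
  finally show ?thesis
    by (rule Lim_transform_eventually) (use eventually_gt_at_top[of 2] in eventually_elim, simp only: eq)
qed

text \<open>Limits at minus infinity, with \<open>Phi z\<close> and \<open>- z\<close> as the scale.  The powers of \<open>- z\<close> in
  the normalisation come from \<open>qmin z \<sim> sqrt pi * Phi z ^ 2 * (- z)\<close> and \<open>\<phi> z \<sim> Phi z * (- z)\<close>.\<close>

lemma \<phi>_over_Phi: "((\<lambda>z. \<phi> z / (Phi z * (-z))) \<longlongrightarrow> 1) at_bot"
  using tendsto_divide[OF tendsto_const[of 1] Mills_ratio] by simp

lemma near_kernel_asymp:
  "((\<lambda>z. kint p near_kernel z / (Phi z ^ (p+3) * (-z) powr (- 1 - 2 * real p)))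
     \<longlongrightarrow> sqrt pi * (2 * fact (2*p+1) / 2 ^ (2*p+2))) at_bot"
proof -
  have "filterlim (\<lambda>z::real. - z) at_top at_bot" by real_asymp
  from filterlim_compose[OF near_kernel_limit[of p] this]
  have k: "((\<lambda>z. kint p near_kernel z / (qmin z * \<phi> z ^ (p+1) / (-z) ^ (3*(p+1)))) \<longlongrightarrow> 2 * fact (2*p+1) / 2 ^ (2*p+2)) at_bot"
    by simp
  have "((\<lambda>z. (qmin z / (Phi z ^ 2 * (-z))) * (\<phi> z / (Phi z * (-z))) ^ (p+1) *
     (kint p near_kernel z / (qmin z * \<phi> z ^ (p+1) / (-z) ^ (3*(p+1))))) \<longlongrightarrow> sqrt pi * 1 ^ (p+1) * (2 * fact (2*p+1) / 2 ^ (2*p+2))) at_bot"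
    by (intro tendsto_mult tendsto_power k qmin_asymp \<phi>_over_Phi)
  then have "((\<lambda>z. (qmin z / (Phi z ^ 2 * (-z))) * (\<phi> z / (Phi z * (-z))) ^ (p+1) *
     (kint p near_kernel z / (qmin z * \<phi> z ^ (p+1) / (-z) ^ (3*(p+1))))) \<longlongrightarrow> sqrt pi * (2 * fact (2*p+1) / 2 ^ (2*p+2))) at_bot"
    by simp
  then show ?thesis
  proof (rule Lim_transform_eventually)
    show "\<forall>\<^sub>F z in at_bot. (qmin z / (Phi z ^ 2 * (-z))) * (\<phi> z / (Phi z * (-z))) ^ (p+1) *
     (kint p near_kernel z / (qmin z * \<phi> z ^ (p+1) / (-z) ^ (3*(p+1))))
     = kint p near_kernel z / (Phi z ^ (p+3) * (-z) powr (- 1 - 2 * real p))"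
      using eventually_le_at_bot[of "-1"]
    proof eventually_elim
      case (elim z)
      define L where "L = - z"
      have L: "L > 0" "-z = L" using elim by (auto simp: L_def)
      have "L powr (- 1 - 2 * real p) = L powr (real (p + 2) - real (3 * (p + 1)))" by (simp add: algebra_simps)
      also have "\<dots> = L ^ (p + 2) / L ^ (3*(p+1))"
        using L by (simp only: powr_diff powr_realpow)
      finally have pw2: "L powr (- 1 - 2 * real p) = L ^ (p + 2) / L ^ (3*(p+1))" .
      have alg: "(q / (P ^ 2 * L)) * (f / (P * L)) ^ (p+1) * (K / (q * f ^ (p+1) / L3))
         = K / (P ^ (p+3) * (L ^ (p+2) / L3))" if "P > 0" "q > 0" "f > 0" "L3 > 0" for P q f K L3 :: real
        using that L by (simp add: power_divide power_mult_distrib field_simps power_add power2_eq_square power3_eq_cube)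
      show ?case unfolding L(2) pw2 using L by (intro alg) auto
    qed
  qed
qed

lemma Phi_tail_le:
  assumes "z \<le> -1" shows "Phi z \<le> exp (- z\<^sup>2 / 2)"
proof -
  have "Phi z \<le> \<phi> z / (-z)" using assms by (intro Phi_upper) simp
  also have "\<dots> \<le> \<phi> z / 1" using assms by (intro divide_left_mono) auto
  also have "\<dots> = \<phi> z" by simp
  also have "\<dots> \<le> exp (- z\<^sup>2 / 2)"
  proof -
    have "1 / sqrt (2 * pi) \<le> 1" using pi_gt3 by (simp add: real_le_rsqrt)
    then show ?thesis unfolding std_normal_density_def
      using mult_right_mono[of "1 / sqrt (2 * pi)" 1 "exp (- z\<^sup>2 / 2)"] by simp
  qed
  finally show ?thesis .
qed

lemma Phi_times_power_vanishes: "((\<lambda>z. Phi z * (-z) ^ m) \<longlongrightarrow> 0) at_bot"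
proof (rule tendsto_sandwich)
  show "\<forall>\<^sub>F z in at_bot. 0 \<le> Phi z * (-z) ^ m"
    using eventually_le_at_bot[of "-1"] by eventually_elim auto
  show "\<forall>\<^sub>F z in at_bot. Phi z * (-z) ^ m \<le> exp (- z\<^sup>2 / 2) * (-z) ^ m"
    using eventually_le_at_bot[of "-1"] by eventually_elim (intro mult_right_mono Phi_tail_le, auto)
  show "((\<lambda>z::real. exp (- z\<^sup>2 / 2) * (-z) ^ m) \<longlongrightarrow> 0) at_bot" by real_asymp
qed simp

lemma powr_minus3: "L > 0 \<Longrightarrow> L powr (-3) = 1 / L ^ 3" for L :: real
  using powr_minus_divide[of L 3] powr_realpow[of L 3] by simp

lemma qmin_square_asymp: "((\<lambda>z. qmin z ^ 2 / (Phi z ^ 3 * (-z) powr (-3))) \<longlongrightarrow> 0) at_bot"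
proof -
  have "((\<lambda>z. (qmin z / (Phi z ^ 2 * (-z))) ^ 2 * (Phi z * (-z) ^ 5)) \<longlongrightarrow> sqrt pi ^ 2 * 0) at_bot"
    by (intro tendsto_mult tendsto_power qmin_asymp Phi_times_power_vanishes)
  then have "((\<lambda>z. (qmin z / (Phi z ^ 2 * (-z))) ^ 2 * (Phi z * (-z) ^ 5)) \<longlongrightarrow> 0) at_bot" by simp
  then show ?thesis
  proof (rule Lim_transform_eventually)
    show "\<forall>\<^sub>F z in at_bot. (qmin z / (Phi z ^ 2 * (-z))) ^ 2 * (Phi z * (-z) ^ 5) = qmin z ^ 2 / (Phi z ^ 3 * (-z) powr (-3))"
      using eventually_le_at_bot[of "-1"]
    proof eventually_elim
      case (elim z)
      have alg: "(q / (P ^ 2 * L)) ^ 2 * (P * L ^ 5) = q ^ 2 / (P ^ 3 * (1 / L ^ 3))" if "P > 0" "L > 0" for P L q :: real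
        using that by (simp add: field_simps eval_nat_numeral)
      show ?case using elim by (simp only: powr_minus3) (intro alg, auto)
    qed
  qed
qed

lemma qmin_cube_asymp: "((\<lambda>z. qmin z ^ 3 / (Phi z ^ 5 * (-z) powr (-3))) \<longlongrightarrow> 0) at_bot"
proof -
  have "((\<lambda>z. (qmin z / (Phi z ^ 2 * (-z))) ^ 3 * (Phi z * (-z) ^ 6)) \<longlongrightarrow> sqrt pi ^ 3 * 0) at_bot"
    by (intro tendsto_mult tendsto_power qmin_asymp Phi_times_power_vanishes)
  then have "((\<lambda>z. (qmin z / (Phi z ^ 2 * (-z))) ^ 3 * (Phi z * (-z) ^ 6)) \<longlongrightarrow> 0) at_bot" by simp
  then show ?thesis
  proof (rule Lim_transform_eventually)
    show "\<forall>\<^sub>F z in at_bot. (qmin z / (Phi z ^ 2 * (-z))) ^ 3 * (Phi z * (-z) ^ 6) = qmin z ^ 3 / (Phi z ^ 5 * (-z) powr (-3))"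
      using eventually_le_at_bot[of "-1"]
    proof eventually_elim
      case (elim z)
      have alg: "(q / (P ^ 2 * L)) ^ 3 * (P * L ^ 6) = q ^ 3 / (P ^ 5 * (1 / L ^ 3))" if "P > 0" "L > 0" for P L q :: real
        using that by (simp add: field_simps eval_nat_numeral)
      show ?case using elim by (simp only: powr_minus3) (intro alg, auto)
    qed
  qed
qed

lemma near_kernel_2_asymp: "((\<lambda>z. kint 2 near_kernel z / (Phi z ^ 5 * (-z) powr (-3))) \<longlongrightarrow> 0) at_bot"
proof -
  have "((\<lambda>z::real. (-z) powr (-2)) \<longlongrightarrow> 0) at_bot" by real_asymp
  from tendsto_mult[OF near_kernel_asymp[of 2] this]
  have "((\<lambda>z. kint 2 near_kernel z / (Phi z ^ (2+3) * (-z) powr (- 1 - 2 * real 2)) * (-z) powr (-2)) \<longlongrightarrow> 0) at_bot" by simp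
  then show ?thesis
  proof (rule Lim_transform_eventually)
    show "\<forall>\<^sub>F z in at_bot. kint 2 near_kernel z / (Phi z ^ (2+3) * (-z) powr (- 1 - 2 * real 2)) * (-z) powr (-2) = kint 2 near_kernel z / (Phi z ^ 5 * (-z) powr (-3))"
      using eventually_le_at_bot[of "-1"]
    proof eventually_elim
      case (elim z)
      have "(-z) powr (-5) = (-z) powr (-3) * (-z) powr (-2)" by (simp add: powr_add[symmetric])
      moreover have "(-z) powr (-2) > 0" using elim by simp
      ultimately show ?case by simp
    qed
  qed
qed

text \<open>Three ways for a pair with \<open>z < w < c\<close> to fail to be near: both entries are in the lower
  half (few candidates for \<open>c\<close>), or the threshold is at least \<open>sqrt (\<bar>z\<bar> / 2 * (w - z))\<close> below
  \<open>z\<close> with \<open>w - z > 1/\<bar>z\<bar>\<close>, or it is \<open>\<bar>z\<bar> / 2\<close> below.\<close>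

lemma far_kernel_le:
  assumes z: "z < -2"
  shows "far_kernel z w c \<le> qmin z * (indicator {..z/2} c * (indicator {z<..} w * exp (2 * z * (w - z)))
      + indicator {z - 1/z<..z/2} w * exp (z / sqrt 2) * exp (z * (w - z)) + exp (- (5/4) * z\<^sup>2))"
    (is "_ \<le> qmin z * (?A + ?B + ?C)")
proof (cases "z < w \<and> w < c \<and> \<not> near z w c")
  case False
  then show ?thesis by (auto simp: far_kernel_def)
next
  case True
  then have h: "far_kernel z w c = edgep 1 z w c" by (simp add: far_kernel_def)
  have nn: "?A \<ge> 0" "?B \<ge> 0" "?C \<ge> 0" by auto
  consider "c \<le> z/2" | "c > z/2" "w > z - 1/z" "w \<le> z/2" | "w > z/2"
    using True z by (force simp: near_def)
  then have "edgep 1 z w c \<le> qmin z * ?A \<or> edgep 1 z w c \<le> qmin z * ?B \<or> edgep 1 z w c \<le> qmin z * ?C"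
  proof cases
    case 1
    have "sqrt ((w - z)\<^sup>2) \<le> sqrt ((w - z) * (c - z))"
      using True by (intro real_sqrt_le_mono) (simp add: power2_eq_square mult_left_mono)
    then have "edgep 1 z w c \<le> qmin z * exp (2 * z * (w - z) - (w - z)\<^sup>2)"
      using True z by (intro edgep_le_exp) auto
    also have "\<dots> \<le> qmin z * exp (2 * z * (w - z))" by (intro mult_left_mono) auto
    finally show ?thesis using 1 True by simp
  next
    case 2
    define a where "a = w - z"
    define L where "L = - z"
    have L: "L > 2" "z = - L" using z by (auto simp: L_def)
    have a: "a > 1 / L" "a \<le> L / 2" using 2 L by (auto simp: a_def)
    have a0: "a > 0" using a(1) L by (smt (verit) divide_pos_pos)
    define s where "s = sqrt (a * (L / 2))"
    have "s \<le> sqrt ((w - z) * (c - z))"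
      unfolding s_def using 2 a0 L by (intro real_sqrt_le_mono mult_mono) (auto simp: a_def)
    moreover have s0: "s \<ge> 0" using a0 L by (simp add: s_def)
    ultimately have "edgep 1 z w c \<le> qmin z * exp (2 * z * s - s\<^sup>2)"
      using z by (intro edgep_le_exp) auto
    also have "\<dots> \<le> qmin z * exp (z / sqrt 2 + z * a)"
    proof -
      have "a \<le> s" unfolding s_def using a a0 by (intro real_le_rsqrt) (simp add: power2_eq_square mult_left_mono)
      moreover have "1 / sqrt 2 \<le> s"
      proof -
        have "1/2 \<le> a * (L/2)" using a L by (simp add: field_simps)
        then have "sqrt (1/2) \<le> s" unfolding s_def by (rule real_sqrt_le_mono)
        then show ?thesis by (simp add: real_sqrt_divide)
      qed
      ultimately have "1 / sqrt 2 + a \<le> 2 * s" by simp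
      then have "z * (2 * s) \<le> z * (1 / sqrt 2 + a)" using z by (intro mult_left_mono_neg) auto
      then have "2 * z * s - s\<^sup>2 \<le> z / sqrt 2 + z * a" by (simp add: algebra_simps) (smt (verit) zero_le_power2)
      then show ?thesis by (intro mult_left_mono) auto
    qed
    finally show ?thesis using 2 by (simp add: a_def exp_add)
  next
    case 3
    have "sqrt ((z/2)\<^sup>2) \<le> sqrt ((w - z) * (c - z))"
    proof (rule real_sqrt_le_mono)
      have "(- z/2) * (- z/2) \<le> (w - z) * (c - z)" using 3 True z by (intro mult_mono) auto
      then show "(z/2)\<^sup>2 \<le> (w - z) * (c - z)" by (simp add: power2_eq_square)
    qed
    then have "edgep 1 z w c \<le> qmin z * exp (2 * z * (- z / 2) - (- z / 2)\<^sup>2)"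
      using z by (intro edgep_le_exp) auto
    also have "2 * z * (- z / 2) - (- z / 2)\<^sup>2 = - (5/4) * z\<^sup>2" by (simp add: power2_eq_square)
    finally show ?thesis by simp
  qed
  then show ?thesis unfolding h distrib_left using nn qmin_pos(1)[of z]
    by (smt (verit) mult_nonneg_nonneg)
qed

lemma exp_integral_normal:
  assumes z: "z < 0"
  shows "integrable \<N> (\<lambda>w. indicator {z<..} w * exp (2 * z * (w - z)))"
    "(\<integral>w. indicator {z<..} w * exp (2 * z * (w - z)) \<partial>\<N>) \<le> \<phi> z / (- z)"
proof -
  show "integrable \<N> (\<lambda>w. indicator {z<..} w * exp (2 * z * (w - z)))"
    using z by (intro N.integrable_const_bound[where B = 1] AE_I2)
      (auto simp: indicator_def mult_nonpos_nonneg)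
  have e: "has_bochner_integral lborel (\<lambda>y. indicator {0<..} y * (y ^ 0 * exp (- (- z) * y))) (fact 0 / (- z) ^ Suc 0)"
    using z by (intro gamma_integral) simp
  have "(\<integral>w. indicator {z<..} w * exp (2 * z * (w - z)) \<partial>\<N>) = (\<integral>w. \<phi> w * (indicator {z<..} w * exp (2 * z * (w - z))) \<partial>lborel)"
    by (subst integral_density) auto
  also have "\<dots> = (\<integral>y. \<phi> (z + 1 * y) * (indicator {z<..} (z + 1 * y) * exp (2 * z * (z + 1 * y - z))) \<partial>lborel)"
    by (subst lborel_integral_real_affine[of 1 _ z]) auto
  also have "\<dots> \<le> (\<integral>y. \<phi> z * (indicator {0<..} y * (y ^ 0 * exp (- (- z) * y))) \<partial>lborel)"
  proof (rule integral_mono)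
    show ig: "integrable lborel (\<lambda>y. \<phi> z * (indicator {0<..} y * (y ^ 0 * exp (- (- z) * y))))"
      by (intro integrable_mult_right integrable.intros[OF e])
    have le: "\<phi> (z + 1 * y) * (indicator {z<..} (z + 1 * y) * exp (2 * z * (z + 1 * y - z))) \<le> \<phi> z * (indicator {0<..} y * (y ^ 0 * exp (- (- z) * y)))" for y
    proof (cases "y > 0")
      case True
      have "\<phi> (z + y) = \<phi> z * exp (- z * y - y\<^sup>2 / 2)" using \<phi>_shift[of z "-y"] by simp
      also have "\<dots> \<le> \<phi> z * exp (- z * y)" by (intro mult_left_mono) auto
      finally have "\<phi> (z + y) * exp (2 * z * y) \<le> \<phi> z * exp (- z * y) * exp (2 * z * y)" by (rule mult_right_mono) simp
      also have "\<dots> = \<phi> z * exp (z * y)" by (simp add: exp_add[symmetric] mult.assoc)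
      finally show ?thesis using True by simp
    qed auto
    then show "\<And>y. \<phi> (z + 1 * y) * (indicator {z<..} (z + 1 * y) * exp (2 * z * (z + 1 * y - z))) \<le> \<phi> z * (indicator {0<..} y * (y ^ 0 * exp (- (- z) * y)))" .
    show "integrable lborel (\<lambda>y. \<phi> (z + 1 * y) * (indicator {z<..} (z + 1 * y) * exp (2 * z * (z + 1 * y - z))))"
      by (rule Bochner_Integration.integrable_bound[OF ig])
         (use le in \<open>auto intro!: AE_I2 simp: abs_mult\<close>)
  qed
  also have "\<dots> = \<phi> z / (- z)"
    using has_bochner_integral_integral_eq[OF e] by simp
  finally show "(\<integral>w. indicator {z<..} w * exp (2 * z * (w - z)) \<partial>\<N>) \<le> \<phi> z / (- z)" .
qed

lemma exp_band_integral_normal: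
  assumes z: "z < 0"
  shows "integrable \<N> (\<lambda>w. indicator {z - 1/z<..z/2} w * exp (z * (w - z)))"
    "(\<integral>w. indicator {z - 1/z<..z/2} w * exp (z * (w - z)) \<partial>\<N>) \<le> \<phi> z * (- z / 2)"
proof -
  have mz: "1 / z < 0" using z by simp
  have neg: "z * (w - z) \<le> 0" if "z - 1/z < w" for w
    using z mz that by (intro mult_nonpos_nonneg) linarith+
  show "integrable \<N> (\<lambda>w. indicator {z - 1/z<..z/2} w * exp (z * (w - z)))"
    using neg by (intro N.integrable_const_bound[where B = 1] AE_I2) (auto simp: indicator_def)
  have "(\<integral>w. indicator {z - 1/z<..z/2} w * exp (z * (w - z)) \<partial>\<N>) = (\<integral>w. \<phi> w * (indicator {z - 1/z<..z/2} w * exp (z * (w - z))) \<partial>lborel)"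
    by (subst integral_density) auto
  also have "\<dots> \<le> (\<integral>w. indicator {z..z/2} w * \<phi> z \<partial>lborel)"
  proof (rule integral_mono)
    show ig: "integrable lborel (\<lambda>w. indicator {z..z/2} w * \<phi> z)"
      using z by (intro integrable_mult_left integrable_real_indicator) auto
    have le: "\<phi> w * (indicator {z - 1/z<..z/2} w * exp (z * (w - z))) \<le> indicator {z..z/2} w * \<phi> z" for w
    proof (cases "w \<in> {z - 1/z<..z/2}")
      case True
      have "\<phi> w = \<phi> z * exp (- z * (w - z) - (w - z)\<^sup>2 / 2)"
        using \<phi>_shift[of z "z - w"] by (simp add: algebra_simps power2_commute)
      also have "\<dots> \<le> \<phi> z * exp (- z * (w - z))" by (intro mult_left_mono) auto
      finally have "\<phi> w * exp (z * (w - z)) \<le> \<phi> z * exp (- z * (w - z)) * exp (z * (w - z))" by (rule mult_right_mono) simp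
      also have "\<dots> = \<phi> z" by (simp add: exp_add[symmetric] mult.assoc)
      finally have "\<phi> w * exp (z * (w - z)) \<le> \<phi> z" .
      moreover have "z - 1/z < w" using True by simp
      then have "z \<le> w" using mz by linarith
      ultimately show ?thesis using True by simp
    qed simp
    then show "\<And>w. \<phi> w * (indicator {z - 1/z<..z/2} w * exp (z * (w - z))) \<le> indicator {z..z/2} w * \<phi> z" .
    show "integrable lborel (\<lambda>w. \<phi> w * (indicator {z - 1/z<..z/2} w * exp (z * (w - z))))"
      by (rule Bochner_Integration.integrable_bound[OF ig]) (use le in \<open>auto intro!: AE_I2 simp: abs_mult\<close>)
  qed
  also have "\<dots> = \<phi> z * (- z / 2)" using z by simp
  finally show "(\<integral>w. indicator {z - 1/z<..z/2} w * exp (z * (w - z)) \<partial>\<N>) \<le> \<phi> z * (- z / 2)" .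
qed

lemma integral_indicator_atMost_N: "(\<integral>c. indicator {..x} c \<partial>\<N>) = Phi x"
  by (simp add: cdf_def)

text \<open>The regularity that the Laplace asymptotic requires of the function of the minimum.\<close>

lemma kint_basic:
  assumes [measurable]: "(\<lambda>(z, w, c). h z w c) \<in> borel_measurable (borel \<Otimes>\<^sub>M borel \<Otimes>\<^sub>M borel)"
    and h: "\<And>z w c. 0 \<le> h z w c" "\<And>z w c. h z w c \<le> 1" "\<And>z w c. h z w c \<noteq> 0 \<Longrightarrow> z < w"
  shows "kint p h \<in> borel_measurable borel" "0 \<le> kint p h z" "kint p h z \<le> 1"
proof -
  have [measurable]: "(\<lambda>x. h (f x) (g x) (k x)) \<in> borel_measurable M"
    if [measurable]: "f \<in> borel_measurable M" "g \<in> borel_measurable M" "k \<in> borel_measurable M" for f g k and M :: "'b measure"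
  proof -
    have "(\<lambda>x. (f x, g x, k x)) \<in> M \<rightarrow>\<^sub>M borel \<Otimes>\<^sub>M borel \<Otimes>\<^sub>M borel" by measurable
    from measurable_compose[OF this assms(1)] show ?thesis by simp
  qed
  show "kint p h \<in> borel_measurable borel"
    unfolding kint_def[abs_def] by measurable
  have b: "0 \<le> (Phi w - Phi z) ^ p * h z w c" "(Phi w - Phi z) ^ p * h z w c \<le> 1" for w c
  proof -
    have "0 \<le> (Phi w - Phi z) ^ p * h z w c \<and> (Phi w - Phi z) ^ p * h z w c \<le> 1"
    proof (cases "h z w c = 0")
      case False
      then have "Phi z \<le> Phi w" using h(3) Phi_mono by (meson less_imp_le)
      moreover have "Phi w - Phi z \<le> 1" using Phi_le_1[of w] Phi_nonneg[of z] by linarith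
      ultimately have "0 \<le> (Phi w - Phi z) ^ p" "(Phi w - Phi z) ^ p \<le> 1" by (auto intro: power_le_one)
      then show ?thesis using h(1,2) by (auto intro: mult_le_one)
    qed simp
    then show "0 \<le> (Phi w - Phi z) ^ p * h z w c" "(Phi w - Phi z) ^ p * h z w c \<le> 1" by auto
  qed
  have i: "0 \<le> (\<integral>c. (Phi w - Phi z) ^ p * h z w c \<partial>\<N>) \<and> (\<integral>c. (Phi w - Phi z) ^ p * h z w c \<partial>\<N>) \<le> 1" for w
  proof -
    define k where "k c = (Phi w - Phi z) ^ p * h z w c" for c
    have [measurable]: "k \<in> borel_measurable borel" unfolding k_def by measurable
    have "0 \<le> k c" "k c \<le> 1" for c using b by (auto simp: k_def)
    then have "0 \<le> (\<integral>c. k c \<partial>\<N>) \<and> (\<integral>c. k c \<partial>\<N>) \<le> 1"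
      by (intro conjI Bochner_Integration.integral_nonneg N.integral_le_const N.integrable_const_bound[where B = 1] AE_I2) auto
    then show ?thesis unfolding k_def .
  qed
  show "0 \<le> kint p h z" unfolding kint_def by (rule Bochner_Integration.integral_nonneg) (use i in blast)
  show "kint p h z \<le> 1" unfolding kint_def
  proof -
    define k where "k w = (\<integral>c. (Phi w - Phi z) ^ p * h z w c \<partial>\<N>)" for w
    have [measurable]: "k \<in> borel_measurable borel" unfolding k_def by measurable
    have "0 \<le> k c" "k c \<le> 1" for c using i by (auto simp: k_def)
    then have "(\<integral>c. k c \<partial>\<N>) \<le> 1"
      by (intro N.integral_le_const N.integrable_const_bound[where B = 1] AE_I2) auto
    then show "(\<integral>w. (\<integral>c. (Phi w - Phi z) ^ p * h z w c \<partial>\<N>) \<partial>\<N>) \<le> 1" unfolding k_def .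
  qed
qed

lemma near_kernel_bounds: "0 \<le> near_kernel z w c" "near_kernel z w c \<le> 1" "near_kernel z w c \<noteq> 0 \<Longrightarrow> z < w"
  by (auto simp: near_kernel_def near_def split: if_splits)

lemma far_kernel_bounds: "0 \<le> far_kernel z w c" "far_kernel z w c \<le> 1" "far_kernel z w c \<noteq> 0 \<Longrightarrow> z < w"
  by (auto simp: far_kernel_def split: if_splits)

lemma path_kernel_bounds: "0 \<le> path_kernel z w c" "path_kernel z w c \<le> 1" "path_kernel z w c \<noteq> 0 \<Longrightarrow> z < w"
  by (auto simp: path_kernel_def mult_le_one split: if_splits)

lemmas kint_far = kint_basic[where h = far_kernel, OF _ far_kernel_bounds]
lemmas kint_path = kint_basic[where h = path_kernel, OF _ path_kernel_bounds]

text \<open>The three cases of the pointwise bound, integrated: the first is small because \<open>c\<close> must be below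
  \<open>z / 2\<close>, the other two by an exponential factor.\<close>

lemma kint_far_le:
  assumes z: "z < -2"
  shows "kint 0 far_kernel z \<le> qmin z * (Phi (z/2) * (\<phi> z / (- z)) + exp (z / sqrt 2) * (\<phi> z * (- z / 2)) + exp (- (5/4) * z\<^sup>2))"
proof -
  define E where "E w = indicator {z<..} w * exp (2 * z * (w - z))" for w :: real
  define B where "B w = indicator {z - 1/z<..z/2} w * exp (z * (w - z))" for w :: real
  define C where "C = exp (- (5/4) * z\<^sup>2)"
  have iE: "integrable \<N> E" "(\<integral>w. E w \<partial>\<N>) \<le> \<phi> z / (- z)"
    unfolding E_def[abs_def] using exp_integral_normal[of z] z by auto
  have iB: "integrable \<N> B" "(\<integral>w. B w \<partial>\<N>) \<le> \<phi> z * (- z / 2)"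
    unfolding B_def[abs_def] using exp_band_integral_normal[of z] z by auto
  have inner: "(\<integral>c. (Phi w - Phi z) ^ 0 * far_kernel z w c \<partial>\<N>) \<le> qmin z * (Phi (z/2) * E w + exp (z / sqrt 2) * B w + C)" for w
  proof -
    have ind: "integrable \<N> (indicator {..z/2} :: real \<Rightarrow> real)"
      by (rule N.integrable_const_bound[where B = 1]) (auto simp: indicator_def)
    have "(\<integral>c. (Phi w - Phi z) ^ 0 * far_kernel z w c \<partial>\<N>)
       \<le> (\<integral>c. qmin z * (indicator {..z/2} c * E w + (exp (z / sqrt 2) * B w + C)) \<partial>\<N>)"
    proof (rule integral_mono)
      show "integrable \<N> (\<lambda>c. (Phi w - Phi z) ^ 0 * far_kernel z w c)"
        by (rule N.integrable_const_bound[where B = 1]) (auto simp: far_kernel_bounds)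
      show "integrable \<N> (\<lambda>c. qmin z * (indicator {..z/2} c * E w + (exp (z / sqrt 2) * B w + C)))"
        by (intro integrable_mult_right Bochner_Integration.integrable_add integrable_mult_left ind) auto
      show "(Phi w - Phi z) ^ 0 * far_kernel z w c \<le> qmin z * (indicator {..z/2} c * E w + (exp (z / sqrt 2) * B w + C))" for c
        using far_kernel_le[OF z, of w c] by (simp add: E_def B_def C_def mult_ac add_ac)
    qed
    also have "\<dots> = qmin z * (Phi (z/2) * E w + (exp (z / sqrt 2) * B w + C))"
      using ind by (simp add: integral_indicator_atMost_N[symmetric])
    finally show ?thesis by (simp add: add_ac)
  qed
  have "kint 0 far_kernel z \<le> (\<integral>w. qmin z * (Phi (z/2) * E w + exp (z / sqrt 2) * B w + C) \<partial>\<N>)"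
    unfolding kint_def
  proof (rule integral_mono[OF _ _ inner])
    show "integrable \<N> (\<lambda>w. \<integral>c. (Phi w - Phi z) ^ 0 * far_kernel z w c \<partial>\<N>)"
    proof (rule N.integrable_const_bound[where B = 1])
      have "(\<integral>c. far_kernel z w c \<partial>\<N>) \<le> 1" for w
        by (intro N.integral_le_const N.integrable_const_bound[where B = 1] AE_I2) (auto simp: far_kernel_bounds)
      moreover have "0 \<le> (\<integral>c. far_kernel z w c \<partial>\<N>)" for w
        by (intro Bochner_Integration.integral_nonneg) (auto simp: far_kernel_bounds)
      ultimately show "AE w in \<N>. norm (\<integral>c. (Phi w - Phi z) ^ 0 * far_kernel z w c \<partial>\<N>) \<le> 1" by simp
    qed measurable
    show "integrable \<N> (\<lambda>w. qmin z * (Phi (z/2) * E w + exp (z / sqrt 2) * B w + C))"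
      by (intro integrable_mult_right Bochner_Integration.integrable_add iE iB) auto
  qed
  also have "\<dots> = qmin z * (Phi (z/2) * (\<integral>w. E w \<partial>\<N>) + exp (z / sqrt 2) * (\<integral>w. B w \<partial>\<N>) + C)"
    using iE(1) iB(1) by simp
  also have "\<dots> \<le> qmin z * (Phi (z/2) * (\<phi> z / (- z)) + exp (z / sqrt 2) * (\<phi> z * (- z / 2)) + C)"
    using iE(2) iB(2) by (intro mult_left_mono add_mono) auto
  finally show ?thesis by (simp add: C_def)
qed

lemma far_kernel_asymp: "((\<lambda>z. kint 0 far_kernel z / (Phi z ^ 3 * (-z) powr (-3))) \<longlongrightarrow> 0) at_bot"
proof (rule tendsto_sandwich)
  define R where "R z = (-z) ^ 5 * (exp (- z\<^sup>2 / 8) + exp (z / sqrt 2) * (- z / 2) + sqrt (2 * pi) * exp (- (3/4) * z\<^sup>2))" for z :: real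
  show "\<forall>\<^sub>F z in at_bot. 0 \<le> kint 0 far_kernel z / (Phi z ^ 3 * (-z) powr (-3))"
    by (simp add: kint_far)
  show "\<forall>\<^sub>F z in at_bot. kint 0 far_kernel z / (Phi z ^ 3 * (-z) powr (-3)) \<le>
     (qmin z / (Phi z ^ 2 * (-z))) * (\<phi> z / (Phi z * (-z))) * R z"
    using eventually_le_at_bot[of "-3"]
  proof eventually_elim
    case (elim z)
    define L where "L = - z"
    have L: "L \<ge> 3" "-z = L" using elim by (auto simp: L_def)
    define X where "X = Phi (z/2) / L + exp (z / sqrt 2) * (- z / 2) + exp (- (5/4) * z\<^sup>2) / \<phi> z"
    have "kint 0 far_kernel z \<le> qmin z * (\<phi> z * X)"
      using kint_far_le[of z] elim unfolding X_def L(2) by (simp add: algebra_simps)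
    also have "X \<le> exp (- z\<^sup>2 / 8) + exp (z / sqrt 2) * (- z / 2) + sqrt (2 * pi) * exp (- (3/4) * z\<^sup>2)"
      unfolding X_def
    proof (intro add_mono)
      have "Phi (z/2) / L \<le> Phi (z/2) / 1" using L by (intro divide_left_mono) auto
      also have "\<dots> \<le> exp (- z\<^sup>2 / 8)" using Phi_tail_le[of "z/2"] elim unfolding power_divide by simp
      finally show "Phi (z/2) / L \<le> exp (- z\<^sup>2 / 8)" .
      have "exp (- (5/4) * z\<^sup>2) = exp (- (3/4) * z\<^sup>2) * exp (- z\<^sup>2 / 2)" by (simp add: exp_add[symmetric])
      then show "exp (- (5/4) * z\<^sup>2) / \<phi> z \<le> sqrt (2 * pi) * exp (- (3/4) * z\<^sup>2)"
        unfolding std_normal_density_def by simp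
    qed simp
    finally have k: "kint 0 far_kernel z \<le> qmin z * (\<phi> z * (R z / L ^ 5))"
      using L by (simp add: R_def mult_left_mono)
    have p: "L powr (-3) = 1 / L ^ 3" using L by (intro powr_minus3) auto
    have "kint 0 far_kernel z / (Phi z ^ 3 * (1 / L ^ 3)) \<le> qmin z * (\<phi> z * (R z / L ^ 5)) / (Phi z ^ 3 * (1 / L ^ 3))"
      using k L by (intro divide_right_mono) auto
    also have "\<dots> = (qmin z / (Phi z ^ 2 * L)) * (\<phi> z / (Phi z * L)) * R z"
      using L by (simp add: field_simps eval_nat_numeral)
    finally show ?case unfolding L(2) p .
  qed
  have "(R \<longlongrightarrow> 0) at_bot" unfolding R_def[abs_def] by real_asymp
  from tendsto_mult[OF tendsto_mult[OF qmin_asymp \<phi>_over_Phi] this]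
  show "((\<lambda>z. (qmin z / (Phi z ^ 2 * (-z))) * (\<phi> z / (Phi z * (-z))) * R z) \<longlongrightarrow> 0) at_bot" by simp
qed simp

text \<open>Two factors \<open>qmin z\<close>, and a further gain: either one of the two entries is below \<open>z / 2\<close>, or the gap is
  at least \<open>\<bar>z\<bar> / 4\<close>.\<close>

lemma path_kernel_le:
  assumes z: "z < 0"
  shows "path_kernel z w c \<le> qmin z ^ 2 * (indicator {..z/2} w + indicator {..z/2} c + exp (- z\<^sup>2 / 2))"
proof (cases "z < w \<and> z < c")
  case True
  have 1: "edgep (1/2) z w c \<le> qmin z" using True by (intro edgep_le_qmin) auto
  have "edgep (1/2) z w c \<le> qmin z * (indicator {..z/2} w + indicator {..z/2} c + exp (- z\<^sup>2 / 2))"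
  proof (cases "w \<le> z/2 \<or> c \<le> z/2")
    case True
    then have "1 \<le> indicator {..z/2} w + indicator {..z/2} c + exp (- z\<^sup>2 / 2)"
      by (auto simp: indicator_def add_nonneg_nonneg)
    then have "qmin z * 1 \<le> qmin z * (indicator {..z/2} w + indicator {..z/2} c + exp (- z\<^sup>2 / 2))"
      by (rule mult_left_mono) simp
    with 1 show ?thesis by (simp only: mult_1_right)
  next
    case False
    have "sqrt ((z/2)\<^sup>2) \<le> sqrt ((w - z) * (c - z))"
    proof (rule real_sqrt_le_mono)
      have "(- z/2) * (- z/2) \<le> (w - z) * (c - z)" using False True z by (intro mult_mono) auto
      then show "(z/2)\<^sup>2 \<le> (w - z) * (c - z)" by (simp add: power2_eq_square)
    qed
    then have "edgep (1/2) z w c \<le> qmin z * exp (2 * z * (- z / 4) - (- z / 4)\<^sup>2)"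
      using z by (intro edgep_le_exp) auto
    also have "\<dots> \<le> qmin z * exp (- z\<^sup>2 / 2)"
      by (intro mult_left_mono) (auto simp: power2_eq_square)
    finally show ?thesis using False by simp
  qed
  then have "qmin z * edgep (1/2) z w c \<le> qmin z * (qmin z * (indicator {..z/2} w + indicator {..z/2} c + exp (- z\<^sup>2 / 2)))"
    by (intro mult_left_mono) auto
  then show ?thesis using True by (simp add: path_kernel_def power2_eq_square mult.assoc)
qed (auto simp: path_kernel_def)

lemma path_kernel_asymp: "((\<lambda>z. kint 0 path_kernel z / (Phi z ^ 4 * (-z) powr (-3))) \<longlongrightarrow> 0) at_bot"
proof (rule tendsto_sandwich)
  define R where "R z = (-z) ^ 5 * (2 * exp (- z\<^sup>2 / 8) + exp (- z\<^sup>2 / 2))" for z :: real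
  show "\<forall>\<^sub>F z in at_bot. 0 \<le> kint 0 path_kernel z / (Phi z ^ 4 * (-z) powr (-3))"
    by (simp add: kint_path)
  show "\<forall>\<^sub>F z in at_bot. kint 0 path_kernel z / (Phi z ^ 4 * (-z) powr (-3)) \<le> (qmin z / (Phi z ^ 2 * (-z))) ^ 2 * R z"
    using eventually_le_at_bot[of "-3"]
  proof eventually_elim
    case (elim z)
    define L where "L = - z"
    have L: "L \<ge> 3" "-z = L" using elim by (auto simp: L_def)
    have ind: "integrable \<N> (indicator {..z/2} :: real \<Rightarrow> real)"
      by (rule N.integrable_const_bound[where B = 1]) (auto simp: indicator_def)
    have inner: "(\<integral>c. (Phi w - Phi z) ^ 0 * path_kernel z w c \<partial>\<N>) \<le> qmin z ^ 2 * (indicator {..z/2} w + (Phi (z/2) + exp (- z\<^sup>2 / 2)))" for w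
    proof -
      have "(\<integral>c. (Phi w - Phi z) ^ 0 * path_kernel z w c \<partial>\<N>)
         \<le> (\<integral>c. qmin z ^ 2 * (indicator {..z/2} c + (indicator {..z/2} w + exp (- z\<^sup>2 / 2))) \<partial>\<N>)"
      proof (rule integral_mono)
        show "integrable \<N> (\<lambda>c. (Phi w - Phi z) ^ 0 * path_kernel z w c)"
          by (rule N.integrable_const_bound[where B = 1]) (auto simp: path_kernel_bounds)
        show "integrable \<N> (\<lambda>c. qmin z ^ 2 * (indicator {..z/2} c + (indicator {..z/2} w + exp (- z\<^sup>2 / 2))))"
          by (intro integrable_mult_right Bochner_Integration.integrable_add ind) auto
        show "(Phi w - Phi z) ^ 0 * path_kernel z w c \<le> qmin z ^ 2 * (indicator {..z/2} c + (indicator {..z/2} w + exp (- z\<^sup>2 / 2)))" for c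
          using path_kernel_le[of z w c] elim by (simp add: add_ac)
      qed
      also have "\<dots> = qmin z ^ 2 * (Phi (z/2) + (indicator {..z/2} w + exp (- z\<^sup>2 / 2)))"
        using ind by (simp add: integral_indicator_atMost_N[symmetric])
      finally show ?thesis by (simp add: add_ac)
    qed
    have "kint 0 path_kernel z \<le> (\<integral>w. qmin z ^ 2 * (indicator {..z/2} w + (Phi (z/2) + exp (- z\<^sup>2 / 2))) \<partial>\<N>)"
      unfolding kint_def
    proof (rule integral_mono[OF _ _ inner])
      show "integrable \<N> (\<lambda>w. \<integral>c. (Phi w - Phi z) ^ 0 * path_kernel z w c \<partial>\<N>)"
      proof (rule N.integrable_const_bound[where B = 1])
        have "(\<integral>c. path_kernel z w c \<partial>\<N>) \<le> 1" for w
          by (intro N.integral_le_const N.integrable_const_bound[where B = 1] AE_I2) (auto simp: path_kernel_bounds)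
        moreover have "0 \<le> (\<integral>c. path_kernel z w c \<partial>\<N>)" for w
          by (intro Bochner_Integration.integral_nonneg) (auto simp: path_kernel_bounds)
        ultimately show "AE w in \<N>. norm (\<integral>c. (Phi w - Phi z) ^ 0 * path_kernel z w c \<partial>\<N>) \<le> 1" by simp
      qed measurable
      show "integrable \<N> (\<lambda>w. qmin z ^ 2 * (indicator {..z/2} w + (Phi (z/2) + exp (- z\<^sup>2 / 2))))"
        by (intro integrable_mult_right Bochner_Integration.integrable_add ind) auto
    qed
    also have "\<dots> = qmin z ^ 2 * (2 * Phi (z/2) + exp (- z\<^sup>2 / 2))"
      using ind by (simp add: integral_indicator_atMost_N[symmetric])
    also have "\<dots> \<le> qmin z ^ 2 * (2 * exp (- z\<^sup>2 / 8) + exp (- z\<^sup>2 / 2))"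
      using Phi_tail_le[of "z/2"] elim unfolding power_divide by (intro mult_left_mono) auto
    finally have k: "kint 0 path_kernel z \<le> qmin z ^ 2 * (R z / L ^ 5)"
      using L by (simp add: R_def)
    have p: "L powr (-3) = 1 / L ^ 3" using L by (intro powr_minus3) auto
    have "kint 0 path_kernel z / (Phi z ^ 4 * (1 / L ^ 3)) \<le> qmin z ^ 2 * (R z / L ^ 5) / (Phi z ^ 4 * (1 / L ^ 3))"
      using k L by (intro divide_right_mono) auto
    also have "\<dots> = (qmin z / (Phi z ^ 2 * L)) ^ 2 * R z"
      using L by (simp add: field_simps eval_nat_numeral)
    finally show ?case unfolding L(2) p .
  qed
  have "(R \<longlongrightarrow> 0) at_bot" unfolding R_def[abs_def] by real_asymp
  from tendsto_mult[OF tendsto_power[OF qmin_asymp, of 2] this]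
  show "((\<lambda>z. (qmin z / (Phi z ^ 2 * (-z))) ^ 2 * R z) \<longlongrightarrow> 0) at_bot" by simp
qed simp

section \<open>Sums over triples of an independent sample\<close>

text \<open>Tonelli for a finite product: conditionally on the coordinates in \<open>I\<close>, the factors indexed by
  \<open>J\<close> are independent.\<close>

lemma (in product_sigma_finite) nn_integral_fold_prod:
  assumes fin [simp]: "finite I" "finite J" and disj: "I \<inter> J = {}"
    and F [measurable]: "F \<in> borel_measurable (Pi\<^sub>M I M)"
    and g: "\<And>j. j \<in> J \<Longrightarrow> (\<lambda>(x, y). g j x y) \<in> borel_measurable (Pi\<^sub>M I M \<Otimes>\<^sub>M M j)"
  shows "(\<integral>\<^sup>+x. F (restrict x I) * (\<Prod>j\<in>J. g j (restrict x I) (x j)) \<partial>Pi\<^sub>M (I \<union> J) M)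
       = (\<integral>\<^sup>+x. F x * (\<Prod>j\<in>J. \<integral>\<^sup>+y. g j x y \<partial>M j) \<partial>Pi\<^sub>M I M)"
proof -
  have r: "(\<lambda>x. restrict x I) \<in> Pi\<^sub>M (I \<union> J) M \<rightarrow>\<^sub>M Pi\<^sub>M I M"
    by (rule measurable_restrict_subset) auto
  have gm: "(\<lambda>x. g j (restrict x I) (x j)) \<in> borel_measurable (Pi\<^sub>M (I \<union> J) M)" if "j \<in> J" for j
  proof -
    have "(\<lambda>x. (restrict x I, x j)) \<in> Pi\<^sub>M (I \<union> J) M \<rightarrow>\<^sub>M Pi\<^sub>M I M \<Otimes>\<^sub>M M j"
      using that r by (intro measurable_Pair measurable_component_singleton) auto
    from measurable_compose[OF this g[OF that]] show ?thesis by simp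
  qed
  have "(\<integral>\<^sup>+x. F (restrict x I) * (\<Prod>j\<in>J. g j (restrict x I) (x j)) \<partial>Pi\<^sub>M (I \<union> J) M)
     = (\<integral>\<^sup>+x. (\<integral>\<^sup>+y. F (restrict (merge I J (x, y)) I) * (\<Prod>j\<in>J. g j (restrict (merge I J (x, y)) I) (merge I J (x, y) j)) \<partial>Pi\<^sub>M J M) \<partial>Pi\<^sub>M I M)"
    using disj by (intro product_nn_integral_fold borel_measurable_times_ennreal borel_measurable_prod_ennreal gm measurable_compose[OF r F]) auto
  also have "\<dots> = (\<integral>\<^sup>+x. F x * (\<Prod>j\<in>J. \<integral>\<^sup>+y. g j x y \<partial>M j) \<partial>Pi\<^sub>M I M)"
  proof (rule nn_integral_cong)
    fix x assume x: "x \<in> space (Pi\<^sub>M I M)"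
    then have rm: "restrict (merge I J (x, y)) I = x" for y
      by (auto simp: space_PiM PiE_def extensional_def restrict_def merge_def fun_eq_iff)
    have mj: "merge I J (x, y) j = y j" if "j \<in> J" for y j
      using that disj by (auto simp: merge_def)
    have gx: "g j x \<in> borel_measurable (M j)" if "j \<in> J" for j
      using measurable_Pair2[OF g[OF that] x] by simp
    have "(\<integral>\<^sup>+y. F (restrict (merge I J (x, y)) I) * (\<Prod>j\<in>J. g j (restrict (merge I J (x, y)) I) (merge I J (x, y) j)) \<partial>Pi\<^sub>M J M)
      = (\<integral>\<^sup>+y. F x * (\<Prod>j\<in>J. g j x (y j)) \<partial>Pi\<^sub>M J M)"
      unfolding rm by (intro nn_integral_cong arg_cong2[where f = "(*)"] prod.cong refl) (simp add: mj)
    also have "\<dots> = F x * (\<integral>\<^sup>+y. (\<Prod>j\<in>J. g j x (y j)) \<partial>Pi\<^sub>M J M)"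
      by (intro nn_integral_cmult borel_measurable_prod_ennreal
          measurable_compose[OF measurable_component_singleton[of _ J M] gx])
    also have "(\<integral>\<^sup>+y. (\<Prod>j\<in>J. g j x (y j)) \<partial>Pi\<^sub>M J M) = (\<Prod>j\<in>J. \<integral>\<^sup>+y. g j x y \<partial>M j)"
      by (intro product_nn_integral_prod gx) auto
    finally show "(\<integral>\<^sup>+y. F (restrict (merge I J (x, y)) I) * (\<Prod>j\<in>J. g j (restrict (merge I J (x, y)) I) (merge I J (x, y) j)) \<partial>Pi\<^sub>M J M)
      = F x * (\<Prod>j\<in>J. \<integral>\<^sup>+y. g j x y \<partial>M j)" .
  qed
  finally show ?thesis .
qed

interpretation PN: product_prob_space "\<lambda>_. \<N>" I for I :: "'i set"
  by standard

abbreviation sample :: "'i set \<Rightarrow> ('i \<Rightarrow> real) measure" where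
  "sample I \<equiv> Pi\<^sub>M I (\<lambda>_. \<N>)"

lemma prob_space_sample: "prob_space (sample I)"
  by (rule PN.prob_space_axioms)

lemma nn_integral_triple:
  assumes d: "a \<noteq> b" "a \<noteq> c" "b \<noteq> c"
    and H [measurable]: "(\<lambda>(z, w, c). H z w c) \<in> borel_measurable (borel \<Otimes>\<^sub>M borel \<Otimes>\<^sub>M borel)"
  shows "(\<integral>\<^sup>+x. H (x a) (x b) (x c) \<partial>sample {a, b, c}) = (\<integral>\<^sup>+z. \<integral>\<^sup>+w. \<integral>\<^sup>+y. H z w y \<partial>\<N> \<partial>\<N> \<partial>\<N>)"
proof -
  have Hm: "(\<lambda>x. H (f x) (g x) (k x)) \<in> borel_measurable M"
    if [measurable]: "f \<in> borel_measurable M" "g \<in> borel_measurable M" "k \<in> borel_measurable M" for f g k and M :: "'z measure"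
  proof -
    have "(\<lambda>x. (f x, g x, k x)) \<in> M \<rightarrow>\<^sub>M borel \<Otimes>\<^sub>M borel \<Otimes>\<^sub>M borel" by measurable
    from measurable_compose[OF this H] show ?thesis by simp
  qed
  have comp: "(\<lambda>x. x i) \<in> borel_measurable (sample J)" if "i \<in> J" for i :: 'a and J
    using measurable_component_singleton[OF that, of "\<lambda>_. \<N>"] by simp
  have "(\<integral>\<^sup>+x. H (x a) (x b) (x c) \<partial>sample {a, b, c}) = (\<integral>\<^sup>+z. \<integral>\<^sup>+x. H ((x(a := z)) a) ((x(a := z)) b) ((x(a := z)) c) \<partial>sample {b, c} \<partial>\<N>)"
    using d by (intro PN.product_nn_integral_insert_rev Hm comp) auto
  also have "\<dots> = (\<integral>\<^sup>+z. \<integral>\<^sup>+x. H z (x b) (x c) \<partial>sample {b, c} \<partial>\<N>)"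
    using d by simp
  also have "\<dots> = (\<integral>\<^sup>+z. \<integral>\<^sup>+w. \<integral>\<^sup>+x. H z ((x(b := w)) b) ((x(b := w)) c) \<partial>sample {c} \<partial>\<N> \<partial>\<N>)"
    using d by (intro nn_integral_cong PN.product_nn_integral_insert_rev Hm comp) auto
  also have "\<dots> = (\<integral>\<^sup>+z. \<integral>\<^sup>+w. \<integral>\<^sup>+x. H z w (x c) \<partial>sample {c} \<partial>\<N> \<partial>\<N>)"
    using d by simp
  also have "\<dots> = (\<integral>\<^sup>+z. \<integral>\<^sup>+w. \<integral>\<^sup>+y. H z w y \<partial>\<N> \<partial>\<N> \<partial>\<N>)"
    by (intro nn_integral_cong PN.product_nn_integral_singleton) (simp add: Hm)
  finally show ?thesis .
qed

definition min_at :: "'i set \<Rightarrow> ('i \<Rightarrow> real) \<Rightarrow> 'i \<Rightarrow> bool" where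
  "min_at I x a \<longleftrightarrow> (\<forall>l\<in>I - {a}. x a < x l)"

definition below :: "'i set \<Rightarrow> ('i \<Rightarrow> real) \<Rightarrow> 'i \<Rightarrow> nat" where
  "below R x b = card {l\<in>R. x l \<le> x b}"

text \<open>The sum of \<open>h\<close> over pairs of entries \<open>b\<close>, \<open>c\<close> other than the minimum \<open>a\<close>, restricted to those
  \<open>b\<close> which have at least \<open>m\<close> further entries below them.\<close>

definition triple_sum :: "'i set \<Rightarrow> nat \<Rightarrow> (real \<Rightarrow> real \<Rightarrow> real \<Rightarrow> real) \<Rightarrow> ('i \<Rightarrow> real) \<Rightarrow> real" where
  "triple_sum I m h x = (\<Sum>a\<in>I. \<Sum>b\<in>I - {a}. \<Sum>c\<in>I - {a, b}.
     (if min_at I x a \<and> m \<le> below (I - {a, b, c}) x b then h (x a) (x b) (x c) else 0))"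

text \<open>A kernel: measurable, with values in the unit interval, and supported where the minimum is
  the first argument.\<close>

definition kernel :: "(real \<Rightarrow> real \<Rightarrow> real \<Rightarrow> real) \<Rightarrow> bool" where
  "kernel h \<longleftrightarrow> (\<lambda>(z, w, c). h z w c) \<in> borel_measurable (borel \<Otimes>\<^sub>M borel \<Otimes>\<^sub>M borel) \<and>
     (\<forall>z w c. 0 \<le> h z w c \<and> h z w c \<le> 1 \<and> (h z w c \<noteq> 0 \<longrightarrow> z < w \<and> z < c))"

lemma kernelD:
  assumes "kernel h"
  shows "(\<lambda>(z, w, c). h z w c) \<in> borel_measurable (borel \<Otimes>\<^sub>M borel \<Otimes>\<^sub>M borel)"
    "0 \<le> h z w c" "h z w c \<le> 1" "h z w c \<noteq> 0 \<Longrightarrow> z < w" "h z w c \<noteq> 0 \<Longrightarrow> z < c"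
  using assms by (auto simp: kernel_def)

lemma kernel_compose:
  assumes "kernel h" and [measurable]: "f \<in> borel_measurable M" "g \<in> borel_measurable M" "k \<in> borel_measurable M"
  shows "(\<lambda>x. h (f x) (g x) (k x)) \<in> borel_measurable M"
proof -
  have "(\<lambda>x. (f x, g x, k x)) \<in> M \<rightarrow>\<^sub>M borel \<Otimes>\<^sub>M borel \<Otimes>\<^sub>M borel" by measurable
  from measurable_compose[OF this kernelD(1)[OF assms(1)]] show ?thesis by simp
qed

lemma emeasure_N_Ioc: "z \<le> w \<Longrightarrow> emeasure \<N> {z<..w} = ennreal (Phi w - Phi z)"
  by (cases "z = w") (auto simp: N.emeasure_eq_measure N.cdf_diff_eq)

lemma emeasure_N_Ioi: "emeasure \<N> {z<..} = ennreal (1 - Phi z)"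
proof -
  have "measure \<N> (UNIV - {..z}) = 1 - measure \<N> {..z}"
    using N.prob_compl[of "{..z}"] by simp
  moreover have "UNIV - {..z} = {z<..}" by auto
  ultimately show ?thesis by (simp add: N.emeasure_eq_measure cdf_def)
qed

text \<open>Given the three chosen entries the others are independent: those in \<open>D\<close> must fall between the minimum
  and \<open>x b\<close>, the remaining ones above the minimum.\<close>

lemma triple_term_integral:
  fixes D I :: "'i set"
  assumes fin: "finite I" and abc: "a \<in> I" "b \<in> I" "c \<in> I" "a \<noteq> b" "a \<noteq> c" "b \<noteq> c"
    and D: "D \<subseteq> I - {a, b, c}" and h: "kernel h"
  defines "T \<equiv> \<lambda>x. if min_at I x a \<and> (\<forall>d\<in>D. x d \<le> x b) then h (x a) (x b) (x c) else 0"
  shows "(\<integral>x. T x \<partial>sample I) = (\<integral>z. kint (card D) h z * (1 - Phi z) ^ (card I - (3 + card D)) \<partial>\<N>)"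
    and "integrable (sample I) T"
proof -
  have comp: "(\<lambda>x. x i) \<in> borel_measurable (sample J)" if "i \<in> J" for i :: 'i and J
    using measurable_component_singleton[OF that, of "\<lambda>_. \<N>"] by simp
  define R where "R = I - {a, b, c}"
  define k where "k = card D"
  define j where "j = card I - (3 + k)"
  have finR: "finite R" "finite D" using fin D by (auto simp: R_def intro: finite_subset)
  have I: "I = {a, b, c} \<union> R" using abc by (auto simp: R_def)
  have cR: "card (R - D) = j"
  proof -
    have "card R = card I - 3"
      unfolding R_def using abc fin by (subst card_Diff_subset) auto
    then show ?thesis using D finR by (subst card_Diff_subset) (auto simp: j_def k_def R_def)
  qed
  have Tm [measurable]: "T \<in> borel_measurable (sample I)"
  proof -
    have "(\<lambda>x. h (x a) (x b) (x c)) \<in> borel_measurable (sample I)"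
      using abc by (intro kernel_compose[OF h] comp)
    moreover have "Measurable.pred (sample I) (\<lambda>x. min_at I x a \<and> (\<forall>d\<in>D. x d \<le> x b))"
    proof -
      have "Measurable.pred (sample I) (\<lambda>x. x a < x l)" if "l \<in> I" for l
        using comp[OF abc(1)] comp[OF that] by measurable
      moreover have "Measurable.pred (sample I) (\<lambda>x. x d \<le> x b)" if "d \<in> D" for d
      proof -
        have "d \<in> I" using that D by auto
        then show ?thesis unfolding pred_def by (intro borel_measurable_le comp abc(2))
      qed
      ultimately show ?thesis unfolding min_at_def
        using fin finR by (intro pred_intros_logic pred_intros_finite) auto
    qed
    ultimately show ?thesis unfolding T_def by measurable
  qed
  have T01: "0 \<le> T x" "T x \<le> 1" for x using kernelD(2,3)[OF h] by (auto simp: T_def)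
  show int: "integrable (sample I) T"
    using T01 by (intro PN.integrable_const_bound[where B = 1] AE_I2) auto
  define g where "g l x y = (if x a < y \<and> (l \<in> D \<longrightarrow> y \<le> x b) then 1 else 0 :: ennreal)" for l :: 'i and x :: "'i \<Rightarrow> real" and y
  define F where "F x = ennreal (h (x a) (x b) (x c))" for x :: "'i \<Rightarrow> real"
  have "(\<integral>\<^sup>+x. ennreal (T x) \<partial>sample I) = (\<integral>\<^sup>+x. F (restrict x {a, b, c}) * (\<Prod>l\<in>R. g l (restrict x {a, b, c}) (x l)) \<partial>sample I)"
  proof (rule nn_integral_cong)
    fix x :: "'i \<Rightarrow> real"
    show "ennreal (T x) = F (restrict x {a, b, c}) * (\<Prod>l\<in>R. g l (restrict x {a, b, c}) (x l))"
    proof (cases "h (x a) (x b) (x c) = 0")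
      case False
      then have lt: "x a < x b" "x a < x c" using kernelD(4,5)[OF h] by auto
      have "min_at I x a \<and> (\<forall>d\<in>D. x d \<le> x b) \<longleftrightarrow> (\<forall>l\<in>R. x a < x l \<and> (l \<in> D \<longrightarrow> x l \<le> x b))"
        using lt D unfolding min_at_def R_def by fastforce
      moreover have "(\<Prod>l\<in>R. g l (restrict x {a, b, c}) (x l)) = (if \<forall>l\<in>R. x a < x l \<and> (l \<in> D \<longrightarrow> x l \<le> x b) then 1 else 0)"
        using finR by (auto simp: g_def intro!: prod_zero)
      moreover have "F (restrict x {a, b, c}) = ennreal (h (x a) (x b) (x c))" by (simp add: F_def)
      moreover have "ennreal (if P then u else 0) = ennreal u * (if P then 1 else 0)" for P and u :: real
        by (cases P) auto
      ultimately show ?thesis by (simp only: T_def)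
    qed (simp add: T_def F_def)
  qed
  also have "\<dots> = (\<integral>\<^sup>+x. F x * (\<Prod>l\<in>R. \<integral>\<^sup>+y. g l x y \<partial>\<N>) \<partial>sample {a, b, c})"
  proof (subst I, rule PN.nn_integral_fold_prod)
    show "F \<in> borel_measurable (sample {a, b, c})"
      unfolding F_def by (intro measurable_compose[OF _ measurable_ennreal] kernel_compose[OF h] comp) auto
    show "(\<lambda>(x, y). g l x y) \<in> borel_measurable (sample {a, b, c} \<Otimes>\<^sub>M \<N>)" for l
    proof -
      have "Measurable.pred (sample {a, b, c} \<Otimes>\<^sub>M \<N>) (\<lambda>p. fst p a < snd p \<and> (l \<in> D \<longrightarrow> snd p \<le> fst p b))"
      proof -
        have [measurable]: "(\<lambda>p. fst p a) \<in> borel_measurable (sample {a, b, c} \<Otimes>\<^sub>M \<N>)" "(\<lambda>p. fst p b) \<in> borel_measurable (sample {a, b, c} \<Otimes>\<^sub>M \<N>)"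
          by (intro measurable_compose[OF measurable_fst comp], simp)+
        have [measurable]: "(\<lambda>p. snd p) \<in> borel_measurable (sample {a, b, c} \<Otimes>\<^sub>M \<N>)"
          using measurable_snd[of "sample {a, b, c}" \<N>] by simp
        show ?thesis by measurable
      qed
      then show ?thesis unfolding g_def case_prod_beta by measurable
    qed
  qed (use finR in \<open>auto simp: R_def\<close>)
  also have "\<dots> = (\<integral>\<^sup>+x. ennreal ((Phi (x b) - Phi (x a)) ^ k * h (x a) (x b) (x c) * (1 - Phi (x a)) ^ j) \<partial>sample {a, b, c})"
  proof (rule nn_integral_cong)
    fix x :: "'i \<Rightarrow> real"
    show "F x * (\<Prod>l\<in>R. \<integral>\<^sup>+y. g l x y \<partial>\<N>) = ennreal ((Phi (x b) - Phi (x a)) ^ k * h (x a) (x b) (x c) * (1 - Phi (x a)) ^ j)"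
    proof (cases "h (x a) (x b) (x c) = 0")
      case False
      then have lt: "x a < x b" using kernelD(4)[OF h] by auto
      have gi: "(\<integral>\<^sup>+y. g l x y \<partial>\<N>) = (if l \<in> D then ennreal (Phi (x b) - Phi (x a)) else ennreal (1 - Phi (x a)))" for l
      proof -
        have "(\<integral>\<^sup>+y. g l x y \<partial>\<N>) = (\<integral>\<^sup>+y. indicator (if l \<in> D then {x a<..x b} else {x a<..}) y \<partial>\<N>)"
          by (intro nn_integral_cong) (auto simp: g_def indicator_def)
        also have "\<dots> = emeasure \<N> (if l \<in> D then {x a<..x b} else {x a<..})"
          by (rule nn_integral_indicator) auto
        finally show ?thesis using lt by (simp add: emeasure_N_Ioc emeasure_N_Ioi)
      qed
      have "(\<Prod>l\<in>R. \<integral>\<^sup>+y. g l x y \<partial>\<N>) = (\<Prod>l\<in>D. \<integral>\<^sup>+y. g l x y \<partial>\<N>) * (\<Prod>l\<in>R - D. \<integral>\<^sup>+y. g l x y \<partial>\<N>)"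
        using D finR by (subst prod.subset_diff[of D R]) (auto simp: R_def mult.commute)
      also have "\<dots> = ennreal (Phi (x b) - Phi (x a)) ^ k * ennreal (1 - Phi (x a)) ^ j"
        unfolding gi using cR by (simp add: k_def)
      finally show ?thesis
        using lt Phi_mono[of "x a" "x b"] kernelD(2)[OF h, of "x a" "x b" "x c"]
        by (simp add: F_def ennreal_power ennreal_mult'[symmetric] mult_ac)
    qed (simp add: F_def)
  qed
  also have "\<dots> = (\<integral>\<^sup>+z. \<integral>\<^sup>+w. \<integral>\<^sup>+y. ennreal ((Phi w - Phi z) ^ k * h z w y * (1 - Phi z) ^ j) \<partial>\<N> \<partial>\<N> \<partial>\<N>)"
  proof (rule nn_integral_triple)
    show "(\<lambda>(z, w, y). ennreal ((Phi w - Phi z) ^ k * h z w y * (1 - Phi z) ^ j)) \<in> borel_measurable (borel \<Otimes>\<^sub>M borel \<Otimes>\<^sub>M borel)"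
    proof -
      have [measurable]: "(\<lambda>p. h (fst p) (fst (snd p)) (snd (snd p))) \<in> borel_measurable (borel \<Otimes>\<^sub>M borel \<Otimes>\<^sub>M borel)"
        by (intro kernel_compose[OF h]) measurable
      show ?thesis unfolding case_prod_beta by measurable
    qed
  qed (use abc in auto)
  also have "\<dots> = ennreal (\<integral>z. kint k h z * (1 - Phi z) ^ j \<partial>\<N>)"
  proof -
    have b: "0 \<le> (Phi w - Phi z) ^ k * h z w y" "(Phi w - Phi z) ^ k * h z w y \<le> 1" for z w y
    proof -
      have "0 \<le> (Phi w - Phi z) ^ k * h z w y \<and> (Phi w - Phi z) ^ k * h z w y \<le> 1"
      proof (cases "h z w y = 0")
        case False
        then have "Phi z \<le> Phi w" using kernelD(4)[OF h] Phi_mono by (meson less_imp_le)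
        moreover have "Phi w - Phi z \<le> 1" using Phi_le_1[of w] Phi_nonneg[of z] by linarith
        ultimately have "0 \<le> (Phi w - Phi z) ^ k" "(Phi w - Phi z) ^ k \<le> 1" by (auto intro: power_le_one)
        then show ?thesis using kernelD(2,3)[OF h] by (auto intro: mult_le_one)
      qed simp
      then show "0 \<le> (Phi w - Phi z) ^ k * h z w y" "(Phi w - Phi z) ^ k * h z w y \<le> 1" by auto
    qed
    define G where "G z w = (\<integral>y. (Phi w - Phi z) ^ k * h z w y \<partial>\<N>)" for z w
    have hm [measurable]: "(\<lambda>x. h (f x) (g x) (k x)) \<in> borel_measurable M"
      if "f \<in> borel_measurable M" "g \<in> borel_measurable M" "k \<in> borel_measurable M" for f g k and M :: "'z measure"
      using kernel_compose[OF h that] .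
    have Gm: "(\<lambda>(z, w). G z w) \<in> borel_measurable (borel \<Otimes>\<^sub>M borel)" unfolding G_def by measurable
    have Gz [measurable]: "G z \<in> borel_measurable borel" for z unfolding G_def by measurable
    have kb: "integrable \<N> (\<lambda>y. (Phi w - Phi z) ^ k * h z w y)" for z w
      by (rule N.integrable_const_bound[where B = 1], rule AE_I2, simp only: real_norm_def abs_of_nonneg[OF b(1)] b(2)) measurable
    have G01: "0 \<le> G z w" "G z w \<le> 1" for z w
    proof -
      have [measurable]: "(\<lambda>y. (Phi w - Phi z) ^ k * h z w y) \<in> borel_measurable borel" by measurable
      show "0 \<le> G z w" unfolding G_def by (rule Bochner_Integration.integral_nonneg) (rule b)
      show "G z w \<le> 1" unfolding G_def
        by (intro N.integral_le_const kb AE_I2 b)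
    qed
    have kG: "kint k h z = (\<integral>w. G z w \<partial>\<N>)" for z by (simp add: kint_def G_def)
    have km: "kint k h \<in> borel_measurable borel" and k01: "0 \<le> kint k h z" "kint k h z \<le> 1" for z
      using kint_basic[OF kernelD(1-4)[OF h]] by auto
    note km [measurable]
    have 1: "(\<integral>\<^sup>+y. ennreal ((Phi w - Phi z) ^ k * h z w y * (1 - Phi z) ^ j) \<partial>\<N>) = ennreal (G z w * (1 - Phi z) ^ j)" for z w
    proof -
      have i: "integrable \<N> (\<lambda>y. (Phi w - Phi z) ^ k * h z w y)"
        by (rule kb)
      have "(\<integral>\<^sup>+y. ennreal ((Phi w - Phi z) ^ k * h z w y * (1 - Phi z) ^ j) \<partial>\<N>)
          = ennreal (\<integral>y. (Phi w - Phi z) ^ k * h z w y * (1 - Phi z) ^ j \<partial>\<N>)"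
        by (intro nn_integral_eq_integral integrable_mult_left i AE_I2 mult_nonneg_nonneg[OF b(1)]) auto
      then show ?thesis unfolding G_def integral_mult_left_zero .
    qed
    have 2: "(\<integral>\<^sup>+w. ennreal (G z w * (1 - Phi z) ^ j) \<partial>\<N>) = ennreal (kint k h z * (1 - Phi z) ^ j)" for z
    proof -
      have i: "integrable \<N> (G z)"
        using G01 by (intro N.integrable_const_bound[where B = 1] AE_I2) auto
      have "(\<integral>\<^sup>+w. ennreal (G z w * (1 - Phi z) ^ j) \<partial>\<N>) = ennreal (\<integral>w. G z w * (1 - Phi z) ^ j \<partial>\<N>)"
        using G01 by (intro nn_integral_eq_integral integrable_mult_left i AE_I2 mult_nonneg_nonneg) auto
      then show ?thesis unfolding kG integral_mult_left_zero .
    qed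
    have 3: "(\<integral>\<^sup>+z. ennreal (kint k h z * (1 - Phi z) ^ j) \<partial>\<N>) = ennreal (\<integral>z. kint k h z * (1 - Phi z) ^ j \<partial>\<N>)"
    proof (intro nn_integral_eq_integral AE_I2)
      show "integrable \<N> (\<lambda>z. kint k h z * (1 - Phi z) ^ j)"
        using k01 by (intro N.integrable_const_bound[where B = 1] AE_I2) (auto simp: abs_mult power_abs intro!: mult_le_one power_le_one)
      show "0 \<le> kint k h z * (1 - Phi z) ^ j" for z using k01 by simp
    qed
    show ?thesis unfolding 1 2 3 ..
  qed
  finally have nn: "(\<integral>\<^sup>+x. ennreal (T x) \<partial>sample I) = ennreal (\<integral>z. kint k h z * (1 - Phi z) ^ j \<partial>\<N>)" .
  have "0 \<le> (\<integral>z. kint k h z * (1 - Phi z) ^ j \<partial>\<N>)"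
    using kint_basic(2)[OF kernelD(1-4)[OF h]] by (intro Bochner_Integration.integral_nonneg) auto
  then show "(\<integral>x. T x \<partial>sample I) = (\<integral>z. kint (card D) h z * (1 - Phi z) ^ (card I - (3 + card D)) \<partial>\<N>)"
    using nn T01 unfolding k_def[symmetric] j_def[symmetric] by (subst integral_eq_nn_integral) auto
qed

lemma below_measurable:
  assumes "finite R" "R \<subseteq> I" "b \<in> I"
  shows "Measurable.pred (sample I) (\<lambda>x. m \<le> below R x b)"
proof -
  have [measurable]: "(\<lambda>x. x i) \<in> borel_measurable (sample I)" if "i \<in> I" for i
    using measurable_component_singleton[OF that, of "\<lambda>_. \<N>"] by simp
  have "(\<lambda>x. if x l \<le> x b then 1 else 0 :: real) \<in> borel_measurable (sample I)" if "l \<in> R" for l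
  proof -
    have "l \<in> I" using that assms by auto
    then have [measurable]: "(\<lambda>x. x l) \<in> borel_measurable (sample I)" "(\<lambda>x. x b) \<in> borel_measurable (sample I)"
      using assms by measurable
    show ?thesis by measurable
  qed
  then have [measurable]: "(\<lambda>x. \<Sum>l\<in>R. if x l \<le> x b then 1 else 0 :: real) \<in> borel_measurable (sample I)"
    by (rule borel_measurable_sum)
  have "(\<Sum>l\<in>R. if x l \<le> x b then 1 else 0 :: real) = real (below R x b)" for x
    using assms(1) by (simp add: below_def sum.If_cases Int_def)
  then have "(\<lambda>x. m \<le> below R x b) = (\<lambda>x. real m \<le> (\<Sum>l\<in>R. if x l \<le> x b then 1 else 0 :: real))"
    by simp
  then show ?thesis by simp
qed

lemma min_at_measurable:
  assumes "finite I" "a \<in> I"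
  shows "Measurable.pred (sample I) (\<lambda>x. min_at I x a)"
  unfolding min_at_def
proof (rule pred_intros_finite(3))
  fix l assume "l \<in> I - {a}"
  then have [measurable]: "(\<lambda>x. x l) \<in> borel_measurable (sample I)" "(\<lambda>x. x a) \<in> borel_measurable (sample I)"
    using assms measurable_component_singleton[of l I "\<lambda>_. \<N>"] measurable_component_singleton[of a I "\<lambda>_. \<N>"] by simp_all
  show "Measurable.pred (sample I) (\<lambda>x. x a < x l)" by measurable
qed (use assms in simp)

text \<open>Truncated inclusion--exclusion: with \<open>N\<close> the number of further entries below \<open>x b\<close>, the
  indicator of \<open>N \<ge> 1\<close> lies between \<open>N - N * (N - 1)\<close> and \<open>N\<close>, and the indicator of \<open>N \<ge> 2\<close>
  is at most \<open>N * (N - 1)\<close>; the factorial moments of \<open>N\<close> are the integrals above.\<close>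

lemma triple_summand_integral:
  fixes I :: "'i set" and n :: nat
  assumes fin: "finite I" and abc: "a \<in> I" "b \<in> I" "c \<in> I" "a \<noteq> b" "a \<noteq> c" "b \<noteq> c" and h: "kernel h"
  defines "\<tau> \<equiv> \<lambda>m x. if min_at I x a \<and> m \<le> below (I - {a, b, c}) x b then h (x a) (x b) (x c) else 0"
    and "n \<equiv> card I"
  defines "v \<equiv> \<lambda>k. \<integral>z. kint k h z * (1 - Phi z) ^ (n - (3 + k)) \<partial>\<N>"
  shows "integrable (sample I) (\<tau> m)"
    "(\<integral>x. \<tau> 0 x \<partial>sample I) = v 0"
    "(\<integral>x. \<tau> 1 x \<partial>sample I) \<le> real (n - 3) * v 1"
    "(\<integral>x. \<tau> 1 x \<partial>sample I) \<ge> real (n - 3) * v 1 - real (n - 3) * real (n - 4) * v 2"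
    "(\<integral>x. \<tau> 2 x \<partial>sample I) \<le> real (n - 3) * real (n - 4) * v 2"
proof -
  define R where "R = I - {a, b, c}"
  have finR: "finite R" using fin by (simp add: R_def)
  have cR: "card R = n - 3"
    unfolding R_def n_def using abc fin by (subst card_Diff_subset) auto
  define T where "T D x = (if min_at I x a \<and> (\<forall>d\<in>D. x d \<le> x b) then h (x a) (x b) (x c) else 0)" for D x
  have TI: "(\<integral>x. T D x \<partial>sample I) = v (card D)" "integrable (sample I) (T D)" if "D \<subseteq> R" for D
    using triple_term_integral[OF fin abc that[unfolded R_def] h] unfolding T_def v_def n_def by auto
  have comp: "(\<lambda>x. x i) \<in> borel_measurable (sample I)" if "i \<in> I" for i
    using measurable_component_singleton[OF that, of "\<lambda>_. \<N>"] by simp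
  show int: "integrable (sample I) (\<tau> m)" for m
  proof (rule PN.integrable_const_bound[where B = 1])
    show "AE x in sample I. norm (\<tau> m x) \<le> 1"
      using kernelD(2,3)[OF h] by (auto simp: \<tau>_def)
    have [measurable]: "(\<lambda>x. h (x a) (x b) (x c)) \<in> borel_measurable (sample I)"
      using abc by (intro kernel_compose[OF h] comp)
    note [measurable] = min_at_measurable[OF fin abc(1)]
    have [measurable]: "Measurable.pred (sample I) (\<lambda>x. m \<le> below (I - {a, b, c}) x b)"
      by (rule below_measurable) (use fin abc in auto)
    show "\<tau> m \<in> borel_measurable (sample I)" unfolding \<tau>_def by measurable
  qed
  have "\<tau> 0 = T {}" by (auto simp: \<tau>_def T_def fun_eq_iff)
  then show "(\<integral>x. \<tau> 0 x \<partial>sample I) = v 0" using TI(1)[of "{}"] by simp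
  define \<Sigma>1 where "\<Sigma>1 x = (\<Sum>d\<in>R. T {d} x)" for x
  define \<Sigma>2 where "\<Sigma>2 x = (\<Sum>d\<in>R. \<Sum>e\<in>R - {d}. T {d, e} x)" for x
  have i1: "integrable (sample I) \<Sigma>1" unfolding \<Sigma>1_def by (intro Bochner_Integration.integrable_sum TI) auto
  have i2: "integrable (sample I) \<Sigma>2" unfolding \<Sigma>2_def by (intro Bochner_Integration.integrable_sum TI) auto
  have I1: "(\<integral>x. \<Sigma>1 x \<partial>sample I) = real (n - 3) * v 1"
  proof -
    have "(\<integral>x. \<Sigma>1 x \<partial>sample I) = (\<Sum>d\<in>R. \<integral>x. T {d} x \<partial>sample I)"
      unfolding \<Sigma>1_def by (intro Bochner_Integration.integral_sum TI) auto
    also have "\<dots> = (\<Sum>d\<in>R. v 1)" by (intro sum.cong refl) (simp add: TI)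
    finally show ?thesis by (simp add: cR)
  qed
  have I2: "(\<integral>x. \<Sigma>2 x \<partial>sample I) = real (n - 3) * real (n - 4) * v 2"
  proof -
    have "(\<integral>x. \<Sigma>2 x \<partial>sample I) = (\<Sum>d\<in>R. \<integral>x. (\<Sum>e\<in>R - {d}. T {d, e} x) \<partial>sample I)"
      unfolding \<Sigma>2_def by (intro Bochner_Integration.integral_sum Bochner_Integration.integrable_sum TI) auto
    also have "\<dots> = (\<Sum>d\<in>R. \<Sum>e\<in>R - {d}. \<integral>x. T {d, e} x \<partial>sample I)"
      by (intro sum.cong refl Bochner_Integration.integral_sum TI) auto
    also have "\<dots> = (\<Sum>d\<in>R. \<Sum>e\<in>R - {d}. v 2)"
      by (intro sum.cong refl) (auto simp: TI numeral_2_eq_2)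
    also have "\<dots> = (\<Sum>d\<in>R. real (n - 4) * v 2)"
      by (intro sum.cong refl) (use finR cR in \<open>simp add: card_Diff_singleton\<close>)
    finally show ?thesis by (simp add: cR)
  qed
  define h' where "h' x = (if min_at I x a then h (x a) (x b) (x c) else 0)" for x
  have h': "h' x \<ge> 0" for x using kernelD(2)[OF h] by (simp add: h'_def)
  define B where "B x = {l\<in>R. x l \<le> x b}" for x :: "'i \<Rightarrow> real"
  have finB: "finite (B x)" for x using finR by (simp add: B_def)
  have \<tau>: "\<tau> m x = (if m \<le> card (B x) then h' x else 0)" for m x
    by (simp add: \<tau>_def h'_def B_def below_def R_def)
  have s1: "\<Sigma>1 x = real (card (B x)) * h' x" for x
  proof -
    have "\<Sigma>1 x = (\<Sum>d\<in>R. if x d \<le> x b then h' x else 0)"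
      unfolding \<Sigma>1_def by (intro sum.cong refl) (simp add: T_def h'_def)
    then show ?thesis using finR by (simp add: sum.If_cases B_def Int_def)
  qed
  have s2: "\<Sigma>2 x = real (card (B x)) * (real (card (B x)) - 1) * h' x" for x
  proof -
    have "\<Sigma>2 x = (\<Sum>d\<in>R. if x d \<le> x b then (\<Sum>e\<in>R - {d}. if x e \<le> x b then h' x else 0) else 0)"
      unfolding \<Sigma>2_def
    proof (rule sum.cong[OF refl])
      fix d
      show "(\<Sum>e\<in>R - {d}. T {d, e} x) = (if x d \<le> x b then (\<Sum>e\<in>R - {d}. if x e \<le> x b then h' x else 0) else 0)"
      proof (cases "x d \<le> x b")
        case True
        then have "T {d, e} x = (if x e \<le> x b then h' x else 0)" for e by (simp add: T_def h'_def)
        with True show ?thesis by simp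
      qed (simp add: T_def)
    qed
    also have "\<dots> = (\<Sum>d\<in>B x. (\<Sum>e\<in>R - {d}. if x e \<le> x b then h' x else 0))"
      using finR by (simp add: sum.If_cases B_def Int_def)
    also have "\<dots> = (\<Sum>d\<in>B x. (real (card (B x)) - 1) * h' x)"
    proof (rule sum.cong[OF refl])
      fix d assume d: "d \<in> B x"
      have "(\<Sum>e\<in>R - {d}. if x e \<le> x b then h' x else 0) = real (card ({e \<in> R - {d}. x e \<le> x b})) * h' x"
        using finR by (simp add: sum.If_cases Int_def)
      also have "{e \<in> R - {d}. x e \<le> x b} = B x - {d}" by (auto simp: B_def)
      also have "real (card (B x - {d})) = real (card (B x)) - 1"
        using d finB[of x] by (simp add: card_Diff_singleton of_nat_diff Suc_leI card_gt_0_iff)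
           (metis One_nat_def Suc_leI card_gt_0_iff empty_iff of_nat_1 of_nat_diff)
      finally show "(\<Sum>e\<in>R - {d}. if x e \<le> x b then h' x else 0) = (real (card (B x)) - 1) * h' x" .
    qed
    finally show ?thesis by simp
  qed
  have N01: "real N * (real N - 1) \<ge> 0" for N :: nat by (cases N) auto
  have le1: "\<tau> 1 x \<le> \<Sigma>1 x" for x
    unfolding \<tau> s1 using h'[of x] mult_right_mono[of 1 "real (card (B x))" "h' x"] by auto
  have ge1: "\<Sigma>1 x - \<Sigma>2 x \<le> \<tau> 1 x" for x
  proof -
    have "real N - real N * (real N - 1) \<le> (if 1 \<le> N then 1 else 0)" for N :: nat
    proof -
      consider "N = 0" | "N = 1" | "N \<ge> 2" by linarith
      then show ?thesis
      proof cases
        case 3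
        then have "real N * (real N - 1) \<ge> real N * 1" by (intro mult_left_mono) auto
        then show ?thesis by simp
      qed auto
    qed
    from mult_right_mono[OF this h'[of x], of "card (B x)"] show ?thesis
      unfolding \<tau> s1 s2 by (simp add: left_diff_distrib split: if_splits)
  qed
  have le2: "\<tau> 2 x \<le> \<Sigma>2 x" for x
  proof -
    have "(if 2 \<le> N then 1 else 0) \<le> real N * (real N - 1)" for N :: nat
    proof (cases "2 \<le> N")
      case True
      then have "1 * 1 \<le> real N * (real N - 1)" by (intro mult_mono) auto
      then show ?thesis using True by simp
    qed (use N01 in simp)
    from mult_right_mono[OF this h'[of x], of "card (B x)"] show ?thesis
      unfolding \<tau> s2 by (simp split: if_splits)
  qed
  show "(\<integral>x. \<tau> 1 x \<partial>sample I) \<le> real (n - 3) * v 1"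
    unfolding I1[symmetric] by (rule integral_mono[OF int i1 le1])
  have "(\<integral>x. \<Sigma>1 x - \<Sigma>2 x \<partial>sample I) \<le> (\<integral>x. \<tau> 1 x \<partial>sample I)"
    by (rule integral_mono[OF Bochner_Integration.integrable_diff[OF i1 i2] int ge1])
  then show "(\<integral>x. \<tau> 1 x \<partial>sample I) \<ge> real (n - 3) * v 1 - real (n - 3) * real (n - 4) * v 2"
    unfolding I1[symmetric] I2[symmetric] using i1 i2 by simp
  show "(\<integral>x. \<tau> 2 x \<partial>sample I) \<le> real (n - 3) * real (n - 4) * v 2"
    unfolding I2[symmetric] by (rule integral_mono[OF int i2 le2])
qed

text \<open>The form in which an integral over the whole sample reduces to one over its minimum: \<open>j\<close> entries are
  singled out, and the remaining \<open>n - j\<close> exceed the minimum.\<close>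

definition lap :: "(real \<Rightarrow> real) \<Rightarrow> nat \<Rightarrow> nat \<Rightarrow> real" where
  "lap f j n = (\<integral>z. f z * (1 - Phi z) ^ (n - j) \<partial>\<N>)"

text \<open>By symmetry all ordered triples contribute equally.\<close>

lemma triple_sum_integral:
  fixes I :: "'i set"
  assumes fin: "finite I" and n: "card I = n" and h: "kernel h"
  defines "c3 \<equiv> real n * (real (n - 1) * real (n - 2))"
  shows "integrable (sample I) (triple_sum I m h)"
    "(\<integral>x. triple_sum I 0 h x \<partial>sample I) = c3 * lap (kint 0 h) 3 n"
    "(\<integral>x. triple_sum I 1 h x \<partial>sample I) \<le> c3 * (real (n - 3) * lap (kint 1 h) 4 n)"
    "(\<integral>x. triple_sum I 1 h x \<partial>sample I) \<ge> c3 * (real (n - 3) * lap (kint 1 h) 4 n - real (n - 3) * real (n - 4) * lap (kint 2 h) 5 n)"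
    "(\<integral>x. triple_sum I 2 h x \<partial>sample I) \<le> c3 * (real (n - 3) * real (n - 4) * lap (kint 2 h) 5 n)"
proof -
  define \<tau> where "\<tau> a b c m x = (if min_at I x a \<and> m \<le> below (I - {a, b, c}) x b then h (x a) (x b) (x c) else 0)" for a b c m x
  have ts: "triple_sum I m h x = (\<Sum>a\<in>I. \<Sum>b\<in>I - {a}. \<Sum>c\<in>I - {a, b}. \<tau> a b c m x)" for m x
    by (simp add: triple_sum_def \<tau>_def)
  have int: "integrable (sample I) (\<tau> a b c m)" if "a \<in> I" "b \<in> I - {a}" "c \<in> I - {a, b}" for a b c m
    unfolding \<tau>_def using that by (intro triple_summand_integral(1)[OF fin _ _ _ _ _ _ h]) auto
  show "integrable (sample I) (triple_sum I m h)"
    unfolding ts[abs_def] by (intro Bochner_Integration.integrable_sum int)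
  have I: "(\<integral>x. triple_sum I m h x \<partial>sample I) = (\<Sum>a\<in>I. \<Sum>b\<in>I - {a}. \<Sum>c\<in>I - {a, b}. \<integral>x. \<tau> a b c m x \<partial>sample I)" for m
  proof -
    have "(\<integral>x. triple_sum I m h x \<partial>sample I) = (\<Sum>a\<in>I. \<integral>x. (\<Sum>b\<in>I - {a}. \<Sum>c\<in>I - {a, b}. \<tau> a b c m x) \<partial>sample I)"
      unfolding ts by (intro Bochner_Integration.integral_sum Bochner_Integration.integrable_sum int)
    also have "\<dots> = (\<Sum>a\<in>I. \<Sum>b\<in>I - {a}. \<integral>x. (\<Sum>c\<in>I - {a, b}. \<tau> a b c m x) \<partial>sample I)"
      by (intro sum.cong refl Bochner_Integration.integral_sum Bochner_Integration.integrable_sum int)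
    also have "\<dots> = (\<Sum>a\<in>I. \<Sum>b\<in>I - {a}. \<Sum>c\<in>I - {a, b}. \<integral>x. \<tau> a b c m x \<partial>sample I)"
      by (intro sum.cong refl Bochner_Integration.integral_sum int)
    finally show ?thesis .
  qed
  have const: "(\<Sum>a\<in>I. \<Sum>b\<in>I - {a}. \<Sum>c\<in>I - {a, b}. C) = c3 * C" for C :: real
  proof -
    have "(\<Sum>a\<in>I. \<Sum>b\<in>I - {a}. \<Sum>c\<in>I - {a, b}. C) = (\<Sum>a\<in>I. \<Sum>b\<in>I - {a}. real (n - 2) * C)"
    proof (intro sum.cong refl)
      fix a b assume "a \<in> I" "b \<in> I - {a}"
      then have "card (I - {a, b}) = n - 2" using fin n by (subst card_Diff_subset) auto
      then show "(\<Sum>c\<in>I - {a, b}. C) = real (n - 2) * C" by simp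
    qed
    also have "\<dots> = (\<Sum>a\<in>I. real (n - 1) * (real (n - 2) * C))"
      by (intro sum.cong refl) (use fin n in simp)
    finally show ?thesis using n by (simp add: c3_def mult_ac)
  qed
  note tsi = triple_summand_integral(2-5)[OF fin _ _ _ _ _ _ h, folded \<tau>_def, unfolded n]
  have v: "(\<integral>z. kint k h z * (1 - Phi z) ^ (n - (3 + k)) \<partial>\<N>) = lap (kint k h) (3 + k) n" for k
    by (simp add: lap_def)
  show "(\<integral>x. triple_sum I 0 h x \<partial>sample I) = c3 * lap (kint 0 h) 3 n"
    unfolding I const[symmetric] using tsi(1) v[of 0] by (intro sum.cong refl) auto
  show "(\<integral>x. triple_sum I 1 h x \<partial>sample I) \<le> c3 * (real (n - 3) * lap (kint 1 h) 4 n)"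
    unfolding I const[symmetric] using tsi(2) v[of 1] by (intro sum_mono) auto
  show "(\<integral>x. triple_sum I 1 h x \<partial>sample I) \<ge> c3 * (real (n - 3) * lap (kint 1 h) 4 n - real (n - 3) * real (n - 4) * lap (kint 2 h) 5 n)"
    unfolding I const[symmetric] using tsi(3) v[of 1] v[of 2] by (intro sum_mono) auto
  show "(\<integral>x. triple_sum I 2 h x \<partial>sample I) \<le> c3 * (real (n - 3) * real (n - 4) * lap (kint 2 h) 5 n)"
    unfolding I const[symmetric] using tsi(4) v[of 2] by (intro sum_mono) auto
qed

lemma min_sum_integral:
  fixes I :: "'i set" and f :: "real \<Rightarrow> real"
  assumes fin: "finite I" and n: "card I = n" and [measurable]: "f \<in> borel_measurable borel"
    and f: "\<And>z. 0 \<le> f z" "\<And>z. f z \<le> 1"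
  shows "integrable (sample I) (\<lambda>x. \<Sum>a\<in>I. if min_at I x a then f (x a) else 0)"
    "(\<integral>x. (\<Sum>a\<in>I. if min_at I x a then f (x a) else 0) \<partial>sample I) = real n * lap f 1 n"
proof -
  have comp: "(\<lambda>x. x i) \<in> borel_measurable (sample J)" if "i \<in> J" for i :: 'i and J
    using measurable_component_singleton[OF that, of "\<lambda>_. \<N>"] by simp
  define T where "T a x = (if min_at I x a then f (x a) else 0)" for a x
  have int: "integrable (sample I) (T a)" if "a \<in> I" for a
  proof (rule PN.integrable_const_bound[where B = 1])
    show "AE x in sample I. norm (T a x) \<le> 1" using f by (auto simp: T_def)
    note [measurable] = min_at_measurable[OF fin that] comp[OF that]
    show "T a \<in> borel_measurable (sample I)" unfolding T_def by measurable
  qed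
  have eq: "(\<integral>x. T a x \<partial>sample I) = lap f 1 n" if a: "a \<in> I" for a
  proof -
    define g where "g l x y = (if x a < y then 1 else 0 :: ennreal)" for l :: 'i and x :: "'i \<Rightarrow> real" and y
    have I: "I = {a} \<union> (I - {a})" using a by auto
    have "(\<integral>\<^sup>+x. ennreal (T a x) \<partial>sample I) = (\<integral>\<^sup>+x. ennreal (f (restrict x {a} a)) * (\<Prod>l\<in>I - {a}. g l (restrict x {a}) (x l)) \<partial>sample I)"
    proof (rule nn_integral_cong)
      fix x :: "'i \<Rightarrow> real"
      have "(\<Prod>l\<in>I - {a}. g l (restrict x {a}) (x l)) = (if min_at I x a then 1 else 0)"
        using fin by (auto simp: g_def min_at_def intro!: prod_zero)
      then show "ennreal (T a x) = ennreal (f (restrict x {a} a)) * (\<Prod>l\<in>I - {a}. g l (restrict x {a}) (x l))"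
        by (simp add: T_def)
    qed
    also have "\<dots> = (\<integral>\<^sup>+x. ennreal (f (x a)) * (\<Prod>l\<in>I - {a}. \<integral>\<^sup>+y. g l x y \<partial>\<N>) \<partial>sample {a})"
    proof (subst I, rule PN.nn_integral_fold_prod[where F = "\<lambda>x. ennreal (f (x a))"])
      have [measurable]: "(\<lambda>x. x a) \<in> borel_measurable (sample {a})" by (rule comp) simp
      show "(\<lambda>x. ennreal (f (x a))) \<in> borel_measurable (sample {a})" by measurable
      have [measurable]: "(\<lambda>p. fst p a) \<in> borel_measurable (sample {a} \<Otimes>\<^sub>M \<N>)"
        by (intro measurable_compose[OF measurable_fst comp]) simp
      have [measurable]: "(\<lambda>p. snd p) \<in> borel_measurable (sample {a} \<Otimes>\<^sub>M \<N>)"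
        using measurable_snd[of "sample {a}" \<N>] by simp
      show "(\<lambda>(x, y). g l x y) \<in> borel_measurable (sample {a} \<Otimes>\<^sub>M \<N>)" for l
        unfolding g_def case_prod_beta by measurable
    qed (use fin in auto)
    also have "\<dots> = (\<integral>\<^sup>+x. ennreal (f (x a) * (1 - Phi (x a)) ^ (n - 1)) \<partial>sample {a})"
    proof (rule nn_integral_cong)
      fix x :: "'i \<Rightarrow> real"
      have "(\<integral>\<^sup>+y. g l x y \<partial>\<N>) = ennreal (1 - Phi (x a))" for l
      proof -
        have "(\<integral>\<^sup>+y. g l x y \<partial>\<N>) = (\<integral>\<^sup>+y. indicator {x a<..} y \<partial>\<N>)"
          by (intro nn_integral_cong) (auto simp: g_def indicator_def)
        then show ?thesis by (simp add: emeasure_N_Ioi)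
      qed
      then show "ennreal (f (x a)) * (\<Prod>l\<in>I - {a}. \<integral>\<^sup>+y. g l x y \<partial>\<N>) = ennreal (f (x a) * (1 - Phi (x a)) ^ (n - 1))"
        using f a fin n by (simp add: ennreal_power ennreal_mult'[symmetric])
    qed
    also have "\<dots> = (\<integral>\<^sup>+z. ennreal (f z * (1 - Phi z) ^ (n - 1)) \<partial>\<N>)"
      by (rule PN.product_nn_integral_singleton) measurable
    also have "\<dots> = ennreal (lap f 1 n)"
      unfolding lap_def
    proof (intro nn_integral_eq_integral AE_I2)
      show "integrable \<N> (\<lambda>z. f z * (1 - Phi z) ^ (n - 1))"
        using f by (intro N.integrable_const_bound[where B = 1] AE_I2) (auto simp: abs_mult power_abs intro!: mult_le_one power_le_one)
      show "0 \<le> f z * (1 - Phi z) ^ (n - 1)" for z using f by simp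
    qed
    finally have "(\<integral>\<^sup>+x. ennreal (T a x) \<partial>sample I) = ennreal (lap f 1 n)" .
    moreover have "0 \<le> lap f 1 n" unfolding lap_def using f by (intro Bochner_Integration.integral_nonneg) auto
    moreover have "0 \<le> T a x" for x using f by (simp add: T_def)
    ultimately show ?thesis using int[OF a] by (subst integral_eq_nn_integral) auto
  qed
  show "integrable (sample I) (\<lambda>x. \<Sum>a\<in>I. if min_at I x a then f (x a) else 0)"
    using int unfolding T_def by (intro Bochner_Integration.integrable_sum)
  show "(\<integral>x. (\<Sum>a\<in>I. if min_at I x a then f (x a) else 0) \<partial>sample I) = real n * lap f 1 n"
    using int eq n unfolding T_def by (subst Bochner_Integration.integral_sum) auto
qed

section \<open>Minimizers of a quadratic form on the simplex\<close>

definition bilin :: "nat \<Rightarrow> (nat \<Rightarrow> nat \<Rightarrow> real) \<Rightarrow> (nat \<Rightarrow> real) \<Rightarrow> (nat \<Rightarrow> real) \<Rightarrow> real" where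
  "bilin n Q x y = (\<Sum>i=1..n. \<Sum>j=1..n. x i * Q i j * y j)"

definition vertex :: "nat \<Rightarrow> nat \<Rightarrow> real" where
  "vertex i = (\<lambda>k. if k = i then 1 else 0)"

definition symm :: "nat \<Rightarrow> (nat \<Rightarrow> nat \<Rightarrow> real) \<Rightarrow> bool" where
  "symm n Q \<longleftrightarrow> (\<forall>i\<in>{1..n}. \<forall>j\<in>{1..n}. Q i j = Q j i)"

lemma quad_form_combine:
  assumes "symm n Q"
  shows "quad_form n Q (\<lambda>k. u * x k + v * y k) = u\<^sup>2 * quad_form n Q x + 2 * u * v * bilin n Q x y + v\<^sup>2 * quad_form n Q y"
proof -
  have sw: "(\<Sum>i=1..n. \<Sum>j=1..n. y i * Q i j * x j) = bilin n Q x y"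
    unfolding bilin_def
    by (subst sum.swap) (intro sum.cong refl, use assms in \<open>auto simp: symm_def mult_ac\<close>)
  have "quad_form n Q (\<lambda>k. u * x k + v * y k) = (\<Sum>i=1..n. \<Sum>j=1..n.
      u\<^sup>2 * (x i * Q i j * x j) + u * v * (x i * Q i j * y j) + u * v * (y i * Q i j * x j) + v\<^sup>2 * (y i * Q i j * y j))"
    unfolding quad_form_def by (intro sum.cong refl) (simp add: algebra_simps power2_eq_square)
  also have "\<dots> = u\<^sup>2 * quad_form n Q x + u * v * bilin n Q x y + u * v * bilin n Q x y + v\<^sup>2 * quad_form n Q y"
    unfolding sum.distrib sum_distrib_left[symmetric] sw unfolding quad_form_def bilin_def ..
  finally show ?thesis by simp
qed

lemma bilin_vertex_right: "i \<in> {1..n} \<Longrightarrow> bilin n Q x (vertex i) = (\<Sum>m=1..n. x m * Q m i)"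
  unfolding bilin_def vertex_def by (intro sum.cong refl) (simp add: if_distrib[of "(*) _"] cong: if_cong)

lemma bilin_vertex: "i \<in> {1..n} \<Longrightarrow> j \<in> {1..n} \<Longrightarrow> bilin n Q (vertex i) (vertex j) = Q i j"
  by (subst bilin_vertex_right) (auto simp: vertex_def if_distrib[of "\<lambda>x. x * _"] cong: if_cong)

lemma quad_form_vertex: "i \<in> {1..n} \<Longrightarrow> quad_form n Q (vertex i) = Q i i"
  using bilin_vertex[of i n i Q] by (simp add: bilin_def quad_form_def)

lemma vertex_in_simplex: "i \<in> {1..n} \<Longrightarrow> vertex i \<in> std_simplex n"
  by (auto simp: std_simplex_def vertex_def)

lemma simplex_convex:
  assumes "x \<in> std_simplex n" "y \<in> std_simplex n" "u \<ge> 0" "v \<ge> 0" "u + v = 1"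
  shows "(\<lambda>k. u * x k + v * y k) \<in> std_simplex n"
  using assms by (auto simp: std_simplex_def sum.distrib sum_distrib_left[symmetric])

definition edge_point :: "nat \<Rightarrow> nat \<Rightarrow> real \<Rightarrow> real \<Rightarrow> nat \<Rightarrow> real" where
  "edge_point i j u v = (\<lambda>k. u * vertex i k + v * vertex j k)"

lemma edge_point_in_simplex:
  "i \<in> {1..n} \<Longrightarrow> j \<in> {1..n} \<Longrightarrow> u \<ge> 0 \<Longrightarrow> v \<ge> 0 \<Longrightarrow> u + v = 1 \<Longrightarrow> edge_point i j u v \<in> std_simplex n"
  unfolding edge_point_def by (intro simplex_convex vertex_in_simplex)

lemma quad_form_edge_point:
  assumes "symm n Q" "i \<in> {1..n}" "j \<in> {1..n}" "u + v = 1"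
  shows "quad_form n Q (edge_point i j u v) - c = u\<^sup>2 * (Q i i - c) + 2 * u * v * (Q i j - c) + v\<^sup>2 * (Q j j - c)"
proof -
  have "quad_form n Q (edge_point i j u v) - c = u\<^sup>2 * Q i i + 2 * u * v * Q i j + v\<^sup>2 * Q j j - (u + v)\<^sup>2 * c"
    unfolding edge_point_def quad_form_combine[OF assms(1)] using assms
    by (simp add: quad_form_vertex bilin_vertex)
  also have "\<dots> = u\<^sup>2 * (Q i i - c) + 2 * u * v * (Q i j - c) + v\<^sup>2 * (Q j j - c)"
    by (simp add: algebra_simps power2_eq_square)
  finally show ?thesis .
qed

lemma minimizerD:
  assumes "stqp_minimizer n Q x"
  shows "x \<in> std_simplex n" "y \<in> std_simplex n \<Longrightarrow> quad_form n Q x \<le> quad_form n Q y"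
  using assms by (auto simp: stqp_minimizer_def is_arg_min_def not_less)

text \<open>A coordinate in the support can be moved towards its vertex and away from it, so the
  one-sided derivatives vanish.\<close>

lemma minimizer_stationary:
  assumes s: "symm n Q" and x: "stqp_minimizer n Q x" and i: "i \<in> {1..n}" and xi: "x i > 0"
  shows "(\<Sum>m=1..n. x m * Q m i) = quad_form n Q x"
proof -
  define l where "l = quad_form n Q x"
  define d where "d = bilin n Q x (vertex i) - l"
  define E where "E = Q i i - l - 2 * d"
  have xs: "x \<in> std_simplex n" by (rule minimizerD[OF x])
  have ineq: "0 \<le> 2 * t * d + t\<^sup>2 * E" if t: "- x i \<le> t" "t \<le> 1" for t
  proof -
    have "(\<lambda>k. (1 - t) * x k + t * vertex i k) \<in> std_simplex n"
    proof -
      have xi1: "x i \<le> 1" using xs i member_le_sum[of i "{1..n}" x] by (auto simp: std_simplex_def)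
      have "(1 - t) * x k + t * vertex i k \<ge> 0" if "k \<in> {1..n}" for k
      proof (cases "k = i")
        case True
        have "(1 - t) * x i + t = x i + t * (1 - x i)" by (simp add: algebra_simps)
        also have "\<dots> \<ge> 0"
        proof (cases "t \<ge> 0")
          case False
          have "(- t) * (1 - x i) \<le> (- t) * 1" using False xi by (intro mult_left_mono) auto
          then show ?thesis using t by simp
        qed (use xi xi1 in simp)
        finally show ?thesis using True by (simp add: vertex_def)
      qed (use xs that t in \<open>auto simp: vertex_def std_simplex_def\<close>)
      moreover have "(\<Sum>k=1..n. (1 - t) * x k + t * vertex i k) = 1"
        using xs vertex_in_simplex[OF i] by (simp add: std_simplex_def sum.distrib sum_distrib_left[symmetric])
      moreover have "(1 - t) * x k + t * vertex i k = 0" if "k \<notin> {1..n}" for k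
        using that xs vertex_in_simplex[OF i] by (auto simp: std_simplex_def)
      ultimately show ?thesis unfolding std_simplex_def by blast
    qed
    from minimizerD(2)[OF x this] have "l \<le> (1 - t)\<^sup>2 * l + 2 * (1 - t) * t * (l + d) + t\<^sup>2 * Q i i"
      unfolding quad_form_combine[OF s] using i by (simp add: quad_form_vertex l_def d_def)
    then show ?thesis by (simp add: E_def power2_eq_square algebra_simps)
  qed
  have "d = 0"
  proof (rule ccontr)
    assume d: "d \<noteq> 0"
    define r where "r = min (min (x i) 1) (\<bar>d\<bar> / (\<bar>E\<bar> + 1))"
    have r: "r > 0" "r \<le> x i" "r \<le> 1" "r \<le> \<bar>d\<bar> / (\<bar>E\<bar> + 1)" using xi d by (auto simp: r_def)
    have "r * (\<bar>E\<bar> + 1) \<le> \<bar>d\<bar>" using r(4) by (simp add: pos_le_divide_eq)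
    then have rE: "r * E \<le> \<bar>d\<bar>"
      using r(1) abs_ge_self[of E] mult_left_mono[of E "\<bar>E\<bar> + 1" r] by (smt (verit))
    define t where "t = - sgn d * r"
    have "- x i \<le> t" "t \<le> 1" using r d by (auto simp: t_def sgn_if)
    from ineq[OF this] have "0 \<le> 2 * t * d + t\<^sup>2 * E" .
    also have "2 * t * d + t\<^sup>2 * E = r * (r * E - 2 * \<bar>d\<bar>)"
      using d by (auto simp: t_def sgn_if power2_eq_square algebra_simps)
    also have "\<dots> < 0" using r rE d by (intro mult_pos_neg) auto
    finally show False by simp
  qed
  then show ?thesis using i by (simp add: d_def l_def bilin_vertex_right)
qed

text \<open>A support of size at least three forces small off-diagonal entries in one row.  Let \<open>l\<close> be
  the minimum, \<open>D i = Q i i - l\<close>, and take the support index \<open>i\<close> for which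
  \<open>sqrt (D i) * x i\<close> is largest.  Stationarity in coordinate \<open>i\<close> shows that the normalised entries
  \<open>(l - Q i m) / sqrt (D i * D m)\<close> over the \<open>m\<close> with \<open>Q i m < l\<close> have sum at least one.  A single
  such \<open>m\<close> would make the edge from \<open>i\<close> to \<open>m\<close> reach the minimum as well, against uniqueness; with
  two, one of the two normalised entries is at least one half; three or more give three entries below \<open>z\<close>.\<close>

lemma large_support_row:
  assumes s: "symm n Q" and x: "stqp_minimizer n Q x"
    and uniq: "\<And>y. y \<in> std_simplex n \<Longrightarrow> y \<noteq> x \<Longrightarrow> quad_form n Q x < quad_form n Q y"
    and card: "3 \<le> card {i\<in>{1..n}. 0 < x i}"
    and z: "\<And>i. i \<in> {1..n} \<Longrightarrow> z \<le> Q i i" "i0 \<in> {1..n}" "Q i0 i0 = z"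
  shows "(\<exists>i\<in>{1..n}. \<exists>A. A \<subseteq> {1..n} - {i} \<and> card A = 3 \<and> (\<forall>m\<in>A. Q i m < z)) \<or>
    (\<exists>i\<in>{1..n}. \<exists>m\<in>{1..n} - {i}. \<exists>k\<in>{1..n} - {i, m}. Q i k < z \<and> Q i m \<le> z - 1/2 * sqrt ((Q i i - z) * (Q m m - z)))"
proof -
  define l where "l = quad_form n Q x"
  define K where "K = {i\<in>{1..n}. 0 < x i}"
  have xs: "x \<in> std_simplex n" by (rule minimizerD[OF x])
  have small: "x \<noteq> edge_point i j u v" for i j u v
  proof
    assume "x = edge_point i j u v"
    then have "K \<subseteq> {i, j}" by (auto simp: K_def edge_point_def vertex_def split: if_splits)
    then have "card K \<le> card {i, j}" by (intro card_mono) auto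
    also have "\<dots> \<le> 2" by (simp add: card_insert_if)
    finally show False using card by (simp add: K_def)
  qed
  have ve: "vertex i = edge_point i i 1 0" for i by (simp add: edge_point_def)
  define D where "D i = Q i i - l" for i
  have D: "D i > 0" if "i \<in> {1..n}" for i
    using uniq[OF vertex_in_simplex[OF that]] small[of i i 1 0] quad_form_vertex[OF that, of Q]
    by (auto simp: D_def l_def ve[symmetric])
  have lz: "l < z" using D[OF z(2)] z(3) by (simp add: D_def)
  have Kne: "finite K" "K \<noteq> {}"
  proof -
    show "finite K" by (simp add: K_def)
    have "card K \<noteq> 0" using card unfolding K_def by linarith
    then show "K \<noteq> {}" by auto
  qed
  define y where "y i = sqrt (D i) * x i" for i
  have "Max (y ` K) \<in> y ` K" using Kne by (intro Max_in) auto
  then obtain i where iK: "i \<in> K" and iM: "Max (y ` K) = y i" by auto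
  have imax: "y m \<le> y i" if "m \<in> K" for m
    using Max_ge[of "y ` K" "y m"] that Kne(1) iM by simp
  have i: "i \<in> {1..n}" "x i > 0" using iK by (auto simp: K_def)
  have sq: "sqrt (D m) > 0" if "m \<in> {1..n}" for m using D[OF that] by simp
  define N where "N = {m\<in>{1..n} - {i}. Q i m < l \<and> x m > 0}"
  have finN: "finite N" by (simp add: N_def)
  define r where "r m = (l - Q i m) / (sqrt (D i) * sqrt (D m))" for m
  have yi: "y i > 0" using i sq[OF i(1)] by (simp add: y_def)
  have "0 = (\<Sum>m=1..n. x m * (Q i m - l))"
  proof -
    have "(\<Sum>m=1..n. x m * Q m i) = l" unfolding l_def by (rule minimizer_stationary[OF s x i])
    moreover have "(\<Sum>m=1..n. x m * Q m i) = (\<Sum>m=1..n. x m * Q i m)"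
      using s i(1) by (intro sum.cong refl) (auto simp: symm_def)
    moreover have "(\<Sum>m=1..n. x m) = 1" using xs by (simp add: std_simplex_def)
    ultimately show ?thesis by (simp add: right_diff_distrib sum_subtractf sum_distrib_right[symmetric])
  qed
  also have "\<dots> = x i * D i + (\<Sum>m\<in>{1..n} - {i}. x m * (Q i m - l))"
    using i by (subst sum.remove[of _ i]) (auto simp: D_def)
  finally have "x i * D i = - (\<Sum>m\<in>{1..n} - {i}. x m * (Q i m - l))" by linarith
  moreover have "(\<Sum>m\<in>{1..n} - {i}. x m * (Q i m - l)) \<ge> (\<Sum>m\<in>N. x m * (Q i m - l))"
  proof (rule sum_mono2)
    fix m assume m: "m \<in> {1..n} - {i} - N"
    have "x m \<ge> 0" using m xs by (auto simp: std_simplex_def)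
    moreover have "x m = 0 \<or> Q i m \<ge> l" using m \<open>x m \<ge> 0\<close> by (auto simp: N_def)
    ultimately show "0 \<le> x m * (Q i m - l)" by auto
  qed (auto simp: N_def)
  ultimately have "x i * D i \<le> - (\<Sum>m\<in>N. x m * (Q i m - l))" by linarith
  also have "\<dots> = (\<Sum>m\<in>N. x m * (l - Q i m))" by (simp add: sum_negf[symmetric] algebra_simps)
  also have "\<dots> \<le> (\<Sum>m\<in>N. r m * (sqrt (D i) * y i))"
  proof (rule sum_mono)
    fix m assume m: "m \<in> N"
    then have mn: "m \<in> {1..n}" "m \<in> K" by (auto simp: N_def K_def)
    have r0: "r m \<ge> 0" using m sq[OF mn(1)] sq[OF i(1)] by (simp add: r_def N_def)
    have "x m * (l - Q i m) = r m * (sqrt (D i) * y m)"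
      using sq[OF mn(1)] sq[OF i(1)] D[OF mn(1)] D[OF i(1)] by (simp add: r_def y_def)
    also have "\<dots> \<le> r m * (sqrt (D i) * y i)"
      using r0 imax[OF mn(2)] sq[OF i(1)] by (intro mult_left_mono) auto
    finally show "x m * (l - Q i m) \<le> r m * (sqrt (D i) * y i)" .
  qed
  also have "\<dots> = (\<Sum>m\<in>N. r m) * (sqrt (D i) * y i)" by (simp add: sum_distrib_right)
  also have "x i * D i = 1 * (sqrt (D i) * y i)" using D[OF i(1)] by (simp add: y_def)
  finally have r1: "1 \<le> (\<Sum>m\<in>N. r m)"
    using yi sq[OF i(1)] by (subst (asm) mult_le_cancel_right_pos) auto
  \<comment> \<open>Passing from \<open>l\<close> to the larger \<open>z\<close> shrinks the square root and only helps.\<close>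
  have half: "Q i m \<le> z - 1/2 * sqrt ((Q i i - z) * (Q m m - z))" if m: "m \<in> N" and rm: "r m \<ge> 1/2" for m
  proof -
    have mn: "m \<in> {1..n}" using m by (auto simp: N_def)
    have "1/2 * (sqrt (D i) * sqrt (D m)) \<le> l - Q i m"
      using rm sq[OF i(1)] sq[OF mn] by (simp add: r_def le_divide_eq)
    moreover have "sqrt ((Q i i - z) * (Q m m - z)) \<le> sqrt (D i) * sqrt (D m)"
      unfolding real_sqrt_mult[symmetric] D_def
      using z(1)[OF i(1)] z(1)[OF mn] lz by (intro real_sqrt_le_mono mult_mono) auto
    ultimately show ?thesis using lz by linarith
  qed
  have "N \<noteq> {}" using r1 by auto
  then have "card N > 0" using finN by (simp add: card_gt_0_iff)
  then consider "card N = 1" | "card N = 2" | "card N \<ge> 3" by linarith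
  then show ?thesis
  proof cases
    case 1
    then obtain m where Nm: "N = {m}" by (auto simp: card_1_singleton_iff)
    then have m: "m \<in> {1..n}" "m \<noteq> i" by (auto simp: N_def)
    define a where "a = sqrt (D i)"
    define b where "b = sqrt (D m)"
    have ab: "a > 0" "b > 0" "a\<^sup>2 = D i" "b\<^sup>2 = D m" using sq[OF i(1)] sq[OF m(1)] D[OF i(1)] D[OF m(1)] by (auto simp: a_def b_def)
    have c: "Q i m - l \<le> - (a * b)"
      using r1 ab(1,2) unfolding Nm by (simp add: r_def a_def[symmetric] b_def[symmetric] le_divide_eq)
    define u where "u = b / (a + b)"
    define v where "v = a / (a + b)"
    have uv: "u > 0" "v > 0" "u + v = 1" using ab by (auto simp: u_def v_def add_divide_distrib[symmetric])
    have "quad_form n Q (edge_point i m u v) - l = u\<^sup>2 * a\<^sup>2 + 2 * u * v * (Q i m - l) + v\<^sup>2 * b\<^sup>2"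
      using quad_form_edge_point[OF s i(1) m(1) uv(3), of l] ab by (simp add: D_def)
    also have "\<dots> \<le> u\<^sup>2 * a\<^sup>2 + 2 * u * v * (- (a * b)) + v\<^sup>2 * b\<^sup>2"
      using c uv by (intro add_mono mult_left_mono) auto
    also have "\<dots> = (u * a - v * b)\<^sup>2" by (simp add: power2_eq_square algebra_simps)
    also have "u * a - v * b = 0" by (simp add: u_def v_def mult.commute)
    finally have "quad_form n Q (edge_point i m u v) \<le> l" by simp
    moreover have "edge_point i m u v \<in> std_simplex n" using uv i m by (intro edge_point_in_simplex) auto
    ultimately show ?thesis using uniq[of "edge_point i m u v"] small[of i m u v] by (auto simp: l_def)
  next
    case 2
    then obtain m k where Nm: "N = {m, k}" "m \<noteq> k" by (auto simp: card_2_iff)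
    then have "r m + r k \<ge> 1" using r1 by simp
    then consider "r m \<ge> 1/2" | "r k \<ge> 1/2" by linarith
    then obtain m' k' where mk: "m' \<in> N" "k' \<in> N" "m' \<noteq> k'" "r m' \<ge> 1/2"
      using Nm by cases auto
    then have "m' \<in> {1..n} - {i}" "k' \<in> {1..n} - {i, m'}" "Q i k' < z" using lz by (auto simp: N_def)
    then show ?thesis using half[OF mk(1,4)] i(1) by blast
  next
    case 3
    then obtain A where A: "A \<subseteq> N" "card A = 3" by (meson obtain_subset_with_card_n)
    then have "A \<subseteq> {1..n} - {i}" "\<forall>m\<in>A. Q i m < z" using lz by (auto simp: N_def)
    then show ?thesis using A i(1) by blast
  qed
qed

text \<open>On the edge the excess over \<open>z\<close> is the form \<open>u\<^sup>2 * a + 2 * u * v * d + v\<^sup>2 * b\<close>, which takes a negative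
  value with \<open>u, v \<ge> 0\<close> as soon as \<open>d < - sqrt (a * b)\<close>.\<close>

lemma edge_below:
  assumes s: "symm n Q" and ij: "i \<in> {1..n}" "j \<in> {1..n}"
    and z: "z \<le> Q i i" "z \<le> Q j j" and c: "Q i j < z - sqrt ((Q i i - z) * (Q j j - z))"
  obtains y where "y \<in> std_simplex n" "quad_form n Q y < z"
proof -
  define a where "a = Q i i - z"
  define b where "b = Q j j - z"
  define d where "d = Q i j - z"
  have ab: "a \<ge> 0" "b \<ge> 0" using z by (auto simp: a_def b_def)
  have d: "d < - sqrt (a * b)" using c by (simp add: a_def b_def d_def)
  have d0: "d < 0" using d ab by (smt (verit) real_sqrt_ge_zero mult_nonneg_nonneg)
  have "\<exists>u v. u \<ge> 0 \<and> v \<ge> 0 \<and> u + v = 1 \<and> u\<^sup>2 * a + 2 * u * v * d + v\<^sup>2 * b < 0"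
  proof -
    have corner: "\<exists>t. 0 \<le> t \<and> t \<le> 1 \<and> 2 * (1 - t) * t * d + t\<^sup>2 * e < 0" if e: "e \<ge> 0" for e
    proof -
      define t where "t = - d / (e - 2 * d)"
      have t: "t > 0" "t \<le> 1" "t * (e - 2 * d) = - d" using d0 e by (auto simp: t_def field_simps)
      have "2 * (1 - t) * t * d + t\<^sup>2 * e = t * (2 * d + t * (e - 2 * d))"
        by (simp add: power2_eq_square algebra_simps)
      also have "\<dots> = t * d" using t by simp
      also have "\<dots> < 0" using t d0 by (simp add: mult_pos_neg)
      finally show ?thesis using t by (intro exI[of _ t]) auto
    qed
    consider "a = 0" | "b = 0" | "a > 0" "b > 0" using ab by linarith
    then show ?thesis
    proof cases
      case 1
      obtain t where "0 \<le> t" "t \<le> 1" "2 * (1 - t) * t * d + t\<^sup>2 * b < 0" using corner[OF ab(2)] by blast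
      then show ?thesis using 1 by (intro exI[of _ "1 - t"] exI[of _ t]) auto
    next
      case 2
      obtain t where "0 \<le> t" "t \<le> 1" "2 * (1 - t) * t * d + t\<^sup>2 * a < 0" using corner[OF ab(1)] by blast
      then show ?thesis using 2 by (intro exI[of _ t] exI[of _ "1 - t"]) (auto simp: mult_ac add_ac)
    next
      case 3
      define p where "p = sqrt a"
      define q where "q = sqrt b"
      have pq: "p > 0" "q > 0" "p\<^sup>2 = a" "q\<^sup>2 = b" using 3 by (auto simp: p_def q_def)
      have dpq: "d < - (p * q)" using d by (simp add: p_def q_def real_sqrt_mult)
      define u where "u = q / (p + q)"
      define v where "v = p / (p + q)"
      have uv: "u > 0" "v > 0" "u + v = 1" using pq by (auto simp: u_def v_def add_divide_distrib[symmetric])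
      have "u\<^sup>2 * a + 2 * u * v * d + v\<^sup>2 * b < u\<^sup>2 * p\<^sup>2 + 2 * u * v * (- (p * q)) + v\<^sup>2 * q\<^sup>2"
        unfolding pq using mult_strict_left_mono[OF dpq, of "2 * u * v"] uv by simp
      also have "\<dots> = (u * p - v * q)\<^sup>2" by (simp add: power2_eq_square algebra_simps)
      also have "u * p - v * q = 0" by (simp add: u_def v_def mult.commute)
      finally show ?thesis using uv by (intro exI[of _ u] exI[of _ v]) auto
    qed
  qed
  then obtain u v where uv: "u \<ge> 0" "v \<ge> 0" "u + v = 1" "u\<^sup>2 * a + 2 * u * v * d + v\<^sup>2 * b < 0" by blast
  show ?thesis
  proof (rule that)
    show "edge_point i j u v \<in> std_simplex n" using uv ij by (intro edge_point_in_simplex)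
    show "quad_form n Q (edge_point i j u v) < z"
      using quad_form_edge_point[OF s ij uv(3), of z] uv by (simp add: a_def b_def d_def)
  qed
qed

text \<open>The converse of the preceding lemma, by the inequality between arithmetic and geometric means.\<close>

lemma edge_support:
  assumes s: "symm n Q" and x: "x \<in> std_simplex n" and K: "{i\<in>{1..n}. 0 < x i} = {i, j}" "i \<noteq> j"
    and z: "z \<le> Q i i" "z \<le> Q j j" and l: "quad_form n Q x < z"
  shows "Q i j < z - sqrt ((Q i i - z) * (Q j j - z))"
proof -
  have ij: "i \<in> {1..n}" "j \<in> {1..n}" "x i > 0" "x j > 0" using K by blast+
  have xk: "x k = 0" if "k \<noteq> i" "k \<noteq> j" for k
    using that K x unfolding std_simplex_def by (cases "k \<in> {1..n}") (force, force)
  have xe: "x = edge_point i j (x i) (x j)"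
    using xk K(2) by (auto simp: edge_point_def vertex_def fun_eq_iff)
  have "(\<Sum>k=1..n. x k) = (\<Sum>k\<in>{i, j}. x k)"
    by (rule sum.mono_neutral_right) (use ij xk in auto)
  then have sum: "x i + x j = 1" using x K(2) by (simp add: std_simplex_def)
  define a where "a = sqrt (Q i i - z)"
  define b where "b = sqrt (Q j j - z)"
  have ab: "a \<ge> 0" "b \<ge> 0" "a\<^sup>2 = Q i i - z" "b\<^sup>2 = Q j j - z" using z by (auto simp: a_def b_def)
  define u where "u = x i"
  define v where "v = x j"
  have "u\<^sup>2 * a\<^sup>2 + 2 * u * v * (Q i j - z) + v\<^sup>2 * b\<^sup>2 < 0"
    using quad_form_edge_point[OF s ij(1,2) sum, of z] l xe ab by (simp add: u_def v_def)
  moreover have "0 \<le> (u * a - v * b)\<^sup>2" by simp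
  then have "2 * u * v * (a * b) \<le> u\<^sup>2 * a\<^sup>2 + v\<^sup>2 * b\<^sup>2" by (simp add: power2_eq_square algebra_simps)
  ultimately have neg: "2 * u * v * (Q i j - z + a * b) < 0" by (simp add: algebra_simps)
  have "2 * u * v > 0" using ij by (simp add: u_def v_def)
  then have "Q i j - z + a * b < 0" using neg by (smt (verit) mult_nonneg_nonneg)
  then show ?thesis by (simp add: a_def b_def real_sqrt_mult)
qed

text \<open>The three events below are stated for a level \<open>z\<close>, which will be the smallest diagonal entry.\<close>

definition edge_event :: "nat \<Rightarrow> (nat \<Rightarrow> nat \<Rightarrow> real) \<Rightarrow> real \<Rightarrow> bool" where
  "edge_event n Q z \<longleftrightarrow> (\<exists>i\<in>{1..n}. \<exists>j\<in>{1..n}. i < j \<and> Q i j < z - sqrt ((Q i i - z) * (Q j j - z)))"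

definition star_event :: "nat \<Rightarrow> (nat \<Rightarrow> nat \<Rightarrow> real) \<Rightarrow> real \<Rightarrow> bool" where
  "star_event n Q z \<longleftrightarrow> (\<exists>i\<in>{1..n}. \<exists>A. A \<subseteq> {1..n} - {i} \<and> card A = 3 \<and> (\<forall>m\<in>A. Q i m < z))"

definition path_event :: "nat \<Rightarrow> (nat \<Rightarrow> nat \<Rightarrow> real) \<Rightarrow> real \<Rightarrow> bool" where
  "path_event n Q z \<longleftrightarrow> (\<exists>i\<in>{1..n}. \<exists>m\<in>{1..n} - {i}. \<exists>k\<in>{1..n} - {i, m}.
     Q i k < z \<and> Q i m \<le> z - 1/2 * sqrt ((Q i i - z) * (Q m m - z)))"

text \<open>The edge event implies support at least two, and is implied by support exactly two; so its probability
  differs from that of either by at most the probability of a support of size at least three, which the star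
  and path events control.\<close>

theorem kappa_events:
  assumes s: "symm n Q" and ex: "\<exists>!x. stqp_minimizer n Q x"
    and z: "\<And>i. i \<in> {1..n} \<Longrightarrow> z \<le> Q i i" "i0 \<in> {1..n}" "Q i0 i0 = z"
  shows "kappa n Q \<ge> 1"
    and "edge_event n Q z \<Longrightarrow> kappa n Q \<ge> 2"
    and "kappa n Q = 2 \<Longrightarrow> edge_event n Q z"
    and "kappa n Q \<ge> 3 \<Longrightarrow> star_event n Q z \<or> path_event n Q z"
proof -
  define x where "x = (THE x. stqp_minimizer n Q x)"
  have x: "stqp_minimizer n Q x" unfolding x_def by (rule theI'[OF ex])
  have xs: "x \<in> std_simplex n" by (rule minimizerD[OF x])
  have uniq: "quad_form n Q x < quad_form n Q y" if "y \<in> std_simplex n" "y \<noteq> x" for y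
  proof (rule ccontr)
    assume "\<not> quad_form n Q x < quad_form n Q y"
    then have "stqp_minimizer n Q y" using x that(1)
      by (auto simp: stqp_minimizer_def is_arg_min_def)
    then show False using ex x that(2) by blast
  qed
  define K where "K = {i\<in>{1..n}. 0 < x i}"
  have kap: "kappa n Q = card K" using ex by (simp add: kappa_def K_def x_def)
  have "K \<noteq> {}"
  proof
    assume "K = {}"
    then have "(\<Sum>i=1..n. x i) \<le> 0" by (intro sum_nonpos) (auto simp: K_def not_less)
    then show False using xs by (simp add: std_simplex_def)
  qed
  then show k1: "kappa n Q \<ge> 1" unfolding kap by (simp add: Suc_le_eq card_gt_0_iff K_def)
  have lz: "quad_form n Q x \<le> z"
    using minimizerD(2)[OF x vertex_in_simplex[OF z(2)]] z quad_form_vertex[OF z(2), of Q] by simp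
  show "kappa n Q \<ge> 2" if "edge_event n Q z"
  proof (rule ccontr)
    assume "\<not> kappa n Q \<ge> 2"
    then have "card K = 1" using k1 kap by simp
    then obtain i where Ki: "K = {i}" by (auto simp: card_1_singleton_iff)
    then have i: "i \<in> {1..n}" by (auto simp: K_def)
    have xk: "x k = 0" if "k \<noteq> i" for k
      using that Ki xs unfolding std_simplex_def K_def by (cases "k \<in> {1..n}") (force, force)
    have "(\<Sum>k=1..n. x k) = (\<Sum>k\<in>{i}. x k)"
      by (rule sum.mono_neutral_right) (use i xk in auto)
    then have "x = vertex i" using xs xk by (auto simp: std_simplex_def vertex_def fun_eq_iff)
    then have "quad_form n Q x \<ge> z" using quad_form_vertex[OF i, of Q] z(1)[OF i] by simp
    moreover obtain p q where pq: "p \<in> {1..n}" "q \<in> {1..n}" "Q p q < z - sqrt ((Q p p - z) * (Q q q - z))"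
      using \<open>edge_event n Q z\<close> unfolding edge_event_def by blast
    moreover obtain y where "y \<in> std_simplex n" "quad_form n Q y < z"
      using edge_below[OF s pq(1,2) z(1)[OF pq(1)] z(1)[OF pq(2)] pq(3)] by blast
    ultimately show False using minimizerD(2)[OF x] by fastforce
  qed
  have lt: "quad_form n Q x < z" if "kappa n Q \<ge> 2"
  proof -
    have "x \<noteq> vertex i0"
    proof
      assume "x = vertex i0"
      then have "K \<subseteq> {i0}" by (auto simp: K_def vertex_def split: if_splits)
      then have "card K \<le> 1" using card_mono[of "{i0}" K] by simp
      then show False using that kap by simp
    qed
    then show ?thesis using uniq[OF vertex_in_simplex[OF z(2)]] z(3) quad_form_vertex[OF z(2), of Q] by auto
  qed
  show "edge_event n Q z" if k2: "kappa n Q = 2"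
  proof -
    obtain i j where Kij: "K = {i, j}" "i \<noteq> j" using k2 kap by (auto simp: card_2_iff)
    have *: "\<exists>i j. K = {i, j} \<and> i < j"
      using Kij by (metis insert_commute linorder_neqE_nat)
    then obtain i j where K2: "K = {i, j}" "i < j" by blast
    then have ij: "i \<in> {1..n}" "j \<in> {1..n}" unfolding K_def by blast+
    have "Q i j < z - sqrt ((Q i i - z) * (Q j j - z))"
      using K2 by (intro edge_support[OF s xs]) (use K2 ij z(1) lt k2 in \<open>auto simp: K_def\<close>)
    then show ?thesis using ij K2(2) unfolding edge_event_def by blast
  qed
  show "star_event n Q z \<or> path_event n Q z" if "kappa n Q \<ge> 3"
    unfolding star_event_def path_event_def
    using that kap by (intro large_support_row[OF s x uniq _ z]) (auto simp: K_def)
qed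

section \<open>Uniqueness of the minimizer and measurability of the support size\<close>

definition tri :: "nat \<Rightarrow> (nat \<times> nat) set" where
  "tri n = {(i, j). 1 \<le> i \<and> i \<le> j \<and> j \<le> n}"

definition entry_law :: "nat \<times> nat \<Rightarrow> real measure" where
  "entry_law e = density lborel (normal_density 0 (if fst e = snd e then 1 else sqrt (1/2)))"

definition goe_law :: "nat \<Rightarrow> (nat \<times> nat \<Rightarrow> real) measure" where
  "goe_law n = Pi\<^sub>M (tri n) entry_law"

text \<open>A matrix is represented by its upper triangle; this extends it symmetrically.\<close>

definition mat_of :: "(nat \<times> nat \<Rightarrow> real) \<Rightarrow> nat \<Rightarrow> nat \<Rightarrow> real" where
  "mat_of q i j = q (min i j, max i j)"

lemma finite_tri [simp]: "finite (tri n)"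
  by (rule finite_subset[of _ "{1..n} \<times> {1..n}"]) (auto simp: tri_def)

lemma sets_entry_law [simp, measurable_cong]: "sets (entry_law e) = sets borel"
  by (simp add: entry_law_def)

lemma space_entry_law [simp]: "space (entry_law e) = UNIV"
  by (simp add: entry_law_def)

lemma prob_space_entry_law: "prob_space (entry_law e)"
  unfolding entry_law_def by (rule prob_space_normal_density) auto

interpretation PE: product_prob_space entry_law I for I :: "(nat \<times> nat) set"
proof -
  interpret prob_space "entry_law e" for e by (rule prob_space_entry_law)
  show "product_prob_space entry_law" by unfold_locales
qed

lemma prob_space_goe_law: "prob_space (goe_law n)"
  unfolding goe_law_def by (rule PE.prob_space_axioms)

lemma mat_of_measurable:
  assumes "i \<in> {1..n}" "j \<in> {1..n}"
  shows "(\<lambda>q. mat_of q i j) \<in> borel_measurable (goe_law n)"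
proof -
  have "(min i j, max i j) \<in> tri n" using assms by (auto simp: tri_def)
  from measurable_component_singleton[OF this, of entry_law]
  show ?thesis unfolding mat_of_def goe_law_def by (simp cong: measurable_cong_sets)
qed

lemma symm_mat_of: "symm n (mat_of q)"
  by (simp add: symm_def mat_of_def min.commute max.commute)

lemma quad_form_measurable: "(\<lambda>q. quad_form n (mat_of q) x) \<in> borel_measurable (goe_law n)"
  unfolding quad_form_def
  by (intro borel_measurable_sum borel_measurable_times borel_measurable_const mat_of_measurable)

lemma continuous_quad_form: "continuous_on A (quad_form n Q)"
  unfolding quad_form_def
  by (intro continuous_intros continuous_on_subset[OF continuous_on_product_coordinates]) auto

lemma compact_simplex: "compact (std_simplex n)"
proof -
  define B where "B = Pi\<^sub>E UNIV (\<lambda>i. if i \<in> {1..n} then {0..1::real} else {0})"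
  have "compactin (product_topology (\<lambda>i. euclidean) UNIV) B"
    unfolding B_def compactin_PiE by auto
  then have cB: "compact B" by (simp add: euclidean_product_topology)
  have "closed {x::nat \<Rightarrow> real. (\<Sum>i=1..n. x i) = 1}"
    by (intro closed_Collect_eq continuous_intros continuous_on_product_coordinates) 
  then have "compact (B \<inter> {x. (\<Sum>i=1..n. x i) = 1})" by (rule compact_Int_closed[OF cB])
  also have "B \<inter> {x. (\<Sum>i=1..n. x i) = 1} = std_simplex n"
  proof (intro equalityI subsetI)
    fix x assume x: "x \<in> std_simplex n"
    have "x i \<le> 1" if "i \<in> {1..n}" for i
      using x that member_le_sum[of i "{1..n}" x] by (auto simp: std_simplex_def)
    then show "x \<in> B \<inter> {x. (\<Sum>i=1..n. x i) = 1}" using x by (auto simp: B_def std_simplex_def)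
  qed (auto simp: B_def std_simplex_def PiE_iff split: if_splits)
  finally show ?thesis .
qed

text \<open>Measurable, since the infimum over a compact set is one over a countable dense subset.\<close>

definition min_value :: "nat \<Rightarrow> (nat \<Rightarrow> real) set \<Rightarrow> (nat \<times> nat \<Rightarrow> real) \<Rightarrow> real" where
  "min_value n C q = (INF x\<in>C. quad_form n (mat_of q) x)"

lemma min_value_measurable:
  assumes C: "compact C" "C \<noteq> {}"
  shows "min_value n C \<in> borel_measurable (goe_law n)"
proof -
  obtain D where D: "countable D" "D \<subseteq> C" "C \<subseteq> closure D" using separable by blast
  have Dne: "D \<noteq> {}" using D C by auto
  have bdd: "bdd_below (quad_form n (mat_of q) ` C)" for q
    by (intro bounded_imp_bdd_below compact_imp_bounded compact_continuous_image continuous_quad_form C)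
  have "min_value n C q = (INF x\<in>D. quad_form n (mat_of q) x)" for q
  proof (rule antisym)
    show "min_value n C q \<le> (INF x\<in>D. quad_form n (mat_of q) x)"
      unfolding min_value_def by (rule cINF_superset_mono[OF Dne bdd D(2)]) simp
    show "(INF x\<in>D. quad_form n (mat_of q) x) \<le> min_value n C q"
      unfolding min_value_def
    proof (rule cINF_greatest[OF C(2)])
      fix x assume "x \<in> C"
      then have x: "x \<in> closure D" using D by auto
      have "closed {y. (INF x\<in>D. quad_form n (mat_of q) x) \<le> quad_form n (mat_of q) y}"
        by (intro closed_Collect_le continuous_intros continuous_quad_form)
      moreover have "D \<subseteq> {y. (INF x\<in>D. quad_form n (mat_of q) x) \<le> quad_form n (mat_of q) y}"
        using bdd_below_mono[OF bdd image_mono[OF D(2)]] by (auto intro: cINF_lower)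
      ultimately show "(INF x\<in>D. quad_form n (mat_of q) x) \<le> quad_form n (mat_of q) x"
        using closure_minimal x by blast
    qed
  qed
  then have "min_value n C = (\<lambda>q. INF x\<in>D. quad_form n (mat_of q) x)" by auto
  also have "\<dots> \<in> borel_measurable (goe_law n)"
    using D(1) by (intro borel_measurable_cINF_real quad_form_measurable)
  finally show ?thesis .
qed

text \<open>Minimizers in a compact part \<open>C\<close> of the simplex are detected by comparing two measurable
  minimum values.\<close>

lemma minimizer_in_iff:
  assumes C: "compact C" "C \<noteq> {}" "C \<subseteq> std_simplex n"
  shows "(\<exists>x\<in>C. stqp_minimizer n (mat_of q) x) \<longleftrightarrow> min_value n C q = min_value n (std_simplex n) q"
proof -
  let ?f = "quad_form n (mat_of q)"
  have att: "\<exists>x\<in>A. ?f x = min_value n A q \<and> (\<forall>y\<in>A. ?f x \<le> ?f y)" if A: "compact A" "A \<noteq> {}" for A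
  proof -
    obtain x where x: "x \<in> A" "\<forall>y\<in>A. ?f x \<le> ?f y"
      using continuous_attains_inf[OF A continuous_quad_form] by blast
    then have "min_value n A q = ?f x"
      unfolding min_value_def by (intro cInf_eq_minimum) auto
    then show ?thesis using x by auto
  qed
  have ne: "std_simplex n \<noteq> {}" using C by auto
  obtain x where x: "x \<in> C" "?f x = min_value n C q" using att[OF C(1,2)] by blast
  obtain y where y: "y \<in> std_simplex n" "?f y = min_value n (std_simplex n) q" "\<forall>u\<in>std_simplex n. ?f y \<le> ?f u"
    using att[OF compact_simplex ne] by blast
  have m: "stqp_minimizer n (mat_of q) u \<longleftrightarrow> u \<in> std_simplex n \<and> ?f u = ?f y" for u
  proof
    assume u: "stqp_minimizer n (mat_of q) u"
    then have "u \<in> std_simplex n" "?f u \<le> ?f y" using minimizerD[OF u] y(1) by auto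
    then show "u \<in> std_simplex n \<and> ?f u = ?f y" using y(3) by (auto intro: antisym)
  next
    assume "u \<in> std_simplex n \<and> ?f u = ?f y"
    then show "stqp_minimizer n (mat_of q) u"
      using y(3) unfolding stqp_minimizer_def is_arg_min_def by (auto simp: not_less)
  qed
  show ?thesis
  proof
    assume "\<exists>x\<in>C. stqp_minimizer n (mat_of q) x"
    then obtain u where u: "u \<in> C" "?f u = ?f y" using m by auto
    obtain x where x: "x \<in> C" "?f x = min_value n C q" "\<forall>v\<in>C. ?f x \<le> ?f v" using att[OF C(1,2)] by blast
    have "x \<in> std_simplex n" using x(1) C(3) by blast
    then have "?f x \<le> ?f u" "?f y \<le> ?f x" using x u y(3) by blast+
    then show "min_value n C q = min_value n (std_simplex n) q" using u x y by simp
  next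
    assume "min_value n C q = min_value n (std_simplex n) q"
    then show "\<exists>x\<in>C. stqp_minimizer n (mat_of q) x" using x y m C(3) by auto
  qed
qed

lemma minimizer_in_measurable:
  assumes C: "compact C" "C \<subseteq> std_simplex n"
  shows "Measurable.pred (goe_law n) (\<lambda>q. \<exists>x\<in>C. stqp_minimizer n (mat_of q) x)"
proof (cases "C = {}")
  case False
  then have "std_simplex n \<noteq> {}" using C by auto
  then show ?thesis unfolding minimizer_in_iff[OF C(1) False C(2)] pred_def
    by (intro borel_measurable_eq min_value_measurable C(1) False compact_simplex)
qed simp

text \<open>Failure of uniqueness, one coordinate at a time.  The event is measurable because two rationals
  separate the two coordinates.\<close>

definition split_at :: "nat \<Rightarrow> nat \<Rightarrow> (nat \<times> nat \<Rightarrow> real) \<Rightarrow> bool" where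
  "split_at n i q \<longleftrightarrow> (\<exists>x y. stqp_minimizer n (mat_of q) x \<and> stqp_minimizer n (mat_of q) y \<and> x i < y i)"

lemma closed_coordinate:
  "closed {x :: nat \<Rightarrow> real. x i \<le> r}" "closed {x :: nat \<Rightarrow> real. x i \<ge> r}"
  by (intro closed_Collect_le continuous_intros continuous_on_product_coordinates)+

lemma split_at_measurable: "Measurable.pred (goe_law n) (split_at n i)"
proof -
  define L where "L r = std_simplex n \<inter> {x. x i \<le> r}" for r
  define U where "U r = std_simplex n \<inter> {x. x i \<ge> r}" for r
  have LU: "compact (L r)" "L r \<subseteq> std_simplex n" "compact (U r)" "U r \<subseteq> std_simplex n" for r
    unfolding L_def U_def by (auto intro: compact_Int_closed[OF compact_simplex] closed_coordinate)
  have ms: "stqp_minimizer n Q x \<Longrightarrow> x \<in> std_simplex n" for Q x by (rule minimizerD)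
  define P where "P p q \<longleftrightarrow> (real_of_rat (fst p) < real_of_rat (snd p) \<and>
      ((\<exists>x\<in>L (real_of_rat (fst p)). stqp_minimizer n (mat_of q) x) \<and>
       (\<exists>x\<in>U (real_of_rat (snd p)). stqp_minimizer n (mat_of q) x)))" for p :: "rat \<times> rat" and q
  have eq: "split_at n i q \<longleftrightarrow> (\<exists>p. P p q)" for q
  proof
    assume "split_at n i q"
    then obtain x y where xy: "stqp_minimizer n (mat_of q) x" "stqp_minimizer n (mat_of q) y" "x i < y i"
      by (auto simp: split_at_def)
    obtain r where r: "x i < real_of_rat r" "real_of_rat r < y i"
      using Rats_dense_in_real[OF xy(3)] unfolding Rats_def by blast
    obtain s where s: "real_of_rat r < real_of_rat s" "real_of_rat s < y i"
      using Rats_dense_in_real[OF r(2)] unfolding Rats_def by blast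
    have "x \<in> L (real_of_rat r)" "y \<in> U (real_of_rat s)" using xy r s ms by (auto simp: L_def U_def)
    then have "P (r, s) q" unfolding P_def using xy s by auto
    then show "\<exists>p. P p q" ..
  next
    assume "\<exists>p. P p q"
    then show "split_at n i q" unfolding split_at_def P_def L_def U_def by fastforce
  qed
  have "Measurable.pred (goe_law n) (P p)" for p
    unfolding P_def[abs_def] by (intro pred_intros_logic minimizer_in_measurable LU measurable_const) simp
  then have "Measurable.pred (goe_law n) (\<lambda>q. \<exists>p. P p q)"
    by (rule pred_intros_countable)
  then show ?thesis by (simp only: eq[symmetric])
qed

lemma unique_minimizer_iff:
  assumes "n \<ge> 1"
  shows "(\<exists>!x. stqp_minimizer n (mat_of q) x) \<longleftrightarrow> (\<forall>i\<in>{1..n}. \<not> split_at n i q)"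
proof
  assume "\<exists>!x. stqp_minimizer n (mat_of q) x"
  then show "\<forall>i\<in>{1..n}. \<not> split_at n i q" by (auto simp: split_at_def)
next
  assume ns: "\<forall>i\<in>{1..n}. \<not> split_at n i q"
  have "vertex 1 \<in> std_simplex n" using assms by (intro vertex_in_simplex) auto
  then have "std_simplex n \<noteq> {}" by auto
  from minimizer_in_iff[OF compact_simplex this, of n q]
  obtain x where x: "stqp_minimizer n (mat_of q) x" by auto
  moreover have "y = x" if y: "stqp_minimizer n (mat_of q) y" for y
  proof
    fix i
    show "y i = x i"
    proof (cases "i \<in> {1..n}")
      case True
      then show ?thesis using ns x y unfolding split_at_def by (metis linorder_neqE_linordered_idom)
    qed (use minimizerD(1)[OF x] minimizerD(1)[OF y] in \<open>auto simp: std_simplex_def\<close>)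
  qed
  ultimately show "\<exists>!x. stqp_minimizer n (mat_of q) x" by blast
qed

text \<open>As a function of the diagonal entry \<open>t = Q i i\<close> the minimum is concave, with slope
  \<open>(x i)\<^sup>2\<close> at a minimizer \<open>x\<close>; so the intervals spanned by the \<open>i\<close>-th coordinates of the minimizers
  are disjoint for different \<open>t\<close>, and only countably many of them are nondegenerate.\<close>

lemma countable_split:
  assumes i: "i \<in> {1..n}"
  shows "countable {t. split_at n i (q((i, i) := t))}"
proof -
  define S where "S = {t. split_at n i (q((i, i) := t))}"
  have qf: "quad_form n (mat_of (q((i, i) := t))) x = quad_form n (mat_of (q((i, i) := 0))) x + t * (x i)\<^sup>2" for t x
  proof -
    have m: "mat_of (q((i, i) := t)) k l = mat_of (q((i, i) := 0)) k l + (if k = i then if l = i then t else 0 else 0)" for k l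
      by (auto simp: mat_of_def min_def max_def)
    have "quad_form n (mat_of (q((i, i) := t))) x = quad_form n (mat_of (q((i, i) := 0))) x
        + (\<Sum>k=1..n. \<Sum>l=1..n. x k * (if k = i then if l = i then t else 0 else 0) * x l)"
      unfolding quad_form_def m by (simp add: algebra_simps sum.distrib)
    also have "(\<Sum>k=1..n. \<Sum>l=1..n. x k * (if k = i then if l = i then t else 0 else 0) * x l)
      = (\<Sum>k=1..n. if k = i then (\<Sum>l=1..n. if l = i then x i * t * x i else 0) else 0)"
    proof (intro sum.cong refl)
      fix k
      have "(\<Sum>l=1..n. x i * (if l = i then t else 0) * x l) = (\<Sum>l=1..n. if l = i then x i * t * x i else 0)"
        by (intro sum.cong refl) auto
      then show "(\<Sum>l=1..n. x k * (if k = i then if l = i then t else 0 else 0) * x l)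
        = (if k = i then (\<Sum>l=1..n. if l = i then x i * t * x i else 0) else 0)"
        by (cases "k = i") simp_all
    qed
    also have "\<dots> = t * (x i)\<^sup>2" using i by (simp add: power2_eq_square)
    finally show ?thesis .
  qed
  have anti: "y i \<le> x i" if "stqp_minimizer n (mat_of (q((i, i) := s))) x" "stqp_minimizer n (mat_of (q((i, i) := t))) y" "s < t" for s t x y
  proof -
    have xy: "x \<in> std_simplex n" "y \<in> std_simplex n"
      using minimizerD(1)[OF that(1)] minimizerD(1)[OF that(2)] by auto
    have "quad_form n (mat_of (q((i, i) := 0))) x + s * (x i)\<^sup>2 \<le> quad_form n (mat_of (q((i, i) := 0))) y + s * (y i)\<^sup>2"
      "quad_form n (mat_of (q((i, i) := 0))) y + t * (y i)\<^sup>2 \<le> quad_form n (mat_of (q((i, i) := 0))) x + t * (x i)\<^sup>2"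
      unfolding qf[symmetric] using minimizerD(2)[OF that(1) xy(2)] minimizerD(2)[OF that(2) xy(1)] by auto
    then have "(t - s) * (y i)\<^sup>2 \<le> (t - s) * (x i)\<^sup>2" by (simp add: algebra_simps)
    then have "(y i)\<^sup>2 \<le> (x i)\<^sup>2" using that(3) by simp
    then show ?thesis using xy i by (auto simp: std_simplex_def intro: power2_le_imp_le)
  qed
  define G where "G t r \<longleftrightarrow> r \<in> \<rat> \<and> (\<exists>x y. stqp_minimizer n (mat_of (q((i, i) := t))) x \<and> stqp_minimizer n (mat_of (q((i, i) := t))) y \<and> x i < r \<and> r < y i)" for t r
  have "\<exists>r. G t r" if t: "t \<in> S" for t
  proof -
    obtain x y where xy: "stqp_minimizer n (mat_of (q((i, i) := t))) x" "stqp_minimizer n (mat_of (q((i, i) := t))) y" "x i < y i"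
      using t unfolding S_def split_at_def mem_Collect_eq by blast
    obtain r where "r \<in> \<rat>" "x i < r" "r < y i" using Rats_dense_in_real[OF xy(3)] by blast
    then have "G t r" unfolding G_def using xy(1,2) by blast
    then show ?thesis ..
  qed
  then have "\<forall>t\<in>S. \<exists>r. G t r" by blast
  from bchoice[OF this] obtain r where r: "\<And>t. t \<in> S \<Longrightarrow> G t (r t)" by blast
  have dec: "r t < r s" if st: "s \<in> S" "t \<in> S" "s < t" for s t
  proof -
    obtain x where x: "stqp_minimizer n (mat_of (q((i, i) := s))) x" "x i < r s"
      using r[OF st(1)] unfolding G_def by blast
    obtain y where y: "stqp_minimizer n (mat_of (q((i, i) := t))) y" "r t < y i"
      using r[OF st(2)] unfolding G_def by blast
    show ?thesis using anti[OF x(1) y(1) st(3)] x(2) y(2) by linarith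
  qed
  have "inj_on r S"
  proof (rule inj_onI)
    fix s t assume "s \<in> S" "t \<in> S" "r s = r t"
    then show "s = t" using dec[of s t] dec[of t s] by (cases s t rule: linorder_cases) auto
  qed
  moreover have "countable (r ` S)" by (rule countable_subset[OF _ countable_rat]) (use r in \<open>auto simp: G_def\<close>)
  ultimately show ?thesis unfolding S_def[symmetric] using countable_image_inj_on by blast
qed

lemma AE_not_split:
  assumes i: "i \<in> {1..n}"
  shows "AE q in goe_law n. \<not> split_at n i q"
proof -
  define F where "F q = (if split_at n i q then 1 else 0 :: ennreal)" for q
  have Fm: "F \<in> borel_measurable (goe_law n)"
    unfolding F_def using split_at_measurable[of n i] by measurable
  define J where "J = tri n - {(i, i)}"
  have T: "tri n = insert (i, i) J" using i by (auto simp: J_def tri_def)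
  have "(\<integral>\<^sup>+q. F q \<partial>goe_law n) = (\<integral>\<^sup>+q. (\<integral>\<^sup>+t. F (q((i, i) := t)) \<partial>entry_law (i, i)) \<partial>Pi\<^sub>M J entry_law)"
    using Fm unfolding goe_law_def T by (intro PE.product_nn_integral_insert) (auto simp: J_def)
  also have "\<dots> = (\<integral>\<^sup>+q. 0 \<partial>Pi\<^sub>M J entry_law)"
  proof (rule nn_integral_cong)
    fix q :: "nat \<times> nat \<Rightarrow> real"
    have "AE t in lborel. t \<notin> {t. split_at n i (q((i, i) := t))}"
      by (rule AE_not_in[OF countable_imp_null_set_lborel[OF countable_split[OF i]]])
    then have "AE t in entry_law (i, i). F (q((i, i) := t)) = 0"
      unfolding entry_law_def by (subst AE_density) (auto simp: F_def)
    then have "(\<integral>\<^sup>+t. F (q((i, i) := t)) \<partial>entry_law (i, i)) = (\<integral>\<^sup>+t. 0 \<partial>entry_law (i, i))"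
      by (rule nn_integral_cong_AE)
    then show "(\<integral>\<^sup>+t. F (q((i, i) := t)) \<partial>entry_law (i, i)) = 0" by simp
  qed
  finally have "(\<integral>\<^sup>+q. F q \<partial>goe_law n) = 0" by simp
  then have "AE q in goe_law n. F q = 0" using Fm by (simp add: nn_integral_0_iff_AE)
  then show ?thesis by eventually_elim (auto simp: F_def split: if_splits)
qed

theorem AE_unique_minimizer:
  assumes "n \<ge> 1"
  shows "AE q in goe_law n. \<exists>!x. stqp_minimizer n (mat_of q) x"
  unfolding unique_minimizer_iff[OF assms] by (intro AE_finite_allI AE_not_split) auto

text \<open>For a unique minimizer, a vanishing coordinate is detected by a minimizer in the compact face
  \<open>x i \<le> 0\<close>.\<close>

lemma kappa_measurable:
  assumes "n \<ge> 1"
  shows "(\<lambda>q. real (kappa n (mat_of q))) \<in> borel_measurable (goe_law n)"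
proof -
  define Z where "Z i = std_simplex n \<inter> {x. x i \<le> 0}" for i
  have Z: "compact (Z i)" "Z i \<subseteq> std_simplex n" for i
    unfolding Z_def by (auto intro: compact_Int_closed[OF compact_simplex] closed_coordinate)
  define z where "z i q \<longleftrightarrow> (\<exists>x\<in>Z i. stqp_minimizer n (mat_of q) x)" for i q
  have zm: "Measurable.pred (goe_law n) (z i)" for i
    unfolding z_def[abs_def] by (rule minimizer_in_measurable[OF Z])
  have eq: "real (kappa n (mat_of q)) = (if \<forall>i\<in>{1..n}. \<not> split_at n i q then \<Sum>i=1..n. (if z i q then 0 else 1) else 0)" for q
  proof (cases "\<forall>i\<in>{1..n}. \<not> split_at n i q")
    case True
    then have ex: "\<exists>!x. stqp_minimizer n (mat_of q) x" using unique_minimizer_iff[OF assms] by blast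
    define x where "x = (THE x. stqp_minimizer n (mat_of q) x)"
    have x: "stqp_minimizer n (mat_of q) x" unfolding x_def by (rule theI'[OF ex])
    have "z i q \<longleftrightarrow> x \<in> Z i" for i
      unfolding z_def using x ex by blast
    then have "z i q \<longleftrightarrow> \<not> 0 < x i" for i
      using minimizerD(1)[OF x] by (simp add: Z_def not_less)
    then have "(\<Sum>i=1..n. (if z i q then 0 else 1 :: real)) = real (card {i\<in>{1..n}. 0 < x i})"
      by (simp add: sum.If_cases Int_def conj_commute)
    then show ?thesis using True ex by (simp add: kappa_def x_def)
  next
    case False
    then have "\<not> (\<exists>!x. stqp_minimizer n (mat_of q) x)" using unique_minimizer_iff[OF assms] by blast
    then show ?thesis unfolding kappa_def if_not_P[OF False] by (simp only: if_not_P if_False of_nat_0)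
  qed
  have "Measurable.pred (goe_law n) (\<lambda>q. \<forall>i\<in>{1..n}. \<not> split_at n i q)"
    by (intro pred_intros_finite(3) pred_intros_logic split_at_measurable) simp
  moreover have "(\<lambda>q. \<Sum>i=1..n. if z i q then 0 else 1 :: real) \<in> borel_measurable (goe_law n)"
    using zm by (intro borel_measurable_sum measurable_If measurable_const) (auto simp: pred_def)
  ultimately show ?thesis unfolding eq
    by (intro measurable_If measurable_const) (auto simp: pred_def)
qed

section \<open>Order statistics of the diagonal\<close>

definition diag_idx :: "nat \<Rightarrow> (nat \<times> nat) set" where
  "diag_idx n = (\<lambda>i. (i, i)) ` {1..n}"

lemma finite_diag_idx [simp]: "finite (diag_idx n)"
  by (simp add: diag_idx_def)

lemma card_diag_idx [simp]: "card (diag_idx n) = n"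
  unfolding diag_idx_def by (subst card_image) (auto simp: inj_on_def)

lemma zord_enum:
  obtains s where "bij_betw s {1..n} {1..n}" "\<And>k. k \<in> {1..n} \<Longrightarrow> zord n Q k = Q (s k) (s k)"
    "\<And>i j. i \<in> {1..n} \<Longrightarrow> j \<in> {1..n} \<Longrightarrow> i \<le> j \<Longrightarrow> zord n Q i \<le> zord n Q j"
proof -
  define xs where "xs = map (\<lambda>i. Q i i) [1..<Suc n]"
  have len: "length xs = n" by (simp add: xs_def)
  have "mset (sort xs) = mset xs" by simp
  then obtain p where p: "p permutes {..<length xs}" "permute_list p xs = sort xs"
    by (rule mset_eq_permutation)
  define s where "s k = Suc (p (k - 1))" for k
  have bp: "bij_betw p {..<n} {..<n}" using p(1) permutes_imp_bij len by simp
  have b1: "bij_betw (\<lambda>k. k - 1) {1..n} {..<n}"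
    by (rule bij_betwI[where g = Suc]) auto
  have b2: "bij_betw Suc {..<n} {1..n}"
    by (rule bij_betwI[where g = "\<lambda>k. k - 1"]) auto
  have "bij_betw s {1..n} {1..n}"
    using bij_betw_trans[OF bij_betw_trans[OF b1 bp] b2] unfolding s_def comp_def .
  moreover have "zord n Q k = Q (s k) (s k)" if k: "k \<in> {1..n}" for k
  proof -
    have pk: "p (k - 1) < n" using bp k unfolding bij_betw_def by auto
    have "zord n Q k = permute_list p xs ! (k - 1)" unfolding zord_def xs_def[symmetric] p(2) ..
    also have "\<dots> = xs ! p (k - 1)" using p(1) k len by (intro permute_list_nth) auto
    also have "\<dots> = Q (s k) (s k)" using pk unfolding xs_def s_def by (subst nth_map) (auto simp del: upt_Suc)
    finally show ?thesis .
  qed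
  moreover have "zord n Q i \<le> zord n Q j" if "i \<in> {1..n}" "j \<in> {1..n}" "i \<le> j" for i j
    unfolding zord_def xs_def[symmetric] using that len by (intro sorted_nth_mono) auto
  ultimately show ?thesis by (rule that)
qed

text \<open>With distinct entries, the entry of rank \<open>i\<close> has \<open>i - 2\<close> others between it and the minimum, so the
  condition on \<open>m\<close> selects the lower index \<open>i \<ge> m + 2\<close>.\<close>

lemma triple_sum_sorted:
  fixes I :: "'i set" and x :: "'i \<Rightarrow> real"
  assumes \<pi>: "bij_betw \<pi> {1..n} I" and y: "\<And>k. k \<in> {1..n} \<Longrightarrow> y k = x (\<pi> k)"
    and mono: "\<And>i j. i \<in> {1..n} \<Longrightarrow> j \<in> {1..n} \<Longrightarrow> i < j \<Longrightarrow> y i < y j" and n: "n \<ge> 1"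
    and h: "\<And>z w c. h z w c \<noteq> 0 \<Longrightarrow> w < c"
  shows "triple_sum I m h x = (\<Sum>i=m+2..n. \<Sum>j=i+1..n. h (y 1) (y i) (y j))"
proof -
  have inj: "inj_on \<pi> {1..n}" and im: "\<pi> ` {1..n} = I" using \<pi> by (auto simp: bij_betw_def)
  have y_less: "y i < y j \<longleftrightarrow> i < j" if "i \<in> {1..n}" "j \<in> {1..n}" for i j
    using mono[of i j] mono[of j i] that by (cases i j rule: linorder_cases) auto
  have y_le: "y i \<le> y j \<longleftrightarrow> i \<le> j" if "i \<in> {1..n}" "j \<in> {1..n}" for i j
    using y_less[OF that(2,1)] by auto
  have bij: "bij_betw \<pi> ({1..n} - A) (I - \<pi> ` A)" if "A \<subseteq> {1..n}" for A
    using bij_betw_DiffI[OF \<pi> bij_betw_subset[OF \<pi> that refl]] that im by auto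
  have min: "min_at I x (\<pi> a) \<longleftrightarrow> a = 1" if a: "a \<in> {1..n}" for a
  proof -
    have "min_at I x (\<pi> a) \<longleftrightarrow> (\<forall>l\<in>{1..n} - {a}. x (\<pi> a) < x (\<pi> l))"
    proof -
      have "I - {\<pi> a} = \<pi> ` ({1..n} - {a})" using bij[of "{a}"] a by (simp add: bij_betw_def)
      then show ?thesis unfolding min_at_def by simp
    qed
    also have "\<dots> \<longleftrightarrow> (\<forall>l\<in>{1..n} - {a}. a < l)"
    proof (intro ball_cong refl)
      fix l assume "l \<in> {1..n} - {a}"
      then have l: "l \<in> {1..n}" by simp
      show "x (\<pi> a) < x (\<pi> l) \<longleftrightarrow> a < l"
        using y_less[OF a l] by (simp only: y[OF a] y[OF l])
    qed
    also have "\<dots> \<longleftrightarrow> a = 1"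
    proof
      assume *: "\<forall>l\<in>{1..n} - {a}. a < l"
      show "a = 1"
      proof (rule ccontr)
        assume "a \<noteq> 1"
        then have "1 \<in> {1..n} - {a}" using n by auto
        then show False using * a by fastforce
      qed
    qed auto
    finally show ?thesis .
  qed
  have bel: "below (I - {\<pi> 1, \<pi> b, \<pi> c}) x (\<pi> b) = b - 2" if b: "b \<in> {1..n}" "b \<noteq> 1" and c: "c \<in> {1..n}" "b < c" for b c
  proof -
    have A: "{1, b, c} \<subseteq> {1..n}" using b c n by auto
    have "{l \<in> I - {\<pi> 1, \<pi> b, \<pi> c}. x l \<le> x (\<pi> b)} = \<pi> ` {l \<in> {1..n} - {1, b, c}. x (\<pi> l) \<le> x (\<pi> b)}"
    proof -
      have e: "I - {\<pi> 1, \<pi> b, \<pi> c} = \<pi> ` ({1..n} - {1, b, c})"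
        using bij_betw_imp_surj_on[OF bij[OF A]] by (simp only: image_insert image_empty)
      have "{l \<in> \<pi> ` T. P l} = \<pi> ` {l \<in> T. P (\<pi> l)}" for T P by blast
      then show ?thesis unfolding e .
    qed
    also have "{l \<in> {1..n} - {1, b, c}. x (\<pi> l) \<le> x (\<pi> b)} = {2..<b}"
    proof -
      have "x (\<pi> l) \<le> x (\<pi> b) \<longleftrightarrow> l \<le> b" if "l \<in> {1..n}" for l
        using y_le[OF that b(1)] y[OF that] y[OF b(1)] by simp
      then show ?thesis using b c by auto
    qed
    finally have "below (I - {\<pi> 1, \<pi> b, \<pi> c}) x (\<pi> b) = card (\<pi> ` {2..<b})" by (simp add: below_def)
    also have "\<dots> = b - 2"
    proof -
      have "inj_on \<pi> {2..<b}" by (rule inj_on_subset[OF inj]) (use b in auto)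
      then show ?thesis by (simp add: card_image)
    qed
    finally show ?thesis .
  qed
  define F where "F a b c = (if min_at I x a \<and> m \<le> below (I - {a, b, c}) x b then h (x a) (x b) (x c) else 0)" for a b c
  have "triple_sum I m h x = (\<Sum>a\<in>I. \<Sum>b\<in>I - {a}. \<Sum>c\<in>I - {a, b}. F a b c)"
    by (simp add: triple_sum_def F_def)
  also have "\<dots> = (\<Sum>a=1..n. \<Sum>b\<in>I - {\<pi> a}. \<Sum>c\<in>I - {\<pi> a, b}. F (\<pi> a) b c)"
    by (rule sum.reindex_bij_betw[OF \<pi>, symmetric])
  also have "\<dots> = (\<Sum>b\<in>I - {\<pi> 1}. \<Sum>c\<in>I - {\<pi> 1, b}. F (\<pi> 1) b c)"
  proof -
    have "(\<Sum>b\<in>I - {\<pi> a}. \<Sum>c\<in>I - {\<pi> a, b}. F (\<pi> a) b c) = 0" if "a \<in> {1..n} - {1}" for a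
      using that min[of a] by (simp add: F_def)
    then show ?thesis using n by (subst sum.remove[of _ 1]) auto
  qed
  also have "\<dots> = (\<Sum>b\<in>{1..n} - {1}. \<Sum>c\<in>I - {\<pi> 1, \<pi> b}. F (\<pi> 1) (\<pi> b) c)"
    using sum.reindex_bij_betw[OF bij[of "{1}"], of "\<lambda>b. \<Sum>c\<in>I - {\<pi> 1, b}. F (\<pi> 1) b c"] n by simp
  also have "\<dots> = (\<Sum>b\<in>{1..n} - {1}. \<Sum>c\<in>{1..n} - {1, b}. F (\<pi> 1) (\<pi> b) (\<pi> c))"
  proof (rule sum.cong[OF refl])
    fix b assume "b \<in> {1..n} - {1}"
    then have "{1, b} \<subseteq> {1..n}" using n by auto
    from sum.reindex_bij_betw[OF bij[OF this], of "F (\<pi> 1) (\<pi> b)"]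
    show "(\<Sum>c\<in>I - {\<pi> 1, \<pi> b}. F (\<pi> 1) (\<pi> b) c) = (\<Sum>c\<in>{1..n} - {1, b}. F (\<pi> 1) (\<pi> b) (\<pi> c))" by simp
  qed
  also have "\<dots> = (\<Sum>b\<in>{1..n} - {1}. \<Sum>c\<in>{1..n} - {1, b}. if b < c \<and> m + 2 \<le> b then h (y 1) (y b) (y c) else 0)"
  proof (intro sum.cong refl)
    fix b c assume bc: "b \<in> {1..n} - {1}" "c \<in> {1..n} - {1, b}"
    then have b: "b \<in> {1..n}" "b \<noteq> 1" and c: "c \<in> {1..n}" "c \<noteq> b" by auto
    have 1: "1 \<in> {1..n}" using n by auto
    have F: "F (\<pi> 1) (\<pi> b) (\<pi> c) = (if min_at I x (\<pi> 1) \<and> m \<le> below (I - {\<pi> 1, \<pi> b, \<pi> c}) x (\<pi> b) then h (y 1) (y b) (y c) else 0)"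
      unfolding F_def y[OF 1] y[OF b(1)] y[OF c(1)] ..
    show "F (\<pi> 1) (\<pi> b) (\<pi> c) = (if b < c \<and> m + 2 \<le> b then h (y 1) (y b) (y c) else 0)"
    proof (cases "b < c")
      case True
      have "m \<le> b - 2 \<longleftrightarrow> m + 2 \<le> b" using b by auto
      then show ?thesis using True bel[OF b c(1) True] min[OF 1]
        unfolding F by simp
    next
      case False
      then have "\<not> y b < y c" using y_less[OF b(1) c(1)] by simp
      then have "h (y 1) (y b) (y c) = 0" using h by blast
      then show ?thesis using False unfolding F by simp
    qed
  qed
  also have "\<dots> = (\<Sum>b=m+2..n. \<Sum>c\<in>{1..n} - {1, b}. if b < c \<and> m + 2 \<le> b then h (y 1) (y b) (y c) else 0)"
    by (rule sum.mono_neutral_right) auto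
  also have "\<dots> = (\<Sum>b=m+2..n. \<Sum>c=b+1..n. h (y 1) (y b) (y c))"
  proof (rule sum.cong[OF refl])
    fix b assume b: "b \<in> {m+2..n}"
    have "(\<Sum>c\<in>{1..n} - {1, b}. if b < c \<and> m + 2 \<le> b then h (y 1) (y b) (y c) else 0)
       = (\<Sum>c=b+1..n. if b < c \<and> m + 2 \<le> b then h (y 1) (y b) (y c) else 0)"
      by (rule sum.mono_neutral_right) (use b in auto)
    also have "\<dots> = (\<Sum>c=b+1..n. h (y 1) (y b) (y c))"
      by (rule sum.cong) (use b in auto)
    finally show "(\<Sum>c\<in>{1..n} - {1, b}. if b < c \<and> m + 2 \<le> b then h (y 1) (y b) (y c) else 0) = (\<Sum>c=b+1..n. h (y 1) (y b) (y c))" .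
  qed
  finally show ?thesis .
qed

lemma min_sum_sorted:
  fixes I :: "'i set" and x :: "'i \<Rightarrow> real" and f :: "real \<Rightarrow> real"
  assumes fin: "finite I" and a: "a \<in> I" "min_at I x a"
  shows "(\<Sum>b\<in>I. if min_at I x b then f (x b) else 0) = f (x a)"
proof -
  have "\<not> min_at I x b" if "b \<in> I - {a}" for b
  proof
    assume "min_at I x b"
    then have "x b < x a" using a that by (auto simp: min_at_def)
    moreover have "x a < x b" using a that by (auto simp: min_at_def)
    ultimately show False by simp
  qed
  then show ?thesis using fin a by (subst sum.remove[of _ a]) auto
qed

definition off_idx :: "nat \<Rightarrow> (nat \<times> nat) set" where
  "off_idx n = {(i, j). 1 \<le> i \<and> i < j \<and> j \<le> n}"

lemma finite_off_idx [simp]: "finite (off_idx n)"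
  by (rule finite_subset[of _ "{1..n} \<times> {1..n}"]) (auto simp: off_idx_def)

lemma prod_pairs_permute:
  fixes f :: "nat \<Rightarrow> nat \<Rightarrow> 'b::comm_monoid_mult"
  assumes s: "bij_betw s {1..n} {1..n}" and sym: "\<And>i j. f i j = f j i"
  shows "(\<Prod>(i, j)\<in>off_idx n. f (s i) (s j)) = (\<Prod>(i, j)\<in>off_idx n. f i j)"
proof -
  define g where "g p = (min (s (fst p)) (s (snd p)), max (s (fst p)) (s (snd p)))" for p
  have inj: "inj_on s {1..n}" and im: "s ` {1..n} = {1..n}" using s by (auto simp: bij_betw_def)
  have sin: "s i \<in> {1..n}" if "i \<in> {1..n}" for i using im that by blast
  have sub: "g ` off_idx n \<subseteq> off_idx n"
  proof
    fix p assume "p \<in> g ` off_idx n"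
    then obtain i j where ij: "1 \<le> i" "i < j" "j \<le> n" "p = g (i, j)" by (auto simp: off_idx_def)
    then have r: "i \<in> {1..n}" "j \<in> {1..n}" by auto
    have "s i \<noteq> s j" using inj_on_eq_iff[OF inj r] ij by simp
    then have "s i \<noteq> s j" "s i \<in> {1..n}" "s j \<in> {1..n}" using sin[OF r(1)] sin[OF r(2)] by blast+
    then show "p \<in> off_idx n" using ij(4) by (auto simp: g_def off_idx_def min_def max_def)
  qed
  have "inj_on g (off_idx n)"
  proof (rule inj_onI)
    fix p p' assume p: "p \<in> off_idx n" "p' \<in> off_idx n" "g p = g p'"
    obtain i j i' j' where e: "p = (i, j)" "p' = (i', j')" by (cases p, cases p')
    have r: "i \<in> {1..n}" "j \<in> {1..n}" "i' \<in> {1..n}" "j' \<in> {1..n}" "i < j" "i' < j'" using p e by (auto simp: off_idx_def)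
    have "(s i = s i' \<and> s j = s j') \<or> (s i = s j' \<and> s j = s i')"
      using p(3) e by (auto simp: g_def min_def max_def split: if_splits)
    then have "(i = i' \<and> j = j') \<or> (i = j' \<and> j = i')"
      using inj_on_eq_iff[OF inj r(1,3)] inj_on_eq_iff[OF inj r(2,4)] inj_on_eq_iff[OF inj r(1,4)] inj_on_eq_iff[OF inj r(2,3)] by blast
    then show "p = p'" using r e by auto
  qed
  moreover from this have "g ` off_idx n = off_idx n" using sub by (intro endo_inj_surj) auto
  ultimately have b: "bij_betw g (off_idx n) (off_idx n)" by (simp add: bij_betw_def)
  have "(\<Prod>p\<in>off_idx n. f (fst (g p)) (snd (g p))) = (\<Prod>p\<in>off_idx n. f (fst p) (snd p))"
    by (rule prod.reindex_bij_betw[OF b])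
  moreover have "f (fst (g p)) (snd (g p)) = f (s (fst p)) (s (snd p))" for p
    using sym by (simp add: g_def min_def max_def)
  ultimately show ?thesis by (simp add: case_prod_beta)
qed

lemma edgep_sym: "edgep \<kappa> z w c = edgep \<kappa> z c w"
  by (simp add: edgep_def mult.commute)

lemma edgep_min: "edgep \<kappa> z z c = qmin z"
  by (simp add: edgep_def)

lemma pij_edgep: "pij n Q i j = edgep 1 (zord n Q 1) (zord n Q i) (zord n Q j)"
  by (simp add: pij_def tau_def edgep_def)

lemma qn_qmin: "qn n Q = qmin (zord n Q 1)"
  by (simp add: qn_def)

text \<open>Pairs containing the minimum contribute \<open>qn\<close>, pairs whose lower entry has rank two the next factor,
  and the remaining pairs the last; this regrouping is the origin of the three quantities of the theorem.\<close>

lemma edge_product: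
  assumes n: "n \<ge> 2"
  shows "(\<Prod>(i, j)\<in>off_idx n. 1 - edgep 1 (zord n Q 1) (Q i i) (Q j j)) =
    (1 - qn n Q) ^ (n - 1) * (\<Prod>j=3..n. 1 - pij n Q 2 j) *
    (\<Prod>(i, j)\<in>{(i, j). 3 \<le> i \<and> i < j \<and> j \<le> n}. 1 - pij n Q i j)"
proof -
  obtain s where s: "bij_betw s {1..n} {1..n}" "\<And>k. k \<in> {1..n} \<Longrightarrow> zord n Q k = Q (s k) (s k)"
    "\<And>i j. i \<in> {1..n} \<Longrightarrow> j \<in> {1..n} \<Longrightarrow> i \<le> j \<Longrightarrow> zord n Q i \<le> zord n Q j"
    by (rule zord_enum[of n Q]) (rule that)
  define f where "f i j = 1 - edgep 1 (zord n Q 1) (Q i i) (Q j j)" for i j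
  have "(\<Prod>(i, j)\<in>off_idx n. f i j) = (\<Prod>(i, j)\<in>off_idx n. f (s i) (s j))"
    by (rule prod_pairs_permute[OF s(1), symmetric]) (simp add: f_def edgep_sym)
  also have "\<dots> = (\<Prod>(i, j)\<in>off_idx n. 1 - pij n Q i j)"
    by (rule prod.cong) (auto simp: off_idx_def f_def pij_edgep s(2))
  also have "(\<Prod>(i, j)\<in>off_idx n. 1 - pij n Q i j) = (\<Prod>(i, j)\<in>(\<lambda>j. (1, j)) ` {2..n}. 1 - pij n Q i j) *
     ((\<Prod>(i, j)\<in>(\<lambda>j. (2, j)) ` {3..n}. 1 - pij n Q i j) * (\<Prod>(i, j)\<in>{(i, j). 3 \<le> i \<and> i < j \<and> j \<le> n}. 1 - pij n Q i j))"
  proof -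
    have off: "off_idx n = (\<lambda>j. (1, j)) ` {2..n} \<union> ((\<lambda>j. (2, j)) ` {3..n} \<union> {(i, j). 3 \<le> i \<and> i < j \<and> j \<le> n})"
      by (auto simp: off_idx_def image_iff)
    have "finite {(i, j). 3 \<le> i \<and> i < j \<and> j \<le> n}"
      by (rule finite_subset[OF _ finite_off_idx[of n]]) (auto simp: off_idx_def)
    then show ?thesis unfolding off by (subst prod.union_disjoint; (subst prod.union_disjoint)?; auto)
  qed
  also have "(\<Prod>(i, j)\<in>(\<lambda>j. (1, j)) ` {2..n}. 1 - pij n Q i j) = (\<Prod>j=2..n. 1 - qn n Q)"
    by (subst prod.reindex) (auto simp: inj_on_def pij_edgep qn_qmin edgep_min)
  also have "\<dots> = (1 - qn n Q) ^ (n - 1)" using n by simp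
  also have "(\<Prod>(i, j)\<in>(\<lambda>j. (2, j)) ` {3..n}. 1 - pij n Q i j) = (\<Prod>j=3..n. 1 - pij n Q 2 j)"
    by (subst prod.reindex) (auto simp: inj_on_def)
  finally show ?thesis unfolding f_def by (simp only: mult.assoc)
qed

lemma one_minus_prod_bounds:
  fixes p :: "'b \<Rightarrow> real"
  assumes fin: "finite S" and p: "\<And>e. e \<in> S \<Longrightarrow> 0 \<le> p e" "\<And>e. e \<in> S \<Longrightarrow> p e \<le> 1"
  shows "1 - (\<Prod>e\<in>S. 1 - p e) \<le> (\<Sum>e\<in>S. p e)"
    "(\<Sum>e\<in>S. p e) - (\<Sum>e\<in>S. p e)\<^sup>2 \<le> 1 - (\<Prod>e\<in>S. 1 - p e)"
proof -
  show "1 - (\<Prod>e\<in>S. 1 - p e) \<le> (\<Sum>e\<in>S. p e)"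
    using fin p
  proof (induction S rule: finite_induct)
    case (insert e S)
    have "(\<Prod>e\<in>S. 1 - p e) \<le> 1" using insert.prems by (intro prod_le_1) auto
    then have "p e * (\<Prod>e\<in>S. 1 - p e) \<le> p e * 1" using insert.prems by (intro mult_left_mono) auto
    then show ?case using insert by (simp add: algebra_simps)
  qed simp
  define s where "s = (\<Sum>e\<in>S. p e)"
  have s: "s \<ge> 0" using p by (auto simp: s_def intro: sum_nonneg)
  have "(\<Prod>e\<in>S. 1 - p e) \<le> (\<Prod>e\<in>S. exp (- p e))"
  proof (rule prod_mono)
    fix e assume "e \<in> S"
    then show "0 \<le> 1 - p e \<and> 1 - p e \<le> exp (- p e)"
      using p exp_ge_add_one_self[of "- p e"] by simp
  qed
  also have "\<dots> = exp (- s)" using fin by (simp add: exp_sum[symmetric] sum_negf s_def)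
  also have "\<dots> \<le> 1 / (1 + s)"
    using exp_ge_add_one_self[of s] s by (simp add: exp_minus field_simps)
  also have "\<dots> \<le> 1 - s + s\<^sup>2"
  proof -
    have "(1 - s + s\<^sup>2) * (1 + s) = 1 + s ^ 3" by (simp add: algebra_simps power2_eq_square power3_eq_cube)
    then have "1 \<le> (1 - s + s\<^sup>2) * (1 + s)" using s by simp
    then show ?thesis using s by (simp add: divide_le_eq)
  qed
  finally show "(\<Sum>e\<in>S. p e) - (\<Sum>e\<in>S. p e)\<^sup>2 \<le> 1 - (\<Prod>e\<in>S. 1 - p e)" by (simp add: s_def)
qed

text \<open>Products are replaced by sums: the row sum over rank two is bounded by the difference of the pair sums
  for ranks from two and from three, and likewise one rank higher.  All corrections are of second order
  in \<open>n * q\<close>, the bound on a row sum.\<close>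

lemma integrand_brackets:
  fixes Q :: "nat \<Rightarrow> nat \<Rightarrow> real"
  assumes n: "n \<ge> 3"
    and mono: "\<And>i j. i \<in> {1..n} \<Longrightarrow> j \<in> {1..n} \<Longrightarrow> i < j \<Longrightarrow> zord n Q i < zord n Q j"
  defines "y \<equiv> zord n Q" and "q \<equiv> qn n Q"
  defines "Y \<equiv> \<lambda>m h. (\<Sum>i=m+2..n. \<Sum>j=i+1..n. h (y 1) (y i) (y j)) :: real"
    and "u \<equiv> (1 - q) ^ (n - 1)" and "v \<equiv> \<Prod>j=3..n. 1 - pij n Q 2 j"
    and "w \<equiv> \<Prod>(i, j)\<in>{(i, j). 3 \<le> i \<and> i < j \<and> j \<le> n}. 1 - pij n Q i j"
  shows "1 - u \<le> real (n - 1) * q" "real (n - 1) * q - (real n * q)\<^sup>2 \<le> 1 - u"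
    "u * (1 - v) \<le> Y 0 near_kernel + Y 0 far_kernel"
    "Y 0 near_kernel - Y 1 near_kernel - 2 * (real n * q)\<^sup>2 \<le> u * (1 - v)"
    "u * v * (1 - w) \<le> Y 1 near_kernel + Y 0 far_kernel"
    "Y 1 near_kernel - Y 2 near_kernel - 3 * (real n * q)\<^sup>2 \<le> u * v * (1 - w)"
proof -
  define p where "p i j = pij n Q i j" for i j
  have q01: "0 < q" "q < 1" by (simp_all add: q_def qn_qmin)
  have nq: "real n * q \<ge> 0" using q01 by simp
  have y1: "y 1 \<le> y i" if "i \<in> {1..n}" for i
    using mono[of 1 i] that n by (cases "i = 1") (auto simp: y_def less_imp_le)
  have p0: "0 \<le> p i j" "p i j \<le> 1" for i j by (simp_all add: p_def pij_edgep)
  have pq: "p i j \<le> q" if "i \<in> {1..n}" "j \<in> {1..n}" for i j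
    unfolding p_def pij_edgep q_def qn_qmin using y1[OF that(1)] y1[OF that(2)] by (intro edgep_le_qmin) (auto simp: y_def)
  have split: "p i j = near_kernel (y 1) (y i) (y j) + far_kernel (y 1) (y i) (y j)" if "2 \<le> i" "i < j" "j \<le> n" for i j
  proof -
    have "y 1 < y i" "y i < y j" using mono[of 1 i] mono[of i j] that by (auto simp: y_def)
    then show ?thesis by (simp add: p_def pij_edgep near_kernel_def far_kernel_def y_def)
  qed
  have nk: "0 \<le> near_kernel a b c" "0 \<le> far_kernel a b c" for a b c by (simp_all add: near_kernel_bounds far_kernel_bounds)
  have row: "(\<Sum>j=i+1..n. p i j) \<le> real n * q" if "i \<in> {1..n}" for i
  proof -
    have "(\<Sum>j=i+1..n. p i j) \<le> (\<Sum>j=i+1..n. q)" using that by (intro sum_mono pq) auto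
    also have "\<dots> = real (card {i+1..n}) * q" by simp
    also have "\<dots> \<le> real n * q" using q01 by (intro mult_right_mono) auto
    finally show ?thesis .
  qed
  have row0: "0 \<le> (\<Sum>j=i+1..n. p i j)" for i using p0 by (intro sum_nonneg)
  have rown: "(\<Sum>j=i+1..n. near_kernel (y 1) (y i) (y j)) \<le> (\<Sum>j=i+1..n. p i j)" if "2 \<le> i" for i
    using that nk by (intro sum_mono) (auto simp: split)
  have Yhead: "Y m h = (\<Sum>j=m+3..n. h (y 1) (y (m+2)) (y j)) + Y (m + 1) h" if "m \<le> 1" for m h
  proof -
    have "{m+2..n} = insert (m+2) {m+1+2..n}" using n that by auto
    moreover have "m + 2 + 1 = m + 3" by simp
    moreover have "m + 2 \<notin> {m+1+2..n}" by simp
    ultimately show ?thesis unfolding Y_def by (simp only: sum.insert finite_atLeastAtMost not_False_eq_True)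
  qed
  have Y0: "0 \<le> Y m near_kernel" "0 \<le> Y m far_kernel" for m
    unfolding Y_def by (intro sum_nonneg nk)+
  have Yf: "Y 1 far_kernel \<le> Y 0 far_kernel"
  proof -
    have "0 \<le> (\<Sum>j=0+3..n. far_kernel (y 1) (y (0+2)) (y j))" by (intro sum_nonneg nk)
    then show ?thesis using Yhead[of 0 far_kernel] by simp
  qed
  have Ysum: "(\<Sum>i=m+2..n. \<Sum>j=i+1..n. p i j) = Y m near_kernel + Y m far_kernel" for m
  proof -
    have "(\<Sum>i=m+2..n. \<Sum>j=i+1..n. p i j) = (\<Sum>i=m+2..n. \<Sum>j=i+1..n. near_kernel (y 1) (y i) (y j) + far_kernel (y 1) (y i) (y j))"
      by (intro sum.cong refl split) auto
    then show ?thesis by (simp add: Y_def sum.distrib)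
  qed
  have u01: "0 \<le> u" "u \<le> 1" using q01 by (auto simp: u_def intro: power_le_one)
  have v01: "0 \<le> v" "v \<le> 1" unfolding v_def using p0 by (auto simp: p_def intro!: prod_nonneg prod_le_1)
  have w01: "0 \<le> w" "w \<le> 1" unfolding w_def using p0 by (auto simp: p_def case_prod_beta intro!: prod_nonneg prod_le_1)
  have ub: "1 - u \<le> real (n - 1) * q" "real (n - 1) * q - (real (n - 1) * q)\<^sup>2 \<le> 1 - u"
    using one_minus_prod_bounds[of "{1..n-1}" "\<lambda>_. q"] q01 by (simp_all add: u_def)
  show "1 - u \<le> real (n - 1) * q" by (rule ub)
  have "(real (n - 1) * q)\<^sup>2 \<le> (real n * q)\<^sup>2" using q01 by (intro power_mono mult_right_mono) auto
  then show "real (n - 1) * q - (real n * q)\<^sup>2 \<le> 1 - u" using ub(2) by linarith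
  have unq: "1 - u \<le> real n * q"
  proof -
    have "real (n - 1) * q \<le> real n * q" using q01 by (intro mult_right_mono) auto
    then show ?thesis using ub(1) by linarith
  qed
  have e: "2 + 1 = (3::nat)" "0 + 3 = (3::nat)" "0 + 2 = (2::nat)" "0 + 1 = (1::nat)" by simp_all
  define X where "X = (\<Sum>j=3..n. p 2 j)"
  have X: "0 \<le> X" "X \<le> real n * q" using row0[of 2] row[of 2] n unfolding X_def e by auto
  have vb: "1 - v \<le> X" "X - X\<^sup>2 \<le> 1 - v"
    using one_minus_prod_bounds[of "{3..n}" "p 2"] p0 by (simp_all add: v_def X_def p_def)
  have sq: "X\<^sup>2 \<le> (real n * q)\<^sup>2" using X by (intro power_mono) auto
  have XY: "X + (\<Sum>i=3..n. \<Sum>j=i+1..n. p i j) = Y 0 near_kernel + Y 0 far_kernel"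
  proof -
    have "{2..n} = insert 2 {3..n}" using n by auto
    then have "(\<Sum>i=2..n. \<Sum>j=i+1..n. p i j) = (\<Sum>j=2+1..n. p 2 j) + (\<Sum>i=3..n. \<Sum>j=i+1..n. p i j)" by simp
    then show ?thesis using Ysum[of 0] unfolding X_def e by linarith
  qed
  have "(\<Sum>i=3..n. \<Sum>j=i+1..n. p i j) \<ge> 0" by (rule sum_nonneg) (rule row0)
  then have XYle: "X \<le> Y 0 near_kernel + Y 0 far_kernel" using XY by linarith
  have "u * (1 - v) \<le> 1 * (1 - v)" using u01 v01 by (intro mult_right_mono) auto
  then show "u * (1 - v) \<le> Y 0 near_kernel + Y 0 far_kernel"
    unfolding mult_1_left by (rule order_trans[OF _ order_trans[OF vb(1) XYle]])
  have "(1 - u) * (1 - v) \<le> (real n * q) * (real n * q)"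
    using unq vb X u01 v01 by (intro mult_mono) auto
  then have "(1 - v) - u * (1 - v) \<le> (real n * q)\<^sup>2"
    unfolding left_diff_distrib power2_eq_square by (simp only: mult_1_left)
  then have uv: "1 - v - (real n * q)\<^sup>2 \<le> u * (1 - v)" by (simp only: diff_le_eq add.commute)
  have "Y 0 near_kernel - Y 1 near_kernel \<le> X"
    using Yhead[of 0 near_kernel] rown[of 2] unfolding X_def e by simp
  then show "Y 0 near_kernel - Y 1 near_kernel - 2 * (real n * q)\<^sup>2 \<le> u * (1 - v)"
  proof -
    define A where "A = u * (1 - v)"
    define B where "B = (real n * q)\<^sup>2"
    show ?thesis using uv vb(2) sq \<open>Y 0 near_kernel - Y 1 near_kernel \<le> X\<close>
      unfolding A_def[symmetric] B_def[symmetric] by linarith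
  qed
  define S3 where "S3 = {(i, j). 3 \<le> i \<and> i < j \<and> j \<le> n}"
  have S3: "S3 = Sigma {3..n} (\<lambda>i. {i+1..n})" by (auto simp: S3_def)
  have finS3: "finite S3" unfolding S3 by auto
  have wp: "w = (\<Prod>e\<in>S3. 1 - p (fst e) (snd e))" by (simp add: w_def S3_def p_def case_prod_beta)
  have sS3: "(\<Sum>e\<in>S3. p (fst e) (snd e)) = Y 1 near_kernel + Y 1 far_kernel"
  proof -
    have "(\<Sum>e\<in>S3. p (fst e) (snd e)) = (\<Sum>i=3..n. \<Sum>j=i+1..n. p i j)"
      unfolding S3 by (subst sum.Sigma) (auto simp: case_prod_beta)
    moreover have "1 + 2 = (3::nat)" by simp
    ultimately show ?thesis using Ysum[of 1] by (simp only:)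
  qed
  have "1 - w \<le> Y 1 near_kernel + Y 1 far_kernel"
    unfolding sS3[symmetric] wp using finS3 p0 by (intro one_minus_prod_bounds(1)) auto
  moreover have uv01: "0 \<le> u * v" "u * v \<le> 1" using u01 v01 by (auto intro: mult_le_one)
  then have "u * v * (1 - w) \<le> 1 * (1 - w)" using w01 by (intro mult_right_mono) auto
  moreover have "Y 1 near_kernel + Y 1 far_kernel \<le> Y 1 near_kernel + Y 0 far_kernel" using Yf by simp
  ultimately show "u * v * (1 - w) \<le> Y 1 near_kernel + Y 0 far_kernel"
    unfolding mult_1_left by (meson order_trans)
  define X3 where "X3 = (\<Sum>j=4..n. p 3 j)"
  have X3: "0 \<le> X3" "X3 \<le> real n * q" using row0[of 3] row[of 3] n by (simp_all add: X3_def)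
  \<comment> \<open>For the lower bound it suffices to keep the pairs whose lower entry has rank three.\<close>
  define w3 where "w3 = (\<Prod>j=4..n. 1 - p 3 j)"
  have w3b: "1 - w3 \<le> X3" "X3 - X3\<^sup>2 \<le> 1 - w3"
    using one_minus_prod_bounds[of "{4..n}" "p 3"] p0 by (simp_all add: w3_def X3_def)
  have w3: "w3 \<le> 1" unfolding w3_def using p0 by (intro prod_le_1) auto
  have "w \<le> w3"
  proof -
    have sub: "(\<lambda>j. (3, j)) ` {4..n} \<subseteq> S3" by (auto simp: S3_def)
    have "w = (\<Prod>e\<in>S3 - (\<lambda>j. (3, j)) ` {4..n}. 1 - p (fst e) (snd e)) * (\<Prod>e\<in>(\<lambda>j. (3, j)) ` {4..n}. 1 - p (fst e) (snd e))"
      unfolding wp by (rule prod.subset_diff[OF sub finS3])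
    also have "(\<Prod>e\<in>(\<lambda>j. (3, j)) ` {4..n}. 1 - p (fst e) (snd e)) = w3"
      unfolding w3_def by (subst prod.reindex) (auto simp: inj_on_def)
    also have "(\<Prod>e\<in>S3 - (\<lambda>j. (3, j)) ` {4..n}. 1 - p (fst e) (snd e)) * w3 \<le> 1 * w3"
      using p0 by (intro mult_right_mono prod_le_1) (auto simp: w3_def intro!: prod_nonneg)
    finally show ?thesis by simp
  qed
  then have "u * v * (1 - w3) \<le> u * v * (1 - w)" using uv01 by (intro mult_left_mono) auto
  moreover have "1 - u * v \<le> 2 * (real n * q)"
  proof -
    have "u * (1 - v) \<le> 1 * X" using u01 v01 vb X by (intro mult_mono) auto
    then have "u - u * v \<le> X" unfolding right_diff_distrib by (simp only: mult_1_right mult_1_left)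
    moreover have "1 - u * v = (1 - u) + (u - u * v)" by simp
    moreover have "X \<le> real n * q" by (rule X)
    ultimately show ?thesis using unq by simp
  qed
  then have "(1 - u * v) * (1 - w3) \<le> (2 * (real n * q)) * (real n * q)"
    using w3b(1) X3 w3 nq by (intro mult_mono) auto
  then have "(1 - w3) - u * v * (1 - w3) \<le> 2 * (real n * q)\<^sup>2"
    unfolding left_diff_distrib power2_eq_square by (simp only: mult_1_left mult.assoc)
  then have "1 - w3 - 2 * (real n * q)\<^sup>2 \<le> u * v * (1 - w3)" by (simp only: diff_le_eq add.commute)
  moreover have "X3\<^sup>2 \<le> (real n * q)\<^sup>2" using X3 by (intro power_mono) auto
  moreover have "Y 1 near_kernel - Y 2 near_kernel \<le> X3"
  proof -
    have e: "1 + 3 = (4::nat)" "1 + 2 = (3::nat)" "3 + 1 = (4::nat)" "1 + 1 = (2::nat)" by simp_all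
    show ?thesis
      using Yhead[of 1 near_kernel] rown[of 3] unfolding X3_def e by simp
  qed
  moreover have "a - 3 * e \<le> d" if "b \<le> d" "c - 2 * e \<le> b" "f \<le> e" "a \<le> x" "x - f \<le> c" for a b c d e f x :: real
    using that by linarith
  ultimately show "Y 1 near_kernel - Y 2 near_kernel - 3 * (real n * q)\<^sup>2 \<le> u * v * (1 - w)"
    using w3b(2) by blast
qed

section \<open>Conditioning on the diagonal\<close>

lemma tri_split: "tri n = diag_idx n \<union> off_idx n" "diag_idx n \<inter> off_idx n = {}"
  by (auto simp: tri_def diag_idx_def off_idx_def image_iff)

lemma goe_law_diag: "Pi\<^sub>M (diag_idx n) entry_law = sample (diag_idx n)"
  by (rule PiM_cong) (auto simp: diag_idx_def entry_law_def)

lemma restrict_diag_measurable [measurable]: "(\<lambda>q. restrict q (diag_idx n)) \<in> goe_law n \<rightarrow>\<^sub>M sample (diag_idx n)"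
  unfolding goe_law_def goe_law_diag[symmetric] by (rule measurable_restrict_subset) (auto simp: tri_split)

lemma goe_law_integral_diag:
  fixes f :: "(nat \<times> nat \<Rightarrow> real) \<Rightarrow> real"
  assumes "f \<in> borel_measurable (sample (diag_idx n))"
  shows "(\<integral>q. f (restrict q (diag_idx n)) \<partial>goe_law n) = (\<integral>x. f x \<partial>sample (diag_idx n))"
proof -
  have "sample (diag_idx n) = distr (goe_law n) (sample (diag_idx n)) (\<lambda>q. restrict q (diag_idx n))"
    unfolding goe_law_def goe_law_diag[symmetric]
    by (rule PE.distr_PiM_restrict_finite[symmetric]) (auto simp: tri_split)
  then have "(\<integral>x. f x \<partial>sample (diag_idx n)) = (\<integral>x. f x \<partial>distr (goe_law n) (sample (diag_idx n)) (\<lambda>q. restrict q (diag_idx n)))"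
    by simp
  also have "\<dots> = (\<integral>q. f (restrict q (diag_idx n)) \<partial>goe_law n)"
    by (rule integral_distr[OF restrict_diag_measurable assms])
  finally show ?thesis ..
qed

definition off_law :: "real measure" where
  "off_law = density lborel (normal_density 0 (sqrt (1/2)))"

lemma off_law_distr: "off_law = distr \<N> lborel (\<lambda>x. (1 / sqrt 2) * x)"
proof -
  have d: "distributed \<N> lborel (\<lambda>x. x) (normal_density 0 1)"
  proof -
    have "distr \<N> lborel (\<lambda>x. x) = density lborel (normal_density 0 1)"
    proof -
      have "distr \<N> lborel (\<lambda>x. x) = distr \<N> \<N> (\<lambda>x. x)" by (rule distr_cong) auto
      then show ?thesis by (simp add: distr_id2)
    qed
    then show ?thesis unfolding distributed_def by auto
  qed
  have "distributed \<N> lborel (\<lambda>x. 0 + (1 / sqrt 2) * x) (normal_density (0 + (1 / sqrt 2) * 0) (\<bar>1 / sqrt 2\<bar> * 1))"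
    by (rule N.normal_density_affine[OF d]) auto
  then have "distributed \<N> lborel (\<lambda>x. (1 / sqrt 2) * x) (normal_density 0 (sqrt (1/2)))"
    by (simp add: real_sqrt_divide)
  then show ?thesis unfolding off_law_def by (rule distributed_distr_eq_density[symmetric])
qed

lemma off_law_atMost: "emeasure off_law {..t} = ennreal (Phi (sqrt 2 * t))"
proof -
  have "emeasure off_law {..t} = emeasure \<N> ((\<lambda>x. (1 / sqrt 2) * x) -` {..t} \<inter> space \<N>)"
    unfolding off_law_distr by (rule emeasure_distr) auto
  also have "(\<lambda>x. (1 / sqrt 2) * x) -` {..t} \<inter> space \<N> = {..sqrt 2 * t}"
    by (auto simp: field_simps)
  finally show ?thesis by (simp add: N.emeasure_eq_measure cdf_def)
qed

lemma off_law_atLeast: "emeasure off_law {t..} = ennreal (1 - Phi (sqrt 2 * t))"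
proof -
  have "emeasure off_law {t..} = emeasure \<N> ((\<lambda>x. (1 / sqrt 2) * x) -` {t..} \<inter> space \<N>)"
    unfolding off_law_distr by (rule emeasure_distr) auto
  also have "(\<lambda>x. (1 / sqrt 2) * x) -` {t..} \<inter> space \<N> = {sqrt 2 * t..}"
    by (auto simp: field_simps)
  also have "emeasure \<N> {sqrt 2 * t..} = emeasure \<N> {sqrt 2 * t<..}"
  proof (rule emeasure_eq_AE)
    have "AE x in lborel. x \<noteq> sqrt 2 * t" by (rule AE_lborel_singleton)
    then have "AE x in \<N>. x \<noteq> sqrt 2 * t" by (subst AE_density) auto
    then show "AE x in \<N>. (x \<in> {sqrt 2 * t..}) = (x \<in> {sqrt 2 * t<..})" by eventually_elim auto
  qed auto
  finally show ?thesis by (simp add: emeasure_N_Ioi)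
qed

lemma entry_law_off: "e \<in> off_idx n \<Longrightarrow> entry_law e = off_law"
  by (auto simp: off_idx_def entry_law_def off_law_def)

text \<open>Given the diagonal, events on distinct off-diagonal entries are independent, and \<open>G e x\<close> is the
  conditional probability of the event at \<open>e\<close> when the diagonal is \<open>x\<close>.\<close>

lemma goe_cond_prob:
  fixes R :: "nat \<times> nat \<Rightarrow> (nat \<times> nat \<Rightarrow> real) \<Rightarrow> real \<Rightarrow> bool"
  assumes E: "E \<subseteq> off_idx n"
    and R: "\<And>e. e \<in> E \<Longrightarrow> Measurable.pred (sample (diag_idx n) \<Otimes>\<^sub>M borel) (\<lambda>p. R e (fst p) (snd p))"
    and G: "\<And>e x. e \<in> E \<Longrightarrow> emeasure off_law {y. R e x y} = ennreal (G e x)" "\<And>e x. e \<in> E \<Longrightarrow> 0 \<le> G e x" "\<And>e x. e \<in> E \<Longrightarrow> G e x \<le> 1"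
    and Gm: "\<And>e. e \<in> E \<Longrightarrow> G e \<in> borel_measurable (sample (diag_idx n))"
  shows "measure (goe_law n) {q\<in>space (goe_law n). \<forall>e\<in>E. R e (restrict q (diag_idx n)) (q e)}
       = (\<integral>x. (\<Prod>e\<in>E. G e x) \<partial>sample (diag_idx n))"
    "{q\<in>space (goe_law n). \<forall>e\<in>E. R e (restrict q (diag_idx n)) (q e)} \<in> sets (goe_law n)"
proof -
  define D where "D = diag_idx n"
  define S where "S = {q\<in>space (goe_law n). \<forall>e\<in>E. R e (restrict q D) (q e)}"
  have finE: "finite E" by (rule finite_subset[OF E]) simp
  define g where "g e x y = (if e \<in> E \<longrightarrow> R e x y then 1 else 0 :: ennreal)" for e x y
  have Spred: "Measurable.pred (goe_law n) (\<lambda>q. R e (restrict q D) (q e))" if "e \<in> E" for e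
  proof -
    have "e \<in> tri n" using that E by (auto simp: tri_split)
    then have "(\<lambda>q. q e) \<in> goe_law n \<rightarrow>\<^sub>M borel"
      unfolding goe_law_def using measurable_component_singleton[of e "tri n" entry_law]
      by (simp cong: measurable_cong_sets)
    then have "(\<lambda>q. (restrict q D, q e)) \<in> goe_law n \<rightarrow>\<^sub>M sample D \<Otimes>\<^sub>M borel"
      unfolding D_def by (intro measurable_Pair restrict_diag_measurable)
    from measurable_compose[OF this R[OF that, folded D_def]] show ?thesis by simp
  qed
  then have Ssets: "S \<in> sets (goe_law n)"
    unfolding S_def pred_def[symmetric] using finE by (intro pred_intros_finite(3)) auto
  then show "{q\<in>space (goe_law n). \<forall>e\<in>E. R e (restrict q (diag_idx n)) (q e)} \<in> sets (goe_law n)"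
    unfolding S_def D_def .
  have "emeasure (goe_law n) S = (\<integral>\<^sup>+q. indicator S q \<partial>goe_law n)"
    using Ssets by simp
  also have "\<dots> = (\<integral>\<^sup>+q. 1 * (\<Prod>e\<in>off_idx n. g e (restrict q D) (q e)) \<partial>goe_law n)"
  proof (rule nn_integral_cong)
    fix q assume "q \<in> space (goe_law n)"
    then have "indicator S q = (if \<forall>e\<in>off_idx n. e \<in> E \<longrightarrow> R e (restrict q D) (q e) then 1 else 0 :: ennreal)"
      using E by (auto simp: S_def indicator_def)
    also have "\<dots> = (\<Prod>e\<in>off_idx n. g e (restrict q D) (q e))"
      by (auto simp: g_def intro!: prod_zero)
    finally show "indicator S q = 1 * (\<Prod>e\<in>off_idx n. g e (restrict q D) (q e))" by simp
  qed
  also have "\<dots> = (\<integral>\<^sup>+x. 1 * (\<Prod>e\<in>off_idx n. \<integral>\<^sup>+y. g e x y \<partial>entry_law e) \<partial>Pi\<^sub>M D entry_law)"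
    unfolding goe_law_def tri_split(1) D_def
  proof (rule PE.nn_integral_fold_prod)
    fix e assume e: "e \<in> off_idx n"
    have m: "sets (Pi\<^sub>M (diag_idx n) entry_law \<Otimes>\<^sub>M entry_law e) = sets (sample (diag_idx n) \<Otimes>\<^sub>M borel)"
      unfolding goe_law_diag by (rule sets_pair_measure_cong) auto
    show "(\<lambda>(x, y). g e x y) \<in> borel_measurable (Pi\<^sub>M (diag_idx n) entry_law \<Otimes>\<^sub>M entry_law e)"
      unfolding measurable_cong_sets[OF m refl]
    proof (cases "e \<in> E")
      case True
      note [measurable] = R[OF True]
      show "(\<lambda>(x, y). g e x y) \<in> borel_measurable (sample (diag_idx n) \<Otimes>\<^sub>M borel)"
        unfolding g_def case_prod_beta by measurable
    qed (simp add: g_def case_prod_beta)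
  qed (auto simp: tri_split)
  also have "\<dots> = (\<integral>\<^sup>+x. ennreal (\<Prod>e\<in>E. G e x) \<partial>sample D)"
    unfolding goe_law_diag[of n, folded D_def]
  proof (rule nn_integral_cong)
    fix x assume x: "x \<in> space (sample D)"
    have "(\<integral>\<^sup>+y. g e x y \<partial>entry_law e) = (if e \<in> E then ennreal (G e x) else 1)" if e: "e \<in> off_idx n" for e
    proof (cases "e \<in> E")
      case True
      have "Pair x -` {p \<in> space (sample D \<Otimes>\<^sub>M borel). R e (fst p) (snd p)} = {y. R e x y}"
        using x by (auto simp: space_pair_measure)
      then have "{y. R e x y} \<in> sets borel"
        using sets_Pair1[OF R[OF True, unfolded pred_def, folded D_def], of x] by simp
      then have ms: "{y. R e x y} \<in> sets off_law" by (simp add: off_law_def)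
      have "(\<integral>\<^sup>+y. g e x y \<partial>off_law) = (\<integral>\<^sup>+y. indicator {y. R e x y} y \<partial>off_law)"
        using True by (intro nn_integral_cong) (auto simp: g_def indicator_def)
      also have "\<dots> = ennreal (G e x)" using ms G(1)[OF True] by simp
      finally show ?thesis using True by (simp add: entry_law_off[OF e])
    next
      case False
      have "emeasure (entry_law e) UNIV = 1"
        using prob_space.emeasure_space_1[OF prob_space_entry_law, of e] by simp
      then show ?thesis using False by (simp add: g_def)
    qed
    then have "(\<Prod>e\<in>off_idx n. \<integral>\<^sup>+y. g e x y \<partial>entry_law e) = (\<Prod>e\<in>off_idx n. if e \<in> E then ennreal (G e x) else 1)"
      by (intro prod.cong refl)
    also have "\<dots> = (\<Prod>e\<in>E. ennreal (G e x))"
      using E by (subst prod.If_cases) (auto simp: Int_absorb1)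
    also have "\<dots> = ennreal (\<Prod>e\<in>E. G e x)" using G(2) by (intro prod_ennreal) auto
    finally show "1 * (\<Prod>e\<in>off_idx n. \<integral>\<^sup>+y. g e x y \<partial>entry_law e) = ennreal (\<Prod>e\<in>E. G e x)" by simp
  qed
  also have "\<dots> = ennreal (\<integral>x. (\<Prod>e\<in>E. G e x) \<partial>sample D)"
  proof (intro nn_integral_eq_integral AE_I2)
    show "integrable (sample D) (\<lambda>x. \<Prod>e\<in>E. G e x)"
    proof (rule PN.integrable_const_bound[where B = 1])
      show "AE x in sample D. norm (\<Prod>e\<in>E. G e x) \<le> 1"
        using G(2,3) by (intro AE_I2) (auto simp: abs_prod prod_nonneg intro!: prod_le_1)
      show "(\<lambda>x. \<Prod>e\<in>E. G e x) \<in> borel_measurable (sample D)"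
        using Gm unfolding D_def by (intro borel_measurable_prod) auto
    qed
  qed (use G(2) in \<open>auto intro: prod_nonneg\<close>)
  finally have "emeasure (goe_law n) S = ennreal (\<integral>x. (\<Prod>e\<in>E. G e x) \<partial>sample D)" .
  moreover have "0 \<le> (\<integral>x. (\<Prod>e\<in>E. G e x) \<partial>sample D)"
    using G(2) by (intro Bochner_Integration.integral_nonneg prod_nonneg) auto
  ultimately show "measure (goe_law n) {q\<in>space (goe_law n). \<forall>e\<in>E. R e (restrict q (diag_idx n)) (q e)}
       = (\<integral>x. (\<Prod>e\<in>E. G e x) \<partial>sample (diag_idx n))"
    unfolding S_def D_def measure_def by simp
qed

text \<open>Counting expresses order statistics through measurable sums.\<close>

lemma zord_le_iff:
  assumes k: "k \<in> {1..n}"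
  shows "zord n Q k \<le> t \<longleftrightarrow> k \<le> card {i\<in>{1..n}. Q i i \<le> t}"
proof -
  obtain s where s: "bij_betw s {1..n} {1..n}" "\<And>k. k \<in> {1..n} \<Longrightarrow> zord n Q k = Q (s k) (s k)"
    "\<And>i j. i \<in> {1..n} \<Longrightarrow> j \<in> {1..n} \<Longrightarrow> i \<le> j \<Longrightarrow> zord n Q i \<le> zord n Q j"
    by (rule zord_enum[of n Q]) (rule that)
  define T where "T = {j\<in>{1..n}. zord n Q j \<le> t}"
  have "{i\<in>{1..n}. Q i i \<le> t} = s ` T"
  proof (intro equalityI subsetI)
    fix i assume i: "i \<in> {i\<in>{1..n}. Q i i \<le> t}"
    then have "i \<in> s ` {1..n}" using bij_betw_imp_surj_on[OF s(1)] by simp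
    then obtain j where "j \<in> {1..n}" "i = s j" by blast
    then show "i \<in> s ` T" using i s(2)[of j] by (auto simp: T_def)
  next
    fix i assume "i \<in> s ` T"
    then obtain j where "j \<in> {1..n}" "i = s j" "zord n Q j \<le> t" by (auto simp: T_def)
    then show "i \<in> {i\<in>{1..n}. Q i i \<le> t}" using s(2)[of j] bij_betw_apply[OF s(1), of j] by auto
  qed
  moreover have "inj_on s T" using bij_betw_imp_inj_on[OF s(1)] by (rule inj_on_subset) (auto simp: T_def)
  ultimately have c: "card {i\<in>{1..n}. Q i i \<le> t} = card T" by (simp add: card_image)
  show ?thesis unfolding c
  proof
    assume "zord n Q k \<le> t"
    then have "{1..k} \<subseteq> T" using s(3)[of _ k] k by (fastforce simp: T_def)
    then show "k \<le> card T" using card_mono[of T "{1..k}"] by (simp add: T_def)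
  next
    assume kc: "k \<le> card T"
    show "zord n Q k \<le> t"
    proof (rule ccontr)
      assume nk: "\<not> zord n Q k \<le> t"
      have "T \<subseteq> {1..<k}"
      proof
        fix j assume j: "j \<in> T"
        then have "\<not> k \<le> j" using s(3)[of k j] nk k by (auto simp: T_def)
        then show "j \<in> {1..<k}" using j by (auto simp: T_def)
      qed
      then have "card T \<le> k - 1" using card_mono[of "{1..<k}" T] by simp
      then show False using kc k by auto
    qed
  qed
qed

lemma zord_measurable:
  assumes k: "k \<in> {1..n}" and Q: "\<And>i. i \<in> {1..n} \<Longrightarrow> (\<lambda>\<omega>. Q \<omega> i i) \<in> borel_measurable M"
  shows "(\<lambda>\<omega>. zord n (Q \<omega>) k) \<in> borel_measurable M"
proof (rule borel_measurable_iff_le[THEN iffD2], rule allI)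
  fix t
  have "(\<lambda>\<omega>. if Q \<omega> i i \<le> t then 1 else 0 :: real) \<in> borel_measurable M" if "i \<in> {1..n}" for i
    using Q[OF that] by measurable
  then have [measurable]: "(\<lambda>\<omega>. \<Sum>i=1..n. if Q \<omega> i i \<le> t then 1 else 0 :: real) \<in> borel_measurable M"
    by (rule borel_measurable_sum)
  have "zord n (Q \<omega>) k \<le> t \<longleftrightarrow> real k \<le> (\<Sum>i=1..n. if Q \<omega> i i \<le> t then 1 else 0)" for \<omega>
    unfolding zord_le_iff[OF k] by (simp add: sum.If_cases Int_def)
  then have "{\<omega> \<in> space M. zord n (Q \<omega>) k \<le> t} = {\<omega> \<in> space M. real k \<le> (\<Sum>i=1..n. if Q \<omega> i i \<le> t then 1 else 0)}"
    by simp
  also have "\<dots> \<in> sets M" by measurable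
  finally show "{\<omega> \<in> space M. zord n (Q \<omega>) k \<le> t} \<in> sets M" .
qed

lemma zord_cong: "(\<And>i. i \<in> {1..n} \<Longrightarrow> Q i i = Q' i i) \<Longrightarrow> zord n Q k = zord n Q' k"
  unfolding zord_def by (intro arg_cong2[where f = nth] arg_cong[where f = sort] map_cong) auto

lemma zord_restrict: "zord n (mat_of (restrict q (diag_idx n))) k = zord n (mat_of q) k"
  by (rule zord_cong) (auto simp: mat_of_def diag_idx_def)

lemma zord_sample_measurable:
  assumes "k \<in> {1..n}"
  shows "(\<lambda>x. zord n (mat_of x) k) \<in> borel_measurable (sample (diag_idx n))"
proof (rule zord_measurable[OF assms])
  fix i assume "i \<in> {1..n}"
  then have "(i, i) \<in> diag_idx n" by (auto simp: diag_idx_def)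
  from measurable_component_singleton[OF this, of "\<lambda>_. \<N>"]
  show "(\<lambda>x. mat_of x i i) \<in> borel_measurable (sample (diag_idx n))" by (simp add: mat_of_def)
qed

abbreviation zmin :: "nat \<Rightarrow> (nat \<times> nat \<Rightarrow> real) \<Rightarrow> real" where
  "zmin n q \<equiv> zord n (mat_of q) 1"

lemma zmin_le: "i \<in> {1..n} \<Longrightarrow> zord n Q 1 \<le> Q i i"
proof -
  assume i: "i \<in> {1..n}"
  then have "1 \<in> {1..n}" by auto
  moreover have "{j\<in>{1..n}. Q j j \<le> Q i i} \<noteq> {}" using i by auto
  then have "1 \<le> card {j\<in>{1..n}. Q j j \<le> Q i i}" by (simp add: Suc_le_eq card_gt_0_iff)
  ultimately show ?thesis using zord_le_iff[of 1 n Q "Q i i"] by simp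
qed

lemma zmin_attained:
  assumes "n \<ge> 1" obtains i where "i \<in> {1..n}" "Q i i = zord n Q 1"
proof -
  obtain s where s: "bij_betw s {1..n} {1..n}" "\<And>k. k \<in> {1..n} \<Longrightarrow> zord n Q k = Q (s k) (s k)"
    "\<And>i j. i \<in> {1..n} \<Longrightarrow> j \<in> {1..n} \<Longrightarrow> i \<le> j \<Longrightarrow> zord n Q i \<le> zord n Q j"
    by (rule zord_enum[of n Q]) (rule that)
  have 1: "1 \<in> {1..n}" using assms by auto
  show ?thesis by (rule that[OF bij_betw_apply[OF s(1) 1] s(2)[OF 1, symmetric]])
qed

lemma AE_inj_sample:
  fixes I :: "'i set"
  assumes fin: "finite I"
  shows "AE x in sample I. inj_on x I"
proof -
  have "AE x in sample I. x i \<noteq> x j" if ij: "i \<in> I" "j \<in> I" "i \<noteq> j" for i j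
  proof -
    define F where "F x = (if x i = x j then 1 else 0 :: ennreal)" for x :: "'i \<Rightarrow> real"
    have [measurable]: "(\<lambda>x. x i) \<in> borel_measurable (sample I)" "(\<lambda>x. x j) \<in> borel_measurable (sample I)"
      using measurable_component_singleton[OF ij(1), of "\<lambda>_. \<N>"] measurable_component_singleton[OF ij(2), of "\<lambda>_. \<N>"] by simp_all
    have Fm: "F \<in> borel_measurable (sample I)" unfolding F_def by measurable
    define J where "J = I - {i}"
    have I: "I = insert i J" using ij by (auto simp: J_def)
    have "(\<integral>\<^sup>+x. F x \<partial>sample I) = (\<integral>\<^sup>+x. (\<integral>\<^sup>+t. F (x(i := t)) \<partial>\<N>) \<partial>sample J)"
      using Fm fin unfolding I by (intro PN.product_nn_integral_insert) (auto simp: J_def)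
    also have "\<dots> = (\<integral>\<^sup>+x. 0 \<partial>sample J)"
    proof (rule nn_integral_cong)
      fix x :: "'i \<Rightarrow> real"
      have "AE t in lborel. t \<noteq> x j" by (rule AE_lborel_singleton)
      then have "AE t in \<N>. F (x(i := t)) = 0"
        using ij(3) by (subst AE_density) (auto simp: F_def)
      then have "(\<integral>\<^sup>+t. F (x(i := t)) \<partial>\<N>) = (\<integral>\<^sup>+t. 0 \<partial>\<N>)" by (rule nn_integral_cong_AE)
      then show "(\<integral>\<^sup>+t. F (x(i := t)) \<partial>\<N>) = 0" by simp
    qed
    finally have "(\<integral>\<^sup>+x. F x \<partial>sample I) = 0" by simp
    then have "AE x in sample I. F x = 0" using Fm by (simp add: nn_integral_0_iff_AE)
    then show ?thesis by eventually_elim (auto simp: F_def split: if_splits)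
  qed
  then have "AE x in sample I. \<forall>i\<in>I. \<forall>j\<in>I. i \<noteq> j \<longrightarrow> x i \<noteq> x j"
    using fin by (intro AE_finite_allI) (auto intro!: AE_I2)
  then show ?thesis by eventually_elim (auto simp: inj_on_def)
qed

section \<open>Probabilities of the edge, star and path events\<close>

lemma kernel_near: "kernel near_kernel" and kernel_far: "kernel far_kernel" and kernel_path: "kernel path_kernel"
proof -
  have m: "(\<lambda>(z, w, c). near_kernel z w c) \<in> borel_measurable (borel \<Otimes>\<^sub>M borel \<Otimes>\<^sub>M borel)"
    "(\<lambda>(z, w, c). far_kernel z w c) \<in> borel_measurable (borel \<Otimes>\<^sub>M borel \<Otimes>\<^sub>M borel)"
    "(\<lambda>(z, w, c). path_kernel z w c) \<in> borel_measurable (borel \<Otimes>\<^sub>M borel \<Otimes>\<^sub>M borel)"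
    unfolding case_prod_beta by measurable
  have "z < c" if "near_kernel z w c \<noteq> 0" for z w c
    using that near_less[of z w c] by (auto simp: near_kernel_def split: if_splits)
  then show "kernel near_kernel" unfolding kernel_def using m(1) near_kernel_bounds by blast
  have "z < c" if "far_kernel z w c \<noteq> 0" for z w c
    using that by (auto simp: far_kernel_def split: if_splits)
  then show "kernel far_kernel" unfolding kernel_def using m(2) far_kernel_bounds by blast
  have "z < c" if "path_kernel z w c \<noteq> 0" for z w c
    using that by (auto simp: path_kernel_def split: if_splits)
  then show "kernel path_kernel" unfolding kernel_def using m(3) path_kernel_bounds by blast
qed

lemma diag_component:
  assumes "i \<in> {1..n}"
  shows "(\<lambda>x. x (i, i)) \<in> borel_measurable (sample (diag_idx n))"
proof -
  have "(i, i) \<in> diag_idx n" using assms by (auto simp: diag_idx_def)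
  from measurable_component_singleton[OF this, of "\<lambda>_. \<N>"] show ?thesis by simp
qed

lemma zmin_measurable: "n \<ge> 1 \<Longrightarrow> zmin n \<in> borel_measurable (sample (diag_idx n))"
  by (rule zord_sample_measurable) auto

text \<open>No edge reaches below the minimum precisely when every off-diagonal entry is at least its threshold, and
  these are independent given the diagonal.\<close>

lemma edge_prob:
  assumes n: "n \<ge> 1"
  defines "A \<equiv> {q\<in>space (goe_law n). edge_event n (mat_of q) (zmin n q)}"
  shows "A \<in> sets (goe_law n)"
    "measure (goe_law n) A = 1 - (\<integral>x. (\<Prod>(i, j)\<in>off_idx n. 1 - edgep 1 (zmin n x) (mat_of x i i) (mat_of x j j)) \<partial>sample (diag_idx n))"
proof -
  interpret W: prob_space "goe_law n" by (rule prob_space_goe_law)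
  define t where "t e x = zmin n x - sqrt ((x (fst e, fst e) - zmin n x) * (x (snd e, snd e) - zmin n x))" for e :: "nat \<times> nat" and x
  define G where "G e x = 1 - edgep 1 (zmin n x) (x (fst e, fst e)) (x (snd e, snd e))" for e :: "nat \<times> nat" and x
  define C where "C = {q\<in>space (goe_law n). \<forall>e\<in>off_idx n. t e (restrict q (diag_idx n)) \<le> q e}"
  have tG: "t e \<in> borel_measurable (sample (diag_idx n))" "G e \<in> borel_measurable (sample (diag_idx n))"
    if "e \<in> off_idx n" for e
  proof -
    have [measurable]: "(\<lambda>x. x (fst e, fst e)) \<in> borel_measurable (sample (diag_idx n))"
      "(\<lambda>x. x (snd e, snd e)) \<in> borel_measurable (sample (diag_idx n))"
      using that by (intro diag_component; auto simp: off_idx_def)+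
    note [measurable] = zmin_measurable[OF n]
    show "t e \<in> borel_measurable (sample (diag_idx n))" unfolding t_def by measurable
    show "G e \<in> borel_measurable (sample (diag_idx n))" unfolding G_def by measurable
  qed
  have R: "Measurable.pred (sample (diag_idx n) \<Otimes>\<^sub>M borel) (\<lambda>p. t e (fst p) \<le> snd p)" if "e \<in> off_idx n" for e
    unfolding pred_def
    by (intro borel_measurable_le measurable_compose[OF measurable_fst tG(1)[OF that]] measurable_snd)
  have em: "emeasure off_law {y. t e x \<le> y} = ennreal (G e x)" for e x
    using off_law_atLeast[of "t e x"] by (simp add: atLeast_def G_def edgep_def t_def)
  have C: "measure (goe_law n) C = (\<integral>x. (\<Prod>e\<in>off_idx n. G e x) \<partial>sample (diag_idx n))" "C \<in> sets (goe_law n)"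
    unfolding C_def
    by (rule goe_cond_prob[where R = "\<lambda>e x y. t e x \<le> y" and G = G], use R em tG in \<open>auto simp: G_def\<close>)+
  have "A = space (goe_law n) - C"
  proof -
    have "edge_event n (mat_of q) (zmin n q) \<longleftrightarrow> \<not> (\<forall>e\<in>off_idx n. t e (restrict q (diag_idx n)) \<le> q e)" for q
    proof -
      have "t (i, j) (restrict q (diag_idx n)) = zmin n q - sqrt ((mat_of q i i - zmin n q) * (mat_of q j j - zmin n q))
          \<and> mat_of q i j = q (i, j)" if "(i, j) \<in> off_idx n" for i j
        using that zord_restrict[of n q 1] by (auto simp: t_def mat_of_def off_idx_def diag_idx_def)
      moreover have "edge_event n (mat_of q) (zmin n q) \<longleftrightarrow>
        (\<exists>(i, j)\<in>off_idx n. mat_of q i j < zmin n q - sqrt ((mat_of q i i - zmin n q) * (mat_of q j j - zmin n q)))"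
        unfolding edge_event_def off_idx_def by fastforce
      ultimately show ?thesis by (force simp: not_le)
    qed
    then show ?thesis unfolding A_def C_def by auto
  qed
  then show "A \<in> sets (goe_law n)" using C(2) by auto
  have 1: "measure (goe_law n) A = 1 - measure (goe_law n) C"
    unfolding \<open>A = space (goe_law n) - C\<close> by (rule W.prob_compl[OF C(2)])
  have 2: "(\<integral>x. (\<Prod>e\<in>off_idx n. G e x) \<partial>sample (diag_idx n)) = (\<integral>x. (\<Prod>(i, j)\<in>off_idx n. 1 - edgep 1 (zmin n x) (mat_of x i i) (mat_of x j j)) \<partial>sample (diag_idx n))"
    by (simp add: G_def case_prod_beta mat_of_def)
  show "measure (goe_law n) A = 1 - (\<integral>x. (\<Prod>(i, j)\<in>off_idx n. 1 - edgep 1 (zmin n x) (mat_of x i i) (mat_of x j j)) \<partial>sample (diag_idx n))"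
    unfolding 1 C(1) 2 ..
qed

definition edge_idx :: "nat \<Rightarrow> nat \<Rightarrow> nat \<times> nat" where
  "edge_idx i m = (min i m, max i m)"

lemma edge_idx_off: "i \<in> {1..n} \<Longrightarrow> m \<in> {1..n} - {i} \<Longrightarrow> edge_idx i m \<in> off_idx n"
  by (auto simp: edge_idx_def off_idx_def min_def max_def)

lemma edge_idx_inj: "edge_idx i m = edge_idx i k \<longleftrightarrow> m = k"
  by (auto simp: edge_idx_def min_def max_def split: if_splits)

lemma mat_of_edge_idx: "mat_of q i m = q (edge_idx i m)"
  by (simp add: mat_of_def edge_idx_def)

lemma goe_threshold_prob:
  assumes E: "E \<subseteq> off_idx n" and t: "\<And>e. e \<in> E \<Longrightarrow> t e \<in> borel_measurable (sample (diag_idx n))"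
  defines "A \<equiv> {q\<in>space (goe_law n). \<forall>e\<in>E. q e \<le> t e (restrict q (diag_idx n))}"
  shows "measure (goe_law n) A = (\<integral>x. (\<Prod>e\<in>E. Phi (sqrt 2 * t e x)) \<partial>sample (diag_idx n))" "A \<in> sets (goe_law n)"
proof -
  have R: "Measurable.pred (sample (diag_idx n) \<Otimes>\<^sub>M borel) (\<lambda>p. snd p \<le> t e (fst p))" if "e \<in> E" for e
    unfolding pred_def
    by (intro borel_measurable_le measurable_compose[OF measurable_fst t[OF that]] measurable_snd)
  have em: "emeasure off_law {y. y \<le> t e x} = ennreal (Phi (sqrt 2 * t e x))" for e x
    using off_law_atMost[of "t e x"] by (simp add: atMost_def)
  have Gm: "(\<lambda>x. Phi (sqrt 2 * t e x)) \<in> borel_measurable (sample (diag_idx n))" if "e \<in> E" for e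
    using t[OF that] by measurable
  show "measure (goe_law n) A = (\<integral>x. (\<Prod>e\<in>E. Phi (sqrt 2 * t e x)) \<partial>sample (diag_idx n))" "A \<in> sets (goe_law n)"
    unfolding A_def
    by (rule goe_cond_prob[where R = "\<lambda>e x y. y \<le> t e x" and G = "\<lambda>e x. Phi (sqrt 2 * t e x)", OF E],
        use R em Gm in auto)+
qed

lemma zmin_integral:
  assumes n: "n \<ge> 1" and [measurable]: "f \<in> borel_measurable borel" and f: "\<And>z. 0 \<le> f z" "\<And>z. f z \<le> (1::real)"
  shows "integrable (sample (diag_idx n)) (\<lambda>x. f (zmin n x))"
    "(\<integral>x. f (zmin n x) \<partial>sample (diag_idx n)) = real n * lap f 1 n"
proof -
  have "(\<lambda>x. f (zmin n x)) \<in> borel_measurable (sample (diag_idx n))"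
    by (rule measurable_compose[OF zmin_measurable[OF n] assms(2)])
  moreover have "AE x in sample (diag_idx n). norm (f (zmin n x)) \<le> 1" using f by (intro AE_I2) simp
  ultimately show int: "integrable (sample (diag_idx n)) (\<lambda>x. f (zmin n x))"
    by (intro PN.integrable_const_bound[where B = 1])
  have "AE x in sample (diag_idx n). f (zmin n x) = (\<Sum>a\<in>diag_idx n. if min_at (diag_idx n) x a then f (x a) else 0)"
    using AE_inj_sample[OF finite_diag_idx, of n]
  proof eventually_elim
    case (elim x)
    obtain i where i: "i \<in> {1..n}" "mat_of x i i = zord n (mat_of x) 1" using zmin_attained[OF n] by blast
    then have a: "(i, i) \<in> diag_idx n" "x (i, i) = zmin n x" by (auto simp: diag_idx_def mat_of_def)
    have "min_at (diag_idx n) x (i, i)"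
      unfolding min_at_def
    proof
      fix l assume l: "l \<in> diag_idx n - {(i, i)}"
      then obtain j where j: "l = (j, j)" "j \<in> {1..n}" by (auto simp: diag_idx_def)
      have "zmin n x \<le> mat_of x j j" by (rule zmin_le[OF j(2)])
      moreover have "x l \<noteq> x (i, i)" using elim l a(1) by (auto simp: inj_on_def)
      ultimately show "x (i, i) < x l" using a(2) j(1) by (simp add: mat_of_def)
    qed
    from min_sum_sorted[OF finite_diag_idx a(1) this, of f] show ?case using a(2) by simp
  qed
  then have "(\<integral>x. f (zmin n x) \<partial>sample (diag_idx n)) = (\<integral>x. (\<Sum>a\<in>diag_idx n. if min_at (diag_idx n) x a then f (x a) else 0) \<partial>sample (diag_idx n))"
    using int min_sum_integral(1)[OF finite_diag_idx card_diag_idx assms(2) f, of n]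
    by (intro integral_cong_AE) (auto intro: borel_measurable_integrable)
  then show "(\<integral>x. f (zmin n x) \<partial>sample (diag_idx n)) = real n * lap f 1 n"
    using min_sum_integral(2)[OF finite_diag_idx card_diag_idx assms(2) f, of n] by simp
qed

text \<open>Pairs that contain the minimum itself have no gap; there are at most \<open>2 * n\<close> ordered ones.\<close>

lemma path_sum_le:
  assumes n: "n \<ge> 1" and inj: "inj_on x (diag_idx n)"
  shows "(\<Sum>i\<in>{1..n}. \<Sum>m\<in>{1..n} - {i}. qmin (zmin n x) * edgep (1/2) (zmin n x) (x (i, i)) (x (m, m)))
    \<le> 2 * real n * qmin (zmin n x) ^ 2 + triple_sum (diag_idx n) 0 path_kernel x"
proof -
  define D where "D = diag_idx n"
  define z where "z = zmin n x"
  define f where "f b c = qmin z * edgep (1/2) z (x b) (x c)" for b c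
  have f0: "0 \<le> f b c" for b c by (simp add: f_def)
  obtain i where i: "i \<in> {1..n}" "mat_of x i i = zord n (mat_of x) 1" using zmin_attained[OF n] by blast
  define a where "a = (i, i)"
  have a: "a \<in> D" "x a = z" using i by (auto simp: a_def D_def diag_idx_def mat_of_def z_def)
  have lt: "z < x b" if b: "b \<in> D - {a}" for b
  proof -
    obtain j where j: "b = (j, j)" "j \<in> {1..n}" using b by (auto simp: D_def diag_idx_def)
    have "z \<le> mat_of x j j" unfolding z_def by (rule zmin_le[OF j(2)])
    moreover have "x b \<noteq> x a" using inj b a(1) by (auto simp: inj_on_def D_def)
    ultimately show ?thesis using a(2) j(1) by (simp add: mat_of_def)
  qed
  have min_a: "min_at D x a" unfolding min_at_def a(2) using lt by blast
  have fb: "f b c \<le> qmin z ^ 2" if "z \<le> x b" "z \<le> x c" for b c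
    using edgep_le_qmin[of "1/2" z "x b" "x c"] that by (simp add: f_def power2_eq_square mult_left_mono)
  have le: "z \<le> x b" if "b \<in> D" for b using lt[of b] that a by (cases "b = a") auto
  have bij: "bij_betw (\<lambda>i. (i, i)) ({1..n} - A) (D - (\<lambda>i. (i, i)) ` A)" if "A \<subseteq> {1..n}" for A
    using that by (auto simp: bij_betw_def inj_on_def D_def diag_idx_def)
  have "(\<Sum>i\<in>{1..n}. \<Sum>m\<in>{1..n} - {i}. f (i, i) (m, m)) = (\<Sum>i\<in>{1..n}. \<Sum>c\<in>D - {(i, i)}. f (i, i) c)"
  proof (rule sum.cong[OF refl])
    fix i assume "i \<in> {1..n}"
    then show "(\<Sum>m\<in>{1..n} - {i}. f (i, i) (m, m)) = (\<Sum>c\<in>D - {(i, i)}. f (i, i) c)"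
      using sum.reindex_bij_betw[OF bij[of "{i}"], of "f (i, i)"] by simp
  qed
  also have "\<dots> = (\<Sum>b\<in>D. \<Sum>c\<in>D - {b}. f b c)"
    using sum.reindex_bij_betw[OF bij[of "{}"], of "\<lambda>b. \<Sum>c\<in>D - {b}. f b c"] by simp
  also have "\<dots> = (\<Sum>c\<in>D - {a}. f a c) + (\<Sum>b\<in>D - {a}. \<Sum>c\<in>D - {b}. f b c)"
    using a(1) by (subst sum.remove[of _ a]) (auto simp: D_def)
  also have "(\<Sum>b\<in>D - {a}. \<Sum>c\<in>D - {b}. f b c) = (\<Sum>b\<in>D - {a}. f b a + (\<Sum>c\<in>D - {a, b}. f b c))"
  proof (rule sum.cong[OF refl])
    fix b assume b: "b \<in> D - {a}"
    have "D - {b} - {a} = D - {a, b}" by auto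
    then show "(\<Sum>c\<in>D - {b}. f b c) = f b a + (\<Sum>c\<in>D - {a, b}. f b c)"
      using a(1) b by (subst sum.remove[of _ a]) (auto simp: D_def)
  qed
  also have "\<dots> = (\<Sum>b\<in>D - {a}. f b a) + (\<Sum>b\<in>D - {a}. \<Sum>c\<in>D - {a, b}. f b c)"
    by (rule sum.distrib)
  also have "(\<Sum>b\<in>D - {a}. \<Sum>c\<in>D - {a, b}. f b c) = triple_sum D 0 path_kernel x"
  proof -
    have na: "\<not> min_at D x b" if "b \<in> D - {a}" for b
    proof
      assume "min_at D x b"
      then have "x b < x a" using a(1) that by (auto simp: min_at_def)
      then show False using lt[OF that] a(2) by simp
    qed
    have "triple_sum D 0 path_kernel x = (\<Sum>b\<in>D - {a}. \<Sum>c\<in>D - {a, b}. path_kernel (x a) (x b) (x c))"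
    proof -
      have "finite D" by (simp add: D_def)
      then show ?thesis unfolding triple_sum_def using na min_a a(1) by (subst sum.remove[of _ a]) auto
    qed
    also have "\<dots> = (\<Sum>b\<in>D - {a}. \<Sum>c\<in>D - {a, b}. f b c)"
      using lt a(2) by (intro sum.cong refl) (auto simp: path_kernel_def f_def)
    finally show ?thesis ..
  qed
  also have "(\<Sum>c\<in>D - {a}. f a c) \<le> (\<Sum>c\<in>D - {a}. qmin z ^ 2)"
    using le a by (intro sum_mono fb) auto
  also have "(\<Sum>b\<in>D - {a}. f b a) \<le> (\<Sum>c\<in>D - {a}. qmin z ^ 2)"
    using le a by (intro sum_mono fb) auto
  also have "(\<Sum>c\<in>D - {a}. qmin z ^ 2) \<le> real n * qmin z ^ 2"
  proof -
    have "card (D - {a}) \<le> n" using card_mono[of D "D - {a}"] by (simp add: D_def)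
    then show ?thesis by (simp add: mult_right_mono)
  qed
  finally show ?thesis by (simp add: f_def D_def z_def)
qed

text \<open>Union bounds over the choices of a row with three entries below the minimum, and of a row with two small
  entries, one of them meeting the requirement with \<open>\<kappa> = 1/2\<close>.\<close>

theorem large_support_prob:
  assumes n: "n \<ge> 1"
  shows "measure (goe_law n) {q\<in>space (goe_law n). kappa n (mat_of q) \<ge> 3} \<le>
    real n ^ 4 * (real n * lap (\<lambda>z. qmin z ^ 3) 1 n) +
    real n * (2 * real n * (real n * lap (\<lambda>z. qmin z ^ 2) 1 n) + (\<integral>x. triple_sum (diag_idx n) 0 path_kernel x \<partial>sample (diag_idx n)))"
proof -
  interpret W: prob_space "goe_law n" by (rule prob_space_goe_law)
  define D where "D = diag_idx n"
  note zmin_measurable[OF n, measurable]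
  define N where "N = {1..n}"
  define SI where "SI = Sigma N (\<lambda>i. {A. A \<subseteq> N - {i} \<and> card A = 3})"
  define PI where "PI = Sigma N (\<lambda>i. Sigma (N - {i}) (\<lambda>m. N - {i, m}))"
  define S where "S p = {q\<in>space (goe_law n). \<forall>e\<in>edge_idx (fst p) ` snd p. q e \<le> zmin n (restrict q D)}" for p
  define t where "t i m e x = (if e = edge_idx i m then zmin n x - 1/2 * sqrt ((x (i, i) - zmin n x) * (x (m, m) - zmin n x)) else zmin n x)" for i m e x
  define P where "P p = {q\<in>space (goe_law n). \<forall>e\<in>{edge_idx (fst p) (fst (snd p)), edge_idx (fst p) (snd (snd p))}.
      q e \<le> t (fst p) (fst (snd p)) e (restrict q D)}" for p
  have finSI: "finite SI" unfolding SI_def N_def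
    by (intro finite_SigmaI) auto
  have finPI: "finite PI" unfolding PI_def N_def by auto
  have Sm: "measure (goe_law n) (S p) = real n * lap (\<lambda>z. qmin z ^ 3) 1 n \<and> S p \<in> sets (goe_law n)" if "p \<in> SI" for p
  proof -
    obtain i A where p: "p = (i, A)" "i \<in> N" "A \<subseteq> N - {i}" "card A = 3" using \<open>p \<in> SI\<close> by (auto simp: SI_def)
    have E: "edge_idx i ` A \<subseteq> off_idx n"
    proof
      fix e assume "e \<in> edge_idx i ` A"
      then obtain m where "m \<in> A" and e: "e = edge_idx i m" by blast
      then have "m \<in> {1..n} - {i}" "i \<in> {1..n}" using p(2,3) unfolding N_def by blast+
      then show "e \<in> off_idx n" using edge_idx_off[of i n m] e by simp
    qed
    have card: "card (edge_idx i ` A) = 3"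
      using p(4) by (subst card_image) (auto simp: inj_on_def edge_idx_inj)
    note gt = goe_threshold_prob[OF E, where t = "\<lambda>_ x. zmin n x", folded D_def, OF zmin_measurable[OF n, folded D_def]]
    have "measure (goe_law n) (S p) = (\<integral>x. (\<Prod>e\<in>edge_idx i ` A. qmin (zmin n x)) \<partial>sample D)"
      unfolding S_def p(1) fst_conv snd_conv by (rule gt(1))
    also have "\<dots> = (\<integral>x. qmin (zmin n x) ^ 3 \<partial>sample D)" by (simp add: card)
    also have "\<dots> = real n * lap (\<lambda>z. qmin z ^ 3) 1 n"
      unfolding D_def by (rule zmin_integral(2)[OF n, where f = "\<lambda>z. qmin z ^ 3"]) (auto intro: power_le_one)
    finally show ?thesis unfolding S_def p(1) fst_conv snd_conv using gt(2) by blast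
  qed
  have Pm: "measure (goe_law n) (P p) = (\<integral>x. qmin (zmin n x) * edgep (1/2) (zmin n x) (x (fst p, fst p)) (x (fst (snd p), fst (snd p))) \<partial>sample D) \<and> P p \<in> sets (goe_law n)"
    if "p \<in> PI" for p
  proof -
    obtain i m k where p: "p = (i, m, k)" "i \<in> N" "m \<in> N - {i}" "k \<in> N - {i, m}" using \<open>p \<in> PI\<close> by (auto simp: PI_def)
    have E: "{edge_idx i m, edge_idx i k} \<subseteq> off_idx n"
      using p edge_idx_off[of i n m] edge_idx_off[of i n k] by (auto simp: N_def)
    have ne: "edge_idx i m \<noteq> edge_idx i k" using p by (auto simp: edge_idx_inj)
    have tm: "t i m e \<in> borel_measurable (sample D)" for e
    proof -
      have [measurable]: "(\<lambda>x. x (i, i)) \<in> borel_measurable (sample D)" "(\<lambda>x. x (m, m)) \<in> borel_measurable (sample D)"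
        unfolding D_def using p by (auto simp: N_def intro!: diag_component)
      have [measurable]: "zmin n \<in> borel_measurable (sample D)" unfolding D_def by (rule zmin_measurable[OF n])
      show ?thesis unfolding t_def by measurable
    qed
    note gt = goe_threshold_prob[OF E, where t = "t i m", folded D_def, OF tm]
    have "measure (goe_law n) (P p) = (\<integral>x. (\<Prod>e\<in>{edge_idx i m, edge_idx i k}. Phi (sqrt 2 * t i m e x)) \<partial>sample D)"
      unfolding P_def p(1) fst_conv snd_conv by (rule gt(1))
    also have "\<dots> = (\<integral>x. qmin (zmin n x) * edgep (1/2) (zmin n x) (x (i, i)) (x (m, m)) \<partial>sample D)"
    proof -
      have "(\<Prod>e\<in>{edge_idx i m, edge_idx i k}. Phi (sqrt 2 * t i m e x)) = qmin (zmin n x) * edgep (1/2) (zmin n x) (x (i, i)) (x (m, m))" for x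
        using ne by (simp add: t_def edgep_def mult.commute)
      then show ?thesis by simp
    qed
    finally show ?thesis unfolding P_def p(1) fst_conv snd_conv using gt(2) by blast
  qed
  have "measure (goe_law n) {q\<in>space (goe_law n). kappa n (mat_of q) \<ge> 3} \<le> measure (goe_law n) ((\<Union>p\<in>SI. S p) \<union> (\<Union>p\<in>PI. P p))"
  proof (rule W.finite_measure_mono_AE)
    show "AE q in goe_law n. q \<in> {q\<in>space (goe_law n). kappa n (mat_of q) \<ge> 3} \<longrightarrow> q \<in> (\<Union>p\<in>SI. S p) \<union> (\<Union>p\<in>PI. P p)"
      using AE_unique_minimizer[OF n]
    proof eventually_elim
      case (elim q)
      show ?case
      proof
        assume q: "q \<in> {q\<in>space (goe_law n). kappa n (mat_of q) \<ge> 3}"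
        obtain i0 where i0: "i0 \<in> {1..n}" "mat_of q i0 i0 = zmin n q" using zmin_attained[OF n] by blast
        have zr: "zmin n (restrict q D) = zmin n q" unfolding D_def by (rule zord_restrict)
        have dr: "restrict q D (i, i) = mat_of q i i" if "i \<in> {1..n}" for i
          using that by (auto simp: D_def diag_idx_def mat_of_def)
        have "star_event n (mat_of q) (zmin n q) \<or> path_event n (mat_of q) (zmin n q)"
          using q by (intro kappa_events(4)[OF symm_mat_of elim zmin_le i0]) auto
        then show "q \<in> (\<Union>p\<in>SI. S p) \<union> (\<Union>p\<in>PI. P p)"
        proof
          assume "star_event n (mat_of q) (zmin n q)"
          then obtain i A where iA: "i \<in> N" "A \<subseteq> N - {i}" "card A = 3" "\<forall>m\<in>A. mat_of q i m < zmin n q"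
            unfolding star_event_def N_def by blast
          then have "(i, A) \<in> SI" by (simp add: SI_def)
          moreover have "q \<in> S (i, A)" using q iA(4) by (auto simp: S_def zr mat_of_edge_idx less_imp_le simp del: One_nat_def)
          ultimately show ?thesis by blast
        next
          assume "path_event n (mat_of q) (zmin n q)"
          then obtain i m k where imk: "i \<in> N" "m \<in> N - {i}" "k \<in> N - {i, m}" "mat_of q i k < zmin n q"
             "mat_of q i m \<le> zmin n q - 1/2 * sqrt ((mat_of q i i - zmin n q) * (mat_of q m m - zmin n q))"
            unfolding path_event_def N_def by blast
          then have "(i, m, k) \<in> PI" by (auto simp: PI_def)
          moreover have "q \<in> P (i, m, k)"
          proof -
            have "edge_idx i k \<noteq> edge_idx i m" using imk by (auto simp: edge_idx_inj)
            moreover have "i \<in> {1..n}" "m \<in> {1..n}" using imk by (auto simp: N_def)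
            ultimately show ?thesis using q imk(4,5) dr[of i] dr[of m]
              by (simp add: P_def t_def zr mat_of_edge_idx[symmetric] less_imp_le del: One_nat_def)
          qed
          ultimately show ?thesis by blast
        qed
      qed
    qed
    show "(\<Union>p\<in>SI. S p) \<union> (\<Union>p\<in>PI. P p) \<in> sets (goe_law n)"
      using finSI finPI Sm Pm by (intro sets.Un sets.finite_UN) auto
  qed
  also have "\<dots> \<le> measure (goe_law n) (\<Union>p\<in>SI. S p) + measure (goe_law n) (\<Union>p\<in>PI. P p)"
    using finSI finPI Sm Pm by (intro measure_Un_le sets.finite_UN) auto
  also have "measure (goe_law n) (\<Union>p\<in>SI. S p) \<le> (\<Sum>p\<in>SI. measure (goe_law n) (S p))"
    using finSI Sm by (intro W.finite_measure_subadditive_finite) auto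
  also have "(\<Sum>p\<in>SI. measure (goe_law n) (S p)) \<le> real n ^ 4 * (real n * lap (\<lambda>z. qmin z ^ 3) 1 n)"
  proof -
    have "(\<Sum>p\<in>SI. measure (goe_law n) (S p)) = real (card SI) * (real n * lap (\<lambda>z. qmin z ^ 3) 1 n)"
      using Sm by simp
    moreover have "card SI \<le> n ^ 4"
    proof -
      have "card SI = (\<Sum>i\<in>N. card {A. A \<subseteq> N - {i} \<and> card A = 3})"
        unfolding SI_def by (intro card_SigmaI) (auto simp: N_def)
      also have "\<dots> \<le> (\<Sum>i\<in>N. n ^ 3)"
      proof (rule sum_mono)
        fix i assume "i \<in> N"
        have "card {A. A \<subseteq> N - {i} \<and> card A = 3} = card (N - {i}) choose 3"
          by (rule n_subsets) (simp add: N_def)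
        also have "\<dots> \<le> card (N - {i}) ^ 3"
          by (cases "3 \<le> card (N - {i})") (auto intro: binomial_le_pow simp: binomial_eq_0)
        also have "\<dots> \<le> n ^ 3"
          using card_mono[of N "N - {i}"] by (intro power_mono) (auto simp: N_def)
        finally show "card {A. A \<subseteq> N - {i} \<and> card A = 3} \<le> n ^ 3" .
      qed
      also have "\<dots> = n ^ 4" by (simp add: N_def eval_nat_numeral)
      finally show ?thesis .
    qed
    then have "real (card SI) \<le> real n ^ 4" by (metis of_nat_le_iff of_nat_power)
    moreover have "0 \<le> real n * lap (\<lambda>z. qmin z ^ 3) 1 n"
      unfolding lap_def by (intro mult_nonneg_nonneg Bochner_Integration.integral_nonneg) auto
    ultimately show ?thesis by (simp add: mult_right_mono)
  qed
  also have "measure (goe_law n) (\<Union>p\<in>PI. P p) \<le> (\<Sum>p\<in>PI. measure (goe_law n) (P p))"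
    using finPI Pm by (intro W.finite_measure_subadditive_finite) auto
  also have "(\<Sum>p\<in>PI. measure (goe_law n) (P p)) \<le> real n * (2 * real n * (real n * lap (\<lambda>z. qmin z ^ 2) 1 n) + (\<integral>x. triple_sum D 0 path_kernel x \<partial>sample D))"
  proof -
    define g where "g i m x = qmin (zmin n x) * edgep (1/2) (zmin n x) (x (i, i)) (x (m, m))" for i m x
    have gi: "integrable (sample D) (g i m)" if "i \<in> N" "m \<in> N" for i m
    proof (rule PN.integrable_const_bound[where B = 1])
      show "AE x in sample D. norm (g i m x) \<le> 1" by (intro AE_I2) (auto simp: g_def intro: mult_le_one)
      have [measurable]: "(\<lambda>x. x (i, i)) \<in> borel_measurable (sample D)" "(\<lambda>x. x (m, m)) \<in> borel_measurable (sample D)"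
        unfolding D_def using that by (auto simp: N_def intro!: diag_component)
      have [measurable]: "zmin n \<in> borel_measurable (sample D)" unfolding D_def by (rule zmin_measurable[OF n])
      show "g i m \<in> borel_measurable (sample D)" unfolding g_def by measurable
    qed
    have g0: "0 \<le> (\<integral>x. g i m x \<partial>sample D)" for i m
      by (intro Bochner_Integration.integral_nonneg) (simp add: g_def)
    have "(\<Sum>p\<in>PI. measure (goe_law n) (P p)) = (\<Sum>p\<in>PI. \<integral>x. g (fst p) (fst (snd p)) x \<partial>sample D)"
      using Pm by (intro sum.cong refl) (simp add: g_def)
    also have "\<dots> = (\<Sum>i\<in>N. \<Sum>m\<in>N - {i}. \<Sum>k\<in>N - {i, m}. \<integral>x. g i m x \<partial>sample D)"
    proof -
      have fN: "finite N" by (simp add: N_def)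
      have "(\<Sum>i\<in>N. \<Sum>m\<in>N - {i}. \<Sum>k\<in>N - {i, m}. \<integral>x. g i m x \<partial>sample D)
        = (\<Sum>i\<in>N. \<Sum>p\<in>Sigma (N - {i}) (\<lambda>m. N - {i, m}). \<integral>x. g i (fst p) x \<partial>sample D)"
        by (intro sum.cong refl, subst sum.Sigma) (use fN in \<open>auto simp: case_prod_beta\<close>)
      also have "\<dots> = (\<Sum>p\<in>PI. \<integral>x. g (fst p) (fst (snd p)) x \<partial>sample D)"
        unfolding PI_def by (subst sum.Sigma) (use fN in \<open>auto simp: case_prod_beta\<close>)
      finally show ?thesis ..
    qed
    also have "\<dots> \<le> (\<Sum>i\<in>N. \<Sum>m\<in>N - {i}. real n * (\<integral>x. g i m x \<partial>sample D))"
    proof (intro sum_mono)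
      fix i m
      have "card (N - {i, m}) \<le> n" using card_mono[of N "N - {i, m}"] by (simp add: N_def)
      then show "(\<Sum>k\<in>N - {i, m}. \<integral>x. g i m x \<partial>sample D) \<le> real n * (\<integral>x. g i m x \<partial>sample D)"
        using g0 by (simp add: mult_right_mono)
    qed
    also have "\<dots> = real n * (\<integral>x. (\<Sum>i\<in>N. \<Sum>m\<in>N - {i}. g i m x) \<partial>sample D)"
    proof -
      have "(\<integral>x. (\<Sum>i\<in>N. \<Sum>m\<in>N - {i}. g i m x) \<partial>sample D) = (\<Sum>i\<in>N. \<integral>x. (\<Sum>m\<in>N - {i}. g i m x) \<partial>sample D)"
        by (intro Bochner_Integration.integral_sum Bochner_Integration.integrable_sum gi) auto
      also have "\<dots> = (\<Sum>i\<in>N. \<Sum>m\<in>N - {i}. \<integral>x. g i m x \<partial>sample D)"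
        by (intro sum.cong refl Bochner_Integration.integral_sum gi) auto
      finally show ?thesis by (simp add: sum_distrib_left)
    qed
    also have "(\<integral>x. (\<Sum>i\<in>N. \<Sum>m\<in>N - {i}. g i m x) \<partial>sample D) \<le> (\<integral>x. 2 * real n * qmin (zmin n x) ^ 2 + triple_sum D 0 path_kernel x \<partial>sample D)"
    proof (rule integral_mono_AE)
      show "integrable (sample D) (\<lambda>x. \<Sum>i\<in>N. \<Sum>m\<in>N - {i}. g i m x)"
        by (intro Bochner_Integration.integrable_sum gi) auto
      show "integrable (sample D) (\<lambda>x. 2 * real n * qmin (zmin n x) ^ 2 + triple_sum D 0 path_kernel x)"
        unfolding D_def
        by (intro Bochner_Integration.integrable_add integrable_mult_right triple_sum_integral(1)[OF finite_diag_idx card_diag_idx kernel_path]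
            zmin_integral(1)[OF n, where f = "\<lambda>z. qmin z ^ 2"]) (auto intro: power_le_one)
      show "AE x in sample D. (\<Sum>i\<in>N. \<Sum>m\<in>N - {i}. g i m x) \<le> 2 * real n * qmin (zmin n x) ^ 2 + triple_sum D 0 path_kernel x"
        using AE_inj_sample[OF finite_diag_idx, of n] unfolding D_def
        by eventually_elim (use path_sum_le[OF n] in \<open>simp add: g_def N_def\<close>)
    qed
    also have "\<dots> = 2 * real n * (real n * lap (\<lambda>z. qmin z ^ 2) 1 n) + (\<integral>x. triple_sum D 0 path_kernel x \<partial>sample D)"
    proof -
      have i1: "integrable (sample D) (\<lambda>x. qmin (zmin n x) ^ 2)"
        unfolding D_def by (rule zmin_integral(1)[OF n, where f = "\<lambda>z. qmin z ^ 2"]) (auto intro: power_le_one)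
      have i2: "integrable (sample D) (triple_sum D 0 path_kernel)"
        unfolding D_def by (rule triple_sum_integral(1)[OF finite_diag_idx card_diag_idx kernel_path])
      have "(\<integral>x. qmin (zmin n x) ^ 2 \<partial>sample D) = real n * lap (\<lambda>z. qmin z ^ 2) 1 n"
        unfolding D_def by (rule zmin_integral(2)[OF n, where f = "\<lambda>z. qmin z ^ 2"]) (auto intro: power_le_one)
      then show ?thesis using i1 i2 by simp
    qed
    finally show ?thesis by (simp add: mult_left_mono)
  qed
  finally show ?thesis unfolding D_def by linarith
qed

section \<open>Expectations of the three integrands\<close>

definition S_int :: "nat \<Rightarrow> (nat \<Rightarrow> nat \<Rightarrow> real) \<Rightarrow> real" where
  "S_int n Q = 1 - (1 - qn n Q) ^ (n - 1)"

definition A_int :: "nat \<Rightarrow> (nat \<Rightarrow> nat \<Rightarrow> real) \<Rightarrow> real" where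
  "A_int n Q = (1 - qn n Q) ^ (n - 1) * (1 - (\<Prod>j=3..n. 1 - pij n Q 2 j))"

definition B_int :: "nat \<Rightarrow> (nat \<Rightarrow> nat \<Rightarrow> real) \<Rightarrow> real" where
  "B_int n Q = (1 - qn n Q) ^ (n - 1) * (\<Prod>j=3..n. 1 - pij n Q 2 j) *
     (1 - (\<Prod>(i, j)\<in>{(i, j). 3 \<le> i \<and> i < j \<and> j \<le> n}. 1 - pij n Q i j))"

definition diag_mean :: "nat \<Rightarrow> ((nat \<Rightarrow> nat \<Rightarrow> real) \<Rightarrow> real) \<Rightarrow> real" where
  "diag_mean n F = (\<integral>x. F (mat_of x) \<partial>sample (diag_idx n))"

lemma pij_measurable:
  assumes "n \<ge> 1" "i \<in> {1..n}" "j \<in> {1..n}"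
  shows "(\<lambda>x. pij n (mat_of x) i j) \<in> borel_measurable (sample (diag_idx n))"
  unfolding pij_edgep using assms by (intro edgep_measurable zord_sample_measurable) auto

lemma qn_measurable:
  assumes "n \<ge> 1" shows "(\<lambda>x. qn n (mat_of x)) \<in> borel_measurable (sample (diag_idx n))"
  unfolding qn_qmin by (rule measurable_compose[OF zmin_measurable[OF assms]]) measurable

lemma pij_range: "0 \<le> pij n Q i j" "pij n Q i j \<le> 1" and qn_range: "0 \<le> qn n Q" "qn n Q \<le> 1"
  by (simp_all add: pij_edgep qn_qmin)

lemma int_measurable:
  assumes n: "n \<ge> 3"
  shows "(\<lambda>x. S_int n (mat_of x)) \<in> borel_measurable (sample (diag_idx n))"
    "(\<lambda>x. A_int n (mat_of x)) \<in> borel_measurable (sample (diag_idx n))"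
    "(\<lambda>x. B_int n (mat_of x)) \<in> borel_measurable (sample (diag_idx n))"
proof -
  have [measurable]: "(\<lambda>x. qn n (mat_of x)) \<in> borel_measurable (sample (diag_idx n))"
    using n by (intro qn_measurable) auto
  have [measurable]: "(\<lambda>x. \<Prod>j=3..n. 1 - pij n (mat_of x) 2 j) \<in> borel_measurable (sample (diag_idx n))"
    using n by (intro borel_measurable_prod borel_measurable_diff borel_measurable_const pij_measurable) auto
  have "(\<lambda>x. \<Prod>e\<in>{(i, j). 3 \<le> i \<and> i < j \<and> j \<le> n}. 1 - pij n (mat_of x) (fst e) (snd e)) \<in> borel_measurable (sample (diag_idx n))"
    using n by (intro borel_measurable_prod borel_measurable_diff borel_measurable_const pij_measurable) auto
  then have [measurable]: "(\<lambda>x. \<Prod>(i, j)\<in>{(i, j). 3 \<le> i \<and> i < j \<and> j \<le> n}. 1 - pij n (mat_of x) i j) \<in> borel_measurable (sample (diag_idx n))"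
    by (simp add: case_prod_beta)
  show "(\<lambda>x. S_int n (mat_of x)) \<in> borel_measurable (sample (diag_idx n))"
    "(\<lambda>x. A_int n (mat_of x)) \<in> borel_measurable (sample (diag_idx n))"
    "(\<lambda>x. B_int n (mat_of x)) \<in> borel_measurable (sample (diag_idx n))"
    unfolding S_int_def A_int_def B_int_def by measurable
qed

lemma int_range:
  "0 \<le> S_int n Q" "S_int n Q \<le> 1" "0 \<le> A_int n Q" "A_int n Q \<le> 1" "0 \<le> B_int n Q" "B_int n Q \<le> 1"
proof -
  have u: "0 \<le> (1 - qn n Q) ^ (n - 1)" "(1 - qn n Q) ^ (n - 1) \<le> 1"
    using qn_range[of n Q] by (auto intro: power_le_one)
  have v: "0 \<le> (\<Prod>j=3..n. 1 - pij n Q 2 j)" "(\<Prod>j=3..n. 1 - pij n Q 2 j) \<le> 1"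
    using pij_range by (auto intro!: prod_nonneg prod_le_1)
  have w: "0 \<le> (\<Prod>(i, j)\<in>{(i, j). 3 \<le> i \<and> i < j \<and> j \<le> n}. 1 - pij n Q i j)"
    "(\<Prod>(i, j)\<in>{(i, j). 3 \<le> i \<and> i < j \<and> j \<le> n}. 1 - pij n Q i j) \<le> 1"
    using pij_range by (auto simp: case_prod_beta intro!: prod_nonneg prod_le_1)
  show "0 \<le> S_int n Q" "S_int n Q \<le> 1" using u by (auto simp: S_int_def)
  show "0 \<le> A_int n Q" "A_int n Q \<le> 1" using u v by (auto simp: A_int_def intro!: mult_le_one)
  show "0 \<le> B_int n Q" "B_int n Q \<le> 1" using u v w by (auto simp: B_int_def intro!: mult_le_one)
qed

lemma int_integrable:
  assumes n: "n \<ge> 3"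
  shows "integrable (sample (diag_idx n)) (\<lambda>x. S_int n (mat_of x))"
    "integrable (sample (diag_idx n)) (\<lambda>x. A_int n (mat_of x))"
    "integrable (sample (diag_idx n)) (\<lambda>x. B_int n (mat_of x))"
  using int_range by (auto intro!: PN.integrable_const_bound[where B = 1] int_measurable[OF n])

lemma diag_mean_brackets:
  assumes n: "n \<ge> 3"
  defines "Y \<equiv> \<lambda>m h. (\<integral>x. triple_sum (diag_idx n) m h x \<partial>sample (diag_idx n))"
    and "e1 \<equiv> real n * lap qmin 1 n" and "e2 \<equiv> real n * lap (\<lambda>z. qmin z ^ 2) 1 n"
  shows "diag_mean n (S_int n) \<le> real (n - 1) * e1" "real (n - 1) * e1 - real n ^ 2 * e2 \<le> diag_mean n (S_int n)"
    "diag_mean n (A_int n) \<le> Y 0 near_kernel + Y 0 far_kernel"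
    "Y 0 near_kernel - Y 1 near_kernel - 2 * (real n ^ 2 * e2) \<le> diag_mean n (A_int n)"
    "diag_mean n (B_int n) \<le> Y 1 near_kernel + Y 0 far_kernel"
    "Y 1 near_kernel - Y 2 near_kernel - 3 * (real n ^ 2 * e2) \<le> diag_mean n (B_int n)"
proof -
  define D where "D = diag_idx n"
  have n1: "n \<ge> 1" using n by simp
  define q where "q x = qn n (mat_of x)" for x
  have qz: "q = (\<lambda>x. qmin (zmin n x))" by (simp add: q_def qn_qmin fun_eq_iff)
  have q1: "integrable (sample D) q" "(\<integral>x. q x \<partial>sample D) = e1"
    using zmin_integral[OF n1, of qmin] unfolding qz D_def e1_def by auto
  have q2: "integrable (sample D) (\<lambda>x. q x ^ 2)" "(\<integral>x. q x ^ 2 \<partial>sample D) = e2"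
    using zmin_integral[OF n1, of "\<lambda>z. qmin z ^ 2"] unfolding qz D_def e2_def by (auto simp: power_le_one)
  have tI: "integrable (sample D) (triple_sum D m h)" if "kernel h" for m h
    unfolding D_def by (rule triple_sum_integral(1)[OF finite_diag_idx card_diag_idx that])
  note tn = tI[OF kernel_near] and tf = tI[OF kernel_far]
  have ae: "AE x in sample D.
     S_int n (mat_of x) \<le> real (n - 1) * q x \<and> real (n - 1) * q x - (real n * q x)\<^sup>2 \<le> S_int n (mat_of x) \<and>
     A_int n (mat_of x) \<le> triple_sum D 0 near_kernel x + triple_sum D 0 far_kernel x \<and>
     triple_sum D 0 near_kernel x - triple_sum D 1 near_kernel x - 2 * (real n * q x)\<^sup>2 \<le> A_int n (mat_of x) \<and>
     B_int n (mat_of x) \<le> triple_sum D 1 near_kernel x + triple_sum D 0 far_kernel x \<and>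
     triple_sum D 1 near_kernel x - triple_sum D 2 near_kernel x - 3 * (real n * q x)\<^sup>2 \<le> B_int n (mat_of x)"
    using AE_inj_sample[OF finite_diag_idx, of n, folded D_def]
  proof eventually_elim
    case (elim x)
    obtain s where s: "bij_betw s {1..n} {1..n}" "\<And>k. k \<in> {1..n} \<Longrightarrow> zord n (mat_of x) k = mat_of x (s k) (s k)"
      "\<And>i j. i \<in> {1..n} \<Longrightarrow> j \<in> {1..n} \<Longrightarrow> i \<le> j \<Longrightarrow> zord n (mat_of x) i \<le> zord n (mat_of x) j"
      by (rule zord_enum[of n "mat_of x"]) (rule that)
    define \<pi> where "\<pi> k = (s k, s k)" for k
    have bD: "bij_betw (\<lambda>i. (i, i)) {1..n} D" by (auto simp: bij_betw_def inj_on_def D_def diag_idx_def)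
    have \<pi>: "bij_betw \<pi> {1..n} D"
      using bij_betw_trans[OF s(1) bD] unfolding \<pi>_def comp_def .
    have y: "zord n (mat_of x) k = x (\<pi> k)" if "k \<in> {1..n}" for k
      using s(2)[OF that] by (simp add: \<pi>_def mat_of_def)
    have mono: "zord n (mat_of x) i < zord n (mat_of x) j" if "i \<in> {1..n}" "j \<in> {1..n}" "i < j" for i j
    proof -
      have "\<pi> i \<noteq> \<pi> j" using inj_on_eq_iff[OF bij_betw_imp_inj_on[OF \<pi>] that(1,2)] that(3) by simp
      moreover have "\<pi> i \<in> D" "\<pi> j \<in> D" using bij_betw_apply[OF \<pi>] that by auto
      ultimately have "x (\<pi> i) \<noteq> x (\<pi> j)" using inj_on_eq_iff[OF elim] by blast
      then have "zord n (mat_of x) i \<noteq> zord n (mat_of x) j" using y that by simp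
      moreover have "zord n (mat_of x) i \<le> zord n (mat_of x) j" using that by (intro s(3)) auto
      ultimately show ?thesis by simp
    qed
    have nl: "w < c" if "near_kernel z w c \<noteq> 0" for z w c
      using that near_less[of z w c] by (auto simp: near_kernel_def split: if_splits)
    have fl: "w < c" if "far_kernel z w c \<noteq> 0" for z w c
      using that by (auto simp: far_kernel_def split: if_splits)
    have ts: "triple_sum D m h x = (\<Sum>i=m+2..n. \<Sum>j=i+1..n. h (zord n (mat_of x) 1) (zord n (mat_of x) i) (zord n (mat_of x) j))"
      if "\<And>z w c. h z w c \<noteq> 0 \<Longrightarrow> w < c" for m h
      by (rule triple_sum_sorted[where \<pi> = \<pi>]) (use \<pi> y mono n1 that in blast)+
    have tsn: "triple_sum D m near_kernel x = (\<Sum>i=m+2..n. \<Sum>j=i+1..n. near_kernel (zord n (mat_of x) 1) (zord n (mat_of x) i) (zord n (mat_of x) j))" for m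
      by (rule ts) (rule nl)
    have tsf: "triple_sum D m far_kernel x = (\<Sum>i=m+2..n. \<Sum>j=i+1..n. far_kernel (zord n (mat_of x) 1) (zord n (mat_of x) i) (zord n (mat_of x) j))" for m
      by (rule ts) (rule fl)
    show ?case
      using integrand_brackets[OF n mono] unfolding S_int_def A_int_def B_int_def q_def
      by (simp add: tsn tsf)
  qed
  have nn: "(real n * q x)\<^sup>2 = real n ^ 2 * q x ^ 2" for x by (rule power_mult_distrib)
  note ii = int_integrable[OF n, folded D_def]
  note mono = integral_mono_AE
  have "diag_mean n (S_int n) \<le> (\<integral>x. real (n - 1) * q x \<partial>sample D)"
    unfolding diag_mean_def D_def[symmetric] using ae by (intro mono ii integrable_mult_right q1) auto
  then show "diag_mean n (S_int n) \<le> real (n - 1) * e1" using q1 by simp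
  have "(\<integral>x. real (n - 1) * q x - real n ^ 2 * q x ^ 2 \<partial>sample D) \<le> diag_mean n (S_int n)"
    unfolding diag_mean_def D_def[symmetric] using ae
    by (intro mono ii Bochner_Integration.integrable_diff integrable_mult_right q1 q2) (auto simp: nn)
  then show "real (n - 1) * e1 - real n ^ 2 * e2 \<le> diag_mean n (S_int n)" using q1 q2 by simp
  have "diag_mean n (A_int n) \<le> (\<integral>x. triple_sum D 0 near_kernel x + triple_sum D 0 far_kernel x \<partial>sample D)"
    unfolding diag_mean_def D_def[symmetric] using ae by (intro mono ii Bochner_Integration.integrable_add tn tf) auto
  then show "diag_mean n (A_int n) \<le> Y 0 near_kernel + Y 0 far_kernel"
    using tn tf by (simp add: Y_def D_def)
  have "(\<integral>x. triple_sum D 0 near_kernel x - triple_sum D 1 near_kernel x - 2 * (real n ^ 2 * q x ^ 2) \<partial>sample D) \<le> diag_mean n (A_int n)"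
    unfolding diag_mean_def D_def[symmetric] using ae
    by (intro mono ii Bochner_Integration.integrable_diff integrable_mult_right tn q2) (auto simp: nn)
  then show "Y 0 near_kernel - Y 1 near_kernel - 2 * (real n ^ 2 * e2) \<le> diag_mean n (A_int n)"
    using tn[of 0] tn[of 1] q2 by (simp add: Y_def D_def)
  have "diag_mean n (B_int n) \<le> (\<integral>x. triple_sum D 1 near_kernel x + triple_sum D 0 far_kernel x \<partial>sample D)"
    unfolding diag_mean_def D_def[symmetric] using ae by (intro mono ii Bochner_Integration.integrable_add tn tf) auto
  then show "diag_mean n (B_int n) \<le> Y 1 near_kernel + Y 0 far_kernel"
    using tn tf by (simp add: Y_def D_def)
  have "(\<integral>x. triple_sum D 1 near_kernel x - triple_sum D 2 near_kernel x - 3 * (real n ^ 2 * q x ^ 2) \<partial>sample D) \<le> diag_mean n (B_int n)"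
    unfolding diag_mean_def D_def[symmetric] using ae
    by (intro mono ii Bochner_Integration.integrable_diff integrable_mult_right tn q2) (auto simp: nn)
  then show "Y 1 near_kernel - Y 2 near_kernel - 3 * (real n ^ 2 * e2) \<le> diag_mean n (B_int n)"
    using tn[of 1] tn[of 2] q2 by (simp add: Y_def D_def)
qed

text \<open>The complement of the product over all edges telescopes, \<open>1 - u * v * w = (1 - u) + u * (1 - v) + u * v * (1 - w)\<close>,
  so the three quantities add up to this probability without any error.\<close>

lemma edge_prob_sum:
  assumes n: "n \<ge> 3"
  shows "measure (goe_law n) {q\<in>space (goe_law n). edge_event n (mat_of q) (zmin n q)} =
    diag_mean n (S_int n) + diag_mean n (A_int n) + diag_mean n (B_int n)"
proof -
  have n2: "n \<ge> 2" "n \<ge> 1" using n by auto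
  have pt: "(\<Prod>(i, j)\<in>off_idx n. 1 - edgep 1 (zmin n x) (mat_of x i i) (mat_of x j j)) = 1 - (S_int n (mat_of x) + A_int n (mat_of x) + B_int n (mat_of x))" for x
    unfolding edge_product[OF n2(1)] S_int_def A_int_def B_int_def by (simp add: algebra_simps)
  show ?thesis
    unfolding edge_prob(2)[OF n2(2)] pt diag_mean_def
    using int_integrable[OF n] prob_space.prob_space[OF prob_space_sample, of "diag_idx n"] by simp
qed

section \<open>Asymptotics\<close>

lemma ratio_minus: "(\<lambda>n. real (n - k) / real n) \<longlonglongrightarrow> 1"
proof -
  have "(\<lambda>n. (real n - real k) / real n) \<longlonglongrightarrow> 1" by real_asymp
  then show ?thesis
    by (rule Lim_transform_eventually) (use eventually_ge_at_top[of k] in eventually_elim, simp add: of_nat_diff)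
qed

text \<open>\<open>B\<close> has exact order \<open>1 / err_scale\<close>, so negligible terms are those that vanish after multiplication
  by \<open>err_scale\<close>.\<close>

definition err_scale :: "nat \<Rightarrow> real" where
  "err_scale n = real n * ln (real n) powr (3/2)"

lemma err_scale_pos: "n \<ge> 2 \<Longrightarrow> err_scale n > 0"
  by (simp add: err_scale_def)

lemma qmin_asymp_powr: "((\<lambda>z. qmin z / (Phi z ^ 2 * (-z) powr 1)) \<longlongrightarrow> sqrt pi) at_bot"
  by (rule Lim_transform_eventually[OF qmin_asymp]) (use eventually_le_at_bot[of "-1"] in eventually_elim, simp)

text \<open>Every limit is an instance of \<open>laplace_minimum\<close> at the exponent supplied by the corresponding tail
  asymptotics; where the limit vanishes, the tail is compared with the scale that would give order
  \<open>1 / err_scale\<close>.\<close>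

lemma lap_limits:
  "(\<lambda>n. real n ^ 3 * ln (real n) powr (- (1/2)) * lap qmin 1 n) \<longlonglongrightarrow> 2 * sqrt (2 * pi)"
  "(\<lambda>n. real n ^ 4 * ln (real n) powr (3/2) * lap (\<lambda>z. qmin z ^ 2) 1 n) \<longlonglongrightarrow> 0"
  "(\<lambda>n. real n ^ 6 * ln (real n) powr (3/2) * lap (\<lambda>z. qmin z ^ 3) 1 n) \<longlonglongrightarrow> 0"
  "(\<lambda>n. real n ^ 4 * ln (real n) powr (1/2) * lap (kint 0 near_kernel) 3 n) \<longlonglongrightarrow> 3 * sqrt (pi / 2)"
  "(\<lambda>n. real n ^ 5 * ln (real n) powr (3/2) * lap (kint 1 near_kernel) 4 n) \<longlonglongrightarrow> 9 * sqrt (pi / 2)"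
  "(\<lambda>n. real n ^ 6 * ln (real n) powr (3/2) * lap (kint 2 near_kernel) 5 n) \<longlonglongrightarrow> 0"
  "(\<lambda>n. real n ^ 4 * ln (real n) powr (3/2) * lap (kint 0 far_kernel) 3 n) \<longlonglongrightarrow> 0"
  "(\<lambda>n. real n ^ 5 * ln (real n) powr (3/2) * lap (kint 0 path_kernel) 3 n) \<longlonglongrightarrow> 0"
proof -
  have q: "0 \<le> qmin z ^ k" "qmin z ^ k \<le> 1" for z k by (auto intro: power_le_one)
  have qm: "(\<lambda>z. qmin z ^ k) \<in> borel_measurable borel" for k by measurable
  have km: "kint p h \<in> borel_measurable borel" "0 \<le> kint p h z" "kint p h z \<le> 1" if "kernel h" for p h z
    using kint_basic[OF kernelD(1-4)[OF that]] by auto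
  have s2: "2 powr (1/2) = sqrt 2" "2 powr (-1/2) = 1 / sqrt 2" "2 powr (-3/2) = 1 / (2 * sqrt 2)"
  proof -
    show *: "2 powr (1/2) = sqrt (2::real)" by (simp add: powr_half_sqrt)
    show "2 powr (-1/2) = 1 / sqrt (2::real)" using powr_minus_divide[of 2 "1/2::real"] * by simp
    have "2 powr (-3/2) = 2 powr (-1) * 2 powr (-1/2 :: real)" by (subst powr_add[symmetric]) simp
    then show "2 powr (-3/2) = 1 / (2 * sqrt (2::real))"
      using powr_minus_divide[of 2 "1/2::real"] * by (simp add: powr_minus_divide)
  qed
  have "(\<lambda>n. real n ^ Suc 2 * ln (real n) powr (- (1/2)) * lap qmin 1 n) \<longlonglongrightarrow> sqrt pi * 2 powr (1/2) * fact 2"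
    unfolding lap_def using qm[of 1] by (intro laplace_minimum[OF _ _ _ _ _ qmin_asymp_powr]) auto
  also have "sqrt pi * 2 powr (1/2) * fact 2 = 2 * sqrt (2 * pi)"
    by (simp add: s2 real_sqrt_mult)
  finally show "(\<lambda>n. real n ^ 3 * ln (real n) powr (- (1/2)) * lap qmin 1 n) \<longlonglongrightarrow> 2 * sqrt (2 * pi)"
    by (simp add: numeral_3_eq_3)
  have "(\<lambda>n. real n ^ Suc 3 * ln (real n) powr (- (-3/2)) * lap (\<lambda>z. qmin z ^ 2) 1 n) \<longlonglongrightarrow> 0 * 2 powr (-3/2) * fact 3"
    unfolding lap_def by (intro laplace_minimum[OF _ _ qm q qmin_square_asymp]) auto
  then show "(\<lambda>n. real n ^ 4 * ln (real n) powr (3/2) * lap (\<lambda>z. qmin z ^ 2) 1 n) \<longlonglongrightarrow> 0" by simp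
  have "(\<lambda>n. real n ^ Suc 5 * ln (real n) powr (- (-3/2)) * lap (\<lambda>z. qmin z ^ 3) 1 n) \<longlonglongrightarrow> 0 * 2 powr (-3/2) * fact 5"
    unfolding lap_def by (intro laplace_minimum[OF _ _ qm q qmin_cube_asymp]) auto
  then show "(\<lambda>n. real n ^ 6 * ln (real n) powr (3/2) * lap (\<lambda>z. qmin z ^ 3) 1 n) \<longlonglongrightarrow> 0" by simp
  have "(\<lambda>n. real n ^ Suc 5 * ln (real n) powr (- (-3/2)) * lap (kint 2 near_kernel) 5 n) \<longlonglongrightarrow> 0 * 2 powr (-3/2) * fact 5"
    unfolding lap_def by (intro laplace_minimum[OF _ _ km[OF kernel_near] near_kernel_2_asymp]) auto
  then show "(\<lambda>n. real n ^ 6 * ln (real n) powr (3/2) * lap (kint 2 near_kernel) 5 n) \<longlonglongrightarrow> 0" by simp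
  have "(\<lambda>n. real n ^ Suc 3 * ln (real n) powr (- (-3/2)) * lap (kint 0 far_kernel) 3 n) \<longlonglongrightarrow> 0 * 2 powr (-3/2) * fact 3"
    unfolding lap_def by (intro laplace_minimum[OF _ _ km[OF kernel_far] far_kernel_asymp]) auto
  then show "(\<lambda>n. real n ^ 4 * ln (real n) powr (3/2) * lap (kint 0 far_kernel) 3 n) \<longlonglongrightarrow> 0" by simp
  have "(\<lambda>n. real n ^ Suc 4 * ln (real n) powr (- (-3/2)) * lap (kint 0 path_kernel) 3 n) \<longlonglongrightarrow> 0 * 2 powr (-3/2) * fact 4"
    unfolding lap_def by (intro laplace_minimum[OF _ _ km[OF kernel_path] path_kernel_asymp]) auto
  then show "(\<lambda>n. real n ^ 5 * ln (real n) powr (3/2) * lap (kint 0 path_kernel) 3 n) \<longlonglongrightarrow> 0" by simp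
  have k0: "((\<lambda>z. kint 0 near_kernel z / (Phi z ^ 3 * (-z) powr (-1))) \<longlongrightarrow> sqrt pi * (1/2)) at_bot"
    using near_kernel_asymp[of 0] by simp
  have "(\<lambda>n. real n ^ Suc 3 * ln (real n) powr (- (-1/2)) * lap (kint 0 near_kernel) 3 n) \<longlonglongrightarrow> sqrt pi * (1/2) * 2 powr (-1/2) * fact 3"
    unfolding lap_def by (intro laplace_minimum[OF _ _ km[OF kernel_near] k0]) auto
  also have "sqrt pi * (1/2) * 2 powr (-1/2) * fact 3 = 3 * sqrt (pi / 2)"
    unfolding s2 by (simp add: fact_numeral real_sqrt_divide)
  finally show "(\<lambda>n. real n ^ 4 * ln (real n) powr (1/2) * lap (kint 0 near_kernel) 3 n) \<longlonglongrightarrow> 3 * sqrt (pi / 2)" by simp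
  have k1: "((\<lambda>z. kint 1 near_kernel z / (Phi z ^ 4 * (-z) powr (-3))) \<longlongrightarrow> sqrt pi * (3/4)) at_bot"
    using near_kernel_asymp[of 1] by (simp add: fact_numeral)
  have "(\<lambda>n. real n ^ Suc 4 * ln (real n) powr (- (-3/2)) * lap (kint 1 near_kernel) 4 n) \<longlonglongrightarrow> sqrt pi * (3/4) * 2 powr (-3/2) * fact 4"
    unfolding lap_def by (intro laplace_minimum[OF _ _ km[OF kernel_near] k1]) auto
  also have "sqrt pi * (3/4) * 2 powr (-3/2) * fact 4 = 9 * sqrt (pi / 2)"
    unfolding s2 by (simp add: fact_numeral real_sqrt_divide)
  finally show "(\<lambda>n. real n ^ 5 * ln (real n) powr (3/2) * lap (kint 1 near_kernel) 4 n) \<longlonglongrightarrow> 9 * sqrt (pi / 2)" by simp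
qed

definition triples :: "nat \<Rightarrow> real" where
  "triples n = real n * (real (n - 1) * real (n - 2))"

text \<open>Falling factorials may be replaced by powers of \<open>n\<close>.\<close>

lemma ratio_transfer:
  assumes l: "f \<longlonglongrightarrow> L" and r: "g \<longlonglongrightarrow> 1"
    and eq: "\<And>n. n \<ge> 1 \<Longrightarrow> h n = f n * g n"
  shows "h \<longlonglongrightarrow> (L::real)"
proof -
  have "(\<lambda>n. f n * g n) \<longlonglongrightarrow> L" using tendsto_mult[OF l r] by simp
  then show ?thesis
    by (rule Lim_transform_eventually) (use eventually_ge_at_top[of 1] in eventually_elim, simp add: eq)
qed

lemma scaled_limits:
  "(\<lambda>n. real n * ln (real n) powr (- (1/2)) * (real (n - 1) * (real n * lap qmin 1 n))) \<longlonglongrightarrow> 2 * sqrt (2 * pi)"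
  "(\<lambda>n. real n * ln (real n) powr (1/2) * (triples n * lap (kint 0 near_kernel) 3 n)) \<longlonglongrightarrow> 3 * sqrt (pi / 2)"
  "(\<lambda>n. err_scale n * (triples n * (real (n - 3) * lap (kint 1 near_kernel) 4 n))) \<longlonglongrightarrow> 9 * sqrt (pi / 2)"
  "(\<lambda>n. err_scale n * (triples n * (real (n - 3) * real (n - 4) * lap (kint 2 near_kernel) 5 n))) \<longlonglongrightarrow> 0"
  "(\<lambda>n. err_scale n * (triples n * lap (kint 0 far_kernel) 3 n)) \<longlonglongrightarrow> 0"
  "(\<lambda>n. err_scale n * (real n ^ 2 * (real n * lap (\<lambda>z. qmin z ^ 2) 1 n))) \<longlonglongrightarrow> 0"
  "(\<lambda>n. err_scale n * (real n ^ 4 * (real n * lap (\<lambda>z. qmin z ^ 3) 1 n))) \<longlonglongrightarrow> 0"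
  "(\<lambda>n. err_scale n * (real n * (triples n * lap (kint 0 path_kernel) 3 n))) \<longlonglongrightarrow> 0"
proof -
  have d: "(\<lambda>n. real (n - 1) / real n * (real (n - 2) / real n)) \<longlonglongrightarrow> 1"
    using tendsto_mult[OF ratio_minus[of 1] ratio_minus[of 2]] by simp
  have d3: "(\<lambda>n. real (n - 1) / real n * (real (n - 2) / real n) * (real (n - 3) / real n)) \<longlonglongrightarrow> 1"
    using tendsto_mult[OF d ratio_minus[of 3]] by simp
  have d4: "(\<lambda>n. real (n - 1) / real n * (real (n - 2) / real n) * (real (n - 3) / real n) * (real (n - 4) / real n)) \<longlonglongrightarrow> 1"
    using tendsto_mult[OF d3 ratio_minus[of 4]] by simp
  show "(\<lambda>n. real n * ln (real n) powr (- (1/2)) * (real (n - 1) * (real n * lap qmin 1 n))) \<longlonglongrightarrow> 2 * sqrt (2 * pi)"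
    by (rule ratio_transfer[OF lap_limits(1) ratio_minus[of 1]]) (simp add: power3_eq_cube)
  show "(\<lambda>n. real n * ln (real n) powr (1/2) * (triples n * lap (kint 0 near_kernel) 3 n)) \<longlonglongrightarrow> 3 * sqrt (pi / 2)"
    by (rule ratio_transfer[OF lap_limits(4) d]) (simp add: triples_def power4_eq_xxxx)
  show "(\<lambda>n. err_scale n * (triples n * (real (n - 3) * lap (kint 1 near_kernel) 4 n))) \<longlonglongrightarrow> 9 * sqrt (pi / 2)"
    by (rule ratio_transfer[OF lap_limits(5) d3]) (simp add: triples_def err_scale_def eval_nat_numeral del: diff_Suc_Suc diff_Suc_eq_diff_pred)
  show "(\<lambda>n. err_scale n * (triples n * (real (n - 3) * real (n - 4) * lap (kint 2 near_kernel) 5 n))) \<longlonglongrightarrow> 0"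
    by (rule ratio_transfer[OF lap_limits(6) d4]) (simp add: triples_def err_scale_def power_numeral_reduce)
  show "(\<lambda>n. err_scale n * (triples n * lap (kint 0 far_kernel) 3 n)) \<longlonglongrightarrow> 0"
    by (rule ratio_transfer[OF lap_limits(7) d]) (simp add: triples_def err_scale_def power4_eq_xxxx)
  show "(\<lambda>n. err_scale n * (real n ^ 2 * (real n * lap (\<lambda>z. qmin z ^ 2) 1 n))) \<longlonglongrightarrow> 0"
    by (rule ratio_transfer[OF lap_limits(2) tendsto_const]) (simp add: err_scale_def power4_eq_xxxx power2_eq_square)
  show "(\<lambda>n. err_scale n * (real n ^ 4 * (real n * lap (\<lambda>z. qmin z ^ 3) 1 n))) \<longlonglongrightarrow> 0"
    by (rule ratio_transfer[OF lap_limits(3) tendsto_const]) (simp add: err_scale_def power_numeral_reduce)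
  show "(\<lambda>n. err_scale n * (real n * (triples n * lap (kint 0 path_kernel) 3 n))) \<longlonglongrightarrow> 0"
    by (rule ratio_transfer[OF lap_limits(8) d]) (simp add: triples_def err_scale_def power_numeral_reduce)
qed

section \<open>Limits of the three expectations and of the remainder\<close>

text \<open>A term of order \<open>1 / err_scale\<close> is negligible on the coarser scales of \<open>A\<close> and \<open>S\<close>.\<close>

lemma scale_down:
  assumes "(\<lambda>n. err_scale n * f n) \<longlonglongrightarrow> L"
  shows "(\<lambda>n. real n * ln (real n) powr (1/2) * f n) \<longlonglongrightarrow> 0"
    and "(\<lambda>n. real n * ln (real n) powr (- (1/2)) * f n) \<longlonglongrightarrow> 0"
proof -
  have l: "(\<lambda>n. 1 / ln (real n)) \<longlonglongrightarrow> 0" "(\<lambda>n. 1 / ln (real n) ^ 2) \<longlonglongrightarrow> 0" by real_asymp+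
  have e: "ln (real n) powr (1/2) = ln (real n) powr (3/2) * (1 / ln (real n))"
    "ln (real n) powr (- (1/2)) = ln (real n) powr (3/2) * (1 / ln (real n) ^ 2)" if "n \<ge> 2" for n
  proof -
    have pos: "ln (real n) > 0" using that by simp
    have h1: "ln (real n) powr (3/2) = ln (real n) powr (1/2) * ln (real n)"
      using powr_add[of "ln (real n)" "1/2" 1] pos by simp
    have h2: "ln (real n) powr (3/2) = ln (real n) powr (- (1/2)) * ln (real n) ^ 2"
      using powr_add[of "ln (real n)" "- (1/2)" 2] pos by (simp add: powr_numeral)
    show "ln (real n) powr (1/2) = ln (real n) powr (3/2) * (1 / ln (real n))" unfolding h1 using pos by simp
    show "ln (real n) powr (- (1/2)) = ln (real n) powr (3/2) * (1 / ln (real n) ^ 2)" unfolding h2 using pos by simp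
  qed
  have "(\<lambda>n. err_scale n * f n * (1 / ln (real n))) \<longlonglongrightarrow> 0"
    using tendsto_mult[OF assms l(1)] by simp
  then show "(\<lambda>n. real n * ln (real n) powr (1/2) * f n) \<longlonglongrightarrow> 0"
    by (rule Lim_transform_eventually) (use eventually_ge_at_top[of 2] in eventually_elim, simp add: e err_scale_def)
  have "(\<lambda>n. err_scale n * f n * (1 / ln (real n) ^ 2)) \<longlonglongrightarrow> 0"
    using tendsto_mult[OF assms l(2)] by simp
  then show "(\<lambda>n. real n * ln (real n) powr (- (1/2)) * f n) \<longlonglongrightarrow> 0"
    by (rule Lim_transform_eventually) (use eventually_ge_at_top[of 2] in eventually_elim, simp add: e err_scale_def)
qed

lemma scaled_sandwich:
  fixes f :: "nat \<Rightarrow> real"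
  assumes w: "\<And>n. 0 \<le> w n" and b: "\<And>n. n \<ge> 3 \<Longrightarrow> l n \<le> f n \<and> f n \<le> u n"
    and l: "(\<lambda>n. w n * l n) \<longlonglongrightarrow> L" and u: "(\<lambda>n. w n * u n) \<longlonglongrightarrow> L"
  shows "(\<lambda>n. w n * f n) \<longlonglongrightarrow> L"
proof (rule tendsto_sandwich[OF _ _ l u])
  show "\<forall>\<^sub>F n in sequentially. w n * l n \<le> w n * f n"
    using eventually_ge_at_top[of 3] by eventually_elim (use b w in \<open>auto intro: mult_left_mono\<close>)
  show "\<forall>\<^sub>F n in sequentially. w n * f n \<le> w n * u n"
    using eventually_ge_at_top[of 3] by eventually_elim (use b w in \<open>auto intro: mult_left_mono\<close>)
qed

text \<open>The near sums over ranks from two and from three give \<open>A\<close> and \<open>B\<close>; the sums one rank higher, the far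
  sums and the quadratic corrections vanish on the relevant scale.\<close>

theorem diag_mean_limits:
  "(\<lambda>n. real n * ln (real n) powr (- (1/2)) * diag_mean n (S_int n)) \<longlonglongrightarrow> 2 * sqrt (2 * pi)"
  "(\<lambda>n. real n * ln (real n) powr (1/2) * diag_mean n (A_int n)) \<longlonglongrightarrow> 3 * sqrt (pi / 2)"
  "(\<lambda>n. err_scale n * diag_mean n (B_int n)) \<longlonglongrightarrow> 9 * sqrt (pi / 2)"
  "(\<lambda>n. err_scale n * measure (goe_law n) {q\<in>space (goe_law n). kappa n (mat_of q) \<ge> 3}) \<longlonglongrightarrow> 0"
proof -
  define S0 where "S0 n = real (n - 1) * (real n * lap qmin 1 n)" for n
  define E where "E n = real n ^ 2 * (real n * lap (\<lambda>z. qmin z ^ 2) 1 n)" for n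
  define G where "G n = real n ^ 4 * (real n * lap (\<lambda>z. qmin z ^ 3) 1 n)" for n
  define N0 where "N0 n = triples n * lap (kint 0 near_kernel) 3 n" for n
  define N1 where "N1 n = triples n * (real (n - 3) * lap (kint 1 near_kernel) 4 n)" for n
  define N2 where "N2 n = triples n * (real (n - 3) * real (n - 4) * lap (kint 2 near_kernel) 5 n)" for n
  define F where "F n = triples n * lap (kint 0 far_kernel) 3 n" for n
  define P where "P n = real n * (triples n * lap (kint 0 path_kernel) 3 n)" for n
  note defs = S0_def E_def G_def N0_def N1_def N2_def F_def P_def
  note lim = scaled_limits[folded defs]
  define r where "r n = measure (goe_law n) {q\<in>space (goe_law n). kappa n (mat_of q) \<ge> 3}" for n
  define Y where "Y n m h = (\<integral>x. triple_sum (diag_idx n) m h x \<partial>sample (diag_idx n))" for n m h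
  note ti = triple_sum_integral[OF finite_diag_idx card_diag_idx]
  have Y: "Y n 0 near_kernel = N0 n" "Y n 1 near_kernel \<le> N1 n" "N1 n - N2 n \<le> Y n 1 near_kernel"
    "Y n 2 near_kernel \<le> N2 n" "Y n 0 far_kernel = F n" "real n * Y n 0 path_kernel = P n" for n
    unfolding Y_def defs triples_def
    using ti(2)[OF kernel_near, of n] ti(3)[OF kernel_near, of n] ti(4)[OF kernel_near, of n] ti(5)[OF kernel_near, of n]
      ti(2)[OF kernel_far, of n] ti(2)[OF kernel_path, of n]
    by (simp_all add: right_diff_distrib)
  have b: "S0 n - E n \<le> diag_mean n (S_int n) \<and> diag_mean n (S_int n) \<le> S0 n"
    "N0 n - N1 n - 2 * E n \<le> diag_mean n (A_int n) \<and> diag_mean n (A_int n) \<le> N0 n + F n"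
    "N1 n - 2 * N2 n - 3 * E n \<le> diag_mean n (B_int n) \<and> diag_mean n (B_int n) \<le> N1 n + F n"
    "0 \<le> r n \<and> r n \<le> G n + 2 * E n + P n" if n: "n \<ge> 3" for n
  proof -
    note db = diag_mean_brackets[OF n, folded Y_def, folded S0_def E_def]
    show "S0 n - E n \<le> diag_mean n (S_int n) \<and> diag_mean n (S_int n) \<le> S0 n" using db(1,2) by simp
    show "N0 n - N1 n - 2 * E n \<le> diag_mean n (A_int n) \<and> diag_mean n (A_int n) \<le> N0 n + F n"
      using db(3,4) Y[of n] by linarith
    show "N1 n - 2 * N2 n - 3 * E n \<le> diag_mean n (B_int n) \<and> diag_mean n (B_int n) \<le> N1 n + F n"
      using db(5,6) Y[of n] by linarith
    have "r n \<le> G n + real n * (2 * real n * (real n * lap (\<lambda>z. qmin z ^ 2) 1 n) + Y n 0 path_kernel)"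
      using large_support_prob[of n] n unfolding r_def G_def Y_def by simp
    also have "\<dots> = G n + 2 * E n + real n * Y n 0 path_kernel"
      by (simp add: E_def power2_eq_square algebra_simps)
    finally show "0 \<le> r n \<and> r n \<le> G n + 2 * E n + P n" unfolding Y by (simp add: r_def)
  qed
  note down1 = lim(3,4,5,6)[THEN scale_down(1)] and down2 = lim(6)[THEN scale_down(2)]
  have wn: "0 \<le> real n * ln (real n) powr p" "0 \<le> err_scale n" for n p by (simp_all add: err_scale_def)
  show "(\<lambda>n. real n * ln (real n) powr (- (1/2)) * diag_mean n (S_int n)) \<longlonglongrightarrow> 2 * sqrt (2 * pi)"
    by (rule scaled_sandwich[OF wn(1) b(1) _ lim(1)])
       (use tendsto_diff[OF lim(1) down2] in \<open>simp_all add: right_diff_distrib\<close>)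
  show "(\<lambda>n. real n * ln (real n) powr (1/2) * diag_mean n (A_int n)) \<longlonglongrightarrow> 3 * sqrt (pi / 2)"
    by (rule scaled_sandwich[OF wn(1) b(2)])
       (use tendsto_diff[OF tendsto_diff[OF lim(2) down1(1)] tendsto_mult_left[OF down1(4), of 2]]
          tendsto_add[OF lim(2) down1(3)] in \<open>simp_all add: algebra_simps\<close>)
  show "(\<lambda>n. err_scale n * diag_mean n (B_int n)) \<longlonglongrightarrow> 9 * sqrt (pi / 2)"
    by (rule scaled_sandwich[OF wn(2) b(3)])
       (use tendsto_diff[OF tendsto_diff[OF lim(3) tendsto_mult_left[OF lim(4), of 2]] tendsto_mult_left[OF lim(6), of 3]]
          tendsto_add[OF lim(3) lim(5)] in \<open>simp_all add: algebra_simps\<close>)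
  show "(\<lambda>n. err_scale n * measure (goe_law n) {q\<in>space (goe_law n). kappa n (mat_of q) \<ge> 3}) \<longlonglongrightarrow> 0"
    unfolding r_def[symmetric]
    by (rule scaled_sandwich[OF wn(2) b(4)])
       (use tendsto_add[OF tendsto_add[OF lim(7) tendsto_mult_left[OF lim(6), of 2]] lim(8)] in \<open>simp_all add: algebra_simps\<close>)
qed

section \<open>The support size up to the remainder\<close>

lemma kappa_set: "n \<ge> 1 \<Longrightarrow> {q\<in>space (goe_law n). P (kappa n (mat_of q))} \<in> sets (goe_law n)"
proof -
  assume n: "n \<ge> 1"
  have "real ` {k. P k} \<in> sets borel" by (rule sets.countable) auto
  from measurable_sets[OF kappa_measurable[OF n] this]
  show ?thesis by (rule back_subst[where P = "\<lambda>A. A \<in> sets (goe_law n)"]) auto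
qed

abbreviation kappa_prob :: "nat \<Rightarrow> (nat \<Rightarrow> bool) \<Rightarrow> real" where
  "kappa_prob n P \<equiv> measure (goe_law n) {q\<in>space (goe_law n). P (kappa n (mat_of q))}"

lemma kappa_prob_bounds:
  assumes n: "n \<ge> 3"
  defines "m \<equiv> diag_mean n (S_int n) + diag_mean n (A_int n) + diag_mean n (B_int n)"
  shows "\<bar>kappa_prob n (\<lambda>k. k > 1) - m\<bar> \<le> kappa_prob n (\<lambda>k. k \<ge> 3)"
    "\<bar>kappa_prob n (\<lambda>k. k = 2) - m\<bar> \<le> kappa_prob n (\<lambda>k. k \<ge> 3)"
    "kappa_prob n (\<lambda>k. k = 1) = 1 - kappa_prob n (\<lambda>k. k > 1)"
proof -
  interpret W: prob_space "goe_law n" by (rule prob_space_goe_law)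
  have n1: "n \<ge> 1" using n by simp
  define K where "K P = {q\<in>space (goe_law n). P (kappa n (mat_of q))}" for P
  define A where "A = {q\<in>space (goe_law n). edge_event n (mat_of q) (zmin n q)}"
  have [measurable]: "K P \<in> sets (goe_law n)" for P unfolding K_def by (rule kappa_set[OF n1])
  have [measurable]: "A \<in> sets (goe_law n)" unfolding A_def by (rule edge_prob(1)[OF n1])
  have m: "measure (goe_law n) A = m" unfolding A_def m_def by (rule edge_prob_sum[OF n])
  have ae: "AE q in goe_law n. kappa n (mat_of q) \<ge> 1 \<and> (q \<in> A \<longrightarrow> kappa n (mat_of q) \<ge> 2) \<and> (kappa n (mat_of q) = 2 \<longrightarrow> q \<in> A)"
    using AE_unique_minimizer[OF n1] AE_space
  proof eventually_elim
    case (elim q)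
    obtain i where i: "i \<in> {1..n}" "mat_of q i i = zmin n q" using zmin_attained[OF n1] by blast
    note ev = kappa_events[OF symm_mat_of elim(1) zmin_le i]
    show ?case using ev(1-3) elim(2) by (auto simp: A_def simp del: One_nat_def)
  qed
  have up: "measure (goe_law n) C \<le> measure (goe_law n) D + kappa_prob n (\<lambda>k. k \<ge> 3)"
    if "AE q in goe_law n. q \<in> C \<longrightarrow> q \<in> D \<union> K (\<lambda>k. k \<ge> 3)" "D \<in> sets (goe_law n)" for C D
  proof -
    have "measure (goe_law n) C \<le> measure (goe_law n) (D \<union> K (\<lambda>k. k \<ge> 3))"
      using that by (intro W.finite_measure_mono_AE) auto
    also have "\<dots> \<le> measure (goe_law n) D + measure (goe_law n) (K (\<lambda>k. k \<ge> 3))"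
      using that by (intro measure_Un_le) auto
    finally show ?thesis by (simp add: K_def)
  qed
  have "m \<le> measure (goe_law n) (K (\<lambda>k. k > 1))"
    unfolding m[symmetric] using ae by (intro W.finite_measure_mono_AE) (auto simp: K_def A_def kappa_set[OF n1, of "(<) (Suc 0)"])
  moreover have "kappa_prob n (\<lambda>k. k > 1) \<le> m + kappa_prob n (\<lambda>k. k \<ge> 3)"
    unfolding m[symmetric] using ae by (intro up) (auto simp: K_def)
  ultimately show "\<bar>kappa_prob n (\<lambda>k. k > 1) - m\<bar> \<le> kappa_prob n (\<lambda>k. k \<ge> 3)" unfolding K_def by linarith
  have "measure (goe_law n) (K (\<lambda>k. k = 2)) \<le> m"
    unfolding m[symmetric] using ae by (intro W.finite_measure_mono_AE) (auto simp: K_def)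
  moreover have "m \<le> measure (goe_law n) (K (\<lambda>k. k = 2)) + kappa_prob n (\<lambda>k. k \<ge> 3)"
    unfolding m[symmetric] using ae by (intro up) (auto simp: K_def A_def kappa_set[OF n1, of "\<lambda>k. k = 2"])
  ultimately show "\<bar>kappa_prob n (\<lambda>k. k = 2) - m\<bar> \<le> kappa_prob n (\<lambda>k. k \<ge> 3)" unfolding K_def by linarith
  have "kappa_prob n (\<lambda>k. k = 1) = measure (goe_law n) (space (goe_law n) - K (\<lambda>k. k > 1))"
    unfolding K_def[symmetric, of "\<lambda>k. k = 1"] using ae
    by (intro W.finite_measure_eq_AE) (auto simp: K_def kappa_set[OF n1, of "(<) (Suc 0)"] kappa_set[OF n1, of "\<lambda>k. k = Suc 0"])
  also have "\<dots> = 1 - measure (goe_law n) (K (\<lambda>k. k > 1))" by (rule W.prob_compl) simp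
  finally show "kappa_prob n (\<lambda>k. k = 1) = 1 - kappa_prob n (\<lambda>k. k > 1)" by (simp add: K_def)
qed

section \<open>Transfer to an arbitrary probability space\<close>

lemma quad_form_cong: "(\<And>i j. i \<in> {1..n} \<Longrightarrow> j \<in> {1..n} \<Longrightarrow> Q i j = Q' i j) \<Longrightarrow> quad_form n Q = quad_form n Q'"
  unfolding quad_form_def by (intro ext sum.cong refl) simp

text \<open>The law of these entries is a product measure, whatever the underlying probability space.\<close>

definition upper_entries :: "nat \<Rightarrow> ('a \<Rightarrow> nat \<Rightarrow> nat \<Rightarrow> real) \<Rightarrow> 'a \<Rightarrow> nat \<times> nat \<Rightarrow> real" where
  "upper_entries n Q \<omega> = (\<lambda>e\<in>tri n. Q \<omega> (fst e) (snd e))"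

lemma upper_entries_law:
  assumes g: "goe M n Q" and n: "n \<ge> 1"
  shows "upper_entries n Q \<in> M \<rightarrow>\<^sub>M goe_law n" "distr M (goe_law n) (upper_entries n Q) = goe_law n"
proof -
  interpret prob_space M using g by (simp add: goe_def)
  have d: "distributed M lborel (\<lambda>\<omega>. Q \<omega> (fst e) (snd e)) (normal_density 0 (if fst e = snd e then 1 else sqrt (1/2)))"
    if "e \<in> tri n" for e
    using g that by (auto simp: goe_def tri_def)
  have rv: "random_variable borel (\<lambda>\<omega>. Q \<omega> (fst e) (snd e))" if "e \<in> tri n" for e
    using distributed_measurable[OF d[OF that]] by simp
  have law: "distr M borel (\<lambda>\<omega>. Q \<omega> (fst e) (snd e)) = entry_law e" if "e \<in> tri n" for e
  proof -
    have "distr M borel (\<lambda>\<omega>. Q \<omega> (fst e) (snd e)) = distr M lborel (\<lambda>\<omega>. Q \<omega> (fst e) (snd e))"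
      by (rule distr_cong) auto
    then show ?thesis using distributed_distr_eq_density[OF d[OF that]] by (simp add: entry_law_def)
  qed
  have sets: "sets (Pi\<^sub>M (tri n) (\<lambda>_. borel)) = sets (goe_law n)"
    unfolding goe_law_def by (rule sets_PiM_cong) auto
  have ne: "tri n \<noteq> {}" using n by (auto simp: tri_def)
  have "(\<lambda>(i, j) \<omega>. Q \<omega> i j) = (\<lambda>e \<omega>. Q \<omega> (fst e) (snd e))" by (auto simp: fun_eq_iff)
  then have "indep_vars (\<lambda>_. borel) (\<lambda>e \<omega>. Q \<omega> (fst e) (snd e)) (tri n)"
    using g by (simp add: goe_def tri_def)
  then have "distr M (Pi\<^sub>M (tri n) (\<lambda>_. borel)) (upper_entries n Q) = (\<Pi>\<^sub>M e\<in>tri n. distr M borel (\<lambda>\<omega>. Q \<omega> (fst e) (snd e)))"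
    unfolding upper_entries_def[abs_def] by (subst (asm) indep_vars_iff_distr_eq_PiM'[OF ne rv]) auto
  also have "\<dots> = goe_law n"
    unfolding goe_law_def by (rule PiM_cong) (auto simp: law)
  also have "distr M (Pi\<^sub>M (tri n) (\<lambda>_. borel)) (upper_entries n Q) = distr M (goe_law n) (upper_entries n Q)"
    by (rule distr_cong) (auto simp: sets)
  finally show "distr M (goe_law n) (upper_entries n Q) = goe_law n" .
  show "upper_entries n Q \<in> M \<rightarrow>\<^sub>M goe_law n"
    unfolding upper_entries_def[abs_def] goe_law_def
    by (rule measurable_restrict) (use rv in \<open>simp cong: measurable_cong_sets\<close>)
qed

lemma mat_of_upper_entries:
  assumes "goe M n Q" "\<omega> \<in> space M" "i \<in> {1..n}" "j \<in> {1..n}"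
  shows "mat_of (upper_entries n Q \<omega>) i j = Q \<omega> i j"
  using assms by (cases "i \<le> j") (auto simp: mat_of_def upper_entries_def tri_def goe_def min_def max_def)

lemma minimizer_upper_entries:
  assumes "goe M n Q" "\<omega> \<in> space M"
  shows "stqp_minimizer n (mat_of (upper_entries n Q \<omega>)) = stqp_minimizer n (Q \<omega>)"
    and "kappa n (mat_of (upper_entries n Q \<omega>)) = kappa n (Q \<omega>)"
proof -
  have "quad_form n (mat_of (upper_entries n Q \<omega>)) = quad_form n (Q \<omega>)"
    by (rule quad_form_cong) (rule mat_of_upper_entries[OF assms])
  then show "stqp_minimizer n (mat_of (upper_entries n Q \<omega>)) = stqp_minimizer n (Q \<omega>)"
    by (simp add: stqp_minimizer_def)
  then show "kappa n (mat_of (upper_entries n Q \<omega>)) = kappa n (Q \<omega>)" by (simp add: kappa_def)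
qed

lemma goe_unique_minimizer:
  assumes g: "goe M n Q" and n: "n \<ge> 1"
  shows "AE \<omega> in M. \<exists>!x. stqp_minimizer n (Q \<omega>) x"
proof -
  have "AE \<omega> in M. \<exists>!x. stqp_minimizer n (mat_of (upper_entries n Q \<omega>)) x"
    by (rule AE_distrD[OF upper_entries_law(1)[OF g n]]) (subst upper_entries_law(2)[OF g n], rule AE_unique_minimizer[OF n])
  then show ?thesis using AE_space by eventually_elim (simp add: minimizer_upper_entries(1)[OF g])
qed

lemma goe_kappa_prob:
  assumes g: "goe M n Q" and n: "n \<ge> 1"
  shows "\<P>(\<omega> in M. P (kappa n (Q \<omega>))) = kappa_prob n P"
proof -
  have "kappa_prob n P = measure (distr M (goe_law n) (upper_entries n Q)) {q\<in>space (goe_law n). P (kappa n (mat_of q))}"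
    by (simp add: upper_entries_law(2)[OF g n])
  also have "\<dots> = measure M (upper_entries n Q -` {q\<in>space (goe_law n). P (kappa n (mat_of q))} \<inter> space M)"
    by (rule measure_distr[OF upper_entries_law(1)[OF g n] kappa_set[OF n]])
  also have "upper_entries n Q -` {q\<in>space (goe_law n). P (kappa n (mat_of q))} \<inter> space M = {\<omega>\<in>space M. P (kappa n (Q \<omega>))}"
    using measurable_space[OF upper_entries_law(1)[OF g n]] minimizer_upper_entries(2)[OF g] by auto
  finally show ?thesis by simp
qed

text \<open>A functional of the order statistics sees only the diagonal, so its mean is an integral over an
  independent normal sample.\<close>

lemma goe_diag_mean:
  assumes g: "goe M n Q" and n: "n \<ge> 1"
    and F: "\<And>R R'. (\<And>k. zord n R k = zord n R' k) \<Longrightarrow> F R = F R'"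
    and m: "(\<lambda>x. F (mat_of x)) \<in> borel_measurable (sample (diag_idx n))"
  shows "prob_space.expectation M (\<lambda>\<omega>. F (Q \<omega>)) = diag_mean n F"
proof -
  have r: "F (mat_of q) = F (mat_of (restrict q (diag_idx n)))" for q
    by (rule F) (simp add: zord_restrict)
  have mg: "(\<lambda>q. F (mat_of q)) \<in> borel_measurable (goe_law n)"
    by (subst r) (rule measurable_compose[OF restrict_diag_measurable m])
  have "(\<integral>\<omega>. F (Q \<omega>) \<partial>M) = (\<integral>\<omega>. F (mat_of (upper_entries n Q \<omega>)) \<partial>M)"
    by (intro Bochner_Integration.integral_cong refl F zord_cong) (simp add: mat_of_upper_entries[OF g])
  also have "\<dots> = (\<integral>q. F (mat_of q) \<partial>goe_law n)"
    using integral_distr[OF upper_entries_law(1)[OF g n] mg] by (simp add: upper_entries_law(2)[OF g n])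
  also have "\<dots> = (\<integral>q. F (mat_of (restrict q (diag_idx n))) \<partial>goe_law n)" by (subst r) (rule refl)
  also have "\<dots> = diag_mean n F" unfolding diag_mean_def by (rule goe_law_integral_diag[OF m])
  finally show ?thesis .
qed

lemma int_cong:
  assumes "\<And>k. zord n R k = zord n R' k"
  shows "S_int n R = S_int n R'" "A_int n R = A_int n R'" "B_int n R = B_int n R'"
  by (simp_all add: S_int_def A_int_def B_int_def qn_qmin pij_edgep assms)

lemma goe_sequences:
  assumes g: "goe (M n) n (Q n)" and n: "n \<ge> 3"
  shows "S_seq M Q n = diag_mean n (S_int n)" "A_seq M Q n = diag_mean n (A_int n)" "B_seq M Q n = diag_mean n (B_int n)"
proof -
  have n1: "n \<ge> 1" using n by simp
  interpret prob_space "M n" using g by (simp add: goe_def)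
  have "expectation (\<lambda>\<omega>. S_int n (Q n \<omega>)) = diag_mean n (S_int n)"
    "expectation (\<lambda>\<omega>. A_int n (Q n \<omega>)) = diag_mean n (A_int n)"
    "expectation (\<lambda>\<omega>. B_int n (Q n \<omega>)) = diag_mean n (B_int n)"
    by (rule goe_diag_mean[OF g n1], erule int_cong, rule int_measurable[OF n])+
  then show "S_seq M Q n = diag_mean n (S_int n)" "A_seq M Q n = diag_mean n (A_int n)" "B_seq M Q n = diag_mean n (B_int n)"
    by (simp_all only: S_seq_def A_seq_def B_seq_def S_int_def A_int_def B_int_def)
qed

section \<open>The distribution of the support size\<close>

theorem theorem10p1:
  fixes M :: "nat \<Rightarrow> 'a measure"
    and Q :: "nat \<Rightarrow> 'a \<Rightarrow> nat \<Rightarrow> nat \<Rightarrow> real"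
  assumes GOE: "\<And>n. 1 \<le> n \<Longrightarrow> goe (M n) n (Q n)"
  shows
    "(\<forall>n\<ge>1. AE \<omega> in M n. \<exists>!x. stqp_minimizer n (Q n \<omega>) x) \<and>
     ((\<lambda>n. \<P>(\<omega> in M n. kappa n (Q n \<omega>) = 2) - (S_seq M Q n + A_seq M Q n + B_seq M Q n))
       \<in> o(B_seq M Q)) \<and>
     ((\<lambda>n. \<P>(\<omega> in M n. kappa n (Q n \<omega>) > 1) - (S_seq M Q n + A_seq M Q n + B_seq M Q n))
       \<in> o(B_seq M Q)) \<and>
     ((\<lambda>n. \<P>(\<omega> in M n. kappa n (Q n \<omega>) = 1) - (1 - S_seq M Q n - A_seq M Q n - B_seq M Q n))
       \<in> o(B_seq M Q)) \<and>
     (A_seq M Q \<sim>[at_top] (\<lambda>n. 3 * sqrt (pi / 2) * (1 / (real n * sqrt (ln (real n)))))) \<and>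
     (B_seq M Q \<sim>[at_top] (\<lambda>n. 9 * sqrt (pi / 2) * (1 / (real n * ln (real n) powr (3 / 2))))) \<and>
     (S_seq M Q \<sim>[at_top] (\<lambda>n. 2 * sqrt (2 * pi) * (sqrt (ln (real n)) / real n))) \<and>
     ((\<lambda>n. \<P>(\<omega> in M n. kappa n (Q n \<omega>) > 1))
       \<sim>[at_top] (\<lambda>n. 2 * sqrt (2 * pi) * (sqrt (ln (real n)) / real n))) \<and>
     ((\<lambda>n. 1 - \<P>(\<omega> in M n. kappa n (Q n \<omega>) = 1))
       \<in> \<Theta>(\<lambda>n. sqrt (ln (real n)) / real n))"
proof -
  define S where "S = S_seq M Q"
  define A where "A = A_seq M Q"
  define B where "B = B_seq M Q"
  define p where "p P n = \<P>(\<omega> in M n. P (kappa n (Q n \<omega>)))" for P and n :: nat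
  define m where "m n = S n + A n + B n" for n
  define r where "r n = kappa_prob n (\<lambda>k. k \<ge> 3)" for n
  have ev: "\<forall>\<^sub>F n in sequentially. n \<ge> 3" by (rule eventually_ge_at_top)
  have seq: "S n = diag_mean n (S_int n)" "A n = diag_mean n (A_int n)" "B n = diag_mean n (B_int n)" if "n \<ge> 3" for n
    using goe_sequences[of M n Q] GOE[of n] that by (auto simp: S_def A_def B_def)
  have pk: "p P n = kappa_prob n P" if "n \<ge> 3" for P n
    unfolding p_def using GOE[of n] that by (intro goe_kappa_prob) auto
  have lS: "(\<lambda>n. real n * ln (real n) powr (- (1/2)) * S n) \<longlonglongrightarrow> 2 * sqrt (2 * pi)"
    by (rule Lim_transform_eventually[OF diag_mean_limits(1)]) (use ev in eventually_elim, simp add: seq)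
  have lA: "(\<lambda>n. real n * ln (real n) powr (1/2) * A n) \<longlonglongrightarrow> 3 * sqrt (pi / 2)"
    by (rule Lim_transform_eventually[OF diag_mean_limits(2)]) (use ev in eventually_elim, simp add: seq)
  have lB: "(\<lambda>n. err_scale n * B n) \<longlonglongrightarrow> 9 * sqrt (pi / 2)"
    by (rule Lim_transform_eventually[OF diag_mean_limits(3)]) (use ev in eventually_elim, simp add: seq)
  have lr: "(\<lambda>n. err_scale n * r n) \<longlonglongrightarrow> 0"
    unfolding r_def by (rule diag_mean_limits(4))
  have B0: "\<forall>\<^sub>F n in sequentially. B n \<noteq> 0"
  proof -
    have "\<forall>\<^sub>F n in sequentially. err_scale n * B n > 0" by (rule order_tendstoD(1)[OF lB]) simp
    then show ?thesis by eventually_elim auto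
  qed
  have gap: "\<bar>p (\<lambda>k. k > 1) n - m n\<bar> \<le> r n" "\<bar>p (\<lambda>k. k = 2) n - m n\<bar> \<le> r n"
    "p (\<lambda>k. k = 1) n = 1 - p (\<lambda>k. k > 1) n" if "n \<ge> 3" for n
    using kappa_prob_bounds[OF that] unfolding pk[OF that] m_def seq[OF that] r_def by auto
  have err: "(\<lambda>n. err_scale n * f n) \<longlonglongrightarrow> 0" if f: "\<And>n. n \<ge> 3 \<Longrightarrow> \<bar>f n\<bar> \<le> r n" for f
  proof (rule tendsto_0_le[OF lr, where K = 1])
    show "\<forall>\<^sub>F n in sequentially. norm (err_scale n * f n) \<le> norm (err_scale n * r n) * 1"
      using ev
    proof eventually_elim
      case (elim n)
      then show ?case using f[OF elim] err_scale_pos[of n] by (simp add: abs_mult mult_left_mono)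
    qed
  qed
  have small: "f \<in> o(B)" if f: "\<And>n. n \<ge> 3 \<Longrightarrow> \<bar>f n\<bar> \<le> r n" for f
  proof (rule smalloI_tendsto[OF _ B0])
    have "(\<lambda>n. (err_scale n * f n) / (err_scale n * B n)) \<longlonglongrightarrow> 0 / (9 * sqrt (pi / 2))"
      by (intro tendsto_divide err[OF f] lB) auto
    then have "(\<lambda>n. (err_scale n * f n) / (err_scale n * B n)) \<longlonglongrightarrow> 0" by simp
    then show "(\<lambda>n. f n / B n) \<longlonglongrightarrow> 0"
    proof (rule Lim_transform_eventually)
      show "\<forall>\<^sub>F n in sequentially. (err_scale n * f n) / (err_scale n * B n) = f n / B n"
        using ev
      proof eventually_elim
        case (elim n)
        then have "err_scale n \<noteq> 0" using err_scale_pos[of n] by simp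
        then show ?case by simp
      qed
    qed
  qed
  have o2: "(\<lambda>n. p (\<lambda>k. k = 2) n - (S n + A n + B n)) \<in> o(B)"
    by (rule small) (use gap(2) in \<open>simp add: m_def\<close>)
  have o1: "(\<lambda>n. p (\<lambda>k. k > 1) n - (S n + A n + B n)) \<in> o(B)"
    by (rule small) (use gap(1) in \<open>simp add: m_def\<close>)
  have o0: "(\<lambda>n. p (\<lambda>k. k = 1) n - (1 - S n - A n - B n)) \<in> o(B)"
  proof (rule small)
    fix n :: nat assume "n \<ge> 3"
    then show "\<bar>p (\<lambda>k. k = 1) n - (1 - S n - A n - B n)\<bar> \<le> r n"
      using gap(1,3)[of n] unfolding m_def by linarith
  qed
  have sq: "ln (real n) powr (1/2) = sqrt (ln (real n))" "ln (real n) powr (- (1/2)) = 1 / sqrt (ln (real n))" if "n \<ge> 3" for n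
    using that by (simp_all add: powr_half_sqrt powr_minus_divide)
  have eA: "A \<sim>[at_top] (\<lambda>n. 3 * sqrt (pi / 2) * (1 / (real n * sqrt (ln (real n)))))"
  proof (rule asymp_equivI'_const)
    show "(\<lambda>n. A n / (1 / (real n * sqrt (ln (real n))))) \<longlonglongrightarrow> 3 * sqrt (pi / 2)"
      by (rule Lim_transform_eventually[OF lA]) (use ev in eventually_elim, simp add: sq)
  qed simp
  have eB: "B \<sim>[at_top] (\<lambda>n. 9 * sqrt (pi / 2) * (1 / (real n * ln (real n) powr (3 / 2))))"
  proof (rule asymp_equivI'_const)
    show "(\<lambda>n. B n / (1 / (real n * ln (real n) powr (3 / 2)))) \<longlonglongrightarrow> 9 * sqrt (pi / 2)"
      by (rule Lim_transform_eventually[OF lB]) (use ev in eventually_elim, simp add: err_scale_def)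
  qed simp
  have eS: "f \<sim>[at_top] (\<lambda>n. 2 * sqrt (2 * pi) * (sqrt (ln (real n)) / real n))"
    if "(\<lambda>n. real n * ln (real n) powr (- (1/2)) * f n) \<longlonglongrightarrow> 2 * sqrt (2 * pi)" for f
  proof (rule asymp_equivI'_const)
    show "(\<lambda>n. f n / (sqrt (ln (real n)) / real n)) \<longlonglongrightarrow> 2 * sqrt (2 * pi)"
      by (rule Lim_transform_eventually[OF that]) (use ev in eventually_elim, simp add: sq)
  qed simp
  have lp: "(\<lambda>n. real n * ln (real n) powr (- (1/2)) * p (\<lambda>k. k > 1) n) \<longlonglongrightarrow> 2 * sqrt (2 * pi)"
  proof -
    have l0: "(\<lambda>n. 1 / ln (real n)) \<longlonglongrightarrow> 0" by real_asymp
    have "(\<lambda>n. real n * ln (real n) powr (1/2) * A n * (1 / ln (real n))) \<longlonglongrightarrow> 0"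
      using tendsto_mult[OF lA l0] by simp
    then have dA: "(\<lambda>n. real n * ln (real n) powr (- (1/2)) * A n) \<longlonglongrightarrow> 0"
    proof (rule Lim_transform_eventually)
      show "\<forall>\<^sub>F n in sequentially. real n * ln (real n) powr (1/2) * A n * (1 / ln (real n)) = real n * ln (real n) powr (- (1/2)) * A n"
        using ev
      proof eventually_elim
        case (elim n)
        then have "ln (real n) > 0" by simp
        then have "sqrt (ln (real n)) * (1 / ln (real n)) = 1 / sqrt (ln (real n))"
          by (simp add: field_simps)
        then show ?case using sq[OF elim] by (metis (no_types) mult.assoc mult.commute)
      qed
    qed
    have "(\<lambda>n. err_scale n * (p (\<lambda>k. k > 1) n - m n)) \<longlonglongrightarrow> 0" by (rule err) (rule gap(1))
    from tendsto_add[OF tendsto_add[OF lS dA] tendsto_add[OF scale_down(2)[OF lB] scale_down(2)[OF this]]]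
    show ?thesis by (simp add: m_def algebra_simps)
  qed
  note ep = eS[OF lp]
  have c: "2 * sqrt (2 * pi) \<noteq> 0" by simp
  have "p (\<lambda>k. k > 1) \<in> \<Theta>(\<lambda>n. sqrt (ln (real n)) / real n)"
    using asymp_equiv_imp_bigtheta[OF ep] unfolding landau_theta.cmult[OF c] .
  moreover have "\<forall>\<^sub>F n in sequentially. 1 - p (\<lambda>k. k = 1) n = p (\<lambda>k. k > 1) n"
    using ev by eventually_elim (simp add: gap(3) del: One_nat_def)
  ultimately have th: "(\<lambda>n. 1 - p (\<lambda>k. k = 1) n) \<in> \<Theta>(\<lambda>n. sqrt (ln (real n)) / real n)"
    using landau_theta.in_cong[of "\<lambda>n. 1 - p (\<lambda>k. k = 1) n" "p (\<lambda>k. k > 1)"] by simp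
  have ae: "\<forall>n\<ge>1. AE \<omega> in M n. \<exists>!x. stqp_minimizer n (Q n \<omega>) x"
    using GOE by (auto intro: goe_unique_minimizer)
  show ?thesis
    using ae o2 o1 o0 eA eB eS[OF lS] ep th unfolding p_def S_def A_def B_def by (intro conjI) assumption+
qed

end
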